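(* Let $f$ be a uniquely ergodic minimal homeomorphism of a Cantor set $\mathcal{K}$, with invariant probability measure $\mu$, and let $(Y,\nu,S)$ be an ergodic measured dynamical system on a standard Borel space which is an extension of $(\mathcal{K},\mu,f)$ through a map $p$. Let $\pi_1$ denote the first projection of a product. Then there exist a Cantor set $\mathcal{Q}$, a uniquely ergodic minimal homeomorphism $g$ of the product $\mathcal{K}\times\mathcal{Q}$ with invariant probability measure $\nu'$, a full measure subset $Y_0$ of $Y$ (contained in the domain of $p$, with $S(Y_0)=Y_0$) and a map $\Phi:Y_0\to\mathcal{K}\times\mathcal{Q}$ such that $\Phi$ is an isomorphism between $(Y,\nu,S)$ and $(\mathcal{K}\times\mathcal{Q},\nu',g)$, and $$\Phi\circ S=g\circ\Phi \text{ on } Y_0,\qquad \pi_1\circ g=f\circ\pi_1 \text{ on } \mathcal{K}\times\mathcal{Q},\qquad \pi_1\circ\Phi=p \text{ on } Y_0 .$$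
   Context: A measured dynamical system $(X,\mu,R)$ consists of a probability space $(X,\mu)$ and a bi-measurable bijection $R:X\to X$ for which $\mu$ is invariant. Given two such systems $(X,\mu,R)$ and $(Y,\nu,S)$, the second is an extension of the first through a measurable map $p:Y_1\to X_1$ if $X_1,Y_1$ are full measure subsets of $X,Y$, the map $p$ sends $\nu$ to $\mu$, and $pS=Rp$ holds on $Y_1$. A map $\Phi$ defined on a full measure subset $Y_0\subset Y$ is an isomorphism between the systems if it is a bi-measurable bijection from $Y_0$ onto a full measure subset of $X$, sends $\nu$ to $\mu$ and satisfies $\Phi S=R\Phi$ on $Y_0$. A standard Borel space is a measurable space whose $\sigma$-algebra is the Borel $\sigma$-algebra of some Polish topology. Topological spaces are equipped with their Borel $\sigma$-algebra. A Cantor set is a topological space homeomorphic to $\{0,1\}^{\mathbb{N}}$. A homeomorphism is minimal if all its orbits are dense, and uniquely ergodic if it has a unique invariant probability measure. *)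

theory Defs
  imports "HOL-Probability.Probability"
begin

definition borel_of :: "'a topology \<Rightarrow> 'a measure" where
  "borel_of X = sigma (topspace X) {U. openin X U}"

definition cantor_set :: "'a topology \<Rightarrow> bool" where
  "cantor_set X \<longleftrightarrow>
     X homeomorphic_space product_topology (\<lambda>_::nat. discrete_topology (UNIV :: bool set)) UNIV"

definition polish_space :: "'a topology \<Rightarrow> bool" where
  "polish_space X \<longleftrightarrow> completely_metrizable_space X \<and> separable_space X"

definition standard_borel :: "'a measure \<Rightarrow> bool" where
  "standard_borel M \<longleftrightarrow> (\<exists>X. polish_space X \<and> topspace X = space M \<and> sets M = sets (borel_of X))"

(* A full measure subset is a measurable set with null complement. *)
definition full_measure :: "'a measure \<Rightarrow> 'a set \<Rightarrow> bool" where
  "full_measure M A \<longleftrightarrow> A \<in> sets M \<and> emeasure M (space M - A) = 0"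

definition measure_preserving :: "'a measure \<Rightarrow> 'b measure \<Rightarrow> ('a \<Rightarrow> 'b) \<Rightarrow> bool" where
  "measure_preserving M N h \<longleftrightarrow> h \<in> measurable M N \<and> distr M N h = N"

definition measured_system :: "'a measure \<Rightarrow> ('a \<Rightarrow> 'a) \<Rightarrow> bool" where
  "measured_system M R \<longleftrightarrow>
     prob_space M \<and> bij_betw R (space M) (space M) \<and>
     measure_preserving M M R \<and> inv_into (space M) R \<in> measurable M M"

definition ergodic :: "'a measure \<Rightarrow> ('a \<Rightarrow> 'a) \<Rightarrow> bool" where
  "ergodic M R \<longleftrightarrow>
     (\<forall>A\<in>sets M. R -` A \<inter> space M = A \<longrightarrow> emeasure M A = 0 \<or> emeasure M A = 1)"

(* (N, S) is an extension of (M, R) through p : Y1 \<rightarrow> X1. As p is a total function here but only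
   meaningful on Y1, the relation p S = R p on Y1 includes the requirement S(Y1) \<subseteq> Y1. *)
definition extension_through ::
  "'b measure \<Rightarrow> ('b \<Rightarrow> 'b) \<Rightarrow> 'a measure \<Rightarrow> ('a \<Rightarrow> 'a) \<Rightarrow> 'b set \<Rightarrow> 'a set \<Rightarrow> ('b \<Rightarrow> 'a) \<Rightarrow> bool" where
  "extension_through N S M R Y1 X1 p \<longleftrightarrow>
     measured_system N S \<and> measured_system M R \<and>
     full_measure N Y1 \<and> full_measure M X1 \<and>
     measure_preserving (restrict_space N Y1) (restrict_space M X1) p \<and>
     S ` Y1 \<subseteq> Y1 \<and> (\<forall>y\<in>Y1. p (S y) = R (p y))"

(* h, defined on Y0, is an isomorphism from (N, S) to (M, R); again h S = R h on Y0 includes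
   S(Y0) \<subseteq> Y0. *)
definition system_isomorphism ::
  "'b measure \<Rightarrow> ('b \<Rightarrow> 'b) \<Rightarrow> 'a measure \<Rightarrow> ('a \<Rightarrow> 'a) \<Rightarrow> 'b set \<Rightarrow> ('b \<Rightarrow> 'a) \<Rightarrow> bool" where
  "system_isomorphism N S M R Y0 h \<longleftrightarrow>
     measured_system N S \<and> measured_system M R \<and>
     full_measure N Y0 \<and> full_measure M (h ` Y0) \<and> inj_on h Y0 \<and>
     measure_preserving (restrict_space N Y0) (restrict_space M (h ` Y0)) h \<and>
     inv_into Y0 h \<in> measurable (restrict_space M (h ` Y0)) (restrict_space N Y0) \<and>
     S ` Y0 \<subseteq> Y0 \<and> (\<forall>y\<in>Y0. h (S y) = R (h y))"

definition two_sided_orbit :: "'a topology \<Rightarrow> ('a \<Rightarrow> 'a) \<Rightarrow> 'a \<Rightarrow> 'a set" where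
  "two_sided_orbit X f x =
     range (\<lambda>n::nat. (f ^^ n) x) \<union> range (\<lambda>n::nat. (inv_into (topspace X) f ^^ n) x)"

definition minimal_homeo :: "'a topology \<Rightarrow> ('a \<Rightarrow> 'a) \<Rightarrow> bool" where
  "minimal_homeo X f \<longleftrightarrow>
     homeomorphic_map X X f \<and>
     (\<forall>x\<in>topspace X. X closure_of (two_sided_orbit X f x) = topspace X)"

definition invariant_prob :: "'a topology \<Rightarrow> ('a \<Rightarrow> 'a) \<Rightarrow> 'a measure \<Rightarrow> bool" where
  "invariant_prob X f m \<longleftrightarrow>
     prob_space m \<and> sets m = sets (borel_of X) \<and> measure_preserving m m f"

definition uniquely_ergodic :: "'a topology \<Rightarrow> ('a \<Rightarrow> 'a) \<Rightarrow> bool" where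
  "uniquely_ergodic X f \<longleftrightarrow> (\<exists>!m. invariant_prob X f m)"

end

theory Submission
  imports Defs "HOL-Library.Nat_Bijection"
begin

text \<open>
  Identify \<open>K\<close> with \<open>C = 2\<^sup>N\<close>. Fix a point \<open>x0\<close> and clopen sets \<open>B 0 \<supseteq> B 1 \<supseteq> \<dots>\<close> shrinking to \<open>x0\<close>; the returns to
  \<open>B n\<close> cut every orbit of the base into \<open>n\<close>-blocks, and every \<open>(n+1)\<close>-block is a concatenation of \<open>n\<close>-blocks.
  Start with a sequence of bits \<open>q 0 i = 1\<^bsub>E i\<^esub>\<close> on \<open>Y\<close>, where every set of a separating family occurs infinitely often among
  the \<open>E i\<close>. At stage \<open>n\<close> declare a word over an \<open>(n+1)\<close>-block admissible if it is a concatenation of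
  admissible \<open>n\<close>-words in which every \<open>n\<close>-word occurs and has, relative to its base type, almost the frequency that \<open>\<nu>\<close> prescribes;
  then move the names of the points of \<open>Y\<close> to a nearest admissible word. By the mean ergodic theorem this changes the names
  only on a set of small measure, so the names converge almost everywhere by Borel-Cantelli and still separate points.

  The system \<open>X\<close> of all pairs (base point, bi-infinite sequence all of whose blocks are admissible) is a closed
  invariant subset of \<open>C \<times> C\<close>. It is minimal because every word occurs in every longer one, and uniquely ergodic because an invariant
  measure is determined on blocks up to small errors by its projection to the base. Any few positions of a long block may be
  prescribed at will, with a free bit left; hence the fibres of \<open>X\<close> over the base are perfect and vary continuously, and recording
  the bits at the branching levels of the fibres identifies \<open>X\<close> with \<open>C \<times> C\<close> over the base.
\<close>

section \<open>The Cantor space and fibrewise trivialisation\<close>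

text \<open>The names of generic points alone would give a measurable model, but their closure may
  carry further invariant sets and measures; so minimality and unique ergodicity are forced by
  conditions imposed on every word. These conditions move names, while the names must converge and
  keep separating points. This conflict is settled by the order in which bits are edited: stage
  \<open>n\<close> changes only bits of index at most \<open>n\<close>, and only on a set of measure
  at most \<open>(1/2) ^ n\<close>. A point left alone from stage \<open>m\<close> on therefore
  keeps all its bits of index at least \<open>m\<close>, and this tail of original indicators is
  what separates points in the limit. Frequencies are prescribed only relative to the type of a
  block, that is, to finitely many coordinates of its base point: how often the types themselves
  occur is a matter of the base, where unique ergodicity of \<open>f\<close> takes over.\<close>

type_synonym cant = "nat \<Rightarrow> bool"

text \<open>\<open>agr N k\<close> is the cylinder of length \<open>N\<close> around
  \<open>k\<close>. These sets play the part of metric balls: openness, continuity and uniform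
  continuity on \<open>cant\<close> are all rephrased with them.\<close>

definition agr :: "nat \<Rightarrow> cant \<Rightarrow> cant \<Rightarrow> bool" where
  "agr N k k' \<longleftrightarrow> (\<forall>i<N. k i = k' i)"

lemma agr_refl [simp]: "agr N k k" by (simp add: agr_def)
lemma agr_sym: "agr N k k' \<Longrightarrow> agr N k' k" by (simp add: agr_def)
lemma agr_trans: "agr N a b \<Longrightarrow> agr N b c \<Longrightarrow> agr N a c" by (simp add: agr_def)
lemma agr_mono: "agr N a b \<Longrightarrow> M \<le> N \<Longrightarrow> agr M a b" by (simp add: agr_def)
lemma agr_0 [simp]: "agr 0 a b" by (simp add: agr_def)
lemma agr_Suc: "agr (Suc N) a b \<longleftrightarrow> agr N a b \<and> a N = b N" by (auto simp: agr_def less_Suc_eq)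
lemma agr_all_eq: "(\<And>N. agr N a b) \<Longrightarrow> a = b" by (auto simp: agr_def fun_eq_iff)

lemma open_coord: "open {k::cant. k i = b}"
proof -
  have "open {b}" by (rule Topological_Spaces.open_discrete)
  then have "open ((\<lambda>h::cant. h i) -` {b})" by (rule open_vimage) simp
  moreover have "(\<lambda>h::cant. h i) -` {b} = {k. k i = b}" by auto
  ultimately show ?thesis by simp
qed

lemma open_cyl: "open {k'. agr N k k'}"
proof -
  have "{k'. agr N k k'} = (\<Inter>i\<in>{..<N}. {k'. k' i = k i})" by (auto simp: agr_def)
  also have "open \<dots>" by (rule open_INT) (auto intro: open_coord)
  finally show ?thesis .
qed

lemma open_iff_agr: "open (U::cant set) \<longleftrightarrow> (\<forall>k\<in>U. \<exists>N. \<forall>k'. agr N k k' \<longrightarrow> k' \<in> U)"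
proof
  assume U: "open U"
  show "\<forall>k\<in>U. \<exists>N. \<forall>k'. agr N k k' \<longrightarrow> k' \<in> U"
  proof
    fix k assume "k \<in> U"
    from product_topology_open_contains_basis[OF U[unfolded open_fun_def] this]
    obtain X where X: "k \<in> (\<Pi>\<^sub>E i\<in>UNIV. X i)" "finite {i. X i \<noteq> UNIV}" "(\<Pi>\<^sub>E i\<in>UNIV. X i) \<subseteq> U"
      by auto
    obtain N where N: "\<forall>i\<in>{i. X i \<noteq> UNIV}. i < N"
      using X(2) finite_nat_set_iff_bounded by blast
    have "k' \<in> U" if "agr N k k'" for k'
    proof -
      have "k' i \<in> X i" for i
      proof (cases "X i = UNIV")
        case False
        then have "k' i = k i" using N that by (auto simp: agr_def)
        moreover have "k i \<in> X i" using X(1) by (auto simp: PiE_iff)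
        ultimately show ?thesis by simp
      qed auto
      then show ?thesis using X(3) by (auto simp: PiE_iff)
    qed
    then show "\<exists>N. \<forall>k'. agr N k k' \<longrightarrow> k' \<in> U" by blast
  qed
next
  assume *: "\<forall>k\<in>U. \<exists>N. \<forall>k'. agr N k k' \<longrightarrow> k' \<in> U"
  show "open U"
  proof (subst open_subopen, intro ballI)
    fix k assume "k \<in> U"
    with * obtain N where "\<forall>k'. agr N k k' \<longrightarrow> k' \<in> U" by blast
    then show "\<exists>T. open T \<and> k \<in> T \<and> T \<subseteq> U"
      by (intro exI[of _ "{k'. agr N k k'}"]) (auto simp: open_cyl)
  qed
qed

lemma compact_cantor: "compact (UNIV :: cant set)"
proof -
  have "compact_space (product_topology (\<lambda>_::nat. euclidean :: bool topology) UNIV)"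
    by (subst compact_space_product_topology) (auto simp: compact_space_def finite_imp_compact)
  then show ?thesis by (simp add: euclidean_product_topology compact_space_def)
qed

lemma Hausdorff_cantor: "Hausdorff_space (euclidean :: cant topology)"
proof -
  have "Hausdorff_space (euclidean :: bool topology)"
    unfolding Hausdorff_space_def using hausdorff by (simp add: disjnt_def) (metis hausdorff)
  then have "Hausdorff_space (product_topology (\<lambda>_::nat. euclidean :: bool topology) UNIV)"
    by (simp add: Hausdorff_space_product_topology)
  then show ?thesis by (simp add: euclidean_product_topology)
qed

lemma compact_imp_closed_cantor: "compact (Z::cant set) \<Longrightarrow> closed Z"
  using compactin_imp_closedin[OF Hausdorff_cantor] by simp

text \<open>A Lebesgue number argument: finitely many of the cylinders on which
  \<open>\<psi>\<close> is constant cover the space, and the longest of their lengths works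
  everywhere.\<close>

lemma unif_dep:
  fixes \<psi> :: "cant \<Rightarrow> 'b"
  assumes "\<And>k. \<exists>N. \<forall>k'. agr N k k' \<longrightarrow> \<psi> k' = \<psi> k"
  shows "\<exists>N. \<forall>k k'. agr N k k' \<longrightarrow> \<psi> k = \<psi> k'"
proof -
  obtain N where N: "\<And>k k'. agr (N k) k k' \<Longrightarrow> \<psi> k' = \<psi> k" using assms by metis
  obtain D where D: "finite D" "UNIV \<subseteq> (\<Union>d\<in>D. {k'. agr (N d) d k'})"
  proof (rule compactE_image[OF compact_cantor, of UNIV "\<lambda>d. {k'. agr (N d) d k'}"])
    show "open {k'. agr (N d) d k'}" for d by (rule open_cyl)
    show "UNIV \<subseteq> (\<Union>d\<in>UNIV. {k'. agr (N d) d k'})" using agr_refl by blast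
  qed auto
  define M where "M = Max (insert 0 (N ` D))"
  have "\<psi> k = \<psi> k'" if "agr M k k'" for k k'
  proof -
    obtain d where d: "d \<in> D" "agr (N d) d k" using D(2) by blast
    have "N d \<le> M" using d(1) D(1) by (simp add: M_def)
    then have "agr (N d) d k'" using d(2) that agr_mono agr_trans by blast
    then show ?thesis using N d(2) by metis
  qed
  then show ?thesis by blast
qed

lemma clopen_dep:
  assumes "open (U::cant set)" "open (- U)"
  shows "\<exists>N. \<forall>k k'. agr N k k' \<longrightarrow> (k \<in> U) = (k' \<in> U)"
proof (rule unif_dep)
  fix k show "\<exists>N. \<forall>k'. agr N k k' \<longrightarrow> (k' \<in> U) = (k \<in> U)"
    using assms unfolding open_iff_agr by (cases "k \<in> U") blast+
qed

lemma continuous_agr_iff: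
  fixes f :: "cant \<Rightarrow> cant"
  shows "continuous_on UNIV f \<longleftrightarrow> (\<forall>k M. \<exists>N. \<forall>k'. agr N k k' \<longrightarrow> agr M (f k) (f k'))"
proof
  assume c: "continuous_on UNIV f"
  show "\<forall>k M. \<exists>N. \<forall>k'. agr N k k' \<longrightarrow> agr M (f k) (f k')"
  proof (intro allI)
    fix k M
    have "open (f -` {k'. agr M (f k) k'})" by (rule open_vimage[OF open_cyl c])
    then show "\<exists>N. \<forall>k'. agr N k k' \<longrightarrow> agr M (f k) (f k')"
      unfolding open_iff_agr by force
  qed
next
  assume *: "\<forall>k M. \<exists>N. \<forall>k'. agr N k k' \<longrightarrow> agr M (f k) (f k')"
  show "continuous_on UNIV f"
    unfolding continuous_on_topological
  proof (intro ballI allI impI)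
    fix k B assume "open B" "f k \<in> B"
    then obtain M where M: "\<forall>k'. agr M (f k) k' \<longrightarrow> k' \<in> B" unfolding open_iff_agr by blast
    obtain N where "\<forall>k'. agr N k k' \<longrightarrow> agr M (f k) (f k')" using * by blast
    with M show "\<exists>A. open A \<and> k \<in> A \<and> (\<forall>y\<in>UNIV. y \<in> A \<longrightarrow> f y \<in> B)"
      by (intro exI[of _ "{k'. agr N k k'}"]) (auto simp: open_cyl)
  qed
qed

lemma unif_cont_agr:
  assumes "continuous_on UNIV (f::cant \<Rightarrow> cant)"
  shows "\<exists>N. \<forall>k k'. agr N k k' \<longrightarrow> agr M (f k) (f k')"
proof -
  \<comment> \<open>The first \<open>M\<close> bits are packed into one finite set, so that
    \<open>unif_dep\<close> applies to a single locally constant function.\<close>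
  have *: "agr M a b \<longleftrightarrow> {i. i < M \<and> a i} = {i. i < M \<and> b i}" for a b
    by (auto simp: agr_def)
  have "\<exists>N. \<forall>k k'. agr N k k' \<longrightarrow> {i. i < M \<and> f k i} = {i. i < M \<and> f k' i}"
  proof (rule unif_dep)
    fix k
    obtain N where "\<forall>k'. agr N k k' \<longrightarrow> agr M (f k) (f k')"
      using assms unfolding continuous_agr_iff by blast
    then show "\<exists>N. \<forall>k'. agr N k k' \<longrightarrow> {i. i < M \<and> f k' i} = {i. i < M \<and> f k i}"
      unfolding * by metis
  qed
  then show ?thesis unfolding * .
qed

lemma continuous_on_pairs_agr:
  fixes h :: "cant \<times> cant \<Rightarrow> cant"
  assumes "\<And>k x i. (k, x) \<in> X \<Longrightarrow>
    \<exists>N. \<forall>k' x'. (k', x') \<in> X \<longrightarrow> agr N k k' \<longrightarrow> agr N x x' \<longrightarrow> h (k', x') i = h (k, x) i"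
  shows "continuous_on X h"
proof (rule continuous_on_coordinatewise_then_product)
  fix i
  show "continuous_on X (\<lambda>z. h z i)"
    unfolding continuous_on_topological
  proof (intro ballI allI impI)
    fix z B assume z: "z \<in> X" and B: "h z i \<in> B"
    obtain k x where kx: "z = (k, x)" by (cases z)
    obtain N where "\<forall>k' x'. (k', x') \<in> X \<longrightarrow> agr N k k' \<longrightarrow> agr N x x' \<longrightarrow> h (k', x') i = h (k, x) i"
      using assms z kx by blast
    then show "\<exists>A. open A \<and> z \<in> A \<and> (\<forall>y\<in>X. y \<in> A \<longrightarrow> h y i \<in> B)"
      using B kx by (intro exI[of _ "{k'. agr N k k'} \<times> {k'. agr N x k'}"]) (auto intro!: open_Times open_cyl)
  qed
qed

lemma open_prod_agr:
  assumes "open (U :: (cant \<times> cant) set)" "(k, x) \<in> U"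
  obtains N where "\<And>k' x'. agr N k k' \<Longrightarrow> agr N x x' \<Longrightarrow> (k', x') \<in> U"
proof -
  obtain A B where AB: "open A" "open B" "k \<in> A" "x \<in> B" "A \<times> B \<subseteq> U"
    using assms open_prod_elim by (metis mem_Sigma_iff)
  obtain N where N: "\<forall>k'. agr N k k' \<longrightarrow> k' \<in> A" using AB unfolding open_iff_agr by blast
  obtain M where M: "\<forall>k'. agr M x k' \<longrightarrow> k' \<in> B" using AB unfolding open_iff_agr by blast
  show ?thesis
  proof (rule that[of "max N M"])
    fix k' x' assume "agr (max N M) k k'" "agr (max N M) x x'"
    then have "k' \<in> A" "x' \<in> B" using N M by (simp_all add: agr_def)
    then show "(k', x') \<in> U" using AB(5) by blast
  qed
qed

text \<open>Finding the \<open>i\<close>-th element of a set inspects only the part of the set up to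
  that element. This makes codes read at branching levels continuous, and comparable along a common
  prefix.\<close>

lemma enumerate_eq_of_initial:
  fixes A B :: "nat set"
  assumes "infinite A" "infinite B" "\<And>m. m < n \<Longrightarrow> m \<in> A \<longleftrightarrow> m \<in> B" "enumerate A i < n"
  shows "enumerate B i = enumerate A i"
  using assms(4)
proof (induction i)
  case 0
  have ltn: "(LEAST m. m \<in> A) < n" using 0 by (simp add: enumerate_0)
  have inA: "(LEAST m. m \<in> A) \<in> A" using assms(1) enumerate_in_set[of A 0] by (simp add: enumerate_0)
  have "(LEAST m. m \<in> B) = (LEAST m. m \<in> A)"
  proof (intro Least_equality)
    fix y assume "y \<in> B"
    then show "(LEAST m. m \<in> A) \<le> y"
      using assms(3)[of y] ltn by (cases "y < n") (auto intro: Least_le)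
  qed (use inA ltn assms(3) in blast)
  then show ?case by (simp add: enumerate_0)
next
  case (Suc i)
  have lt: "enumerate A i < enumerate A (Suc i)" using assms(1) by (rule enumerate_step)
  then have IH: "enumerate B i = enumerate A i" using Suc by simp
  let ?s = "enumerate A (Suc i)"
  have sA: "?s \<in> A" using assms(1) enumerate_in_set by blast
  have "enumerate B (Suc i) = (LEAST s. s \<in> B \<and> enumerate B i < s)"
    using assms(2) by (rule enumerate_Suc'')
  also have "\<dots> = ?s"
  proof (rule Least_equality)
    show "?s \<in> B \<and> enumerate B i < ?s" using sA Suc.prems assms(3) IH lt by auto
    fix y assume y: "y \<in> B \<and> enumerate B i < y"
    show "?s \<le> y"
    proof (rule ccontr)
      assume "\<not> ?s \<le> y"
      then have "y \<in> A" using y assms(3) Suc.prems by auto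
      then have "?s \<le> y" unfolding enumerate_Suc''[OF assms(1)]
        using y IH by (intro Least_le) auto
      with \<open>\<not> ?s \<le> y\<close> show False by simp
    qed
  qed
  finally show ?case .
qed

text \<open>Each fibre is seen as the set of branches of a binary tree without isolated branches.
  \<open>fib_open\<close> is lower semicontinuity of the fibre in \<open>k\<close>; compactness of
  \<open>X\<close> supplies upper semicontinuity.\<close>

locale fibre_tree =
  fixes X :: "(cant \<times> cant) set"
  assumes compact_X: "compact X"
    and perfect: "\<And>k x N. (k, x) \<in> X \<Longrightarrow> \<exists>x'. (k, x') \<in> X \<and> agr N x x' \<and> x \<noteq> x'"
    and fib_open: "\<And>k x N. (k, x) \<in> X \<Longrightarrow> \<exists>N'. \<forall>k'. agr N' k k' \<longrightarrow> (\<exists>x'. (k', x') \<in> X \<and> agr N x x')"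
    and nonempty: "\<And>k. \<exists>x. (k, x) \<in> X"
begin

text \<open>The heights at which the branch \<open>x\<close> passes a node with two children in the
  tree of its fibre.\<close>

definition branch_levels :: "cant \<Rightarrow> cant \<Rightarrow> nat set" where
  "branch_levels k x = {n. \<exists>x'. (k, x') \<in> X \<and> agr n x x' \<and> x' n \<noteq> x n}"

text \<open>Bits of \<open>x\<close> off the branching levels are forced by the earlier ones;
  deleting them turns the tree of the fibre into the full binary tree.\<close>

definition branch_code :: "cant \<times> cant \<Rightarrow> cant" where
  "branch_code z = (\<lambda>i. snd z (enumerate (branch_levels (fst z) (snd z)) i))"

lemma first_diff:
  assumes "x \<noteq> x'"
  obtains n where "agr n x x'" "x' n \<noteq> x n"
proof -
  let ?n = "LEAST n. x' n \<noteq> x n"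
  have "\<exists>n. x' n \<noteq> x n" using assms by (auto simp: fun_eq_iff)
  then have "x' ?n \<noteq> x ?n" by (rule LeastI_ex)
  moreover have "agr ?n x x'" using not_less_Least by (fastforce simp: agr_def)
  ultimately show ?thesis using that by blast
qed

lemma inf_branch_levels:
  assumes "(k, x) \<in> X" shows "infinite (branch_levels k x)"
proof
  assume "finite (branch_levels k x)"
  then obtain N where N: "\<forall>n\<in>branch_levels k x. n < N" using finite_nat_set_iff_bounded by blast
  obtain x' where x': "(k, x') \<in> X" "agr N x x'" "x \<noteq> x'" using perfect[OF assms] by blast
  obtain n where n: "agr n x x'" "x' n \<noteq> x n" using first_diff[OF x'(3)] by blast
  then have "n \<in> branch_levels k x" using x'(1) by (auto simp: branch_levels_def)
  then show False using N n(2) x'(2) by (auto simp: agr_def)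
qed

lemma branch_levels_prefix:
  assumes "agr n x x'" "m < n" shows "m \<in> branch_levels k x \<longleftrightarrow> m \<in> branch_levels k x'"
proof -
  have *: "m \<in> branch_levels k b" if ab: "agr n a b" and mk: "m \<in> branch_levels k a" for a b
  proof -
    obtain y where "(k, y) \<in> X" "agr m a y" "y m \<noteq> a m" using mk by (auto simp: branch_levels_def)
    then have "agr m b y" "y m \<noteq> b m" using ab assms(2) by (auto simp: agr_def)
    then show ?thesis using \<open>(k, y) \<in> X\<close> by (auto simp: branch_levels_def)
  qed
  show ?thesis using *[of x x'] *[of x' x] assms(1) agr_sym by blast
qed

text \<open>If there is a second branch at height \<open>m\<close>, \<open>fib_open\<close> carries
  it to the neighbouring fibres. If there is none, the points of \<open>X\<close> that leave
  \<open>x\<close> at height \<open>m\<close> form a compact set whose projection misses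
  \<open>k\<close>, hence misses a neighbourhood of \<open>k\<close>.\<close>

lemma branch_levels_local:
  assumes "(k, x) \<in> X"
  shows "\<exists>N. \<forall>k' x'. (k', x') \<in> X \<longrightarrow> agr N k k' \<longrightarrow> agr N x x' \<longrightarrow> (m \<in> branch_levels k' x' \<longleftrightarrow> m \<in> branch_levels k x)"
proof (cases "m \<in> branch_levels k x")
  case True
  then obtain x1 where x1: "(k, x1) \<in> X" "agr m x x1" "x1 m \<noteq> x m" by (auto simp: branch_levels_def)
  obtain N where N: "\<And>k'. agr N k k' \<Longrightarrow> \<exists>x'. (k', x') \<in> X \<and> agr (Suc m) x1 x'" using fib_open[OF x1(1)] by blast
  show ?thesis
  proof (intro exI[of _ "max N (Suc m)"] allI impI)
    fix k' x' assume a: "(k', x') \<in> X" "agr (max N (Suc m)) k k'" "agr (max N (Suc m)) x x'"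
    obtain y where "(k', y) \<in> X" "agr (Suc m) x1 y" using N[of k'] agr_mono[OF a(2), of N] by auto
    moreover have "agr (Suc m) x x'" using agr_mono[OF a(3)] by simp
    ultimately have "m \<in> branch_levels k' x'" using x1(2,3) unfolding branch_levels_def agr_Suc by (auto simp: agr_def intro!: exI[of _ y])
    then show "m \<in> branch_levels k' x' \<longleftrightarrow> m \<in> branch_levels k x" using True by simp
  qed
next
  case False
  define Z where "Z = X \<inter> (UNIV \<times> ({y. agr m x y} \<inter> {y. y m = (\<not> x m)}))"
  have "open (- ({y. agr m x y} \<inter> {y. y m = (\<not> x m)}))"
    unfolding open_iff_agr
  proof
    fix k assume k: "k \<in> - ({y. agr m x y} \<inter> {y. y m = (\<not> x m)})"
    show "\<exists>N. \<forall>k'. agr N k k' \<longrightarrow> k' \<in> - ({y. agr m x y} \<inter> {y. y m = (\<not> x m)})"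
      using k by (intro exI[of _ "Suc m"]) (auto simp: agr_def less_Suc_eq)
  qed
  then have "closed ({y. agr m x y} \<inter> {y. y m = (\<not> x m)})" by (simp add: closed_def)
  then have "compact Z" unfolding Z_def
    by (intro compact_Int_closed compact_X closed_Times) auto
  then have "compact (fst ` Z)" by (intro compact_continuous_image continuous_on_fst continuous_on_id)
  then have "open (- (fst ` Z))" using compact_imp_closed_cantor by (auto simp: closed_def)
  moreover have "k \<in> - (fst ` Z)" using False by (auto simp: Z_def branch_levels_def)
  ultimately obtain N where N: "\<forall>k'. agr N k k' \<longrightarrow> k' \<in> - (fst ` Z)" unfolding open_iff_agr by blast
  show ?thesis
  proof (intro exI[of _ "max N (Suc m)"] allI impI)
    fix k' x' assume a: "(k', x') \<in> X" "agr (max N (Suc m)) k k'" "agr (max N (Suc m)) x x'"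
    have nZ: "k' \<notin> fst ` Z" using N agr_mono[OF a(2), of N] by auto
    have xx: "agr (Suc m) x x'" using agr_mono[OF a(3)] by simp
    have "m \<notin> branch_levels k' x'"
    proof
      assume "m \<in> branch_levels k' x'"
      then obtain y where y: "(k', y) \<in> X" "agr m x' y" "y m \<noteq> x' m" by (auto simp: branch_levels_def)
      then have "agr m x y" "y m = (\<not> x m)" using xx agr_trans by (auto simp: agr_Suc)
      then have "(k', y) \<in> Z" using y by (simp add: Z_def)
      then show False using nZ by force
    qed
    then show "m \<in> branch_levels k' x' \<longleftrightarrow> m \<in> branch_levels k x" using False by simp
  qed
qed

lemma branch_levels_local_upto:
  assumes "(k, x) \<in> X"
  shows "\<exists>N. \<forall>k' x'. (k', x') \<in> X \<longrightarrow> agr N k k' \<longrightarrow> agr N x x' \<longrightarrow> (\<forall>m<n. m \<in> branch_levels k' x' \<longleftrightarrow> m \<in> branch_levels k x)"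
proof -
  obtain N where N: "\<And>m k' x'. (k', x') \<in> X \<Longrightarrow> agr (N m) k k' \<Longrightarrow> agr (N m) x x' \<Longrightarrow> (m \<in> branch_levels k' x' \<longleftrightarrow> m \<in> branch_levels k x)"
    using branch_levels_local[OF assms] by metis
  have "N m \<le> Max (insert 0 (N ` {..<n}))" if "m < n" for m using that by simp
  then show ?thesis
    by (intro exI[of _ "Max (insert 0 (N ` {..<n}))"]) (use N agr_mono in blast)
qed

lemma cont_branch_code: "continuous_on X branch_code"
proof (rule continuous_on_pairs_agr)
  fix k x i assume kx: "(k, x) \<in> X"
  define n where "n = enumerate (branch_levels k x) i"
  obtain N where N: "\<And>k' x'. (k', x') \<in> X \<Longrightarrow> agr N k k' \<Longrightarrow> agr N x x' \<Longrightarrow> (\<forall>m<Suc n. m \<in> branch_levels k' x' \<longleftrightarrow> m \<in> branch_levels k x)"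
    using branch_levels_local_upto[OF kx] by metis
  show "\<exists>N. \<forall>k' x'. (k', x') \<in> X \<longrightarrow> agr N k k' \<longrightarrow> agr N x x' \<longrightarrow> branch_code (k', x') i = branch_code (k, x) i"
  proof (intro exI[of _ "max N (Suc n)"] allI impI)
    fix k' x' assume a: "(k', x') \<in> X" "agr (max N (Suc n)) k k'" "agr (max N (Suc n)) x x'"
    have "enumerate (branch_levels k' x') i = enumerate (branch_levels k x) i"
    proof (rule enumerate_eq_of_initial[of _ _ "Suc n"])
      show "infinite (branch_levels k x)" "infinite (branch_levels k' x')" using inf_branch_levels kx a by auto
      show "\<And>m. m < Suc n \<Longrightarrow> (m \<in> branch_levels k x) = (m \<in> branch_levels k' x')"
        using N[OF a(1)] agr_mono[OF a(2), of N] agr_mono[OF a(3), of N] by simp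
      show "enumerate (branch_levels k x) i < Suc n" by (simp add: n_def)
    qed
    moreover have "x' n = x n" using a(3) by (simp add: agr_def)
    ultimately show "branch_code (k', x') i = branch_code (k, x) i" by (simp add: branch_code_def n_def)
  qed
qed

text \<open>The first difference of two points of one fibre is a branching level of both, and of the
  same rank, since the branching levels below it agree.\<close>

lemma inj_branch_code:
  assumes "(k, x) \<in> X" "(k, x') \<in> X" "branch_code (k, x) = branch_code (k, x')" shows "x = x'"
proof (rule ccontr)
  assume "x \<noteq> x'"
  then obtain n where n: "agr n x x'" "x' n \<noteq> x n" using first_diff by blast
  have nb: "n \<in> branch_levels k x" "n \<in> branch_levels k x'" using n assms(1,2) agr_sym unfolding branch_levels_def by blast+
  obtain i where i: "enumerate (branch_levels k x) i = n" using enumerate_Ex[OF inf_branch_levels[OF assms(1)] nb(1)] by blast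
  have "enumerate (branch_levels k x') i = enumerate (branch_levels k x) i"
  proof (rule enumerate_eq_of_initial[of _ _ "Suc n"])
    show "\<And>m. m < Suc n \<Longrightarrow> (m \<in> branch_levels k x) = (m \<in> branch_levels k x')"
      using nb branch_levels_prefix[OF n(1)] by (auto simp: less_Suc_eq)
  qed (use inf_branch_levels assms i in auto)
  then have "branch_code (k, x') i = x' n" "branch_code (k, x) i = x n" by (auto simp: branch_code_def i)
  then show False using assms(3) n(2) by simp
qed

text \<open>One correction at a time: if the code is wrong at place \<open>M\<close>, crossing to
  the other branch at the corresponding level changes that bit and none of the earlier ones.\<close>

lemma dense_branch_code: "\<exists>x. (k, x) \<in> X \<and> agr M (branch_code (k, x)) b"
proof (induction M)
  case 0 then show ?case using nonempty by simp
next
  case (Suc M)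
  then obtain x where x: "(k, x) \<in> X" "agr M (branch_code (k, x)) b" by blast
  show ?case
  proof (cases "branch_code (k, x) M = b M")
    case True then show ?thesis using x by (auto simp: agr_Suc)
  next
    case False
    define n where "n = enumerate (branch_levels k x) M"
    have n: "n \<in> branch_levels k x" using inf_branch_levels[OF x(1)] enumerate_in_set n_def by blast
    then obtain x' where x': "(k, x') \<in> X" "agr n x x'" "x' n \<noteq> x n" by (auto simp: branch_levels_def)
    have n': "n \<in> branch_levels k x'" using x' x(1) agr_sym unfolding branch_levels_def by blast
    have e: "enumerate (branch_levels k x') i = enumerate (branch_levels k x) i" if "i \<le> M" for i
    proof (rule enumerate_eq_of_initial[of _ _ "Suc n"])
      show "\<And>m. m < Suc n \<Longrightarrow> (m \<in> branch_levels k x) = (m \<in> branch_levels k x')"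
        using n n' branch_levels_prefix[OF x'(2)] by (auto simp: less_Suc_eq)
      show "enumerate (branch_levels k x) i < Suc n"
        using that inf_branch_levels[OF x(1)] by (simp add: n_def less_Suc_eq_le)
    qed (use inf_branch_levels x x' in auto)
    have "enumerate (branch_levels k x) i < n" if "i < M" for i
      using that inf_branch_levels[OF x(1)] by (simp add: n_def)
    then have "agr M (branch_code (k, x')) b"
      using e x(2) x'(2) by (auto simp: agr_def branch_code_def)
    moreover have "branch_code (k, x') M = b M" using False e[of M] x'(3) by (simp add: branch_code_def n_def)
    ultimately show ?thesis using x'(1) by (auto simp: agr_Suc)
  qed
qed

text \<open>The image of a fibre is dense by the previous lemma, and it is compact.\<close>

lemma surj_branch_code: "\<exists>x. (k, x) \<in> X \<and> branch_code (k, x) = b"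
proof -
  have "closed ({k} \<times> (UNIV :: cant set))"
    by (rule closed_Times) (auto intro: compact_imp_closed_cantor)
  then have "compact (X \<inter> ({k} \<times> UNIV))" using compact_X by (rule compact_Int_closed[rotated])
  then have "compact (branch_code ` (X \<inter> ({k} \<times> UNIV)))"
    by (rule compact_continuous_image[rotated]) (rule continuous_on_subset[OF cont_branch_code], simp)
  then have op: "open (- (branch_code ` (X \<inter> ({k} \<times> UNIV))))" using compact_imp_closed_cantor by (auto simp: closed_def)
  have "b \<in> branch_code ` (X \<inter> ({k} \<times> UNIV))"
  proof (rule ccontr)
    assume "b \<notin> branch_code ` (X \<inter> ({k} \<times> UNIV))"
    then obtain N where N: "\<forall>b'. agr N b b' \<longrightarrow> b' \<notin> branch_code ` (X \<inter> ({k} \<times> UNIV))"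
      using op unfolding open_iff_agr by blast
    obtain x where "(k, x) \<in> X" "agr N (branch_code (k, x)) b" using dense_branch_code by blast
    then show False using N agr_sym by blast
  qed
  then show ?thesis by auto
qed

lemma fibre_homeo:
  shows "continuous_on X (\<lambda>z. (fst z, branch_code z))" "bij_betw (\<lambda>z. (fst z, branch_code z)) X UNIV"
proof -
  show "continuous_on X (\<lambda>z. (fst z, branch_code z))"
    by (intro continuous_on_Pair continuous_on_fst continuous_on_id cont_branch_code)
  show "bij_betw (\<lambda>z. (fst z, branch_code z)) X UNIV"
    unfolding bij_betw_def inj_on_def using inj_branch_code surj_branch_code by (auto simp: image_iff) (metis fst_conv)
qed

end

section \<open>Return times, the maximal ergodic inequality and towers\<close>

text \<open>Negative powers use \<open>inv f\<close>, the inverse on the whole type; therefore the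
  systems below are arranged to be bijections of the type and not only of the carrier.\<close>

definition ziter :: "('a \<Rightarrow> 'a) \<Rightarrow> int \<Rightarrow> 'a \<Rightarrow> 'a" where
  "ziter f j = (if 0 \<le> j then f ^^ nat j else inv f ^^ nat (- j))"

lemma ziter_0 [simp]: "ziter f 0 k = k" by (simp add: ziter_def)
lemma ziter_nat: "ziter f (int n) = f ^^ n" by (simp add: ziter_def)
lemma ziter_neg: "ziter f (- int n) = inv f ^^ n" by (cases n) (simp_all add: ziter_def nat_add_distrib)

lemma ziter_Suc: assumes "bij f" shows "ziter f (j + 1) k = f (ziter f j k)"
proof (cases "0 \<le> j")
  case True
  then have "nat (j + 1) = Suc (nat j)" by simp
  then show ?thesis using True by (simp add: ziter_def)
next
  case False
  define m where "m = nat (- j - 1)"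
  have j: "j = - int (Suc m)" using False by (simp add: m_def)
  have "ziter f (j + 1) k = (inv f ^^ m) k" using ziter_neg[of f m] by (simp add: j)
  moreover have "ziter f j k = inv f ((inv f ^^ m) k)" unfolding j ziter_neg by simp
  ultimately show ?thesis using assms by (simp add: bij_is_surj surj_f_inv_f)
qed

lemma ziter_pred: assumes "bij f" shows "ziter f (j - 1) k = inv f (ziter f j k)"
  using ziter_Suc[OF assms, of "j - 1" k] assms by (simp add: bij_is_inj)

lemma ziter_add: assumes "bij f" shows "ziter f (i + j) k = ziter f i (ziter f j k)"
proof (induction i rule: int_induct[where k=0])
  case (step1 i)
  then show ?case using ziter_Suc[OF assms, of "i + j" k] ziter_Suc[OF assms, of i "ziter f j k"] by (simp add: algebra_simps)
next
  case (step2 i)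
  then show ?case using ziter_pred[OF assms, of "i + j" k] ziter_pred[OF assms, of i "ziter f j k"] by (simp add: algebra_simps)
qed simp

text \<open>Relative to an invariant set \<open>A\<close>, because the intertwining relation is
  available only on the space of a measure.\<close>

lemma ziter_intertwine:
  assumes "bij f" "bij g" "\<And>y. y \<in> A \<Longrightarrow> g y \<in> A" "\<And>y. y \<in> A \<Longrightarrow> inv g y \<in> A"
    "\<And>y. y \<in> A \<Longrightarrow> P (g y) = f (P y)" "y \<in> A"
  shows "P (ziter g j y) = ziter f j (P y) \<and> ziter g j y \<in> A"
proof (induction j rule: int_induct[where k=0])
  case base then show ?case using assms(6) by simp
next
  case (step1 i)
  then show ?case using assms by (simp add: ziter_Suc)
next
  case (step2 i)
  have "f (P (inv g (ziter g i y))) = P (ziter g i y)"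
    using assms(2,4,5) step2 by (metis bij_is_surj surj_f_inv_f)
  then have "P (inv g (ziter g i y)) = inv f (P (ziter g i y))" using assms(1) by (metis bij_is_inj inv_f_f)
  then show ?case using assms step2 by (simp add: ziter_pred)
qed

definition ret :: "('a \<Rightarrow> 'a) \<Rightarrow> 'a set \<Rightarrow> 'a \<Rightarrow> nat" where
  "ret f B k = (LEAST j. 0 < j \<and> (f ^^ j) k \<in> B)"

text \<open>The height of \<open>k\<close> in the tower over \<open>B\<close>. A point of
  \<open>B\<close> has height \<open>0\<close>, whereas \<open>ret\<close> looks at positive times
  only.\<close>

definition off :: "('a \<Rightarrow> 'a) \<Rightarrow> 'a set \<Rightarrow> 'a \<Rightarrow> nat" where
  "off f B k = (LEAST j. ziter f (- int j) k \<in> B)"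

text \<open>Gaps bounded in both directions: the two \<open>LEAST\<close> searches above succeed,
  and \<open>R\<close> bounds every block length.\<close>

definition recur :: "('a \<Rightarrow> 'a) \<Rightarrow> 'a set \<Rightarrow> nat \<Rightarrow> bool" where
  "recur f B R \<longleftrightarrow> (\<forall>k. (\<exists>j. 0 < j \<and> j \<le> R \<and> (f ^^ j) k \<in> B) \<and> (\<exists>j\<le>R. ziter f (- int j) k \<in> B))"

lemma ret_props:
  assumes "recur f B R"
  shows "0 < ret f B k" "(f ^^ ret f B k) k \<in> B" "ret f B k \<le> R"
proof -
  obtain j where j: "0 < j" "j \<le> R" "(f ^^ j) k \<in> B" using assms by (auto simp: recur_def)
  have "0 < ret f B k \<and> (f ^^ ret f B k) k \<in> B"
    unfolding ret_def by (rule LeastI[of _ j]) (use j in auto)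
  then show "0 < ret f B k" "(f ^^ ret f B k) k \<in> B" by auto
  have "ret f B k \<le> j" unfolding ret_def by (rule Least_le) (use j in auto)
  then show "ret f B k \<le> R" using j by simp
qed

lemma ret_min: "0 < j \<Longrightarrow> j < ret f B k \<Longrightarrow> (f ^^ j) k \<notin> B"
  unfolding ret_def using not_less_Least by blast

lemma ret_le: "0 < j \<Longrightarrow> (f ^^ j) k \<in> B \<Longrightarrow> ret f B k \<le> j"
  unfolding ret_def by (rule Least_le) simp

lemma off_in:
  assumes "recur f B R" shows "ziter f (- int (off f B k)) k \<in> B"
proof -
  obtain j where "ziter f (- int j) k \<in> B" using assms by (auto simp: recur_def)
  then show ?thesis unfolding off_def by (rule LeastI)
qed

lemma off_le:
  assumes "recur f B R" shows "off f B k \<le> R"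
proof -
  obtain j where "j \<le> R" "ziter f (- int j) k \<in> B" using assms by (auto simp: recur_def)
  then show ?thesis unfolding off_def by (metis (no_types, lifting) Least_le le_trans)
qed

lemma off_min: "j < off f B k \<Longrightarrow> ziter f (- int j) k \<notin> B"
  unfolding off_def using not_less_Least by blast

text \<open>The tower coordinates: height \<open>j\<close> consists of the \<open>j\<close>-th
  iterates of base points whose return time exceeds \<open>j\<close>. This is the change of
  variables behind every sum over columns.\<close>

lemma off_fwd_iff:
  assumes "bij f" "recur f B R"
  shows "off f B ((f ^^ j) k) = j \<longleftrightarrow> k \<in> B \<and> j < ret f B k"
proof -
  have z: "ziter f (- int i) ((f ^^ j) k) = (f ^^ (j - i)) k" if "i \<le> j" for i
    using that ziter_add[OF assms(1), of "- int i" "int j" k]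
    by (simp add: ziter_nat[symmetric] of_nat_diff)
  show ?thesis
  proof
    assume o: "off f B ((f ^^ j) k) = j"
    have "k \<in> B" using off_in[OF assms(2), of "(f ^^ j) k"] z[of j] by (simp add: o)
    moreover have "j < ret f B k"
    proof (rule ccontr)
      assume "\<not> j < ret f B k"
      then have "ziter f (- int (j - ret f B k)) ((f ^^ j) k) \<in> B"
        using ret_props(2)[OF assms(2), of k] z[of "j - ret f B k"] by simp
      moreover have "j - ret f B k < j" using ret_props(1)[OF assms(2), of k] \<open>\<not> j < ret f B k\<close> by simp
      ultimately show False using off_min o by metis
    qed
    ultimately show "k \<in> B \<and> j < ret f B k" by simp
  next
    assume a: "k \<in> B \<and> j < ret f B k"
    show "off f B ((f ^^ j) k) = j"
      unfolding off_def
    proof (rule Least_equality)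
      show "ziter f (- int j) ((f ^^ j) k) \<in> B" using a z[of j] by simp
      fix i assume i: "ziter f (- int i) ((f ^^ j) k) \<in> B"
      show "j \<le> i"
      proof (rule ccontr)
        assume "\<not> j \<le> i"
        then have "(f ^^ (j - i)) k \<in> B" using i z[of i] by simp
        moreover have "0 < j - i" "j - i < ret f B k" using a \<open>\<not> j \<le> i\<close> by auto
        ultimately show False using ret_min by metis
      qed
    qed
  qed
qed

lemma off_less_ret:
  assumes "bij f" "recur f B R"
  shows "off f B k < ret f B (ziter f (- int (off f B k)) k)"
proof -
  have "(f ^^ off f B k) (ziter f (- int (off f B k)) k) = k"
    using ziter_add[OF assms(1), of "int (off f B k)" "- int (off f B k)" k] by (simp add: ziter_nat)
  then show ?thesis
    using off_fwd_iff[OF assms, of "off f B k" "ziter f (- int (off f B k)) k"] by simp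
qed

section \<open>Birkhoff sums and the mean ergodic theorem\<close>

locale mps = prob_space M for M :: "'a measure" +
  fixes T :: "'a \<Rightarrow> 'a"
  assumes bijT: "bij T"
    and T_meas [measurable]: "T \<in> measurable M M"
    and Ti_meas [measurable]: "inv T \<in> measurable M M"
    and T_pres: "distr M M T = M"
begin

lemma T_space: "y \<in> space M \<Longrightarrow> T y \<in> space M" using T_meas by (rule measurable_space)
lemma Ti_space: "y \<in> space M \<Longrightarrow> inv T y \<in> space M" using Ti_meas by (rule measurable_space)

lemma Tn_meas [measurable]: "T ^^ n \<in> measurable M M"
proof (induction n)
  case (Suc n)
  show ?case unfolding funpow.simps(2) using Suc T_meas by (rule measurable_comp)
qed (simp add: id_def)

lemma Tin_meas [measurable]: "inv T ^^ n \<in> measurable M M"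
proof (induction n)
  case (Suc n)
  show ?case unfolding funpow.simps(2) using Suc Ti_meas by (rule measurable_comp)
qed (simp add: id_def)

lemma ziter_meas [measurable]: "ziter T j \<in> measurable M M"
  by (simp add: ziter_def)

lemma ziter_space: "y \<in> space M \<Longrightarrow> ziter T j y \<in> space M" using ziter_meas by (rule measurable_space)

lemma Tn_pres: "distr M M (T ^^ n) = M"
proof (induction n)
  case 0 then show ?case by (simp add: distr_id2 id_def)
next
  case (Suc n)
  have "distr M M (T ^^ Suc n) = distr (distr M M (T ^^ n)) M T"
    by (subst distr_distr) (simp_all add: o_def)
  then show ?case unfolding Suc T_pres .
qed

lemma integral_Tn:
  fixes F :: "'a \<Rightarrow> real"
  assumes "F \<in> borel_measurable M"
  shows "(\<integral>y. F ((T ^^ n) y) \<partial>M) = (\<integral>y. F y \<partial>M)"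
proof -
  have "(\<integral>y. F y \<partial>M) = (\<integral>y. F y \<partial>distr M M (T ^^ n))" by (simp add: Tn_pres)
  also have "\<dots> = (\<integral>y. F ((T ^^ n) y) \<partial>M)" by (rule integral_distr) (use assms in auto)
  finally show ?thesis by simp
qed

lemma bounded_integrable:
  fixes F :: "'a \<Rightarrow> real"
  assumes "F \<in> borel_measurable M" "\<And>y. \<bar>F y\<bar> \<le> c"
  shows "integrable M F"
  by (rule integrable_const_bound[of _ c]) (use assms in auto)

definition bsum :: "('a \<Rightarrow> real) \<Rightarrow> nat \<Rightarrow> 'a \<Rightarrow> real" where
  "bsum F n y = (\<Sum>i<n. F ((T ^^ i) y))"

lemma bsum_meas [measurable]: "F \<in> borel_measurable M \<Longrightarrow> bsum F n \<in> borel_measurable M"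
  unfolding bsum_def[abs_def]
  by (intro borel_measurable_sum) (rule measurable_compose[OF Tn_meas])

lemma bsum_Suc: "bsum F (Suc n) y = F y + bsum F n (T y)"
  unfolding bsum_def sum.lessThan_Suc_shift by (simp add: funpow_swap1)

lemma bsum_bound: "(\<And>y. \<bar>F y\<bar> \<le> c) \<Longrightarrow> \<bar>bsum F n y\<bar> \<le> n * c"
  unfolding bsum_def by (rule order_trans[OF sum_abs]) (use sum_bounded_above[of "{..<n}" _ c] in auto)

text \<open>The recursion computes the maximum of the Birkhoff sums \<open>bsum F i\<close>, \<open>i \<le> n\<close>; in this form Garsia's inequality is immediate.\<close>

fun mxs :: "('a \<Rightarrow> real) \<Rightarrow> nat \<Rightarrow> 'a \<Rightarrow> real" where
  "mxs F 0 y = 0"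
| "mxs F (Suc n) y = max 0 (F y + mxs F n (T y))"

lemma mxs_meas [measurable]: "F \<in> borel_measurable M \<Longrightarrow> mxs F n \<in> borel_measurable M"
proof (induction n)
  case 0 then show ?case by (simp add: mxs.simps[abs_def])
next
  case (Suc n)
  have "mxs F (Suc n) = (\<lambda>y. max 0 (F y + mxs F n (T y)))" by auto
  also have "\<dots> \<in> borel_measurable M" using Suc by measurable
  finally show ?case .
qed

lemma mxs_nonneg: "0 \<le> mxs F n y" by (cases n) auto

lemma mxs_mono: "mxs F n y \<le> mxs F (Suc n) y"
proof (induction n arbitrary: y)
  case (Suc n)
  show ?case using Suc[of "T y"] by (simp only: mxs.simps)
qed simp

lemma mxs_bound: "(\<And>y. \<bar>F y\<bar> \<le> c) \<Longrightarrow> \<bar>mxs F n y\<bar> \<le> n * c"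
proof (induction n arbitrary: y)
  case (Suc n)
  have "\<bar>F y\<bar> \<le> c" "\<bar>mxs F n (T y)\<bar> \<le> n * c" using Suc by auto
  then show ?case by (auto simp: algebra_simps)
qed simp

lemma bsum_le_mxs: "bsum F n y \<le> mxs F n y"
proof (induction n arbitrary: y)
  case (Suc n) then show ?case by (simp add: bsum_Suc max.coboundedI2)
qed (simp add: bsum_def)

text \<open>Where \<open>mxs F n\<close> is positive, \<open>F\<close> dominates the coboundary
  \<open>mxs F n y - mxs F n (T y)\<close>, because \<open>mxs\<close> grows with \<open>n\<close>;
  elsewhere the coboundary is at most \<open>0\<close>. Its integral vanishes by invariance.\<close>

lemma maximal_ergodic:
  assumes F [measurable]: "F \<in> borel_measurable M" and c: "\<And>y. \<bar>F y\<bar> \<le> c"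
  shows "0 \<le> (\<integral>y. (if mxs F n y > 0 then F y else 0) \<partial>M)"
proof (cases n)
  case (Suc m)
  have i1: "integrable M (\<lambda>y. mxs F n y)" using mxs_bound[OF c] by (intro bounded_integrable) auto
  have i2: "integrable M (\<lambda>y. mxs F n (T y))" using mxs_bound[OF c] by (intro bounded_integrable) auto
  have "0 = (\<integral>y. mxs F n y \<partial>M) - (\<integral>y. mxs F n (T y) \<partial>M)"
    using integral_Tn[of "mxs F n" 1] by simp
  also have "\<dots> = (\<integral>y. mxs F n y - mxs F n (T y) \<partial>M)" using i1 i2 by simp
  also have "\<dots> \<le> (\<integral>y. (if mxs F n y > 0 then F y else 0) \<partial>M)"
  proof (rule integral_mono)
    show "integrable M (\<lambda>y. mxs F n y - mxs F n (T y))" using i1 i2 by simp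
    have "0 \<le> c" using c[of undefined] by linarith
    then show "integrable M (\<lambda>y. if mxs F n y > 0 then F y else 0)"
      using c by (intro bounded_integrable[of _ c]) auto
    fix y
    show "mxs F n y - mxs F n (T y) \<le> (if mxs F n y > 0 then F y else 0)"
      using mxs_nonneg[of F n "T y"] mxs_mono[of F m "T y"] unfolding Suc mxs.simps(2) by (simp add: max_def)
  qed
  finally show ?thesis .
qed simp

end

locale erg = mps +
  assumes ergodic0: "\<And>A. A \<in> sets M \<Longrightarrow> T -` A \<inter> space M = A \<Longrightarrow> emeasure M A = 0 \<or> emeasure M A = 1"
begin

text \<open>The set where the sums are unbounded above is invariant. If it had full measure,
  \<open>mxs F n\<close> would be eventually positive almost everywhere, and the maximal inequality
  would give a nonnegative integral of \<open>F\<close> in the limit.\<close>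

lemma bsum_bdd_above:
  assumes F [measurable]: "F \<in> borel_measurable M" and c: "\<And>y. \<bar>F y\<bar> \<le> c" and neg: "(\<integral>y. F y \<partial>M) < 0"
  shows "AE y in M. \<exists>C::nat. \<forall>n. bsum F n y \<le> C"
proof -
  define G where "G = {y\<in>space M. \<forall>C::nat. \<exists>n. bsum F n y > C}"
  have [measurable]: "G \<in> sets M" unfolding G_def by measurable
  have "T y \<in> G \<longleftrightarrow> y \<in> G" if y: "y \<in> space M" for y
  proof
    assume a: "T y \<in> G"
    have "\<exists>n. bsum F n y > C" for C :: nat
    proof -
      obtain n where "bsum F n (T y) > real (C + nat \<lceil>\<bar>F y\<bar>\<rceil>)" using a unfolding G_def by blast
      then have "bsum F (Suc n) y > C" by (simp add: bsum_Suc) linarith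
      then show ?thesis by blast
    qed
    then show "y \<in> G" using y by (simp add: G_def)
  next
    assume a: "y \<in> G"
    have "\<exists>n. bsum F n (T y) > C" for C :: nat
    proof -
      obtain n where n: "bsum F n y > real (C + nat \<lceil>\<bar>F y\<bar>\<rceil>)" using a unfolding G_def by blast
      then obtain m where "n = Suc m" by (cases n) (auto simp: bsum_def, linarith)
      then have "bsum F m (T y) > C" using n by (simp add: bsum_Suc) linarith
      then show ?thesis by blast
    qed
    then show "T y \<in> G" using y T_space by (simp add: G_def)
  qed
  then have "T -` G \<inter> space M = G" by (auto simp: G_def)
  then have "emeasure M G = 0 \<or> emeasure M G = 1" by (intro ergodic0) auto
  moreover have "emeasure M G \<noteq> 1"
  proof
    assume "emeasure M G = 1"
    then have "AE y in M. y \<in> G" by (intro AE_prob_1) (simp add: measure_def)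
    then have ae: "AE y in M. (\<lambda>n. if mxs F n y > 0 then F y else 0) \<longlonglongrightarrow> F y"
    proof eventually_elim
      case (elim y)
      then obtain n where "bsum F n y > real 0" unfolding G_def by blast
      then have n: "mxs F n y > 0" using bsum_le_mxs[of F n y] by simp
      have "mxs F m y > 0" if "m \<ge> n" for m
        using that by (induction m rule: dec_induct) (use n mxs_mono less_le_trans in \<open>blast+\<close>)
      then have "eventually (\<lambda>m. (if mxs F m y > 0 then F y else 0) = F y) sequentially"
        by (auto simp: eventually_sequentially intro!: exI[of _ n])
      then show ?case by (rule tendsto_eventually)
    qed
    have "0 \<le> c" using c[of undefined] by linarith
    then have "(\<lambda>n. \<integral>y. (if mxs F n y > 0 then F y else 0) \<partial>M) \<longlonglongrightarrow> (\<integral>y. F y \<partial>M)"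
      using c by (intro integral_dominated_convergence[where w="\<lambda>_. c"] ae) auto
    then have "0 \<le> (\<integral>y. F y \<partial>M)"
      by (rule LIMSEQ_le_const) (use maximal_ergodic[OF F c] in auto)
    then show False using neg by simp
  qed
  ultimately have "emeasure M G = 0" by simp
  then have "AE y in M. y \<notin> G" by (intro AE_I[of _ _ G]) auto
  then show ?thesis
    using AE_space by eventually_elim (auto simp: G_def not_less)
qed

text \<open>Subtracting a small \<open>e\<close> from \<open>F\<close> and from \<open>- F\<close>
  makes both integrals negative, so both families of sums are bounded above and
  \<open>bsum F n\<close> stays within a constant plus \<open>n * e\<close>. Dominated convergence
  turns this into convergence in mean.\<close>

lemma mean_ergodic:
  assumes F [measurable]: "F \<in> borel_measurable M" and c: "\<And>y. \<bar>F y\<bar> \<le> c" and zero: "(\<integral>y. F y \<partial>M) = 0"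
  shows "(\<lambda>n. \<integral>y. \<bar>bsum F n y / n\<bar> \<partial>M) \<longlonglongrightarrow> 0"
proof -
  have iF: "integrable M F" using c by (intro bounded_integrable) auto
  have 1: "AE y in M. \<exists>C::nat. \<forall>n. \<bar>bsum F n y\<bar> \<le> C + n / real (Suc m)" for m
  proof -
    define e where "e = 1 / real (Suc m)"
    have e: "e > 0" by (simp add: e_def)
    have s1: "bsum (\<lambda>y. F y - e) n y = bsum F n y - n * e" for n y by (simp add: bsum_def sum_subtractf)
    have s2: "bsum (\<lambda>y. - F y - e) n y = - bsum F n y - n * e" for n y
      by (simp add: bsum_def sum_subtractf sum_negf)
    have "\<bar>F y - e\<bar> \<le> c + e" "\<bar>- F y - e\<bar> \<le> c + e" for y using c[of y] e by linarith+
    then have "AE y in M. \<exists>C::nat. \<forall>n. bsum (\<lambda>y. F y - e) n y \<le> C"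
      "AE y in M. \<exists>C::nat. \<forall>n. bsum (\<lambda>y. - F y - e) n y \<le> C"
      using iF zero e by (auto intro!: bsum_bdd_above[where c="c+e"] simp: prob_space)
    then show ?thesis
    proof eventually_elim
      case (elim y)
      then obtain C1 C2 :: nat where C: "\<forall>n. bsum F n y - n * e \<le> C1" "\<forall>n. - bsum F n y - n * e \<le> C2"
        unfolding s1 s2 by blast
      have "\<bar>bsum F n y\<bar> \<le> real (max C1 C2) + n / real (Suc m)" for n
        using C(1)[rule_format, of n] C(2)[rule_format, of n] by (simp add: e_def abs_le_iff) linarith
      then show ?case by blast
    qed
  qed
  then have "AE y in M. \<forall>m. \<exists>C::nat. \<forall>n. \<bar>bsum F n y\<bar> \<le> C + n / real (Suc m)"
    by (subst AE_all_countable) simp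
  then have ae: "AE y in M. (\<lambda>n. \<bar>bsum F n y / n\<bar>) \<longlonglongrightarrow> 0"
  proof eventually_elim
    case (elim y)
    show ?case
    proof (rule LIMSEQ_I)
      fix r :: real assume "0 < r"
      then obtain m where m: "inverse (real (Suc m)) < r / 2" using reals_Archimedean[of "r/2"] by auto
      obtain C :: nat where C: "\<forall>n. \<bar>bsum F n y\<bar> \<le> C + n / real (Suc m)" using elim by blast
      obtain n0 :: nat where n0: "2 * C / r < n0" using reals_Archimedean2 by blast
      have "\<bar>bsum F n y / n\<bar> < r" if "n \<ge> Suc n0" for n
      proof -
        have n: "real n > 0" "real n > 2 * C / r" using that n0 by auto
        have "\<bar>bsum F n y / n\<bar> \<le> (C + n / real (Suc m)) / n"
          using C n by (simp add: abs_divide divide_right_mono)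
        also have "\<dots> = C / n + inverse (real (Suc m))" using n by (simp add: field_simps)
        also have "C / n < r / 2" using n \<open>0 < r\<close> by (simp add: field_simps)
        finally show ?thesis using m by simp
      qed
      then show "\<exists>no. \<forall>n\<ge>no. norm (\<bar>bsum F n y / real n\<bar> - 0) < r" by auto
    qed
  qed
  have c0: "0 \<le> c" using c[of undefined] by linarith
  have "(\<lambda>n. \<integral>y. \<bar>bsum F n y / n\<bar> \<partial>M) \<longlonglongrightarrow> (\<integral>y. 0 \<partial>M)"
  proof (rule integral_dominated_convergence[where w="\<lambda>_. c"])
    show "AE y in M. norm \<bar>bsum F n y / real n\<bar> \<le> c" for n
      using bsum_bound[OF c, where n=n] c0 by (cases "n = 0") (auto simp: abs_divide field_simps)
  qed (use ae in auto)
  then show ?thesis by simp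
qed

end

section \<open>Minimal homeomorphisms of the Cantor space\<close>

locale cdyn =
  fixes f :: "cant \<Rightarrow> cant"
  assumes bijf: "bij f" and contf: "continuous_on UNIV f" and contfi: "continuous_on UNIV (inv f)"
    and minimal: "\<And>U k. open U \<Longrightarrow> U \<noteq> {} \<Longrightarrow> \<exists>j. ziter f j k \<in> U"
begin

lemma cont_ziter: "continuous_on UNIV (ziter f j)"
proof -
  have "continuous_on UNIV (g ^^ n)" if "continuous_on UNIV g" for g :: "cant \<Rightarrow> cant" and n
  proof (induction n)
    case (Suc n)
    show ?case unfolding funpow.simps using that continuous_on_compose[OF Suc] continuous_on_subset by blast
  qed (simp add: id_def)
  then show ?thesis using contf contfi by (simp add: ziter_def)
qed

lemma cont_fn: "continuous_on UNIV (f ^^ n)" using cont_ziter[of "int n"] by (simp add: ziter_nat)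

lemma meas_ziter [measurable]: "ziter f j \<in> borel_measurable borel"
  using cont_ziter by (rule borel_measurable_continuous_onI)

lemma meas_fn [measurable]: "f ^^ n \<in> borel_measurable borel"
  using cont_fn by (rule borel_measurable_continuous_onI)

lemma open_vimage_ziter: "open U \<Longrightarrow> open (ziter f j -` U)" using cont_ziter open_vimage by blast

lemma open_vimage_fn: "open U \<Longrightarrow> open ((f ^^ n) -` U)" using cont_fn open_vimage by blast

text \<open>By compactness finitely many preimages of \<open>B\<close> cover the space, which bounds
  the distance to a visit by \<open>R\<close> in one of the two directions; searching from
  \<open>R + 1\<close> steps ahead, or from \<open>R\<close> steps behind, decides the
  direction.\<close>

lemma recur_ex:
  assumes "open B" "B \<noteq> {}" shows "\<exists>R. recur f B R"
proof -
  obtain D where D: "finite D" "UNIV \<subseteq> (\<Union>j\<in>D. ziter f j -` B)"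
  proof (rule compactE_image[OF compact_cantor, of UNIV "\<lambda>j. ziter f j -` B"])
    show "UNIV \<subseteq> (\<Union>j\<in>UNIV. ziter f j -` B)" using minimal[OF assms] by auto
  qed (use assms open_vimage_ziter in auto)
  define R where "R = nat (Max (insert 0 (abs ` D)))"
  have R: "\<bar>j\<bar> \<le> int R" if "j \<in> D" for j using that D(1) by (simp add: R_def)
  have ex: "\<exists>j. \<bar>j\<bar> \<le> int R \<and> ziter f j k \<in> B" for k using D(2) R by blast
  have "\<exists>j. 0 < j \<and> j \<le> 2 * R + 1 \<and> (f ^^ j) k \<in> B" for k
  proof -
    obtain j where j: "\<bar>j\<bar> \<le> int R" "ziter f j (ziter f (int R + 1) k) \<in> B" using ex by blast
    then have "ziter f (j + (int R + 1)) k \<in> B" using ziter_add[OF bijf] by simp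
    moreover have "j + (int R + 1) = int (nat (j + int R + 1))" using j by simp
    ultimately have "(f ^^ nat (j + int R + 1)) k \<in> B" by (metis ziter_nat)
    then show ?thesis using j by (intro exI[of _ "nat (j + int R + 1)"]) auto
  qed
  moreover have "\<exists>j\<le>2 * R + 1. ziter f (- int j) k \<in> B" for k
  proof -
    obtain j where j: "\<bar>j\<bar> \<le> int R" "ziter f j (ziter f (- int R) k) \<in> B" using ex by blast
    then have "ziter f (j + - int R) k \<in> B" using ziter_add[OF bijf, of j "- int R" k] by simp
    moreover have "j + - int R = - int (nat (int R - j))" using j by simp
    ultimately have "ziter f (- int (nat (int R - j))) k \<in> B" by metis
    then show ?thesis using j by (intro exI[of _ "nat (int R - j)"]) auto
  qed
  ultimately show ?thesis unfolding recur_def by blast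
qed

lemma off_borel [measurable]:
  assumes rec: "recur f B R" and B [measurable]: "B \<in> sets borel"
  shows "{k. off f B k = j} \<in> sets borel"
proof -
  have "off f B k = j \<longleftrightarrow> ziter f (- int j) k \<in> B \<and> (\<forall>i\<in>{..<j}. ziter f (- int i) k \<notin> B)" for k
    using off_in[OF rec, of k] off_min[of _ f B k]
    by (auto simp: off_def intro!: Least_equality)
  then have "{k. off f B k = j} = {k\<in>space borel. ziter f (- int j) k \<in> B \<and> (\<forall>i\<in>{..<j}. ziter f (- int i) k \<notin> B)}" by auto
  also have "\<dots> \<in> sets borel" by measurable
  finally show ?thesis .
qed

lemma ret_borel [measurable]:
  assumes rec: "recur f B R" and B [measurable]: "B \<in> sets borel"
  shows "{k. j < ret f B k} \<in> sets borel"
proof -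
  have "j < ret f B k \<longleftrightarrow> (\<forall>i\<in>{..j}. 0 < i \<longrightarrow> (f ^^ i) k \<notin> B)" for k
    using ret_min[of _ f B k] ret_props(1,2)[OF rec, of k] by (meson atMost_iff le_less_trans linorder_not_le)
  then have "{k. j < ret f B k} = {k\<in>space borel. \<forall>i\<in>{..j}. 0 < i \<longrightarrow> (f ^^ i) k \<notin> B}" by auto
  also have "\<dots> \<in> sets borel" by measurable
  finally show ?thesis .
qed

end

text \<open>Applied to two kinds of systems: the given extension with its map to the base, and every
  invariant measure on the limit system with the first projection.\<close>

locale ext = cdyn f + mps M T for f and M :: "'a measure" and T +
  fixes P :: "'a \<Rightarrow> cant"
  assumes P_meas [measurable]: "P \<in> borel_measurable M"
    and P_equi: "\<And>y. y \<in> space M \<Longrightarrow> P (T y) = f (P y)"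
begin

lemma P_ziter: "y \<in> space M \<Longrightarrow> P (ziter T j y) = ziter f j (P y)"
  using ziter_intertwine[OF bijf bijT, of "space M" P y j] T_space Ti_space P_equi by blast

lemma P_fn: "y \<in> space M \<Longrightarrow> P ((T ^^ n) y) = (f ^^ n) (P y)"
  using P_ziter[of y "int n"] by (simp add: ziter_nat)

text \<open>The sum of \<open>\<phi>\<close> over the column above a base point. It is
  \<open>0\<close> off the base, so that integrals over the base can be written over the whole
  space.\<close>

definition rsum :: "cant set \<Rightarrow> ('a \<Rightarrow> real) \<Rightarrow> 'a \<Rightarrow> real" where
  "rsum B \<phi> y = (if P y \<in> B then \<Sum>j<ret f B (P y). \<phi> ((T ^^ j) y) else 0)"

lemma rsum_alt:
  assumes "recur f B R"
  shows "rsum B \<phi> y = (\<Sum>j<R. if P y \<in> B \<and> P y \<in> {k. j < ret f B k} then \<phi> ((T ^^ j) y) else 0)"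
  unfolding rsum_def using ret_props(3)[OF assms, of "P y"]
  by (auto intro!: sum.mono_neutral_cong_left split: if_splits)

lemma rsum_meas:
  assumes "recur f B R" and [measurable]: "B \<in> sets borel" "\<phi> \<in> borel_measurable M"
  shows "rsum B \<phi> \<in> borel_measurable M"
proof -
  note [measurable] = ret_borel[OF assms(1,2)]
  have "(\<lambda>y. \<Sum>j<R. if P y \<in> B \<and> P y \<in> {k. j < ret f B k} then \<phi> ((T ^^ j) y) else 0) \<in> borel_measurable M"
    by measurable
  then show ?thesis unfolding rsum_alt[OF assms(1), abs_def] .
qed

lemma rsum_bound:
  assumes "recur f B R" "\<And>y. \<bar>\<phi> y\<bar> \<le> c"
  shows "\<bar>rsum B \<phi> y\<bar> \<le> R * c"
proof -
  have "0 \<le> c" using assms(2)[of undefined] by linarith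
  have "\<bar>rsum B \<phi> y\<bar> \<le> (\<Sum>j<R. c)"
    unfolding rsum_alt[OF assms(1)] by (rule order_trans[OF sum_abs sum_mono]) (use assms(2) \<open>0 \<le> c\<close> in auto)
  then show ?thesis by simp
qed

text \<open>Kac's formula for the tower over \<open>B\<close>. The space is cut by height, the part
  at height \<open>j\<close> is moved down to the base by invariance, and \<open>off_fwd_iff\<close>
  says where it lands. Bounded return times keep all sums finite.\<close>

lemma tower:
  fixes \<phi> :: "'a \<Rightarrow> real"
  assumes rec: "recur f B R" and B [measurable]: "B \<in> sets borel"
    and \<phi> [measurable]: "\<phi> \<in> borel_measurable M" and c: "\<And>y. \<bar>\<phi> y\<bar> \<le> c"
  shows "(\<integral>y. \<phi> y \<partial>M) = (\<integral>y. rsum B \<phi> y \<partial>M)"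
proof -
  note [measurable] = off_borel[OF rec B]
  define g where "g j y = (if P y \<in> {k. off f B k = j} then \<phi> y else 0)" for j y
  have gm [measurable]: "g j \<in> borel_measurable M" for j unfolding g_def[abs_def] by measurable
  have c0: "0 \<le> c" using c[of undefined] by linarith
  have gb: "\<bar>g j y\<bar> \<le> c" for j y using c c0 by (simp add: g_def)
  have "\<phi> y = (\<Sum>j\<in>{..R}. g j y)" for y
    using off_le[OF rec, of "P y"] by (simp add: g_def sum.delta)
  then have "(\<integral>y. \<phi> y \<partial>M) = (\<integral>y. (\<Sum>j\<in>{..R}. g j y) \<partial>M)" by presburger
  also have "\<dots> = (\<Sum>j\<in>{..R}. \<integral>y. g j y \<partial>M)"
    by (rule Bochner_Integration.integral_sum) (rule bounded_integrable[OF gm gb])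
  also have "\<dots> = (\<Sum>j\<in>{..R}. \<integral>y. g j ((T ^^ j) y) \<partial>M)" by (simp add: integral_Tn)
  also have "\<dots> = (\<integral>y. (\<Sum>j\<in>{..R}. g j ((T ^^ j) y)) \<partial>M)"
    by (rule Bochner_Integration.integral_sum[symmetric]) (rule bounded_integrable[OF _ gb], measurable)
  also have "\<dots> = (\<integral>y. rsum B \<phi> y \<partial>M)"
  proof (rule Bochner_Integration.integral_cong)
    fix y assume y: "y \<in> space M"
    have g: "g j ((T ^^ j) y) = (if P y \<in> B \<and> j < ret f B (P y) then \<phi> ((T ^^ j) y) else 0)" for j
      unfolding g_def using P_fn[OF y] off_fwd_iff[OF bijf rec] by simp
    have "(\<Sum>j\<in>{..R}. if j < ret f B (P y) then \<phi> ((T ^^ j) y) else 0) = (\<Sum>j<ret f B (P y). \<phi> ((T ^^ j) y))"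
      using ret_props(3)[OF rec, of "P y"]
      by (intro sum.mono_neutral_cong_right) auto
    then show "(\<Sum>j\<in>{..R}. g j ((T ^^ j) y)) = rsum B \<phi> y"
      unfolding g rsum_def by simp
  qed simp
  finally show ?thesis .
qed

end

section \<open>Choosing words on one block\<close>

text \<open>Words are sets of pairs (position, bit index). The excerpt is re-indexed to start at
  position \<open>0\<close> and loses the bit indices from \<open>n\<close> on, since sub-blocks
  belong to the lower level.\<close>

definition sub :: "nat \<Rightarrow> nat \<Rightarrow> nat \<Rightarrow> (nat \<times> nat) set \<Rightarrow> (nat \<times> nat) set" where
  "sub n j l v = {(a, i). a < l \<and> i < n \<and> (j + a, i) \<in> v}"

text \<open>Bit indices up to and including \<open>n\<close> count, because words of the new level
  carry the additional bit \<open>n\<close>.\<close>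

definition mismatch :: "nat \<Rightarrow> nat \<Rightarrow> (nat \<times> nat) set \<Rightarrow> (nat \<times> nat) set \<Rightarrow> nat set" where
  "mismatch n L u v = {a. a < L \<and> (\<exists>i\<le>n. ((a, i) \<in> u) \<noteq> ((a, i) \<in> v))}"

lemma finite_mismatch [simp]: "finite (mismatch n L u v)" by (simp add: mismatch_def)

text \<open>Greedy choice: every \<open>V i\<close> is larger than the forbidden set together with
  all the other representatives.\<close>

lemma sdr_avoid:
  assumes "finite I" "finite A" "\<And>i. i \<in> I \<Longrightarrow> finite (V i) \<and> card A + card I \<le> card (V i)"
  shows "\<exists>h. inj_on h I \<and> (\<forall>i\<in>I. h i \<in> V i - A)"
  using assms
proof (induction I rule: finite_induct)
  case (insert x I)
  then obtain h where h: "inj_on h I" "\<forall>i\<in>I. h i \<in> V i - A"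
    by (metis Suc_leD add_Suc_right card_insert_disjoint insertCI)
  have "card (A \<union> h ` I) \<le> card A + card I"
    using card_Un_le[of A "h ` I"] card_image_le[OF insert(1), of h] by linarith
  also have "\<dots> < card (V x)" using insert.prems(2)[of x] insert(1,2) by simp
  finally have "\<not> V x \<subseteq> A \<union> h ` I"
    using insert(1) insert.prems(1) by (metis card_mono finite_UnI finite_imageI linorder_not_le)
  then obtain p where p: "p \<in> V x" "p \<notin> A" "p \<notin> h ` I" by blast
  show ?case
    using h p insert(2) by (intro exI[of _ "h(x := p)"]) (auto simp: inj_on_def)
qed simp

text \<open>One block of level \<open>n + 1\<close>: \<open>St\<close> are the starting times of its sub-blocks, \<open>l j\<close> their lengths, \<open>ty j\<close> their types
  and \<open>WW t\<close> the words allowed on a sub-block of type \<open>t\<close>; \<open>\<tau> t\<close> is the target distribution on \<open>WW t\<close>.\<close>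
locale comb =
  fixes n L R :: nat and St :: "nat set" and l :: "nat \<Rightarrow> nat" and ty :: "nat \<Rightarrow> 't"
    and WW :: "'t \<Rightarrow> (nat \<times> nat) set set" and \<tau> :: "'t \<Rightarrow> (nat \<times> nat) set \<Rightarrow> real" and \<Omega> :: "('t \<times> (nat \<times> nat) set) set"
  assumes St: "St \<subseteq> {..<L}" and l: "\<And>j. j \<in> St \<Longrightarrow> 0 < l j \<and> l j \<le> R \<and> j + l j \<le> L"
    and disj: "\<And>j j'. j \<in> St \<Longrightarrow> j' \<in> St \<Longrightarrow> j < j' \<Longrightarrow> j + l j \<le> j'"
    and cover: "\<And>a. a < L \<Longrightarrow> \<exists>j\<in>St. j \<le> a \<and> a < j + l j"
    and WW: "\<And>j. j \<in> St \<Longrightarrow> WW (ty j) \<noteq> {} \<and> WW (ty j) \<subseteq> Pow ({..<l j} \<times> {..<n})"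
    and finP: "finite \<Omega>" and \<Omega>: "\<And>j w. j \<in> St \<Longrightarrow> (ty j, w) \<in> \<Omega> \<longleftrightarrow> w \<in> WW (ty j)"
    and \<Omega>W: "\<And>t w. (t, w) \<in> \<Omega> \<Longrightarrow> w \<in> WW t"
    and \<tau>: "\<And>t w. (t, w) \<in> \<Omega> \<Longrightarrow> 0 \<le> \<tau> t w \<and> \<tau> t w \<le> 1"
    and \<tau>1: "\<And>j. j \<in> St \<Longrightarrow> (\<Sum>w\<in>WW (ty j). \<tau> (ty j) w) = 1"
begin

lemma finSt [simp]: "finite St" using St finite_subset by blast

lemma finW: "j \<in> St \<Longrightarrow> finite (WW (ty j))" using WW finite_subset by (metis finite_Pow_iff finite_SigmaI finite_lessThan)

text \<open>Signed excess of \<open>w\<close> over its target share among the visits to type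
  \<open>t\<close>. The set \<open>S\<close> of starts varies so that the excess can be followed
  while a block is filled from left to right.\<close>

definition discr :: "(nat \<Rightarrow> (nat \<times> nat) set) \<Rightarrow> nat set \<Rightarrow> 't \<Rightarrow> (nat \<times> nat) set \<Rightarrow> real" where
  "discr c S t w = (\<Sum>j\<in>S. if ty j = t then of_bool (c j = w) - \<tau> t w else 0)"

definition ok :: "(nat \<Rightarrow> (nat \<times> nat) set) \<Rightarrow> bool" where
  "ok c \<longleftrightarrow> (\<forall>j\<in>St. c j \<in> WW (ty j))"

text \<open>Every visit selects exactly one word of its type, and the targets of the type add up to
  \<open>1\<close>.\<close>

lemma discr_sum_zero:
  assumes "ok c" "S \<subseteq> St" "j0 \<in> St"
  shows "(\<Sum>w\<in>WW (ty j0). discr c S (ty j0) w) = 0"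
proof -
  have "(\<Sum>w\<in>WW (ty j0). discr c S (ty j0) w)
      = (\<Sum>j\<in>S. \<Sum>w\<in>WW (ty j0). if ty j = ty j0 then of_bool (c j = w) - \<tau> (ty j0) w else 0)"
    unfolding discr_def by (rule sum.swap)
  also have "\<dots> = (\<Sum>j\<in>S. 0)"
  proof (rule sum.cong)
    fix j assume j: "j \<in> S"
    show "(\<Sum>w\<in>WW (ty j0). if ty j = ty j0 then of_bool (c j = w) - \<tau> (ty j0) w else 0) = 0"
    proof (cases "ty j = ty j0")
      case True
      have "c j \<in> WW (ty j)" using assms(1,2) j by (auto simp: ok_def)
      then have "c j \<in> WW (ty j0)" using True by simp
      then have "(\<Sum>w\<in>WW (ty j0). of_bool (c j = w)) = (1::real)"
        using finW[OF assms(3)] by (simp add: of_bool_def)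
      then show ?thesis using True \<tau>1[OF assms(3)] by (simp add: sum_subtractf)
    qed simp
  qed simp
  finally show ?thesis by simp
qed

text \<open>The discrepancies of the words of one type sum to zero, so at each visit some word is not over-represented; choosing it
  keeps every discrepancy at most 1.\<close>

lemma greedy: "\<exists>c. ok c \<and> (\<forall>j0\<in>St. \<forall>w\<in>WW (ty j0). discr c (St \<inter> {..<T}) (ty j0) w \<le> 1)"
proof (induction T)
  case 0
  have "\<forall>j\<in>St. \<exists>w. w \<in> WW (ty j)" using WW by blast
  then obtain c where "\<forall>j\<in>St. c j \<in> WW (ty j)" by metis
  then show ?case by (auto simp: ok_def discr_def)
next
  case (Suc T)
  then obtain c where c: "ok c" "\<forall>j0\<in>St. \<forall>w\<in>WW (ty j0). discr c (St \<inter> {..<T}) (ty j0) w \<le> 1" by blast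
  show ?case
  proof (cases "T \<in> St")
    case False
    then have "St \<inter> {..<Suc T} = St \<inter> {..<T}" by (auto simp: less_Suc_eq)
    then show ?thesis using c by auto
  next
    case True
    have "\<exists>w\<in>WW (ty T). discr c (St \<inter> {..<T}) (ty T) w \<le> 0"
    proof (rule ccontr)
      assume "\<not> ?thesis"
      then have "(\<Sum>w\<in>WW (ty T). discr c (St \<inter> {..<T}) (ty T) w) > 0"
        using WW[OF True] finW[OF True] by (intro sum_pos) auto
      then show False using discr_sum_zero[OF c(1) _ True, of "St \<inter> {..<T}"] by simp
    qed
    then obtain w0 where w0: "w0 \<in> WW (ty T)" "discr c (St \<inter> {..<T}) (ty T) w0 \<le> 0" by blast
    define c' where "c' = c(T := w0)"
    have ins: "St \<inter> {..<Suc T} = insert T (St \<inter> {..<T})" using True by auto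
    have old: "discr c' (St \<inter> {..<T}) t w = discr c (St \<inter> {..<T}) t w" for t w
      unfolding discr_def by (rule sum.cong) (auto simp: c'_def)
    have new: "discr c' (St \<inter> {..<Suc T}) t w = (if ty T = t then of_bool (w0 = w) - \<tau> t w else 0) + discr c (St \<inter> {..<T}) t w" for t w
      unfolding ins old[symmetric] unfolding discr_def by (subst sum.insert) (auto simp: c'_def)
    have "discr c' (St \<inter> {..<Suc T}) (ty j0) w \<le> 1" if j0: "j0 \<in> St" and w: "w \<in> WW (ty j0)" for j0 w
    proof -
      have "0 \<le> \<tau> (ty j0) w" using \<tau> \<Omega>[OF j0] w by blast
      moreover have "discr c (St \<inter> {..<T}) (ty j0) w \<le> 1" using c(2) j0 w by blast
      ultimately show ?thesis unfolding new using w0(2) by auto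
    qed
    moreover have "ok c'" using c(1) w0(1) by (auto simp: ok_def c'_def)
    ultimately show ?thesis by blast
  qed
qed

text \<open>Upper bounds for all words of a type give a lower bound for each: the discrepancies sum
  to zero, so one of them cannot be very negative while the others are at most
  \<open>1\<close>.\<close>

lemma discr_ge:
  assumes "ok c" "j0 \<in> St" "\<forall>w\<in>WW (ty j0). discr c St (ty j0) w \<le> 1" "w \<in> WW (ty j0)"
  shows "\<bar>discr c St (ty j0) w\<bar> \<le> card \<Omega>"
proof -
  have "0 = discr c St (ty j0) w + (\<Sum>w\<in>WW (ty j0) - {w}. discr c St (ty j0) w)"
    using discr_sum_zero[OF assms(1) order_refl assms(2)] assms(4) finW[OF assms(2)] by (simp add: sum.remove)
  moreover have "(\<Sum>w\<in>WW (ty j0) - {w}. discr c St (ty j0) w) \<le> of_nat (card (WW (ty j0) - {w})) * 1"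
    by (rule sum_bounded_above) (use assms(3) in auto)
  moreover have "card (WW (ty j0) - {w}) \<le> card \<Omega>"
  proof -
    have "card (WW (ty j0)) = card (Pair (ty j0) ` WW (ty j0))" by (simp add: card_image inj_on_def)
    also have "\<dots> \<le> card \<Omega>" using \<Omega>[OF assms(2)] by (intro card_mono finP) auto
    finally show ?thesis using card_mono[OF finW[OF assms(2)], of "WW (ty j0) - {w}"] by (meson Diff_subset le_trans)
  qed
  moreover have "1 \<le> card \<Omega>" using \<Omega>[OF assms(2)] assms(4) finP
    by (metis Suc_leI One_nat_def card_gt_0_iff empty_iff)
  ultimately show ?thesis using assms(3,4) by (fastforce simp: abs_le_iff)
qed

text \<open>Pairs of \<open>\<Omega>\<close> whose type does not occur in the block have discrepancy
  zero.\<close>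

lemma greedy': "\<exists>c. ok c \<and> (\<forall>(t, w)\<in>\<Omega>. \<bar>discr c St t w\<bar> \<le> card \<Omega>)"
proof -
  have "St \<inter> {..<L} = St" using St by auto
  then obtain c where c: "ok c" "\<forall>j0\<in>St. \<forall>w\<in>WW (ty j0). discr c St (ty j0) w \<le> 1" using greedy[of L] by metis
  have "\<bar>discr c St t w\<bar> \<le> card \<Omega>" if "(t, w) \<in> \<Omega>" for t w
  proof (cases "\<exists>j0\<in>St. ty j0 = t")
    case True
    then show ?thesis using discr_ge[OF c(1)] c(2) \<Omega>W[OF that] by blast
  next
    case False
    then show ?thesis by (subst discr_def) (simp add: sum.neutral)
  qed
  then show ?thesis using c(1) by blast
qed

lemma discr_change:
  assumes "(t, w) \<in> \<Omega>"
  shows "\<bar>discr c' St t w\<bar> \<le> \<bar>discr c St t w\<bar> + card {j\<in>St. c' j \<noteq> c j}"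
proof -
  have "\<bar>discr c' St t w - discr c St t w\<bar> = \<bar>\<Sum>j\<in>St. if ty j = t then of_bool (c' j = w) - of_bool (c j = w) else (0::real)\<bar>"
    unfolding discr_def sum_subtractf[symmetric] by (intro arg_cong[where f=abs] sum.cong) auto
  also have "\<dots> \<le> (\<Sum>j\<in>St. of_bool (c' j \<noteq> c j))"
    by (rule order_trans[OF sum_abs sum_mono]) auto
  also have "\<dots> = card {j\<in>St. c' j \<noteq> c j}"
    by (simp add: of_bool_def sum.If_cases Int_def)
  finally show ?thesis by linarith
qed

text \<open>Each pair \<open>(t, w)\<close> of \<open>\<Omega>\<close> reserves its own sub-block of
  type \<open>t\<close> outside the protected set \<open>A\<close>, and \<open>w\<close> is written
  there. At most \<open>card \<Omega>\<close> sub-blocks are touched, however long the block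
  is.\<close>

lemma repair:
  assumes "ok c" "A \<subseteq> St" "\<And>t w. (t, w) \<in> \<Omega> \<Longrightarrow> card A + card \<Omega> \<le> card {j\<in>St. ty j = t}"
  shows "\<exists>c'. ok c' \<and> (\<forall>j\<in>A. c' j = c j) \<and> card {j\<in>St. c' j \<noteq> c j} \<le> card \<Omega> \<and>
    (\<forall>(t, w)\<in>\<Omega>. \<exists>j\<in>St. ty j = t \<and> c' j = w)"
proof -
  have "finite A" using finite_subset[OF assms(2) finSt] .
  then obtain h where h: "inj_on h \<Omega>" "\<forall>\<pi>\<in>\<Omega>. h \<pi> \<in> {j\<in>St. ty j = fst \<pi>} - A"
    using sdr_avoid[OF finP, of A "\<lambda>\<pi>. {j\<in>St. ty j = fst \<pi>}"] assms(3) by auto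
  define c' where "c' j = (if j \<in> h ` \<Omega> then snd (inv_into \<Omega> h j) else c j)" for j
  have c'h: "c' (h \<pi>) = snd \<pi>" if "\<pi> \<in> \<Omega>" for \<pi> using that h(1) by (simp add: c'_def)
  have "ok c'" unfolding ok_def
  proof
    fix j assume j: "j \<in> St"
    show "c' j \<in> WW (ty j)"
    proof (cases "j \<in> h ` \<Omega>")
      case True
      then obtain \<pi> where "\<pi> \<in> \<Omega>" "j = h \<pi>" by blast
      then show ?thesis using c'h h(2) \<Omega>W[of "fst \<pi>" "snd \<pi>"] by auto
    qed (use assms(1) j in \<open>auto simp: ok_def c'_def\<close>)
  qed
  moreover have "\<forall>j\<in>A. c' j = c j" using h(2) by (auto simp: c'_def)
  moreover have "card {j\<in>St. c' j \<noteq> c j} \<le> card \<Omega>"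
  proof -
    have "card {j\<in>St. c' j \<noteq> c j} \<le> card (h ` \<Omega>)" by (intro card_mono finite_imageI finP) (auto simp: c'_def)
    then show ?thesis using card_image_le[OF finP, of h] by simp
  qed
  moreover have "\<forall>(t, w)\<in>\<Omega>. \<exists>j\<in>St. ty j = t \<and> c' j = w" using h(2) c'h by force
  ultimately show ?thesis by blast
qed

text \<open>Concatenation of the chosen words; the new bit \<open>n\<close> is copied from
  \<open>u\<close>, as no condition concerns it.\<close>

definition asm :: "(nat \<Rightarrow> (nat \<times> nat) set) \<Rightarrow> (nat \<times> nat) set \<Rightarrow> (nat \<times> nat) set" where
  "asm c u = {(a, i). a < L \<and> (i < n \<and> (\<exists>j\<in>St. j \<le> a \<and> (a - j, i) \<in> c j) \<or> i = n \<and> (a, i) \<in> u)}"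

lemma same_block:
  assumes "j \<in> St" "j' \<in> St" "j \<le> a" "a < j + l j" "j' \<le> a" "a < j' + l j'" shows "j = j'"
  using disj[OF assms(1,2)] disj[OF assms(2,1)] assms by (meson linorder_neqE_nat leD le_trans less_le_trans)

lemma ok_bound: "ok c \<Longrightarrow> j \<in> St \<Longrightarrow> (a, i) \<in> c j \<Longrightarrow> a < l j \<and> i < n"
  using WW by (fastforce simp: ok_def)

lemma asm_block:
  assumes "ok c" "j \<in> St" "j \<le> a" "a < j + l j" "i < n"
  shows "(a, i) \<in> asm c u \<longleftrightarrow> (a - j, i) \<in> c j"
proof -
  have "a < L" using l[OF assms(2)] assms(4) by linarith
  moreover have *: "j' = j" if "j' \<in> St" "j' \<le> a" "(a - j', i) \<in> c j'" for j'
  proof -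
    have "a - j' < l j'" using ok_bound[OF assms(1) that(1,3)] by simp
    then show ?thesis using same_block[OF that(1) assms(2) that(2) _ assms(3,4)] that(2) by linarith
  qed
  ultimately have "(a, i) \<in> asm c u \<longleftrightarrow> (\<exists>j'\<in>St. j' \<le> a \<and> (a - j', i) \<in> c j')"
    using assms(5) by (simp add: asm_def)
  then show ?thesis using * assms(2,3) by blast
qed

lemma sub_asm:
  assumes "ok c" "j \<in> St" shows "sub n j (l j) (asm c u) = c j"
proof -
  have "(j + a, i) \<in> asm c u \<longleftrightarrow> (a, i) \<in> c j" if "a < l j" "i < n" for a i
    using asm_block[OF assms, of "j + a" i u] that by simp
  then show ?thesis using ok_bound[OF assms] by (auto simp: sub_def)
qed

text \<open>All conditions beyond the first look only at the excerpts \<open>sub n\<close>, so the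
  bit \<open>n\<close> is arbitrary. The tolerance is proportional to \<open>L\<close>, which for
  long blocks outweighs the bounded cost of \<open>repair\<close> and of prescribing a few
  positions.\<close>

definition good :: "real \<Rightarrow> (nat \<times> nat) set set" where
  "good e = {v. v \<subseteq> {..<L} \<times> {..<Suc n} \<and> ok (\<lambda>j. sub n j (l j) v) \<and>
     (\<forall>(t, w)\<in>\<Omega>. \<bar>discr (\<lambda>j. sub n j (l j) v) St t w\<bar> \<le> e * L) \<and>
     (\<forall>(t, w)\<in>\<Omega>. \<exists>j\<in>St. ty j = t \<and> sub n j (l j) v = w)}"

lemma asm_good:
  fixes e :: real
  assumes c: "ok c" and "\<forall>(t, w)\<in>\<Omega>. \<bar>discr c St t w\<bar> \<le> e * L" "\<forall>(t, w)\<in>\<Omega>. \<exists>j\<in>St. ty j = t \<and> c j = w"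
  shows "asm c u \<in> good e"
proof -
  have "discr (\<lambda>j. sub n j (l j) (asm c u)) St t w = discr c St t w" for t w
    unfolding discr_def using sub_asm[OF c] by (intro sum.cong) auto
  moreover have "ok (\<lambda>j. sub n j (l j) (asm c u))" using c sub_asm[OF c] by (simp add: ok_def)
  moreover have "asm c u \<subseteq> {..<L} \<times> {..<Suc n}" by (auto simp: asm_def)
  ultimately show ?thesis using assms(2,3) sub_asm[OF c] by (auto simp: good_def)
qed

text \<open>Fill greedily, overwrite the sub-blocks that meet \<open>A\<close> by the prescribed
  content, then repair outside them. The contributions to the discrepancy are at most
  \<open>card \<Omega>\<close>, \<open>J\<close> and \<open>card \<Omega>\<close>, whence the
  hypothesis on \<open>e\<close>.\<close>

lemma extend:
  fixes e :: real
  assumes A: "A \<subseteq> {..<L}" "card A \<le> J" and u: "\<And>j. j \<in> St \<Longrightarrow> A \<inter> {j..<j + l j} \<noteq> {} \<Longrightarrow> sub n j (l j) u \<in> WW (ty j)"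
    and vis: "\<And>t w. (t, w) \<in> \<Omega> \<Longrightarrow> J + card \<Omega> \<le> card {j\<in>St. ty j = t}"
    and e: "2 * card \<Omega> + J \<le> e * L"
  shows "\<exists>v\<in>good e. \<forall>a\<in>A. \<forall>i\<le>n. (a, i) \<in> v \<longleftrightarrow> (a, i) \<in> u"
proof -
  obtain c0 where c0: "ok c0" "\<forall>(t, w)\<in>\<Omega>. \<bar>discr c0 St t w\<bar> \<le> card \<Omega>" using greedy' by blast
  define P where "P = {j\<in>St. A \<inter> {j..<j + l j} \<noteq> {}}"
  define c1 where "c1 j = (if j \<in> P then sub n j (l j) u else c0 j)" for j
  have fA: "finite A" using A finite_subset by auto
  \<comment> \<open>Sub-blocks are disjoint, so selecting a point of \<open>A\<close> in each one
    that meets \<open>A\<close> is injective.\<close>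
  have "card P \<le> card A"
  proof -
    define g where "g j = (SOME a. a \<in> A \<inter> {j..<j + l j})" for j
    have g: "g j \<in> A \<inter> {j..<j + l j}" if "j \<in> P" for j
      using that some_in_eq[of "A \<inter> {j..<j + l j}"] unfolding g_def P_def by simp
    have "inj_on g P"
    proof (rule inj_onI)
      fix x y assume "x \<in> P" "y \<in> P" "g x = g y"
      then show "x = y" using g[of x] g[of y] by (intro same_block[of x y "g x"]) (auto simp: P_def)
    qed
    then show ?thesis using g fA by (metis Int_iff card_inj_on_le image_subsetI)
  qed
  then have cP: "card P \<le> J" using A by simp
  have ok1: "ok c1" using c0(1) u by (auto simp: ok_def c1_def P_def)
  obtain c2 where c2: "ok c2" "\<forall>j\<in>P. c2 j = c1 j" "card {j\<in>St. c2 j \<noteq> c1 j} \<le> card \<Omega>"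
      "\<forall>(t, w)\<in>\<Omega>. \<exists>j\<in>St. ty j = t \<and> c2 j = w"
  proof -
    have "P \<subseteq> St" by (auto simp: P_def)
    moreover have "card P + card \<Omega> \<le> card {j\<in>St. ty j = t}" if "(t, w) \<in> \<Omega>" for t w
      using vis[OF that] cP by linarith
    ultimately show ?thesis using repair[OF ok1, of P] that by blast
  qed
  have "\<bar>discr c2 St t w\<bar> \<le> e * L" if tw: "(t, w) \<in> \<Omega>" for t w
  proof -
    have "card {j\<in>St. c1 j \<noteq> c0 j} \<le> card P"
      by (rule card_mono) (auto simp: P_def c1_def intro: finite_subset[OF _ finSt])
    moreover have "\<bar>discr c0 St t w\<bar> \<le> card \<Omega>" using c0(2) tw by blast
    ultimately show ?thesis
      using discr_change[OF tw, of c1 c0] discr_change[OF tw, of c2 c1] c2(3) cP e by linarith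
  qed
  then have "asm c2 u \<in> good e" by (intro asm_good[OF c2(1) _ c2(4)]) auto
  moreover have "(a, i) \<in> asm c2 u \<longleftrightarrow> (a, i) \<in> u" if a: "a \<in> A" "i \<le> n" for a i
  proof (cases "i = n")
    case True
    then show ?thesis using a A by (auto simp: asm_def)
  next
    case False
    obtain j where j: "j \<in> St" "j \<le> a" "a < j + l j" using cover a A by blast
    then have "j \<in> P" using a by (auto simp: P_def)
    then have "c2 j = sub n j (l j) u" using c2(2) by (simp add: c1_def)
    then show ?thesis using asm_block[OF c2(1) j, of i u] False a(2) j by (auto simp: sub_def)
  qed
  ultimately show ?thesis by blast
qed

text \<open>A word with the right frequencies up to half the tolerance lacks at most some
  occurrences. Supplying them costs \<open>card \<Omega>\<close> sub-blocks of length at most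
  \<open>R\<close>, and the other half of the tolerance absorbs the change.\<close>

lemma near:
  fixes e :: real
  assumes u: "ok (\<lambda>j. sub n j (l j) u)" "\<forall>(t, w)\<in>\<Omega>. \<bar>discr (\<lambda>j. sub n j (l j) u) St t w\<bar> \<le> e / 2 * L"
    and vis: "\<And>t w. (t, w) \<in> \<Omega> \<Longrightarrow> card \<Omega> \<le> card {j\<in>St. ty j = t}"
    and e: "2 * card \<Omega> \<le> e * L"
  shows "\<exists>v\<in>good e. card (mismatch n L u v) \<le> card \<Omega> * R"
proof -
  define c where "c j = sub n j (l j) u" for j
  obtain c' where c': "ok c'" "card {j\<in>St. c' j \<noteq> c j} \<le> card \<Omega>"
      "\<forall>(t, w)\<in>\<Omega>. \<exists>j\<in>St. ty j = t \<and> c' j = w"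
    using repair[of c "{}"] u(1) vis unfolding c_def by auto
  have "\<bar>discr c' St t w\<bar> \<le> e * L" if tw: "(t, w) \<in> \<Omega>" for t w
  proof -
    have "c = (\<lambda>j. sub n j (l j) u)" by (simp add: c_def fun_eq_iff)
    then have "\<bar>discr c St t w\<bar> \<le> e / 2 * L" using u(2) tw by blast
    then show ?thesis using discr_change[OF tw, of c' c] c'(2) e by linarith
  qed
  then have g: "asm c' u \<in> good e" by (intro asm_good[OF c'(1) _ c'(3)]) auto
  define D where "D = {j\<in>St. c' j \<noteq> c j}"
  have "mismatch n L u (asm c' u) \<subseteq> (\<Union>j\<in>D. {j..<j + l j})"
  proof
    fix a assume "a \<in> mismatch n L u (asm c' u)"
    then obtain i where a: "a < L" "i \<le> n" "((a, i) \<in> u) \<noteq> ((a, i) \<in> asm c' u)" by (auto simp: mismatch_def)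
    \<comment> \<open>The bit \<open>n\<close> is copied from \<open>u\<close>, so a mismatch can
      occur only at a smaller index.\<close>
    then have i: "i < n" by (auto simp: asm_def le_less)
    obtain j where j: "j \<in> St" "j \<le> a" "a < j + l j" using cover a by blast
    have "(a - j, i) \<in> c j \<longleftrightarrow> (a, i) \<in> u" using j i by (auto simp: c_def sub_def)
    then have "c' j \<noteq> c j" using asm_block[OF c'(1) j i, of u] a(3) by auto
    then show "a \<in> (\<Union>j\<in>D. {j..<j + l j})" using j by (auto simp: D_def)
  qed
  then have "card (mismatch n L u (asm c' u)) \<le> card (\<Union>j\<in>D. {j..<j + l j})"
    by (intro card_mono) (auto simp: D_def)
  also have "\<dots> \<le> (\<Sum>j\<in>D. card {j..<j + l j})" by (rule card_UN_le) (auto simp: D_def)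
  also have "\<dots> \<le> (\<Sum>j\<in>D. R)" by (rule sum_mono) (use l in \<open>auto simp: D_def\<close>)
  also have "\<dots> = card D * R" by simp
  also have "\<dots> \<le> card \<Omega> * R" using c'(2) by (intro mult_right_mono) (auto simp: D_def)
  finally show ?thesis using g by blast
qed

text \<open>Summation by pairs instead of by sub-blocks: every statistic of (type, word) deviates
  from its \<open>\<tau>\<close>-average by a combination of discrepancies.\<close>

lemma weighted_discr:
  assumes "ok c"
  shows "(\<Sum>j\<in>St. \<theta> (ty j) (c j) - (\<Sum>w\<in>WW (ty j). \<tau> (ty j) w * \<theta> (ty j) w))
    = (\<Sum>(t, w)\<in>\<Omega>. \<theta> t w * discr c St t w)"
proof -
  have "(\<Sum>(t, w)\<in>\<Omega>. \<theta> t w * discr c St t w)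
      = (\<Sum>j\<in>St. \<Sum>(t, w)\<in>\<Omega>. if ty j = t then \<theta> t w * (of_bool (c j = w) - \<tau> t w) else 0)"
    unfolding discr_def by (subst sum.swap) (auto intro!: sum.cong simp: sum_distrib_left if_distrib cong: if_cong)
  also have "\<dots> = (\<Sum>j\<in>St. \<theta> (ty j) (c j) - (\<Sum>w\<in>WW (ty j). \<tau> (ty j) w * \<theta> (ty j) w))"
  proof (rule sum.cong)
    fix j assume j: "j \<in> St"
    have *: "(\<Sum>(t, w)\<in>\<Omega>. if ty j = t then \<theta> t w * (of_bool (c j = w) - \<tau> t w) else 0)
        = (\<Sum>\<pi>\<in>Pair (ty j) ` WW (ty j). \<theta> (fst \<pi>) (snd \<pi>) * (of_bool (c j = snd \<pi>) - \<tau> (fst \<pi>) (snd \<pi>)))"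
    proof (rule sum.mono_neutral_cong_right[OF finP])
      show "Pair (ty j) ` WW (ty j) \<subseteq> \<Omega>" using \<Omega>[OF j] by auto
      show "\<forall>\<pi>\<in>\<Omega> - Pair (ty j) ` WW (ty j). (case \<pi> of (t, w) \<Rightarrow> if ty j = t then \<theta> t w * (of_bool (c j = w) - \<tau> t w) else 0) = 0"
      proof
        fix \<pi> assume p: "\<pi> \<in> \<Omega> - Pair (ty j) ` WW (ty j)"
        obtain t w where tw: "\<pi> = (t, w)" by (cases \<pi>)
        have "ty j \<noteq> t" using p \<Omega>[OF j, of w] by (auto simp: tw)
        then show "(case \<pi> of (t, w) \<Rightarrow> if ty j = t then \<theta> t w * (of_bool (c j = w) - \<tau> t w) else 0) = 0"
          by (simp add: tw)
      qed
    qed (simp add: case_prod_beta, fastforce)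
    also have "\<dots> = (\<Sum>w\<in>WW (ty j). \<theta> (ty j) w * (of_bool (c j = w) - \<tau> (ty j) w))"
      by (subst sum.reindex) (auto simp: inj_on_def)
    also have "\<dots> = (\<Sum>w\<in>WW (ty j). (if c j = w then \<theta> (ty j) w else 0) - \<tau> (ty j) w * \<theta> (ty j) w)"
      by (rule sum.cong) (auto simp: algebra_simps)
    also have "\<dots> = \<theta> (ty j) (c j) - (\<Sum>w\<in>WW (ty j). \<tau> (ty j) w * \<theta> (ty j) w)"
      using assms j finW[OF j] by (simp add: sum_subtractf ok_def)
    finally show "(\<Sum>(t, w)\<in>\<Omega>. if ty j = t then \<theta> t w * (of_bool (c j = w) - \<tau> t w) else 0)
      = \<theta> (ty j) (c j) - (\<Sum>w\<in>WW (ty j). \<tau> (ty j) w * \<theta> (ty j) w)" .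
  qed simp
  finally show ?thesis by simp
qed

lemma weighted_discr_bound:
  fixes e C :: real
  assumes v: "v \<in> good e" and \<theta>: "\<And>t w. \<bar>\<theta> t w\<bar> \<le> (C::real)"
  shows "\<bar>\<Sum>j\<in>St. \<theta> (ty j) (sub n j (l j) v) - (\<Sum>w\<in>WW (ty j). \<tau> (ty j) w * \<theta> (ty j) w)\<bar> \<le> card \<Omega> * C * e * L"
proof -
  have "\<bar>\<Sum>(t, w)\<in>\<Omega>. \<theta> t w * discr (\<lambda>j. sub n j (l j) v) St t w\<bar> \<le> (\<Sum>(t, w)\<in>\<Omega>. C * (e * L))"
  proof (rule order_trans[OF sum_abs sum_mono])
    fix \<pi> assume "\<pi> \<in> \<Omega>"
    then have "\<bar>\<theta> (fst \<pi>) (snd \<pi>)\<bar> * \<bar>discr (\<lambda>j. sub n j (l j) v) St (fst \<pi>) (snd \<pi>)\<bar> \<le> C * (e * L)"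
      using v \<theta> by (intro mult_mono') (auto simp: good_def)
    then show "\<bar>case \<pi> of (t, w) \<Rightarrow> \<theta> t w * discr (\<lambda>j. sub n j (l j) v) St t w\<bar> \<le> (case \<pi> of (t, w) \<Rightarrow> C * (e * L))"
      by (simp add: case_prod_beta abs_mult)
  qed
  also have "\<dots> = card \<Omega> * C * e * L" by simp
  finally show ?thesis using weighted_discr[of "\<lambda>j. sub n j (l j) v" \<theta>] v by (simp add: good_def)
qed

end

text \<open>Dependence on finitely many coordinates, which by compactness is local constancy. The
  data attached to blocks have this form, which makes them at once finite-valued, continuous and
  measurable.\<close>

definition dep :: "(cant \<Rightarrow> 'b) \<Rightarrow> bool" where
  "dep \<psi> \<longleftrightarrow> (\<exists>N. \<forall>k k'. agr N k k' \<longrightarrow> \<psi> k = \<psi> k')"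

lemma dep_clopen: "open (B::cant set) \<Longrightarrow> open (- B) \<Longrightarrow> dep (\<lambda>k. k \<in> B)"
  unfolding dep_def by (rule clopen_dep)

lemma dep_fun: "dep \<psi> \<Longrightarrow> dep (\<lambda>k. g (\<psi> k))" unfolding dep_def by metis

lemma dep_compose:
  assumes "dep \<psi>" "continuous_on UNIV (h::cant \<Rightarrow> cant)" shows "dep (\<lambda>k. \<psi> (h k))"
  using assms unfolding dep_def by (meson unif_cont_agr)

lemma dep_Pair: "dep \<psi> \<Longrightarrow> dep \<phi> \<Longrightarrow> dep (\<lambda>k. (\<psi> k, \<phi> k))"
  unfolding dep_def by (metis agr_mono max.cobounded1 max.cobounded2)

lemma dep_family:
  assumes "finite I" "\<And>i. i \<in> I \<Longrightarrow> dep (\<psi> i)"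
  shows "dep (\<lambda>k. restrict (\<lambda>i. \<psi> i k) I)"
proof -
  obtain N where N: "\<And>i k k'. i \<in> I \<Longrightarrow> agr (N i) k k' \<Longrightarrow> \<psi> i k = \<psi> i k'" using assms(2) unfolding dep_def by metis
  have "N i \<le> Max (insert 0 (N ` I))" if "i \<in> I" for i using that assms(1) by simp
  then have "agr (Max (insert 0 (N ` I))) k k' \<Longrightarrow> restrict (\<lambda>i. \<psi> i k) I = restrict (\<lambda>i. \<psi> i k') I" for k k'
    by (intro restrict_ext) (meson N agr_mono)
  then show ?thesis unfolding dep_def by blast
qed

lemma dep_agr: "dep (\<lambda>k. {i. i < N \<and> k i})"
  unfolding dep_def agr_def by (intro exI[of _ N]) auto

lemma dep_open: assumes "dep \<psi>" shows "open {k. \<psi> k \<in> S}"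
  using assms unfolding open_iff_agr dep_def by (metis (mono_tags, lifting) mem_Collect_eq)

text \<open>A name for the cylinder of length \<open>N\<close> around \<open>k\<close>; these
  finitely many names serve as the types of blocks.\<close>

definition pfx :: "nat \<Rightarrow> cant \<Rightarrow> nat set" where "pfx N k = {i. i < N \<and> k i}"

lemma pfx_eq_iff: "pfx N k = pfx N k' \<longleftrightarrow> agr N k k'" by (auto simp: pfx_def agr_def)

lemma pfx_finite: "finite (range (pfx N))"
  by (rule finite_subset[of _ "Pow {..<N}"]) (auto simp: pfx_def)

section \<open>Nested clopen bases and their blocks\<close>

context cdyn begin

text \<open>A periodic orbit is finite, hence closed, and in the infinite Cantor space its nonempty
  open complement would never be visited.\<close>

lemma no_periodic:
  assumes "0 < m" shows "(f ^^ m) k \<noteq> k"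
proof
  assume p: "(f ^^ m) k = k"
  define F where "F = (\<lambda>i. (f ^^ i) k) ` {..<m}"
  have "ziter f j k \<in> F" for j
  proof (induction j rule: int_induct[where k=0])
    case base show ?case using assms by (auto simp: F_def image_iff intro!: bexI[of _ 0])
  next
    case (step1 i)
    then obtain a where a: "a < m" "ziter f i k = (f ^^ a) k" by (auto simp: F_def)
    then have "ziter f (i + 1) k = (f ^^ Suc a) k" by (simp add: ziter_Suc[OF bijf])
    moreover have "(f ^^ Suc a) k \<in> F"
    proof (cases "Suc a = m")
      case True
      then show ?thesis using p assms by (auto simp: F_def image_iff intro!: bexI[of _ 0])
    next
      case False
      then show ?thesis using a unfolding F_def by (intro imageI) auto
    qed
    ultimately show ?case by simp
  next
    case (step2 i)
    then obtain a where a: "a < m" "ziter f i k = (f ^^ a) k" by (auto simp: F_def)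
    define b where "b = (if a = 0 then m - 1 else a - 1)"
    have "f ((f ^^ b) k) = (f ^^ a) k"
    proof -
      have "(f ^^ Suc b) k = (f ^^ a) k" using a p assms by (cases "a = 0") (simp_all add: b_def del: funpow.simps)
      then show ?thesis by simp
    qed
    then have "ziter f (i - 1) k = (f ^^ b) k"
      unfolding ziter_pred[OF bijf] a(2) by (metis bijf bij_is_inj inv_f_f)
    then show ?case using a assms by (auto simp: F_def b_def)
  qed
  moreover have "finite F" by (simp add: F_def)
  then have "open (- F)" using compact_imp_closed_cantor finite_imp_compact by (auto simp: closed_def)
  moreover have "- F \<noteq> {}"
  proof
    assume "- F = {}"
    then have "finite (UNIV :: cant set)" using \<open>finite F\<close> by (metis Compl_UNIV_eq double_compl)
    then have "finite (range (\<lambda>n::nat. (\<lambda>i::nat. i = n)))" by (rule rev_finite_subset) simp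
    moreover have "inj (\<lambda>n::nat. (\<lambda>i::nat. i = n))" by (intro injI) metis
    ultimately have "finite (UNIV :: nat set)" by (rule finite_imageD)
    then show False by simp
  qed
  ultimately show False using minimal by blast
qed

text \<open>By aperiodicity \<open>x0\<close> differs from each of its first \<open>h\<close>
  iterates, so a clopen neighbourhood can be made disjoint from its first \<open>h\<close> images.
  Long return times come from here.\<close>

lemma small_nbhd:
  assumes "open B" "open (- B)" "x0 \<in> B"
  shows "\<exists>B'. open B' \<and> open (- B') \<and> x0 \<in> B' \<and> B' \<subseteq> B \<and> (\<forall>k\<in>B'. agr h x0 k) \<and>
    (\<forall>k\<in>B'. \<forall>j. 0 < j \<longrightarrow> j \<le> h \<longrightarrow> (f ^^ j) k \<notin> B')"
proof -
  have "\<exists>i. (f ^^ j) x0 i \<noteq> x0 i" if "0 < j" for j using no_periodic[OF that, of x0] by (auto simp: fun_eq_iff)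
  then obtain c where c: "\<And>j. 0 < j \<Longrightarrow> (f ^^ j) x0 (c j) \<noteq> x0 (c j)" by metis
  \<comment> \<open>A point of \<open>U j\<close> agrees with \<open>x0\<close> at the coordinate
    \<open>c j\<close> and its \<open>j\<close>-th iterate does not; hence no point of
    \<open>U j\<close> is back in \<open>U j\<close> at time \<open>j\<close>.\<close>
  define U where "U j = {k. k (c j) = x0 (c j)} \<inter> (f ^^ j) -` {k. k (c j) = (\<not> x0 (c j))}" for j
  define V where "V = {k. agr h x0 k}"
  have oc: "open {k::cant. k i = b}" "open (- {k::cant. k i = b})" for i b
    using open_coord[of i b] open_coord[of i "\<not> b"] by (simp_all add: Compl_eq)
  have U: "open (U j)" "open (- U j)" for j
  proof -
    show "open (U j)" unfolding U_def by (intro open_Int oc open_vimage_fn)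
    show "open (- U j)" unfolding U_def Compl_Int vimage_Compl[symmetric] by (intro open_Un oc open_vimage_fn)
  qed
  have "dep (\<lambda>k. agr h x0 k)" unfolding dep_def agr_def by (intro exI[of _ h]) auto
  then have V: "open V" "open (- V)" using dep_open[of "agr h x0" "{True}"] dep_open[of "agr h x0" "{False}"]
    by (auto simp: V_def Compl_eq)
  define B' where "B' = B \<inter> V \<inter> (\<Inter>j\<in>{1..h}. U j)"
  have "open B'" unfolding B'_def by (intro open_Int assms V open_INT) (auto simp: U)
  moreover have "open (- B')" unfolding B'_def Compl_Int Compl_INT by (intro open_Un assms V open_UN) (auto simp: U)
  moreover have "x0 \<in> B'" using assms c by (auto simp: B'_def V_def U_def)
  moreover have "(f ^^ j) k \<notin> B'" if "k \<in> B'" "0 < j" "j \<le> h" for k j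
  proof -
    have "j \<in> {1..h}" using that by auto
    then have "k \<in> U j" using that by (auto simp: B'_def)
    then have "(f ^^ j) k \<notin> U j" by (auto simp: U_def)
    then show ?thesis using \<open>j \<in> {1..h}\<close> by (auto simp: B'_def)
  qed
  ultimately show ?thesis by (intro exI[of _ B']) (auto simp: B'_def V_def)
qed

lemma dep_fn: "dep \<psi> \<Longrightarrow> dep (\<lambda>k. \<psi> ((f ^^ j) k))" by (rule dep_compose[OF _ cont_fn])

text \<open>The search for the return stops by time \<open>R\<close>, so finitely many locally
  constant conditions decide it.\<close>

lemma dep_ret:
  assumes "open B" "open (- B)" "recur f B R"
  shows "dep (ret f B)"
proof -
  have "ret f B k = (LEAST j. 0 < j \<and> j \<in> {..R} \<and> restrict (\<lambda>j. (f ^^ j) k \<in> B) {..R} j)" for k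
    unfolding ret_def
  proof (rule Least_equality)
    define Q where "Q j \<longleftrightarrow> 0 < j \<and> j \<in> {..R} \<and> restrict (\<lambda>j. (f ^^ j) k \<in> B) {..R} j" for j
    have QD: "0 < j \<and> j \<le> R \<and> (f ^^ j) k \<in> B" if "Q j" for j using that unfolding Q_def by simp
    have "\<exists>j. Q j" using assms(3) unfolding recur_def Q_def by auto
    then have Q: "Q (LEAST j. Q j)" by (rule LeastI_ex)
    show "0 < (LEAST j. 0 < j \<and> j \<in> {..R} \<and> restrict (\<lambda>j. (f ^^ j) k \<in> B) {..R} j) \<and>
        (f ^^ (LEAST j. 0 < j \<and> j \<in> {..R} \<and> restrict (\<lambda>j. (f ^^ j) k \<in> B) {..R} j)) k \<in> B"
      unfolding Q_def[symmetric] using QD[OF Q] by blast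
    fix j assume j: "0 < j \<and> (f ^^ j) k \<in> B"
    show "(LEAST j. 0 < j \<and> j \<in> {..R} \<and> restrict (\<lambda>j. (f ^^ j) k \<in> B) {..R} j) \<le> j"
      unfolding Q_def[symmetric]
    proof (cases "j \<le> R")
      case True
      then have "Q j" using j by (simp add: Q_def)
      then show "(LEAST j. Q j) \<le> j" by (rule Least_le)
    next
      case False
      moreover have "(LEAST j. Q j) \<le> R" using QD[OF Q] by blast
      ultimately show "(LEAST j. Q j) \<le> j" by linarith
    qed
  qed
  moreover have "dep (\<lambda>k. restrict (\<lambda>j. (f ^^ j) k \<in> B) {..R})"
    by (rule dep_family) (auto intro: dep_fn[OF dep_clopen[OF assms(1,2)]])
  then have "dep (\<lambda>k. (\<lambda>g. LEAST j. 0 < j \<and> j \<in> {..R} \<and> g j) (restrict (\<lambda>j. (f ^^ j) k \<in> B) {..R}))"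
    by (rule dep_fun)
  ultimately show ?thesis by (simp add: dep_def)
qed

text \<open>At least one visit falls into each of \<open>m\<close> disjoint windows of length
  \<open>R + 1\<close>.\<close>

lemma visits:
  assumes "recur f U R"
  shows "m \<le> card {j. j < m * Suc R \<and> (f ^^ j) k \<in> U}"
proof -
  have "\<exists>j. 0 < j \<and> j \<le> R \<and> (f ^^ j) ((f ^^ (a * Suc R)) k) \<in> U" for a using assms by (auto simp: recur_def)
  then obtain g where g: "\<And>a. g a \<le> R" "\<And>a. (f ^^ g a) ((f ^^ (a * Suc R)) k) \<in> U" by metis
  have lt: "a * Suc R + g a < b * Suc R + g b" if "a < b" for a b
  proof -
    have "Suc a * Suc R \<le> b * Suc R" using that by (intro mult_le_mono1) simp
    then show ?thesis using g(1)[of a] by simp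
  qed
  have "inj_on (\<lambda>a. a * Suc R + g a) {..<m}"
  proof (rule inj_onI)
    fix a b assume "a * Suc R + g a = b * Suc R + g b"
    then show "a = b" using lt[of a b] lt[of b a] by (cases a b rule: linorder_cases) auto
  qed
  moreover have "(\<lambda>a. a * Suc R + g a) ` {..<m} \<subseteq> {j. j < m * Suc R \<and> (f ^^ j) k \<in> U}"
  proof safe
    fix a assume "a < m"
    then have "Suc a * Suc R \<le> m * Suc R" by (intro mult_le_mono1) simp
    then show "a * Suc R + g a < m * Suc R" using g(1)[of a] by simp
    show "(f ^^ (a * Suc R + g a)) k \<in> U" using g(2)[of a] by (simp add: funpow_add add.commute)
  qed
  ultimately have "card {..<m} \<le> card {j. j < m * Suc R \<and> (f ^^ j) k \<in> U}"
    by (intro card_inj_on_le) auto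
  then show ?thesis by simp
qed

text \<open>As \<open>B' \<subseteq> B\<close>, every end of a block over \<open>B'\<close> is an
  end of a block over \<open>B\<close>, so no small block straddles the boundary of a large
  one.\<close>

lemma block_starts:
  assumes rec: "recur f B R" and sub: "B' \<subseteq> B" and rec': "recur f B' R'" and k: "k \<in> B'"
  shows "\<And>j. j < ret f B' k \<Longrightarrow> j + ret f B ((f ^^ j) k) \<le> ret f B' k"
    and "\<And>j j'. j < j' \<Longrightarrow> (f ^^ j') k \<in> B \<Longrightarrow> j + ret f B ((f ^^ j) k) \<le> j'"
    and "\<And>a. \<exists>j\<le>a. (f ^^ j) k \<in> B \<and> a < j + ret f B ((f ^^ j) k)"
proof -
  show *: "j + ret f B ((f ^^ j) k) \<le> j'" if "j < j'" "(f ^^ j') k \<in> B" for j j'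
  proof -
    have "(f ^^ (j' - j)) ((f ^^ j) k) = (f ^^ (j' - j + j)) k" unfolding funpow_add by simp
    also have "\<dots> = (f ^^ j') k" using that by simp
    finally have "ret f B ((f ^^ j) k) \<le> j' - j" using that by (intro ret_le) auto
    then show ?thesis using that by simp
  qed
  show "j + ret f B ((f ^^ j) k) \<le> ret f B' k" if "j < ret f B' k" for j
    using *[OF that] ret_props(2)[OF rec', of k] sub by blast
  show "\<exists>j\<le>a. (f ^^ j) k \<in> B \<and> a < j + ret f B ((f ^^ j) k)" for a
  proof -
    define b where "b = off f B ((f ^^ a) k)"
    have z: "ziter f (- int i) ((f ^^ a) k) = (f ^^ (a - i)) k" if "i \<le> a" for i
      using that ziter_add[OF bijf, of "- int i" "int a" k] by (simp add: ziter_nat[symmetric] of_nat_diff)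
    have "ziter f (- int a) ((f ^^ a) k) \<in> B" using z[of a] k sub by auto
    then have ba: "b \<le> a" unfolding b_def off_def by (rule Least_le)
    have "(f ^^ (a - b)) k \<in> B" using off_in[OF rec, of "(f ^^ a) k"] z[OF ba] by (simp add: b_def)
    moreover have "b < ret f B ((f ^^ (a - b)) k)" using off_less_ret[OF bijf rec, of "(f ^^ a) k"] z[OF ba] by (simp add: b_def)
    ultimately show ?thesis using ba by (intro exI[of _ "a - b"]) auto
  qed
qed

end

section \<open>One step of the construction\<close>

text \<open>A shift by one exchanges a single term at each end, by telescoping.\<close>

lemma shifted_sum_diff:
  fixes G :: "nat \<Rightarrow> real"
  assumes "\<And>j. \<bar>G j\<bar> \<le> 1"
  shows "\<bar>(\<Sum>j<L. G (i + j)) - (\<Sum>j<L. G j)\<bar> \<le> 2 * i"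
proof (induction i)
  case (Suc i)
  have "(\<Sum>j<L. G (Suc i + j)) - (\<Sum>j<L. G (i + j)) = (\<Sum>j<L. G (i + Suc j) - G (i + j))"
    by (simp add: sum_subtractf)
  also have "\<dots> = G (i + L) - G i" using sum_lessThan_telescope[of "\<lambda>j. G (i + j)" L] by simp
  finally have "\<bar>(\<Sum>j<L. G (Suc i + j)) - (\<Sum>j<L. G (i + j))\<bar> \<le> 2"
    using assms[of i] assms[of "i + L"] by linarith
  then show ?case using Suc by simp
qed simp

text \<open>A choice that depends only on the level, the length, the set of allowed words and the
  given word, so that it stays measurable when these take finitely many values.\<close>

definition near :: "nat \<Rightarrow> nat \<Rightarrow> (nat \<times> nat) set set \<Rightarrow> (nat \<times> nat) set \<Rightarrow> (nat \<times> nat) set" where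
  "near n L Ws u = (SOME v. v \<in> Ws \<and> (\<forall>v'\<in>Ws. card (mismatch n L u v) \<le> card (mismatch n L u v')))"

lemma near_props:
  assumes "Ws \<noteq> {}"
  shows "near n L Ws u \<in> Ws" "\<And>v. v \<in> Ws \<Longrightarrow> card (mismatch n L u (near n L Ws u)) \<le> card (mismatch n L u v)"
proof -
  obtain w where w: "w \<in> Ws" using assms by blast
  have "\<exists>v. v \<in> Ws \<and> (\<forall>v'. v' \<in> Ws \<longrightarrow> card (mismatch n L u v) \<le> card (mismatch n L u v'))"
    by (rule ex_has_least_nat[where P="\<lambda>v. v \<in> Ws", OF w])
  then have "\<exists>v. v \<in> Ws \<and> (\<forall>v'\<in>Ws. card (mismatch n L u v) \<le> card (mismatch n L u v'))" by blast
  then have "near n L Ws u \<in> Ws \<and> (\<forall>v'\<in>Ws. card (mismatch n L u (near n L Ws u)) \<le> card (mismatch n L u v'))"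
    unfolding near_def by (rule someI_ex)
  then show "near n L Ws u \<in> Ws" "\<And>v. v \<in> Ws \<Longrightarrow> card (mismatch n L u (near n L Ws u)) \<le> card (mismatch n L u v)" by auto
qed

section \<open>Measurability of words and integrals over columns\<close>

context ext begin

text \<open>Simple functions are used in place of measurable ones because their values, words and
  sets of words, may then be combined by arbitrary functions.\<close>

lemma sf_dep:
  assumes "dep \<psi>" shows "simple_function M (\<lambda>y. \<psi> (P y))"
  unfolding simple_function_def
proof safe
  obtain N where N: "\<And>k k'. agr N k k' \<Longrightarrow> \<psi> k = \<psi> k'" using assms unfolding dep_def by blast
  have "\<psi> k = \<psi> (SOME k'. pfx N k' = pfx N k)" for k
    by (rule N) (metis (mono_tags, lifting) pfx_eq_iff someI agr_sym)
  then have "range \<psi> \<subseteq> (\<lambda>t. \<psi> (SOME k'. pfx N k' = t)) ` range (pfx N)" by blast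
  then have "finite (range \<psi>)" using pfx_finite finite_surj by blast
  then show "finite ((\<lambda>y. \<psi> (P y)) ` space M)" by (rule rev_finite_subset) auto
  fix x'
  define x where "x = \<psi> (P x')"
  have "(\<lambda>y. \<psi> (P y)) -` {x} \<inter> space M = P -` {k. \<psi> k \<in> {x}} \<inter> space M" by auto
  also have "\<dots> \<in> sets M" using dep_open[OF assms, of "{x}"] by (intro measurable_sets[OF P_meas]) auto
  finally show "(\<lambda>y. \<psi> (P y)) -` {\<psi> (P x')} \<inter> space M \<in> sets M" by (simp add: x_def)
qed

lemma sf_collect:
  assumes "finite I" "\<And>z. z \<in> I \<Longrightarrow> {y\<in>space M. Q z y} \<in> sets M"
  shows "simple_function M (\<lambda>y. {z\<in>I. Q z y})"
  using assms
proof (induction I rule: finite_induct)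
  case (insert x I)
  have "simple_function M (\<lambda>y. Q x y)"
    unfolding simple_function_def
  proof safe
    have "{y\<in>space M. Q x y} \<in> sets M" using insert.prems by simp
    then have "{y\<in>space M. Q x y = b} \<in> sets M" for b
      by (cases b) (simp_all add: sets.sets_Collect_neg)
    moreover have "Q x -` {b} \<inter> space M = {y\<in>space M. Q x y = b}" for b by auto
    ultimately show "Q x -` {Q x xa} \<inter> space M \<in> sets M" for xa by simp
  qed (rule finite)
  moreover have "simple_function M (\<lambda>y. {z\<in>I. Q z y})" using insert by simp
  ultimately have "simple_function M (\<lambda>y. if Q x y then insert x {z\<in>I. Q z y} else {z\<in>I. Q z y})"
    by (rule simple_function_compose2)
  moreover have "(\<lambda>y. if Q x y then insert x {z\<in>I. Q z y} else {z\<in>I. Q z y}) = (\<lambda>y. {z\<in>insert x I. Q z y})"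
    by (intro ext) auto
  ultimately show ?case by simp
qed simp

lemma sf_measD: "simple_function M g \<Longrightarrow> {y\<in>space M. g y \<in> S} \<in> sets M"
  using simple_functionD(2)[of M g S] by (simp add: vimage_def Int_def conj_commute)

lemma sf_comp_T:
  assumes "simple_function M g" shows "simple_function M (\<lambda>y. g (ziter T j y))"
  unfolding simple_function_def
proof safe
  show "finite ((\<lambda>y. g (ziter T j y)) ` space M)"
    by (rule finite_subset[of _ "g ` space M"]) (use assms ziter_space in \<open>auto simp: simple_function_def\<close>)
  fix x
  have "(\<lambda>y. g (ziter T j y)) -` {g (ziter T j x)} \<inter> space M = ziter T j -` (g -` {g (ziter T j x)} \<inter> space M) \<inter> space M"
    using ziter_space by auto
  also have "\<dots> \<in> sets M" by (rule measurable_sets[OF ziter_meas]) (rule simple_functionD(2)[OF assms])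
  finally show "(\<lambda>y. g (ziter T j y)) -` {g (ziter T j x)} \<inter> space M \<in> sets M" .
qed

definition word :: "nat \<Rightarrow> nat \<Rightarrow> ('a \<Rightarrow> nat \<Rightarrow> bool) \<Rightarrow> 'a \<Rightarrow> (nat \<times> nat) set" where
  "word n l q y = {z\<in>{..<l} \<times> {..<n}. q ((T ^^ fst z) y) (snd z)}"

definition bits_meas :: "('a \<Rightarrow> nat \<Rightarrow> bool) \<Rightarrow> bool" where
  "bits_meas q \<longleftrightarrow> (\<forall>i. {y\<in>space M. q y i} \<in> sets M)"

lemma sub_word:
  assumes "j + l \<le> L" "n \<le> n'" shows "sub n j l (word n' L q y) = word n l q ((T ^^ j) y)"
proof -
  have "(T ^^ a) ((T ^^ j) y) = (T ^^ (j + a)) y" for a by (metis add.commute comp_apply funpow_add)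
  then show ?thesis using assms by (auto simp: sub_def word_def)
qed

lemma sf_word:
  assumes "bits_meas q" shows "simple_function M (word n l q)"
proof -
  have "{y\<in>space M. q ((T ^^ a) y) i} = (T ^^ a) -` {y\<in>space M. q y i} \<inter> space M" for a i
    using measurable_space[OF Tn_meas] by auto
  then have "{y\<in>space M. q ((T ^^ a) y) i} \<in> sets M" for a i
    using assms measurable_sets[OF Tn_meas] by (simp add: bits_meas_def)
  then have "simple_function M (\<lambda>y. {z\<in>{..<l} \<times> {..<n}. q ((T ^^ fst z) y) (snd z)})"
    by (intro sf_collect) auto
  then show ?thesis by (simp add: word_def[abs_def])
qed

lemma sf_word_ret:
  assumes "bits_meas q" "open B" "open (- B)" "recur f B R"
  shows "simple_function M (\<lambda>y. word n (ret f B (P y)) q y)"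
proof -
  have "simple_function M (\<lambda>y. word n R q y \<inter> {..<ret f B (P y)} \<times> UNIV)"
    by (rule simple_function_compose2[of M "word n R q" "\<lambda>y. ret f B (P y)" "\<lambda>w l. w \<inter> {..<l} \<times> UNIV"])
       (use sf_word[OF assms(1)] sf_dep[OF dep_ret[OF assms(2-4)]] in auto)
  moreover have "word n R q y \<inter> {..<ret f B (P y)} \<times> UNIV = word n (ret f B (P y)) q y" for y
    using ret_props(3)[OF assms(4), of "P y"] by (auto simp: word_def)
  ultimately show ?thesis by simp
qed

text \<open>By minimality finitely many preimages of \<open>U\<close>, all of the same measure,
  cover the space.\<close>

lemma measure_pos:
  assumes "open U" "U \<noteq> {}" shows "0 < measure M {y\<in>space M. P y \<in> U}"
proof -
  obtain R where R: "recur f U R" using recur_ex[OF assms] by blast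
  have [measurable]: "U \<in> sets borel" using assms(1) by simp
  define g where "g y = (if P y \<in> U then 1 else (0::real))" for y
  have gm [measurable]: "g \<in> borel_measurable M" unfolding g_def[abs_def] by measurable
  have ig: "integrable M (\<lambda>y. g ((T ^^ j) y))" for j by (rule bounded_integrable[of _ 1]) (auto simp: g_def)
  have "1 = (\<integral>y. (1::real) \<partial>M)" by (simp add: prob_space)
  also have "\<dots> \<le> (\<integral>y. (\<Sum>j\<in>{..R}. g ((T ^^ j) y)) \<partial>M)"
  proof (rule integral_mono)
    show "integrable M (\<lambda>y. \<Sum>j\<in>{..R}. g ((T ^^ j) y))" using ig by simp
    fix y assume y: "y \<in> space M"
    obtain j where j: "j \<le> R" "(f ^^ j) (P y) \<in> U" using R unfolding recur_def by blast
    have "g ((T ^^ j) y) \<le> (\<Sum>j\<in>{..R}. g ((T ^^ j) y))" by (rule member_le_sum) (use j in \<open>auto simp: g_def\<close>)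
    then show "1 \<le> (\<Sum>j\<in>{..R}. g ((T ^^ j) y))" using j P_fn[OF y] by (simp add: g_def)
  qed simp
  also have "\<dots> = (\<Sum>j\<in>{..R}. \<integral>y. g ((T ^^ j) y) \<partial>M)" using ig by (rule Bochner_Integration.integral_sum)
  also have "\<dots> = Suc R * (\<integral>y. g y \<partial>M)" by (simp add: integral_Tn)
  also have "(\<integral>y. g y \<partial>M) = measure M {y\<in>space M. P y \<in> U}"
  proof -
    have "(\<integral>y. g y \<partial>M) = (\<integral>y. indicator {y\<in>space M. P y \<in> U} y \<partial>M)"
      by (rule Bochner_Integration.integral_cong) (auto simp: g_def)
    then show ?thesis by simp
  qed
  finally show ?thesis by (metis measure_nonneg less_eq_real_def mult_zero_right not_one_le_zero)
qed

text \<open>Disjoint columns of height at least \<open>h\<close> stand over the base, and the total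
  mass is \<open>1\<close>.\<close>

lemma base_measure:
  assumes "open B" "recur f B R" "\<And>k. k \<in> B \<Longrightarrow> h \<le> ret f B k" "0 < h"
  shows "measure M {y\<in>space M. P y \<in> B} \<le> 1 / h"
proof -
  have [measurable]: "B \<in> sets borel" using assms(1) by simp
  have "h * measure M {y\<in>space M. P y \<in> B} = (\<integral>y. real h * indicator {y\<in>space M. P y \<in> B} y \<partial>M)" by simp
  also have "\<dots> \<le> (\<integral>y. rsum B (\<lambda>_. 1) y \<partial>M)"
  proof (rule integral_mono)
    show "integrable M (rsum B (\<lambda>_. 1))"
      using rsum_bound[OF assms(2), of "\<lambda>_. 1" 1] rsum_meas[OF assms(2)] by (intro bounded_integrable[of _ "R * 1"]) auto
    show "real h * indicator {y\<in>space M. P y \<in> B} y \<le> rsum B (\<lambda>_. 1) y" for y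
      using assms(3)[of "P y"] by (auto simp: rsum_def indicator_def)
    have "{y\<in>space M. P y \<in> B} \<in> sets M" by measurable
    then show "integrable M (\<lambda>y. real h * indicator {y\<in>space M. P y \<in> B} y)"
      by (intro bounded_integrable[of _ h]) (auto simp: indicator_def)
  qed
  also have "\<dots> = (\<integral>y. 1 \<partial>M)" by (rule tower[OF assms(2), symmetric, of _ 1]) auto
  finally show ?thesis using assms(4) by (simp add: prob_space field_simps)
qed

text \<open>Along a column, summing \<open>F\<close> and summing its averages over \<open>m\<close>
  steps differ only near the ends, by at most \<open>2 * m\<close>. The tower formula turns the
  column sums of averages into the mean ergodic error and the end terms into the measure of the
  base.\<close>

lemma rsum_L1:
  assumes rec: "recur f B R" and B: "open B" and F [measurable]: "F \<in> borel_measurable M" and F1: "\<And>y. \<bar>F y\<bar> \<le> 1"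
    and m: "0 < m"
  shows "(\<integral>y. \<bar>rsum B F y\<bar> \<partial>M) \<le> (\<integral>y. \<bar>bsum F m y / m\<bar> \<partial>M) + 2 * real m * measure M {y\<in>space M. P y \<in> B}"
proof -
  have [measurable]: "B \<in> sets borel" using B by simp
  have rm [measurable]: "\<phi> \<in> borel_measurable M \<Longrightarrow> rsum B \<phi> \<in> borel_measurable M" for \<phi>
    using rsum_meas[OF rec] by simp
  define G where "G y = \<bar>bsum F m y / m\<bar>" for y
  have Gm [measurable]: "G \<in> borel_measurable M" unfolding G_def[abs_def] by measurable
  have G1: "\<bar>G y\<bar> \<le> 1" for y using bsum_bound[OF F1, where n=m] m by (simp add: G_def abs_divide)
  have pw: "\<bar>rsum B F y\<bar> \<le> rsum B G y + 2 * real m * indicat_real {y\<in>space M. P y \<in> B} y" if y: "y \<in> space M" for y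
  proof (cases "P y \<in> B")
    case True
    define L where "L = ret f B (P y)"
    define H where "H j = F ((T ^^ j) y)" for j
    have H1: "\<bar>H j\<bar> \<le> 1" for j by (simp add: H_def F1)
    have "bsum F m ((T ^^ j) y) = (\<Sum>i<m. H (i + j))" for j by (simp add: bsum_def H_def funpow_add)
    \<comment> \<open>After the exchange of sums, each \<open>i < m\<close> contributes the column
      sum of \<open>F\<close> started \<open>i\<close> steps later.\<close>
    then have "(\<Sum>j<L. bsum F m ((T ^^ j) y)) = (\<Sum>i<m. \<Sum>j<L. H (i + j))" by (simp add: sum.swap[of _ "{..<m}"])
    moreover have "\<bar>(\<Sum>i<m. \<Sum>j<L. H (i + j)) - (\<Sum>i<m. \<Sum>j<L. H j)\<bar> \<le> (\<Sum>i<m. 2 * real m)"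
      unfolding sum_subtractf[symmetric]
    proof (rule order_trans[OF sum_abs sum_mono])
      fix i assume "i \<in> {..<m}"
      then show "\<bar>\<Sum>j<L. H (i + j) - H j\<bar> \<le> 2 * real m"
        using shifted_sum_diff[where G=H and L=L and i=i, OF H1] by (simp add: sum_subtractf)
    qed
    ultimately have "\<bar>(\<Sum>j<L. bsum F m ((T ^^ j) y)) - m * (\<Sum>j<L. H j)\<bar> \<le> m * (2 * real m)" by simp
    then have "\<bar>m * (\<Sum>j<L. H j)\<bar> \<le> \<bar>\<Sum>j<L. bsum F m ((T ^^ j) y)\<bar> + m * (2 * real m)" by linarith
    also have "\<bar>\<Sum>j<L. bsum F m ((T ^^ j) y)\<bar> \<le> (\<Sum>j<L. \<bar>bsum F m ((T ^^ j) y)\<bar>)" by (rule sum_abs)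
    also have "(\<Sum>j<L. \<bar>bsum F m ((T ^^ j) y)\<bar>) = m * (\<Sum>j<L. G ((T ^^ j) y))"
      using m by (simp add: G_def abs_divide sum_distrib_left)
    finally have "m * \<bar>\<Sum>j<L. H j\<bar> \<le> m * ((\<Sum>j<L. G ((T ^^ j) y)) + 2 * m)" by (simp add: abs_mult algebra_simps)
    then have "\<bar>\<Sum>j<L. H j\<bar> \<le> (\<Sum>j<L. G ((T ^^ j) y)) + 2 * m" using m by simp
    then show ?thesis using True y by (simp add: rsum_def L_def H_def)
  qed (simp add: rsum_def)
  have b: "{y\<in>space M. P y \<in> B} \<in> sets M" by measurable
  have ib: "integrable M (indicat_real {y\<in>space M. P y \<in> B})"
    using b by (intro bounded_integrable[of _ 1]) (auto simp: indicator_def)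
  have iG: "integrable M (rsum B G)"
    by (rule bounded_integrable[OF _ rsum_bound[OF rec G1]]) measurable
  have "(\<integral>y. \<bar>rsum B F y\<bar> \<partial>M) \<le> (\<integral>y. rsum B G y + 2 * real m * indicat_real {y\<in>space M. P y \<in> B} y \<partial>M)"
  proof (rule integral_mono)
    show "integrable M (\<lambda>y. \<bar>rsum B F y\<bar>)"
      using rsum_bound[OF rec F1] by (intro bounded_integrable[of _ "R * 1"]) auto
    show "integrable M (\<lambda>y. rsum B G y + 2 * real m * indicat_real {y\<in>space M. P y \<in> B} y)"
      using iG ib by simp
  qed (use pw in auto)
  also have "\<dots> = (\<integral>y. rsum B G y \<partial>M) + 2 * m * measure M {y\<in>space M. P y \<in> B}"
    using iG ib b by (subst Bochner_Integration.integral_add) auto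
  also have "(\<integral>y. rsum B G y \<partial>M) = (\<integral>y. G y \<partial>M)" by (rule tower[OF rec, symmetric, of _ 1]) (auto simp: G1)
  finally show ?thesis by (simp add: G_def)
qed

end

section \<open>The data of one stage\<close>

locale sys = ext f M T P + erg M T for f and M :: "'a measure" and T P +
  fixes x0 :: cant
begin

text \<open>The data of level \<open>n\<close>: the clopen base \<open>B\<close>, a bound \<open>R\<close> for its return time, the set \<open>W k\<close> of words (subsets of
  block \<open>\<times>\<close> bit indices below \<open>n\<close>) admissible on the block starting at \<open>k \<in> B\<close>, and the current bits \<open>q\<close> on the extension. In
  \<open>STEP\<close>, up to \<open>J\<close> positions of a new block can be prescribed, including the bit \<open>n\<close>, on which no condition is imposed yet.\<close>

definition INV :: "nat \<Rightarrow> cant set \<Rightarrow> nat \<Rightarrow> (cant \<Rightarrow> (nat \<times> nat) set set) \<Rightarrow> ('a \<Rightarrow> nat \<Rightarrow> bool) \<Rightarrow> bool" where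
  "INV n B R W q \<longleftrightarrow> open B \<and> open (- B) \<and> x0 \<in> B \<and> recur f B R \<and> dep W \<and>
     (\<forall>k\<in>B. W k \<noteq> {} \<and> W k \<subseteq> Pow ({..<ret f B k} \<times> {..<n})) \<and> bits_meas q \<and>
     (\<forall>y\<in>space M. P y \<in> B \<longrightarrow> word n (ret f B (P y)) q y \<in> W (P y))"

text \<open>Besides the level-\<open>n\<close> data of its block, \<open>N\<close> coordinates of a
  base point determine the first \<open>n\<close> coordinates of the base points along the block;
  the latter are compared when words of equal type are matched.\<close>

definition resol :: "nat \<Rightarrow> cant set \<Rightarrow> nat \<Rightarrow> (cant \<Rightarrow> (nat \<times> nat) set set) \<Rightarrow> nat \<Rightarrow> bool" where
  "resol n B R W N \<longleftrightarrow> (\<forall>k k'. agr N k k' \<longrightarrow> (k \<in> B \<longleftrightarrow> k' \<in> B) \<and> W k = W k' \<and> ret f B k = ret f B k' \<and>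
      (\<forall>a\<le>R. agr n ((f ^^ a) k) ((f ^^ a) k')))"

text \<open>Frequencies in the form of test functions of (type, word). The bound \<open>R\<close> is
  the one obeyed by the number of occurrences inside a block, the statistic used for unique
  ergodicity.\<close>

definition FREQ :: "nat \<Rightarrow> real \<Rightarrow> cant set \<Rightarrow> nat \<Rightarrow> (cant \<Rightarrow> (nat \<times> nat) set set) \<Rightarrow> cant set \<Rightarrow> (cant \<Rightarrow> (nat \<times> nat) set set)
    \<Rightarrow> nat \<Rightarrow> (nat set \<Rightarrow> (nat \<times> nat) set \<Rightarrow> real) \<Rightarrow> bool" where
  "FREQ n \<epsilon> B R W B' W' N \<tau> \<longleftrightarrow> (\<forall>k\<in>B'. \<forall>v\<in>W' k. \<forall>\<theta> :: nat set \<Rightarrow> (nat \<times> nat) set \<Rightarrow> real. (\<forall>t w. \<bar>\<theta> t w\<bar> \<le> R) \<longrightarrow>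
     \<bar>\<Sum>j\<in>{j. j < ret f B' k \<and> (f ^^ j) k \<in> B}. \<theta> (pfx N ((f ^^ j) k)) (sub n j (ret f B ((f ^^ j) k)) v) -
        (\<Sum>w\<in>W ((f ^^ j) k). \<tau> (pfx N ((f ^^ j) k)) w * \<theta> (pfx N ((f ^^ j) k)) w)\<bar> \<le> \<epsilon> * real (ret f B' k))"

definition STEP :: "nat \<Rightarrow> nat \<Rightarrow> real \<Rightarrow> nat \<Rightarrow> cant set \<Rightarrow> nat \<Rightarrow> (cant \<Rightarrow> (nat \<times> nat) set set) \<Rightarrow> ('a \<Rightarrow> nat \<Rightarrow> bool) \<Rightarrow>
    cant set \<Rightarrow> (cant \<Rightarrow> (nat \<times> nat) set set) \<Rightarrow> ('a \<Rightarrow> nat \<Rightarrow> bool) \<Rightarrow> bool" where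
  "STEP n J \<epsilon> h B R W q B' W' q' \<longleftrightarrow>
     B' \<subseteq> B \<and> (\<forall>k\<in>B'. agr h x0 k \<and> h < ret f B' k) \<and>
     (\<forall>k\<in>B'. \<forall>v\<in>W' k. \<forall>j<ret f B' k. (f ^^ j) k \<in> B \<longrightarrow> sub n j (ret f B ((f ^^ j) k)) v \<in> W ((f ^^ j) k)) \<and>
     (\<exists>N \<tau>. resol n B R W N \<and>
        (\<forall>k\<in>B'. \<forall>v\<in>W' k. \<forall>k1\<in>B. \<forall>w\<in>W k1. \<exists>j<ret f B' k. (f ^^ j) k \<in> B \<and> agr N k1 ((f ^^ j) k) \<and> sub n j (ret f B k1) v = w) \<and>
        FREQ n \<epsilon> B R W B' W' N \<tau>) \<and>
     (\<forall>k\<in>B'. \<forall>u A. A \<subseteq> {..<ret f B' k} \<longrightarrow> card A \<le> J \<longrightarrow>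
        (\<forall>j<ret f B' k. (f ^^ j) k \<in> B \<longrightarrow> A \<inter> {j..<j + ret f B ((f ^^ j) k)} \<noteq> {} \<longrightarrow> sub n j (ret f B ((f ^^ j) k)) u \<in> W ((f ^^ j) k)) \<longrightarrow>
        (\<exists>v\<in>W' k. \<forall>a\<in>A. \<forall>i\<le>n. (a, i) \<in> v \<longleftrightarrow> (a, i) \<in> u)) \<and>
     measure M {y\<in>space M. \<exists>i\<le>n. q' y i \<noteq> q y i} \<le> \<epsilon> \<and> (\<forall>y i. i > n \<longrightarrow> q' y i = q y i)"

lemma resol_ex:
  assumes "INV n B R W q" shows "\<exists>N. resol n B R W N"
proof -
  have "dep (\<lambda>k. (k \<in> B, W k, ret f B k, restrict (\<lambda>a. pfx n ((f ^^ a) k)) {..R}))"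
    using assms unfolding INV_def
    by (intro dep_Pair dep_clopen dep_ret[where R=R] dep_family) (auto intro!: dep_fn simp: pfx_def intro: dep_agr)
  then obtain N where N: "\<And>k k'. agr N k k' \<Longrightarrow> (k \<in> B, W k, ret f B k, restrict (\<lambda>a. pfx n ((f ^^ a) k)) {..R})
      = (k' \<in> B, W k', ret f B k', restrict (\<lambda>a. pfx n ((f ^^ a) k')) {..R})" unfolding dep_def by blast
  have "agr n ((f ^^ a) k) ((f ^^ a) k')" if "agr N k k'" "a \<le> R" for a k k'
  proof -
    have "restrict (\<lambda>a. pfx n ((f ^^ a) k)) {..R} a = restrict (\<lambda>a. pfx n ((f ^^ a) k')) {..R} a" using N[OF that(1)] by simp
    then show ?thesis using that(2) by (simp add: pfx_eq_iff)
  qed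
  then show ?thesis using N unfolding resol_def by blast
qed

end

locale st1 = sys f M T P x0 for f and M :: "'a measure" and T P x0 +
  fixes n B R W and q :: "'a \<Rightarrow> nat \<Rightarrow> bool" and N
  assumes inv: "INV n B R W q" and res: "resol n B R W N"
begin

lemma invD: "open B" "open (- B)" "x0 \<in> B" "recur f B R" "dep W" "\<And>k. k \<in> B \<Longrightarrow> W k \<noteq> {}"
  "\<And>k. k \<in> B \<Longrightarrow> W k \<subseteq> Pow ({..<ret f B k} \<times> {..<n})" "bits_meas q"
  "\<And>y. y \<in> space M \<Longrightarrow> P y \<in> B \<Longrightarrow> word n (ret f B (P y)) q y \<in> W (P y)"
  using inv by (auto simp: INV_def)

lemma resD: "agr N k k' \<Longrightarrow> k \<in> B \<longleftrightarrow> k' \<in> B" "agr N k k' \<Longrightarrow> W k = W k'" "agr N k k' \<Longrightarrow> ret f B k = ret f B k'"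
  using res unfolding resol_def by blast+

text \<open>Allowed words indexed by types; \<open>resol\<close> makes this a union of equal
  sets.\<close>

definition WW :: "nat set \<Rightarrow> (nat \<times> nat) set set" where "WW t = (\<Union>k\<in>{k\<in>B. pfx N k = t}. W k)"

definition \<Omega> :: "(nat set \<times> (nat \<times> nat) set) set" where "\<Omega> = {(pfx N k, w) | k w. k \<in> B \<and> w \<in> W k}"

lemma WW_eq: "k \<in> B \<Longrightarrow> WW (pfx N k) = W k"
  using resD(2) by (auto simp: WW_def pfx_eq_iff)

lemma fin\<Omega>: "finite \<Omega>"
proof (rule finite_subset)
  show "\<Omega> \<subseteq> range (pfx N) \<times> Pow ({..<R} \<times> {..<n})"
  proof
    fix \<pi> assume "\<pi> \<in> \<Omega>"
    then obtain k w where kw: "\<pi> = (pfx N k, w)" "k \<in> B" "w \<in> W k" by (auto simp: \<Omega>_def)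
    have "{..<ret f B k} \<times> {..<n} \<subseteq> {..<R} \<times> {..<n}" using ret_props(3)[OF invD(4), of k] by auto
    then show "\<pi> \<in> range (pfx N) \<times> Pow ({..<R} \<times> {..<n})" using kw invD(7)[of k] by auto
  qed
  show "finite (range (pfx N) \<times> Pow ({..<R} \<times> {..<n}))" using pfx_finite by blast
qed

lemma \<Omega>_iff: "k \<in> B \<Longrightarrow> (pfx N k, w) \<in> \<Omega> \<longleftrightarrow> w \<in> W k"
  using resD(2) by (auto simp: \<Omega>_def pfx_eq_iff intro: agr_refl)

abbreviation wrd :: "'a \<Rightarrow> (nat \<times> nat) set" where "wrd y \<equiv> word n (ret f B (P y)) q y"

lemma sf_wrd: "simple_function M (\<lambda>y. wrd y)" by (rule sf_word_ret[OF invD(8,1,2,4)])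

lemma sf_typ: "simple_function M (\<lambda>y. (P y \<in> B, pfx N (P y)))"
  by (rule sf_dep[of "\<lambda>k. (k \<in> B, pfx N k)"]) (intro dep_Pair dep_clopen invD, simp add: pfx_def dep_agr)

definition Et :: "nat set \<Rightarrow> 'a set" where "Et t = {y\<in>space M. P y \<in> B \<and> pfx N (P y) = t}"
definition Ew :: "nat set \<Rightarrow> (nat \<times> nat) set \<Rightarrow> 'a set" where "Ew t w = {y\<in>Et t. wrd y = w}"
text \<open>The distribution of the current name of a block conditioned on its type. Types that
  occur have positive measure, by minimality of the base.\<close>

definition \<tau> :: "nat set \<Rightarrow> (nat \<times> nat) set \<Rightarrow> real" where "\<tau> t w = measure M (Ew t w) / measure M (Et t)"

lemma Et_sets [measurable]: "Et t \<in> sets M"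
  using sf_measD[OF sf_typ, of "{(True, t)}"] by (simp add: Et_def)

lemma Ew_sets [measurable]: "Ew t w \<in> sets M"
proof -
  have "{y\<in>space M. wrd y \<in> {w}} \<in> sets M" by (rule sf_measD[OF sf_wrd])
  then have "Et t \<inter> {y\<in>space M. wrd y \<in> {w}} \<in> sets M" by auto
  also have "Et t \<inter> {y\<in>space M. wrd y \<in> {w}} = Ew t w" by (auto simp: Ew_def Et_def)
  finally show ?thesis .
qed

lemma Ew_le: "measure M (Ew t w) \<le> measure M (Et t)"
  by (rule finite_measure_mono) (auto simp: Ew_def)

lemma \<tau>_bounds: "0 \<le> \<tau> t w" "\<tau> t w \<le> 1"
proof -
  show "0 \<le> \<tau> t w" by (simp add: \<tau>_def)
  show "\<tau> t w \<le> 1"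
    using Ew_le[of t w] measure_nonneg[of M "Et t"] by (cases "measure M (Et t) = 0") (simp_all add: \<tau>_def divide_le_eq_1 less_le)
qed

lemma \<tau>_sum: assumes "k \<in> B" shows "(\<Sum>w\<in>W k. \<tau> (pfx N k) w) = 1"
proof -
  let ?t = "pfx N k"
  have U: "open {k'. (k' \<in> B, pfx N k') \<in> {(True, ?t)}}"
    by (rule dep_open) (intro dep_Pair dep_clopen invD, simp add: pfx_def dep_agr)
  have "0 < measure M {y\<in>space M. P y \<in> {k'. (k' \<in> B, pfx N k') \<in> {(True, ?t)}}}"
    by (rule measure_pos[OF U]) (use assms in auto)
  then have pos: "0 < measure M (Et ?t)" by (simp add: Et_def)
  have fW: "finite (W k)" using invD(7)[OF assms] finite_subset by (metis finite_Pow_iff finite_SigmaI finite_lessThan)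
  have "Et ?t = (\<Union>w\<in>W k. Ew ?t w)"
  proof
    show "Et ?t \<subseteq> (\<Union>w\<in>W k. Ew ?t w)"
    proof
      fix y assume y: "y \<in> Et ?t"
      then have "W (P y) = W k" by (intro resD(2)) (simp add: Et_def pfx_eq_iff)
      then have "wrd y \<in> W k" using invD(9)[of y] y by (simp add: Et_def)
      then show "y \<in> (\<Union>w\<in>W k. Ew ?t w)" using y by (simp add: Ew_def)
    qed
  qed (auto simp: Ew_def)
  then have "measure M (Et ?t) = measure M (\<Union>w\<in>W k. Ew ?t w)" by simp
  also have "\<dots> = (\<Sum>w\<in>W k. measure M (Ew ?t w))"
    by (rule finite_measure_finite_Union[OF fW]) (auto simp: disjoint_family_on_def, auto simp: Ew_def)
  finally show ?thesis using pos by (simp add: \<tau>_def sum_divide_distrib[symmetric])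
qed

text \<open>The observable whose column sums are the discrepancies of the pair \<open>\<pi>\<close>.
  It is centred relative to the type, so its integral vanishes.\<close>

definition F :: "nat set \<times> (nat \<times> nat) set \<Rightarrow> 'a \<Rightarrow> real" where
  "F \<pi> y = (if y \<in> space M then indicator (Ew (fst \<pi>) (snd \<pi>)) y - \<tau> (fst \<pi>) (snd \<pi>) * indicator (Et (fst \<pi>)) y else 0)"

lemma F_meas [measurable]: "F \<pi> \<in> borel_measurable M"
  unfolding F_def[abs_def] by measurable

lemma F_bound: "\<bar>F \<pi> y\<bar> \<le> 1"
  using \<tau>_bounds[of "fst \<pi>" "snd \<pi>"] by (auto simp: F_def indicator_def Ew_def)

lemma F_val: "y \<in> space M \<Longrightarrow> F (t, w) y = (if P y \<in> B \<and> pfx N (P y) = t then of_bool (wrd y = w) - \<tau> t w else 0)"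
  by (auto simp: F_def Ew_def Et_def indicator_def)

lemma F_zero: "(\<integral>y. F \<pi> y \<partial>M) = 0"
proof -
  have "(\<integral>y. F \<pi> y \<partial>M) = (\<integral>y. indicator (Ew (fst \<pi>) (snd \<pi>)) y - \<tau> (fst \<pi>) (snd \<pi>) * indicator (Et (fst \<pi>)) y \<partial>M)"
    by (rule Bochner_Integration.integral_cong) (auto simp: F_def)
  also have "\<dots> = measure M (Ew (fst \<pi>) (snd \<pi>)) - \<tau> (fst \<pi>) (snd \<pi>) * measure M (Et (fst \<pi>))"
    by (subst Bochner_Integration.integral_diff) (auto simp: emeasure_eq_measure)
  also have "\<dots> = 0"
  proof (cases "measure M (Et (fst \<pi>)) = 0")
    case True
    then show ?thesis using Ew_le[of "fst \<pi>" "snd \<pi>"] by (simp add: measure_le_0_iff)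
  qed (simp add: \<tau>_def)
  finally show ?thesis .
qed

text \<open>There are finitely many observables, so one averaging time \<open>m\<close> serves all
  of them.\<close>

lemma mean_small:
  assumes "0 < \<delta>" shows "\<exists>m>0. \<forall>\<pi>\<in>\<Omega>. (\<integral>y. \<bar>bsum (F \<pi>) m y / m\<bar> \<partial>M) < \<delta>"
proof -
  have "\<forall>\<^sub>F m in sequentially. (\<integral>y. \<bar>bsum (F \<pi>) m y / m\<bar> \<partial>M) < \<delta>" for \<pi>
    using mean_ergodic[OF F_meas F_bound F_zero] assms by (rule order_tendstoD(2))
  then have "\<forall>\<^sub>F m in sequentially. \<forall>\<pi>\<in>\<Omega>. (\<integral>y. \<bar>bsum (F \<pi>) m y / m\<bar> \<partial>M) < \<delta>"
    by (intro eventually_ball_finite fin\<Omega>) auto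
  then have "\<forall>\<^sub>F m in sequentially. 0 < m \<and> (\<forall>\<pi>\<in>\<Omega>. (\<integral>y. \<bar>bsum (F \<pi>) m y / m\<bar> \<partial>M) < \<delta>)"
    using eventually_gt_at_top[of 0] by eventually_elim simp
  then show ?thesis by (auto simp: eventually_sequentially)
qed

end

section \<open>Admissible words of the next level and the corrected names\<close>

locale st2 = st1 f M T P x0 n B R W q N for f and M :: "'a measure" and T P x0 n B R W and q :: "'a \<Rightarrow> nat \<Rightarrow> bool" and N +
  fixes B' :: "cant set" and R' :: nat and e :: real and J :: nat
  assumes B': "B' \<subseteq> B" "open B'" "open (- B')" "x0 \<in> B'" "recur f B' R'" and e: "0 < e"
    and vis: "\<And>k t w. k \<in> B' \<Longrightarrow> (t, w) \<in> \<Omega> \<Longrightarrow>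
      J + card \<Omega> \<le> card {j. j < ret f B' k \<and> (f ^^ j) k \<in> B \<and> pfx N ((f ^^ j) k) = t}"
    and big: "\<And>k. k \<in> B' \<Longrightarrow> real (2 * card \<Omega> + J) \<le> e * real (ret f B' k)"
begin

definition St :: "cant \<Rightarrow> nat set" where "St k = {j. j < ret f B' k \<and> (f ^^ j) k \<in> B}"
text \<open>Restriction to times up to \<open>R'\<close> turns lengths and types into finite
  families of locally constant functions, as \<open>dep_family\<close> requires.\<close>

definition lf :: "cant \<Rightarrow> nat \<Rightarrow> nat" where "lf k = restrict (\<lambda>j. ret f B ((f ^^ j) k)) {..R'}"
definition tf :: "cant \<Rightarrow> nat \<Rightarrow> nat set" where "tf k = restrict (\<lambda>j. pfx N ((f ^^ j) k)) {..R'}"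

lemma St_val:
  assumes "j \<in> St k"
  shows "lf k j = ret f B ((f ^^ j) k)" "tf k j = pfx N ((f ^^ j) k)" "(f ^^ j) k \<in> B" "j < ret f B' k"
  using assms ret_props(3)[OF B'(5), of k] by (auto simp: St_def lf_def tf_def)

lemma comb_k:
  assumes k: "k \<in> B'"
  shows "comb n (ret f B' k) R (St k) (lf k) (tf k) WW \<tau> \<Omega>"
proof
  note bs = block_starts[OF invD(4) B'(1) B'(5) k]
  show "St k \<subseteq> {..<ret f B' k}" by (auto simp: St_def)
  show "0 < lf k j \<and> lf k j \<le> R \<and> j + lf k j \<le> ret f B' k" if "j \<in> St k" for j
    using St_val[OF that] bs(1)[of j] ret_props[OF invD(4), of "(f ^^ j) k"] by simp
  show "j + lf k j \<le> j'" if "j \<in> St k" "j' \<in> St k" "j < j'" for j j'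
    using St_val[OF that(1)] St_val[OF that(2)] bs(2)[OF that(3)] by simp
  show "\<exists>j\<in>St k. j \<le> a \<and> a < j + lf k j" if "a < ret f B' k" for a
  proof -
    obtain j where j: "j \<le> a" "(f ^^ j) k \<in> B" "a < j + ret f B ((f ^^ j) k)" using bs(3) by blast
    then have "j \<in> St k" using that by (simp add: St_def)
    then show ?thesis using St_val[of j k] j by auto
  qed
  show "WW (tf k j) \<noteq> {} \<and> WW (tf k j) \<subseteq> Pow ({..<lf k j} \<times> {..<n})" if "j \<in> St k" for j
    using St_val[OF that] WW_eq invD(6,7) by simp
  show "finite \<Omega>" by (rule fin\<Omega>)
  show "((tf k j, w) \<in> \<Omega>) = (w \<in> WW (tf k j))" if "j \<in> St k" for j w
    using St_val[OF that] WW_eq \<Omega>_iff by simp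
  show "w \<in> WW t" if "(t, w) \<in> \<Omega>" for t w using that by (auto simp: \<Omega>_def WW_def)
  show "0 \<le> \<tau> t w \<and> \<tau> t w \<le> 1" for t w using \<tau>_bounds by blast
  show "sum (\<tau> (tf k j)) (WW (tf k j)) = 1" if "j \<in> St k" for j
    using St_val[OF that] WW_eq \<tau>_sum by simp
qed

lemma vis':
  assumes "k \<in> B'" "(t, w) \<in> \<Omega>" shows "J + card \<Omega> \<le> card {j \<in> St k. tf k j = t}"
proof -
  have "{j \<in> St k. tf k j = t} = {j. j < ret f B' k \<and> (f ^^ j) k \<in> B \<and> pfx N ((f ^^ j) k) = t}"
    using St_val(2)[of _ k] by (auto simp: St_def)
  then show ?thesis using vis[OF assms] by simp
qed

definition W' :: "cant \<Rightarrow> (nat \<times> nat) set set" where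
  "W' k = (if k \<in> B' then comb.good n (ret f B' k) (St k) (lf k) (tf k) WW \<tau> \<Omega> e else {})"

lemma dep_W': "dep W'"
proof -
  have rd: "dep (ret f B)" by (rule dep_ret[OF invD(1,2,4)])
  have pd: "dep (pfx N)" by (simp add: pfx_def[abs_def] dep_agr)
  have "dep (\<lambda>k. (k \<in> B', ret f B' k, restrict (\<lambda>j. (f ^^ j) k \<in> B) {..R'}, lf k, tf k))"
    unfolding lf_def tf_def
    by (intro dep_Pair dep_clopen dep_ret[where R=R'] B' dep_family dep_fn[OF rd] dep_fn[OF pd]
        dep_fn[OF dep_clopen[OF invD(1,2)]] finite_atMost)
  then have d: "dep (\<lambda>k. (\<lambda>(b, L, s, l, t). if b then comb.good n L {j\<in>{..R'}. j < L \<and> s j} l t WW \<tau> \<Omega> e else {})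
      (k \<in> B', ret f B' k, restrict (\<lambda>j. (f ^^ j) k \<in> B) {..R'}, lf k, tf k))"
    by (rule dep_fun)
  have "St k = {j\<in>{..R'}. j < ret f B' k \<and> restrict (\<lambda>j. (f ^^ j) k \<in> B) {..R'} j}" for k
    using ret_props(3)[OF B'(5), of k] by (auto simp: St_def)
  then have "W' = (\<lambda>k. (\<lambda>(b, L, s, l, t). if b then comb.good n L {j\<in>{..R'}. j < L \<and> s j} l t WW \<tau> \<Omega> e else {})
      (k \<in> B', ret f B' k, restrict (\<lambda>j. (f ^^ j) k \<in> B) {..R'}, lf k, tf k))"
    by (intro ext) (simp add: W'_def)
  then show ?thesis using d by simp
qed

lemma W'_ext:
  assumes k: "k \<in> B'" and A: "A \<subseteq> {..<ret f B' k}" "card A \<le> J"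
    and u: "\<And>j. j < ret f B' k \<Longrightarrow> (f ^^ j) k \<in> B \<Longrightarrow> A \<inter> {j..<j + ret f B ((f ^^ j) k)} \<noteq> {} \<Longrightarrow>
      sub n j (ret f B ((f ^^ j) k)) u \<in> W ((f ^^ j) k)"
  shows "\<exists>v\<in>W' k. \<forall>a\<in>A. \<forall>i\<le>n. (a, i) \<in> v \<longleftrightarrow> (a, i) \<in> u"
proof -
  have "\<exists>v\<in>comb.good n (ret f B' k) (St k) (lf k) (tf k) WW \<tau> \<Omega> e. \<forall>a\<in>A. \<forall>i\<le>n. (a, i) \<in> v \<longleftrightarrow> (a, i) \<in> u"
  proof (rule comb.extend[OF comb_k[OF k] A])
    fix j assume j: "j \<in> St k" "A \<inter> {j..<j + lf k j} \<noteq> {}"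
    then show "sub n j (lf k j) u \<in> WW (tf k j)" using u[of j] St_val[OF j(1)] WW_eq by simp
  qed (use vis'[OF k] big[OF k] in auto)
  then show ?thesis using k by (simp add: W'_def)
qed

lemma W'_ne: "k \<in> B' \<Longrightarrow> W' k \<noteq> {}" using W'_ext[of k "{}"] by auto

lemma W'_box: "k \<in> B' \<Longrightarrow> v \<in> W' k \<Longrightarrow> v \<subseteq> {..<ret f B' k} \<times> {..<Suc n}"
  using comb.good_def[OF comb_k] by (auto simp: W'_def)

lemma W'_sub:
  assumes "k \<in> B'" "v \<in> W' k" "j < ret f B' k" "(f ^^ j) k \<in> B"
  shows "sub n j (ret f B ((f ^^ j) k)) v \<in> W ((f ^^ j) k)"
proof -
  have j: "j \<in> St k" using assms by (simp add: St_def)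
  have "comb.ok (St k) (tf k) WW (\<lambda>j. sub n j (lf k j) v)"
    using assms comb.good_def[OF comb_k[OF assms(1)]] by (simp add: W'_def)
  then have "sub n j (lf k j) v \<in> WW (tf k j)" using j unfolding comb.ok_def[OF comb_k[OF assms(1)]] by blast
  then show ?thesis using St_val[OF j] WW_eq by simp
qed

lemma W'_contain:
  assumes "k \<in> B'" "v \<in> W' k" "k1 \<in> B" "w \<in> W k1"
  shows "\<exists>j<ret f B' k. (f ^^ j) k \<in> B \<and> agr N k1 ((f ^^ j) k) \<and> sub n j (ret f B k1) v = w"
proof -
  have "(pfx N k1, w) \<in> \<Omega>" using assms by (auto simp: \<Omega>_def)
  moreover have "\<forall>(t, w)\<in>\<Omega>. \<exists>j\<in>St k. tf k j = t \<and> sub n j (lf k j) v = w"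
    using assms comb.good_def[OF comb_k[OF assms(1)]] by (simp add: W'_def)
  ultimately obtain j where j: "j \<in> St k" "tf k j = pfx N k1" "sub n j (lf k j) v = w" by fast
  have a: "agr N k1 ((f ^^ j) k)" using j(2) St_val[OF j(1)] pfx_eq_iff by metis
  then have "ret f B k1 = lf k j" using resD(3) St_val[OF j(1)] by simp
  then have "sub n j (ret f B k1) v = w" using j(3) by simp
  then show ?thesis using a St_val(3,4)[OF j(1)] by blast
qed

text \<open>With test functions bounded by \<open>R\<close>, a tolerance \<open>e\<close> for each
  pair of \<open>\<Omega>\<close> adds up to \<open>card \<Omega> * R * e\<close>.\<close>

lemma W'_freq:
  assumes "card \<Omega> * R * e \<le> \<epsilon>" shows "FREQ n \<epsilon> B R W B' W' N \<tau>"
  unfolding FREQ_def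
proof (intro ballI allI impI)
  fix k v and \<theta> :: "nat set \<Rightarrow> (nat \<times> nat) set \<Rightarrow> real"
  assume k: "k \<in> B'" and v: "v \<in> W' k" and \<theta>: "\<forall>t w. \<bar>\<theta> t w\<bar> \<le> real R"
  have "\<bar>\<Sum>j\<in>St k. \<theta> (tf k j) (sub n j (lf k j) v) - (\<Sum>w\<in>WW (tf k j). \<tau> (tf k j) w * \<theta> (tf k j) w)\<bar>
      \<le> card \<Omega> * real R * e * real (ret f B' k)"
    by (rule comb.weighted_discr_bound[OF comb_k[OF k], where \<theta>=\<theta> and C="real R"]) (use k v \<theta> in \<open>auto simp: W'_def\<close>)
  also have "(\<Sum>j\<in>St k. \<theta> (tf k j) (sub n j (lf k j) v) - (\<Sum>w\<in>WW (tf k j). \<tau> (tf k j) w * \<theta> (tf k j) w))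
    = (\<Sum>j\<in>{j. j < ret f B' k \<and> (f ^^ j) k \<in> B}. \<theta> (pfx N ((f ^^ j) k)) (sub n j (ret f B ((f ^^ j) k)) v) -
        (\<Sum>w\<in>W ((f ^^ j) k). \<tau> (pfx N ((f ^^ j) k)) w * \<theta> (pfx N ((f ^^ j) k)) w))"
  proof (rule sum.cong)
    show "St k = {j. j < ret f B' k \<and> (f ^^ j) k \<in> B}" by (rule St_def)
    fix j assume "j \<in> {j. j < ret f B' k \<and> (f ^^ j) k \<in> B}"
    then have j: "j \<in> St k" by (simp add: St_def)
    show "\<theta> (tf k j) (sub n j (lf k j) v) - (\<Sum>w\<in>WW (tf k j). \<tau> (tf k j) w * \<theta> (tf k j) w)
      = \<theta> (pfx N ((f ^^ j) k)) (sub n j (ret f B ((f ^^ j) k)) v) -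
        (\<Sum>w\<in>W ((f ^^ j) k). \<tau> (pfx N ((f ^^ j) k)) w * \<theta> (pfx N ((f ^^ j) k)) w)"
      unfolding St_val[OF j] WW_eq[OF St_val(3)[OF j]] ..
  qed
  also have "card \<Omega> * real R * e * real (ret f B' k) \<le> \<epsilon> * real (ret f B' k)"
    using assms by (intro mult_right_mono) auto
  finally show "\<bar>\<Sum>j\<in>{j. j < ret f B' k \<and> (f ^^ j) k \<in> B}. \<theta> (pfx N ((f ^^ j) k)) (sub n j (ret f B ((f ^^ j) k)) v) -
        (\<Sum>w\<in>W ((f ^^ j) k). \<tau> (pfx N ((f ^^ j) k)) w * \<theta> (pfx N ((f ^^ j) k)) w)\<bar> \<le> \<epsilon> * real (ret f B' k)" .
qed

abbreviation wrd' :: "'a \<Rightarrow> (nat \<times> nat) set" where "wrd' y \<equiv> word (Suc n) (ret f B' (P y)) q y"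

definition nearest :: "'a \<Rightarrow> (nat \<times> nat) set" where
  "nearest y = near n (ret f B' (P y)) (W' (P y)) (wrd' y)"

text \<open>Each column is rewritten as a whole: its points read their bits from the one word chosen
  at its base, so the new name of the column is admissible by construction.\<close>

definition q' :: "'a \<Rightarrow> nat \<Rightarrow> bool" where
  "q' y i = (if i \<le> n then (off f B' (P y), i) \<in> nearest (ziter T (- int (off f B' (P y))) y) else q y i)"

lemma nearest_in: "P y \<in> B' \<Longrightarrow> nearest y \<in> W' (P y)"
  unfolding nearest_def by (rule near_props(1)) (rule W'_ne)

lemma q'_fwd:
  assumes "y \<in> space M" "P y \<in> B'" "j < ret f B' (P y)" "i \<le> n"
  shows "q' ((T ^^ j) y) i \<longleftrightarrow> (j, i) \<in> nearest y"
proof -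
  have "off f B' (P ((T ^^ j) y)) = j" using assms P_fn off_fwd_iff[OF bijf B'(5)] by simp
  moreover have "ziter T (- int j) ((T ^^ j) y) = y" using ziter_add[OF bijT, of "- int j" "int j" y] by (simp add: ziter_nat)
  ultimately show ?thesis using assms(4) by (simp add: q'_def)
qed

lemma word_q':
  assumes "y \<in> space M" "P y \<in> B'" shows "word (Suc n) (ret f B' (P y)) q' y = nearest y"
  using q'_fwd[OF assms] W'_box[OF assms(2) nearest_in[OF assms(2)]] by (auto simp: word_def less_Suc_eq_le)

lemma sf_nearest: "simple_function M nearest"
proof -
  have "simple_function M (\<lambda>y. (ret f B' (P y), W' (P y)))"
    by (rule sf_dep[of "\<lambda>k. (ret f B' k, W' k)"]) (intro dep_Pair dep_ret[OF B'(2,3,5)] dep_W')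
  moreover have "simple_function M wrd'" by (rule sf_word_ret[OF invD(8) B'(2,3,5)])
  ultimately have "simple_function M (\<lambda>y. near n (fst (ret f B' (P y), W' (P y))) (snd (ret f B' (P y), W' (P y))) (wrd' y))"
    by (rule simple_function_compose2[where h="\<lambda>a. near n (fst a) (snd a)"])
  then show ?thesis by (simp add: nearest_def[abs_def])
qed

lemma q'_meas: "bits_meas q'"
  unfolding bits_meas_def
proof
  fix i
  have [measurable]: "B' \<in> sets borel" using B'(2) by simp
  note off_borel[OF B'(5) \<open>B' \<in> sets borel\<close>, measurable]
  show "{y\<in>space M. q' y i} \<in> sets M"
  proof (cases "i \<le> n")
    case True
    have 1: "{y\<in>space M. nearest (ziter T (- int b) y) \<in> {v. (b, i) \<in> v}} \<in> sets M" for b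
      by (rule sf_measD[OF sf_comp_T[OF sf_nearest]])
    have 2: "P -` {k. off f B' k = b} \<inter> space M \<in> sets M" for b by measurable
    have "{y\<in>space M. q' y i} = (\<Union>b\<in>{..R'}. {y\<in>space M. nearest (ziter T (- int b) y) \<in> {v. (b, i) \<in> v}} \<inter> (P -` {k. off f B' k = b} \<inter> space M))"
      using True off_le[OF B'(5)] by (auto simp: q'_def)
    also have "\<dots> \<in> sets M" by (intro sets.finite_UN sets.Int 1 2) simp
    finally show ?thesis .
  next
    case False
    then show ?thesis using invD(8) by (simp add: q'_def bits_meas_def)
  qed
qed

lemma INV': "INV (Suc n) B' R' W' q'"
  unfolding INV_def using W'_ne W'_box word_q' nearest_in by (intro conjI ballI impI B' dep_W' q'_meas subsetI PowI) auto

text \<open>If all discrepancies of the column are at most half the tolerance,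
  \<open>comb.near\<close> gives a cheap correction. Otherwise the whole column may change, but then
  a large discrepancy pays for its length, as in Chebyshev's inequality.\<close>

lemma mismatch_bound:
  assumes y: "y \<in> space M" "P y \<in> B'"
  shows "card (mismatch n (ret f B' (P y)) (wrd' y) (nearest y)) \<le> card \<Omega> * R + 2 / e * (\<Sum>\<pi>\<in>\<Omega>. \<bar>rsum B' (F \<pi>) y\<bar>)"
proof -
  let ?k = "P y" let ?L = "ret f B' ?k"
  interpret C: comb n ?L R "St ?k" "lf ?k" "tf ?k" WW \<tau> \<Omega> by (rule comb_k[OF y(2)])
  have ws: "sub n j (lf ?k j) (wrd' y) = wrd ((T ^^ j) y)" if "j \<in> St ?k" for j
    using St_val[OF that] C.l[OF that] P_fn[OF y(1)] sub_word[of j "lf ?k j" ?L n "Suc n" q y] by simp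
  have sp: "(T ^^ j) y \<in> space M" for j using y(1) measurable_space[OF Tn_meas] by blast
  have ok: "C.ok (\<lambda>j. sub n j (lf ?k j) (wrd' y))"
    unfolding C.ok_def
  proof
    fix j assume j: "j \<in> St ?k"
    then show "sub n j (lf ?k j) (wrd' y) \<in> WW (tf ?k j)"
      using ws[OF j] invD(9)[OF sp[of j]] P_fn[OF y(1)] St_val[OF j] WW_eq by simp
  qed
  \<comment> \<open>Column sums of the centred observables are the discrepancies of the old
    name.\<close>
  have discr: "C.discr (\<lambda>j. sub n j (lf ?k j) (wrd' y)) (St ?k) t w = rsum B' (F (t, w)) y" for t w
  proof -
    have "C.discr (\<lambda>j. sub n j (lf ?k j) (wrd' y)) (St ?k) t w
        = (\<Sum>j\<in>St ?k. F (t, w) ((T ^^ j) y))"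
      unfolding C.discr_def using ws St_val[of _ ?k] P_fn[OF y(1)] by (intro sum.cong) (auto simp: F_val[OF sp])
    also have "\<dots> = (\<Sum>j<?L. F (t, w) ((T ^^ j) y))"
      using P_fn[OF y(1)] by (intro sum.mono_neutral_left) (auto simp: St_def F_val[OF sp])
    finally show ?thesis using y by (simp add: rsum_def)
  qed
  have nonneg: "0 \<le> 2 / e * (\<Sum>\<pi>\<in>\<Omega>. \<bar>rsum B' (F \<pi>) y\<bar>)" using e by (intro mult_nonneg_nonneg sum_nonneg) auto
  show ?thesis
  proof (cases "\<forall>(t, w)\<in>\<Omega>. \<bar>rsum B' (F (t, w)) y\<bar> \<le> e / 2 * ?L")
    case True
    have "\<exists>v\<in>C.good e. card (mismatch n ?L (wrd' y) v) \<le> card \<Omega> * R"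
    proof (rule C.near[OF ok])
      show "\<forall>(t, w)\<in>\<Omega>. \<bar>C.discr (\<lambda>j. sub n j (lf ?k j) (wrd' y)) (St ?k) t w\<bar> \<le> e / 2 * ?L"
        using True discr by simp
      show "card \<Omega> \<le> card {j \<in> St ?k. tf ?k j = t}" if "(t, w) \<in> \<Omega>" for t w using vis'[OF y(2) that] by simp
      show "real (2 * card \<Omega>) \<le> e * ?L" using big[OF y(2)] by simp
    qed
    then obtain v where "v \<in> W' ?k" "card (mismatch n ?L (wrd' y) v) \<le> card \<Omega> * R" using y by (auto simp: W'_def)
    then have "card (mismatch n ?L (wrd' y) (nearest y)) \<le> card \<Omega> * R"
      using near_props(2)[OF W'_ne[OF y(2)]] unfolding nearest_def by (meson le_trans)
    then have "real (card (mismatch n ?L (wrd' y) (nearest y))) \<le> real (card \<Omega> * R)" by (rule of_nat_mono)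
    then show ?thesis using nonneg by linarith
  next
    case False
    then obtain \<pi> where \<pi>: "\<pi> \<in> \<Omega>" "e / 2 * ?L < \<bar>rsum B' (F \<pi>) y\<bar>" by (auto simp: not_le)
    have "\<bar>rsum B' (F \<pi>) y\<bar> \<le> (\<Sum>\<pi>\<in>\<Omega>. \<bar>rsum B' (F \<pi>) y\<bar>)"
      by (rule member_le_sum[OF \<pi>(1)]) (auto simp: fin\<Omega>)
    then have "?L \<le> 2 / e * (\<Sum>\<pi>\<in>\<Omega>. \<bar>rsum B' (F \<pi>) y\<bar>)" using \<pi>(2) e by (simp add: field_simps)
    moreover have "card (mismatch n ?L (wrd' y) (nearest y)) \<le> card {..<?L}"
      by (rule card_mono) (auto simp: mismatch_def)
    then have "real (card (mismatch n ?L (wrd' y) (nearest y))) \<le> ?L" by simp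
    ultimately show ?thesis by linarith
  qed
qed

text \<open>The measure of the changed set is the integral over the base of the number of changed
  positions per column; \<open>mismatch_bound\<close> and \<open>rsum_L1\<close> bound it by the
  measure of the base and the mean ergodic errors.\<close>

lemma close:
  assumes m: "0 < m"
  shows "measure M {y\<in>space M. \<exists>i\<le>n. q' y i \<noteq> q y i} \<le> card \<Omega> * R * measure M {y\<in>space M. P y \<in> B'} +
    2 / e * (\<Sum>\<pi>\<in>\<Omega>. (\<integral>y. \<bar>bsum (F \<pi>) m y / m\<bar> \<partial>M) + 2 * real m * measure M {y\<in>space M. P y \<in> B'})"
proof -
  have [measurable]: "B' \<in> sets borel" using B'(2) by simp
  define D where "D = {y\<in>space M. \<exists>i\<le>n. q' y i \<noteq> q y i}"
  have [measurable]: "{y\<in>space M. q' y i} \<in> sets M" "{y\<in>space M. q y i} \<in> sets M" for i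
    using q'_meas invD(8) by (auto simp: bits_meas_def)
  have "D = (\<Union>i\<in>{..n}. ({y\<in>space M. q' y i} - {y\<in>space M. q y i}) \<union> ({y\<in>space M. q y i} - {y\<in>space M. q' y i}))"
    by (auto simp: D_def)
  also have "\<dots> \<in> sets M" by measurable
  finally have [measurable]: "D \<in> sets M" .
  have rF [measurable]: "rsum B' (F \<pi>) \<in> borel_measurable M" for \<pi> by (rule rsum_meas[OF B'(5)]) measurable
  have iF: "integrable M (\<lambda>y. \<bar>rsum B' (F \<pi>) y\<bar>)" for \<pi>
    using rsum_bound[OF B'(5) F_bound] by (intro bounded_integrable[of _ "R' * 1"]) auto
  have b: "{y\<in>space M. P y \<in> B'} \<in> sets M" by measurable
  have ib: "integrable M (indicat_real {y\<in>space M. P y \<in> B'})"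
    using b by (intro bounded_integrable[of _ 1]) (auto simp: indicator_def)
  have "measure M D = (\<integral>y. indicator D y \<partial>M)" using sets.sets_into_space[OF \<open>D \<in> sets M\<close>] by (simp add: Int_absorb1)
  also have "\<dots> = (\<integral>y. rsum B' (indicator D) y \<partial>M)"
    by (rule tower[OF B'(5), of _ 1]) (auto simp: indicator_def)
  also have "\<dots> \<le> (\<integral>y. real (card \<Omega> * R) * indicator {y\<in>space M. P y \<in> B'} y + 2 / e * (\<Sum>\<pi>\<in>\<Omega>. \<bar>rsum B' (F \<pi>) y\<bar>) \<partial>M)"
  proof (rule integral_mono)
    show "integrable M (rsum B' (indicator D))"
      using rsum_bound[OF B'(5), of "indicator D" 1] rsum_meas[OF B'(5), of "indicator D"]
      by (intro bounded_integrable[of _ "R' * 1"]) (auto simp: indicator_def)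
    show "integrable M (\<lambda>y. real (card \<Omega> * R) * indicator {y\<in>space M. P y \<in> B'} y + 2 / e * (\<Sum>\<pi>\<in>\<Omega>. \<bar>rsum B' (F \<pi>) y\<bar>))"
      using ib iF by (intro Bochner_Integration.integrable_add Bochner_Integration.integrable_sum integrable_mult_right) auto
    fix y assume y: "y \<in> space M"
    show "rsum B' (indicator D) y \<le> real (card \<Omega> * R) * indicator {y\<in>space M. P y \<in> B'} y + 2 / e * (\<Sum>\<pi>\<in>\<Omega>. \<bar>rsum B' (F \<pi>) y\<bar>)"
    proof (cases "P y \<in> B'")
      case True
      let ?L = "ret f B' (P y)"
      have "(T ^^ j) y \<in> D \<longleftrightarrow> j \<in> mismatch n ?L (wrd' y) (nearest y)" if "j < ?L" for j
        using q'_fwd[OF y True that] that measurable_space[OF Tn_meas y]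
        by (auto simp: D_def mismatch_def word_def less_Suc_eq_le)
      then have "rsum B' (indicator D) y = (\<Sum>j<?L. of_bool (j \<in> mismatch n ?L (wrd' y) (nearest y)))"
        using True by (auto simp: rsum_def indicator_def of_bool_def intro!: sum.cong)
      also have "\<dots> = card (mismatch n ?L (wrd' y) (nearest y))"
        by (simp add: of_bool_def sum.If_cases Int_def mismatch_def)
      finally show ?thesis using mismatch_bound[OF y True] True y by simp
    next
      case False
      then show ?thesis using e by (auto simp: rsum_def)
    qed
  qed
  also have "\<dots> = real (card \<Omega> * R) * measure M {y\<in>space M. P y \<in> B'} + 2 / e * (\<Sum>\<pi>\<in>\<Omega>. \<integral>y. \<bar>rsum B' (F \<pi>) y\<bar> \<partial>M)"
    using ib iF b by (subst Bochner_Integration.integral_add) (auto simp: Bochner_Integration.integral_sum intro!: sets.Int_space_eq2)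
  also have "\<dots> \<le> real (card \<Omega> * R) * measure M {y\<in>space M. P y \<in> B'} +
      2 / e * (\<Sum>\<pi>\<in>\<Omega>. (\<integral>y. \<bar>bsum (F \<pi>) m y / m\<bar> \<partial>M) + 2 * real m * measure M {y\<in>space M. P y \<in> B'})"
    using rsum_L1[OF B'(5,2) F_meas F_bound m] e by (intro add_left_mono mult_left_mono sum_mono) auto
  finally show ?thesis by (simp add: D_def)
qed

end

section \<open>The constants of a stage\<close>

context sys begin

text \<open>The averaging time \<open>m\<close> is dictated by the finitely many pairs of level
  \<open>n\<close>; only afterwards is the new base made so small that its columns are long compared
  with all earlier constants.\<close>

theorem step:
  assumes inv: "INV n B R W q" and \<epsilon>: "0 < \<epsilon>"
  shows "\<exists>B' R' W' q'. INV (Suc n) B' R' W' q' \<and> STEP n J \<epsilon> h B R W q B' W' q'"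
proof -
  obtain N where res: "resol n B R W N" using resol_ex[OF inv] by blast
  interpret S: st1 f M T P x0 n B R W q N by unfold_locales (rule inv res)+
  define c where "c = card S.\<Omega>"
  \<comment> \<open>Gives \<open>real c * R * e \<le> \<epsilon>\<close>, the hypothesis of
    \<open>W'_freq\<close>; the \<open>1\<close> keeps the denominator positive.\<close>
  define e where "e = \<epsilon> / (real c * R + 1)"
  have e: "0 < e" using \<epsilon> by (simp add: e_def add_nonneg_pos)
  have e\<epsilon>: "real c * R * e \<le> \<epsilon>"
  proof -
    have "real c * R * e \<le> (real c * R + 1) * e" using e by (intro mult_right_mono) auto
    also have "\<dots> = \<epsilon>" using add_nonneg_pos[of "real c * R" 1] by (simp add: e_def)
    finally show ?thesis .
  qed
  \<comment> \<open>Makes the ergodic error \<open>2 / e * c * \<delta>\<close> at most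
    \<open>\<epsilon> / 2\<close>.\<close>
  define \<delta> where "\<delta> = \<epsilon> * e / (4 * (real c + 1))"
  have \<delta>: "0 < \<delta>" using \<epsilon> e by (simp add: \<delta>_def)
  obtain m where m: "0 < m" "\<forall>\<pi>\<in>S.\<Omega>. (\<integral>y. \<bar>bsum (S.F \<pi>) m y / m\<bar> \<partial>M) < \<delta>"
    using S.mean_small[OF \<delta>] by blast
  \<comment> \<open>The total coefficient of the measure of the new base in the bound of
    \<open>close\<close>.\<close>
  define K where "K = real c * R + 2 / e * (real c * (2 * real m))"
  have K: "0 \<le> K" using e by (simp add: K_def)
  define U where "U t = {k\<in>B. pfx N k = t}" for t
  have "\<exists>Rt. recur f (U t) Rt" if t: "t \<in> fst ` S.\<Omega>" for t
  proof (rule recur_ex)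
    have "U t = {k. (k \<in> B, pfx N k) \<in> {(True, t)}}" by (auto simp: U_def)
    also have "open \<dots>" by (rule dep_open) (intro dep_Pair dep_clopen S.invD, simp add: pfx_def dep_agr)
    finally show "open (U t)" .
    show "U t \<noteq> {}" using t by (auto simp: U_def S.\<Omega>_def)
  qed
  then obtain Rt where Rt: "\<And>t. t \<in> fst ` S.\<Omega> \<Longrightarrow> recur f (U t) (Rt t)" by metis
  \<comment> \<open>The summands provide in turn closeness to \<open>x0\<close> and positivity, a
    base whose measure times \<open>K\<close> is at most \<open>\<epsilon> / 2\<close>, the
    condition \<open>big\<close>, and \<open>J + c\<close> visits to every type.\<close>
  define h0 where "h0 = h + 1 + nat \<lceil>2 * K / \<epsilon>\<rceil> + nat \<lceil>(2 * c + J) / e\<rceil> + (\<Sum>t\<in>fst ` S.\<Omega>. (J + c) * Suc (Rt t))"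
  have h1: "2 * K / \<epsilon> \<le> h0" "real (2 * c + J) / e \<le> h0" "h \<le> h0" "0 < h0"
    unfolding h0_def by linarith+
  have h2: "(J + c) * Suc (Rt t) \<le> h0" if "t \<in> fst ` S.\<Omega>" for t
  proof -
    have "(J + c) * Suc (Rt t) \<le> (\<Sum>t\<in>fst ` S.\<Omega>. (J + c) * Suc (Rt t))"
      by (rule member_le_sum[OF that]) (auto simp: S.fin\<Omega>)
    then show ?thesis by (simp add: h0_def)
  qed
  obtain B' where B': "open B'" "open (- B')" "x0 \<in> B'" "B' \<subseteq> B" "\<forall>k\<in>B'. agr h0 x0 k"
      "\<forall>k\<in>B'. \<forall>j. 0 < j \<longrightarrow> j \<le> h0 \<longrightarrow> (f ^^ j) k \<notin> B'"
    using small_nbhd[OF S.invD(1-3), of h0] by blast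
  obtain R' where R': "recur f B' R'" using recur_ex[of B'] B' by blast
  have ret: "h0 < ret f B' k" if "k \<in> B'" for k
    using ret_props(1,2)[OF R', of k] B'(6) that by (meson not_le)
  interpret S2: st2 f M T P x0 n B R W q N B' R' e J
  proof unfold_locales
    fix k t w assume k: "k \<in> B'" and tw: "(t, w) \<in> S.\<Omega>"
    then have t: "t \<in> fst ` S.\<Omega>" by force
    have "J + c \<le> card {j. j < (J + c) * Suc (Rt t) \<and> (f ^^ j) k \<in> U t}" by (rule visits[OF Rt[OF t]])
    also have "\<dots> \<le> card {j. j < ret f B' k \<and> (f ^^ j) k \<in> B \<and> pfx N ((f ^^ j) k) = t}"
      using h2[OF t] ret[OF k] by (intro card_mono) (auto simp: U_def)
    finally show "J + card S.\<Omega> \<le> card {j. j < ret f B' k \<and> (f ^^ j) k \<in> B \<and> pfx N ((f ^^ j) k) = t}" by (simp add: c_def)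
  next
    fix k assume k: "k \<in> B'"
    have "real (2 * c + J) \<le> e * h0" using h1(2) e by (simp add: field_simps)
    also have "\<dots> \<le> e * ret f B' k" using ret[OF k] e by simp
    finally show "real (2 * card S.\<Omega> + J) \<le> e * real (ret f B' k)" by (simp add: c_def)
  qed (rule B' R' e)+
  let ?\<beta> = "measure M {y\<in>space M. P y \<in> B'}"
  have \<beta>: "?\<beta> \<le> 1 / h0" using ret h1(4) by (intro base_measure[OF B'(1) R']) (auto intro: less_imp_le)
  have "measure M {y\<in>space M. \<exists>i\<le>n. S2.q' y i \<noteq> q y i} \<le> card S.\<Omega> * R * ?\<beta> +
      2 / e * (\<Sum>\<pi>\<in>S.\<Omega>. (\<integral>y. \<bar>bsum (S.F \<pi>) m y / m\<bar> \<partial>M) + 2 * real m * ?\<beta>)"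
    by (rule S2.close[OF m(1)])
  also have "\<dots> \<le> c * R * ?\<beta> + 2 / e * (\<Sum>\<pi>\<in>S.\<Omega>. \<delta> + 2 * real m * ?\<beta>)"
    using m(2) e by (intro add_mono mult_left_mono sum_mono) (auto simp: c_def intro: less_imp_le)
  also have "\<dots> = K * ?\<beta> + 2 / e * c * \<delta>" by (simp add: K_def c_def algebra_simps)
  also have "\<dots> \<le> K * (1 / h0) + 2 / e * c * \<delta>" using \<beta> K by (intro add_right_mono mult_left_mono) auto
  also have "K * (1 / h0) \<le> \<epsilon> / 2" using h1(1,4) \<epsilon> by (simp add: field_simps)
  also have "2 / e * c * \<delta> \<le> \<epsilon> / 2"
  proof -
    have "2 / e * c * \<delta> = \<epsilon> / 2 * (c / (real c + 1))" using e by (simp add: \<delta>_def field_simps)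
    also have "\<dots> \<le> \<epsilon> / 2 * 1" using \<epsilon> by (intro mult_left_mono) auto
    finally show ?thesis by simp
  qed
  finally have cl: "measure M {y\<in>space M. \<exists>i\<le>n. S2.q' y i \<noteq> q y i} \<le> \<epsilon>" by simp
  have "STEP n J \<epsilon> h B R W q B' S2.W' S2.q'"
    unfolding STEP_def
  proof (intro conjI)
    show "B' \<subseteq> B" by (rule B'(4))
    show "\<forall>k\<in>B'. agr h x0 k \<and> h < ret f B' k"
      using B'(5) ret h1(3) agr_mono by (meson le_less_trans)
    show "\<forall>k\<in>B'. \<forall>v\<in>S2.W' k. \<forall>j<ret f B' k. (f ^^ j) k \<in> B \<longrightarrow> sub n j (ret f B ((f ^^ j) k)) v \<in> W ((f ^^ j) k)"
      using S2.W'_sub by blast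
    have "FREQ n \<epsilon> B R W B' S2.W' N S.\<tau>" by (rule S2.W'_freq) (use e\<epsilon> in \<open>simp add: c_def\<close>)
    then show "\<exists>N \<tau>. resol n B R W N \<and>
        (\<forall>k\<in>B'. \<forall>v\<in>S2.W' k. \<forall>k1\<in>B. \<forall>w\<in>W k1. \<exists>j<ret f B' k. (f ^^ j) k \<in> B \<and> agr N k1 ((f ^^ j) k) \<and> sub n j (ret f B k1) v = w) \<and>
        FREQ n \<epsilon> B R W B' S2.W' N \<tau>"
      using res S2.W'_contain by blast
    show "\<forall>k\<in>B'. \<forall>u A. A \<subseteq> {..<ret f B' k} \<longrightarrow> card A \<le> J \<longrightarrow>
        (\<forall>j<ret f B' k. (f ^^ j) k \<in> B \<longrightarrow> A \<inter> {j..<j + ret f B ((f ^^ j) k)} \<noteq> {} \<longrightarrow> sub n j (ret f B ((f ^^ j) k)) u \<in> W ((f ^^ j) k)) \<longrightarrow>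
        (\<exists>v\<in>S2.W' k. \<forall>a\<in>A. \<forall>i\<le>n. (a, i) \<in> v \<longleftrightarrow> (a, i) \<in> u)"
      using S2.W'_ext by metis
    show "measure M {y\<in>space M. \<exists>i\<le>n. S2.q' y i \<noteq> q y i} \<le> \<epsilon>" by (rule cl)
    show "\<forall>y i. i > n \<longrightarrow> S2.q' y i = q y i" by (simp add: S2.q'_def)
  qed
  then show ?thesis using S2.INV' by blast
qed

end

section \<open>The limit system over the base\<close>

text \<open>A point of the Cantor space codes an array of bits indexed by time in \<open>\<int>\<close> and level in \<open>\<nat>\<close>.\<close>

definition bt :: "cant \<Rightarrow> int \<Rightarrow> nat \<Rightarrow> bool" where
  "bt x j i = x (prod_encode (int_encode j, i))"

definition mk :: "(int \<Rightarrow> nat \<Rightarrow> bool) \<Rightarrow> cant" where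
  "mk p = (\<lambda>m. p (int_decode (fst (prod_decode m))) (snd (prod_decode m)))"

lemma bt_mk [simp]: "bt (mk p) j i = p j i" by (simp add: bt_def mk_def)

lemma bt_ext: assumes "\<And>j i. bt x j i = bt x' j i" shows "x = x'"
proof
  fix m
  have "bt y (int_decode (fst (prod_decode m))) (snd (prod_decode m)) = y m" for y by (simp add: bt_def)
  then show "x m = x' m" using assms by metis
qed

lemma decode_bound: "m < N \<Longrightarrow> \<bar>int_decode (fst (prod_decode m))\<bar> \<le> int N \<and> snd (prod_decode m) < N"
proof -
  assume m: "m < N"
  have "fst (prod_decode m) \<le> m" "snd (prod_decode m) \<le> m"
    using le_prod_encode_1[of "fst (prod_decode m)" "snd (prod_decode m)"] le_prod_encode_2[of "snd (prod_decode m)" "fst (prod_decode m)"]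
    by simp_all
  moreover have "\<bar>int_decode a\<bar> \<le> int a" for a
    by (cases "even a") (simp_all add: int_decode_def sum_decode_def, presburger)
  ultimately show ?thesis using m by (meson le_less_trans less_imp_le of_nat_le_iff order_trans)
qed

lemma agr_bt: "agr N x x' \<longleftrightarrow> (\<forall>m<N. bt x (int_decode (fst (prod_decode m))) (snd (prod_decode m)) = bt x' (int_decode (fst (prod_decode m))) (snd (prod_decode m)))"
  by (simp add: agr_def bt_def)

lemma agr_btI:
  assumes "\<And>j i. \<bar>j\<bar> \<le> int N \<Longrightarrow> i < N \<Longrightarrow> bt x j i = bt x' j i" shows "agr N x x'"
  unfolding agr_bt using assms decode_bound by blast

lemma bt_local: "\<exists>N. \<forall>x x'. agr N x x' \<longrightarrow> (\<forall>j i. \<bar>j\<bar> \<le> int n \<longrightarrow> i \<le> n \<longrightarrow> bt x j i = bt x' j i)"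
proof -
  define A where "A = (\<lambda>(j, i). prod_encode (int_encode j, i)) ` ({- int n..int n} \<times> {..n})"
  have "finite A" by (simp add: A_def)
  then obtain N where N: "\<forall>a\<in>A. a < N" using finite_nat_set_iff_bounded by blast
  show ?thesis
  proof (intro exI[of _ N] allI impI)
    fix x x' j i assume a: "agr N x x'" "\<bar>j\<bar> \<le> int n" "i \<le> n"
    then have "prod_encode (int_encode j, i) \<in> A" unfolding A_def by (intro image_eqI[of _ _ "(j, i)"]) auto
    then show "bt x j i = bt x' j i" using N a(1) by (simp add: bt_def agr_def)
  qed
qed

definition shift_by :: "int \<Rightarrow> cant \<Rightarrow> cant" where "shift_by j x = mk (\<lambda>a i. bt x (a + j) i)"

lemma bt_shift_by [simp]: "bt (shift_by j x) a i = bt x (a + j) i" by (simp add: shift_by_def)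

lemma shift_by_shift_by: "shift_by i (shift_by j x) = shift_by (i + j) x"
  by (rule bt_ext) (simp add: algebra_simps)

lemma shift_by_0 [simp]: "shift_by 0 x = x" by (rule bt_ext) simp

lemma shift_by_cont: "\<exists>N. \<forall>x x'. agr N x x' \<longrightarrow> agr M (shift_by j x) (shift_by j x')"
proof -
  define n where "n = M + nat \<bar>j\<bar>"
  obtain N where N: "\<And>x x' a i. agr N x x' \<Longrightarrow> \<bar>a\<bar> \<le> int n \<Longrightarrow> i \<le> n \<Longrightarrow> bt x a i = bt x' a i" using bt_local[of n] by blast
  have "agr M (shift_by j x) (shift_by j x')" if "agr N x x'" for x x'
    by (rule agr_btI) (use N[OF that] in \<open>auto simp: n_def\<close>)
  then show ?thesis by blast
qed

lemma open_prod_agrI: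
  assumes "\<And>k x. (k, x) \<in> U \<Longrightarrow> \<exists>N. \<forall>k' x'. agr N k k' \<longrightarrow> agr N x x' \<longrightarrow> (k', x') \<in> U"
  shows "open (U :: (cant \<times> cant) set)"
proof (subst open_subopen, intro ballI)
  fix z assume "z \<in> U"
  then obtain k x where z: "z = (k, x)" "(k, x) \<in> U" by (cases z) auto
  then obtain N where "\<forall>k' x'. agr N k k' \<longrightarrow> agr N x x' \<longrightarrow> (k', x') \<in> U" using assms by blast
  then show "\<exists>T. open T \<and> z \<in> T \<and> T \<subseteq> U"
    using z by (intro exI[of _ "{k'. agr N k k'} \<times> {k'. agr N x k'}"]) (auto intro!: open_Times open_cyl)
qed

lemma continuous_prod_agrI:
  fixes G :: "cant \<times> cant \<Rightarrow> cant \<times> cant"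
  assumes "\<And>M. \<exists>N. \<forall>k x k' x'. agr N k k' \<longrightarrow> agr N x x' \<longrightarrow> agr M (fst (G (k, x))) (fst (G (k', x'))) \<and> agr M (snd (G (k, x))) (snd (G (k', x')))"
  shows "continuous_on UNIV G"
proof -
  have "continuous_on UNIV (\<lambda>z. fst (G z))" "continuous_on UNIV (\<lambda>z. snd (G z))"
  proof -
    have "\<exists>N. \<forall>k' x'. (k', x') \<in> UNIV \<longrightarrow> agr N k k' \<longrightarrow> agr N x x' \<longrightarrow>
        fst (G (k', x')) i = fst (G (k, x)) i \<and> snd (G (k', x')) i = snd (G (k, x)) i" for k x i
    proof -
      obtain N where N: "\<And>k x k' x'. agr N k k' \<Longrightarrow> agr N x x' \<Longrightarrow>
          agr (Suc i) (fst (G (k, x))) (fst (G (k', x'))) \<and> agr (Suc i) (snd (G (k, x))) (snd (G (k', x')))"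
        using assms by metis
      show ?thesis using N[of k _ x] by (intro exI[of _ N]) (simp add: agr_Suc)
    qed
    then show "continuous_on UNIV (\<lambda>z. fst (G z))" "continuous_on UNIV (\<lambda>z. snd (G z))"
      by (intro continuous_on_pairs_agr; blast)+
  qed
  then have "continuous_on UNIV (\<lambda>z. (fst (G z), snd (G z)))" by (rule continuous_on_Pair)
  then show ?thesis by simp
qed

lemma measurable_loc_const:
  fixes g :: "cant \<times> cant \<Rightarrow> real"
  assumes "\<And>k x k' x'. agr N k k' \<Longrightarrow> agr N x x' \<Longrightarrow> g (k, x) = g (k', x')"
  shows "g \<in> borel_measurable borel"
proof (rule measurableI)
  fix A :: "real set" assume "A \<in> sets borel"
  have "open (g -` A)"
  proof (rule open_prod_agrI)
    fix k x assume "(k, x) \<in> g -` A"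
    then have "(k', x') \<in> g -` A" if "agr N k k'" "agr N x x'" for k' x' using assms[OF that] by simp
    then show "\<exists>N. \<forall>k' x'. agr N k k' \<longrightarrow> agr N x x' \<longrightarrow> (k', x') \<in> g -` A" by blast
  qed
  then show "g -` A \<inter> space borel \<in> sets borel" by simp
qed simp

section \<open>The product of the base map with the shift\<close>

context cdyn begin

definition g0 :: "cant \<times> cant \<Rightarrow> cant \<times> cant" where "g0 z = (f (fst z), shift_by 1 (snd z))"

lemma g0_apply: "g0 (k, x) = (f k, shift_by 1 x)" by (simp add: g0_def)

lemma g0_inv: "g0 (inv f k, shift_by (- 1) x) = (k, x)"
  using bijf by (simp add: g0_def shift_by_shift_by bij_is_surj surj_f_inv_f)

lemma bij_g0: "bij g0"
proof (rule bijI')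
  fix z z' show "(g0 z = g0 z') = (z = z')"
  proof
    assume "g0 z = g0 z'"
    then have 1: "f (fst z) = f (fst z')" "shift_by 1 (snd z) = shift_by 1 (snd z')" by (auto simp: g0_def)
    then have "shift_by (- 1) (shift_by 1 (snd z)) = shift_by (- 1) (shift_by 1 (snd z'))" by simp
    then show "z = z'" using 1(1) bijf by (simp add: shift_by_shift_by prod_eq_iff bij_is_inj inj_eq)
  qed simp
  fix z show "\<exists>z'. z = g0 z'" using g0_inv[of "fst z" "snd z"] by (metis prod.collapse)
qed

lemma inv_g0: "inv g0 (k, x) = (inv f k, shift_by (- 1) x)"
  using g0_inv[of k x] bij_g0 by (metis bij_is_inj inv_f_f)

lemma ziter_g0: "ziter g0 j (k, x) = (ziter f j k, shift_by j x)"
proof (induction j rule: int_induct[where k=0])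
  case (step1 i) then show ?case using ziter_Suc[OF bij_g0, of i "(k, x)"] ziter_Suc[OF bijf, of i k] by (simp add: g0_apply shift_by_shift_by add.commute)
next
  case (step2 i) then show ?case using ziter_pred[OF bij_g0, of i "(k, x)"] ziter_pred[OF bijf, of i k] by (simp add: inv_g0 shift_by_shift_by)
qed simp

lemma g0_pow: "(g0 ^^ a) (k, x) = ((f ^^ a) k, shift_by (int a) x)"
  using ziter_g0[of "int a" k x] by (simp add: ziter_nat)

lemma cont_ziter_g0: "continuous_on UNIV (ziter g0 j)"
proof (rule continuous_prod_agrI)
  fix M
  obtain N1 where "\<forall>k k'. agr N1 k k' \<longrightarrow> agr M (ziter f j k) (ziter f j k')" using unif_cont_agr[OF cont_ziter] by blast
  moreover obtain N2 where "\<forall>x x'. agr N2 x x' \<longrightarrow> agr M (shift_by j x) (shift_by j x')" using shift_by_cont by blast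
  ultimately show "\<exists>N. \<forall>k x k' x'. agr N k k' \<longrightarrow> agr N x x' \<longrightarrow>
      agr M (fst (ziter g0 j (k, x))) (fst (ziter g0 j (k', x'))) \<and> agr M (snd (ziter g0 j (k, x))) (snd (ziter g0 j (k', x')))"
    by (intro exI[of _ "max N1 N2"]) (simp add: ziter_g0, meson agr_mono max.cobounded1 max.cobounded2)
qed

end

text \<open>\<open>2 * n + 1\<close> is the number of times in the window from \<open>-n\<close> to
  \<open>n\<close>, all of which must be prescribable at stage \<open>n\<close>; the errors
  \<open>(1/2) ^ n\<close> are summable, as Borel-Cantelli requires. By \<open>sep\<close>, distinct
  points are separated at arbitrarily late indices.\<close>

locale tow = sys f M T P x0 for f and M :: "'a measure" and T P x0 +
  fixes E :: "nat \<Rightarrow> 'a set" and Bs :: "nat \<Rightarrow> cant set" and Rs :: "nat \<Rightarrow> nat"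
    and Ws :: "nat \<Rightarrow> cant \<Rightarrow> (nat \<times> nat) set set" and qs :: "nat \<Rightarrow> 'a \<Rightarrow> nat \<Rightarrow> bool"
  assumes INVs: "\<And>n. INV n (Bs n) (Rs n) (Ws n) (qs n)"
    and STEPs: "\<And>n. STEP n (2 * n + 1) ((1/2) ^ n) n (Bs n) (Rs n) (Ws n) (qs n) (Bs (Suc n)) (Ws (Suc n)) (qs (Suc n))"
    and q0: "qs 0 = (\<lambda>y i. y \<in> E i)"
    and sep: "\<And>y y' m. y \<in> space M \<Longrightarrow> y' \<in> space M \<Longrightarrow> y \<noteq> y' \<Longrightarrow> \<exists>i\<ge>m. (y \<in> E i) \<noteq> (y' \<in> E i)"
begin

lemma invs: "open (Bs n)" "open (- Bs n)" "x0 \<in> Bs n" "recur f (Bs n) (Rs n)" "dep (Ws n)" "\<And>k. k \<in> Bs n \<Longrightarrow> Ws n k \<noteq> {}"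
  "\<And>k. k \<in> Bs n \<Longrightarrow> Ws n k \<subseteq> Pow ({..<ret f (Bs n) k} \<times> {..<n})" "bits_meas (qs n)"
  "\<And>y. y \<in> space M \<Longrightarrow> P y \<in> Bs n \<Longrightarrow> word n (ret f (Bs n) (P y)) (qs n) y \<in> Ws n (P y)"
  using INVs[of n] by (auto simp: INV_def)

lemma Bs_Suc: "Bs (Suc n) \<subseteq> Bs n" using STEPs[of n] by (auto simp: STEP_def)

lemma Bs_small: "k \<in> Bs (Suc n) \<Longrightarrow> agr n x0 k \<and> n < ret f (Bs (Suc n)) k" using STEPs[of n] by (auto simp: STEP_def)

lemma Ws_sub: "k \<in> Bs (Suc n) \<Longrightarrow> v \<in> Ws (Suc n) k \<Longrightarrow> j < ret f (Bs (Suc n)) k \<Longrightarrow> (f ^^ j) k \<in> Bs n \<Longrightarrow>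
  sub n j (ret f (Bs n) ((f ^^ j) k)) v \<in> Ws n ((f ^^ j) k)"
  by (rule STEPs[of n, unfolded STEP_def, THEN conjunct2, THEN conjunct2, THEN conjunct1, rule_format])

lemma Ws_ext: "k \<in> Bs (Suc n) \<Longrightarrow> A \<subseteq> {..<ret f (Bs (Suc n)) k} \<Longrightarrow> card A \<le> 2 * n + 1 \<Longrightarrow>
  (\<And>j. j < ret f (Bs (Suc n)) k \<Longrightarrow> (f ^^ j) k \<in> Bs n \<Longrightarrow> A \<inter> {j..<j + ret f (Bs n) ((f ^^ j) k)} \<noteq> {} \<Longrightarrow>
     sub n j (ret f (Bs n) ((f ^^ j) k)) u \<in> Ws n ((f ^^ j) k)) \<Longrightarrow>
  \<exists>v\<in>Ws (Suc n) k. \<forall>a\<in>A. \<forall>i\<le>n. (a, i) \<in> v \<longleftrightarrow> (a, i) \<in> u"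
  by (rule STEPs[of n, unfolded STEP_def, THEN conjunct2, THEN conjunct2, THEN conjunct2, THEN conjunct2, THEN conjunct1, rule_format])

lemma Ws_freq: "\<exists>N \<tau>. resol n (Bs n) (Rs n) (Ws n) N \<and>
  (\<forall>k\<in>Bs (Suc n). \<forall>v\<in>Ws (Suc n) k. \<forall>k1\<in>Bs n. \<forall>w\<in>Ws n k1. \<exists>j<ret f (Bs (Suc n)) k.
     (f ^^ j) k \<in> Bs n \<and> agr N k1 ((f ^^ j) k) \<and> sub n j (ret f (Bs n) k1) v = w) \<and>
  FREQ n ((1/2) ^ n) (Bs n) (Rs n) (Ws n) (Bs (Suc n)) (Ws (Suc n)) N \<tau>"
  by (rule STEPs[of n, unfolded STEP_def, THEN conjunct2, THEN conjunct2, THEN conjunct2, THEN conjunct1])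

definition word_at :: "nat \<Rightarrow> nat \<Rightarrow> cant \<Rightarrow> int \<Rightarrow> (nat \<times> nat) set" where
  "word_at n l x j = {z\<in>{..<l} \<times> {..<n}. bt x (j + int (fst z)) (snd z)}"

definition admissible :: "nat \<Rightarrow> cant \<Rightarrow> cant \<Rightarrow> bool" where
  "admissible n k x \<longleftrightarrow> (\<forall>j. ziter f j k \<in> Bs n \<longrightarrow> word_at n (ret f (Bs n) (ziter f j k)) x j \<in> Ws n (ziter f j k))"

definition X :: "(cant \<times> cant) set" where "X = {(k, x). \<forall>n. admissible n k x}"

lemma sub_word_at: "a + l \<le> L \<Longrightarrow> n \<le> n' \<Longrightarrow> sub n a l (word_at n' L x s) = word_at n l x (s + int a)"
  by (auto simp: sub_def word_at_def algebra_simps)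

lemma ziter_fn: "(f ^^ a) (ziter f j k) = ziter f (j + int a) k"
  using ziter_add[OF bijf, of "int a" j k] by (simp add: ziter_nat add.commute)

lemma block_of:
  obtains s where "ziter f s k \<in> Bs n" "s \<le> j" "j < s + int (ret f (Bs n) (ziter f s k))" "s = j - int (off f (Bs n) (ziter f j k))"
proof -
  define b where "b = off f (Bs n) (ziter f j k)"
  have z: "ziter f (- int b) (ziter f j k) = ziter f (j - int b) k" using ziter_add[OF bijf, of "- int b" j k] by (simp add: algebra_simps)
  have "ziter f (j - int b) k \<in> Bs n" using off_in[OF invs(4), of n "ziter f j k"] z by (simp add: b_def)
  moreover have "b < ret f (Bs n) (ziter f (j - int b) k)" using off_less_ret[OF bijf invs(4), of n "ziter f j k"] z by (simp add: b_def)
  ultimately show ?thesis by (intro that[of "j - int b"]) (auto simp: b_def)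
qed

lemma off_block:
  assumes "ziter f s k \<in> Bs n" "a < ret f (Bs n) (ziter f s k)"
  shows "off f (Bs n) (ziter f (s + int a) k) = a"
  using off_fwd_iff[OF bijf invs(4), of n a "ziter f s k"] assms by (simp add: ziter_fn)

text \<open>An \<open>n\<close>-block lies inside one block of level \<open>n + 1\<close>, and its
  word is an excerpt of the word there.\<close>

lemma admissible_Suc: assumes "admissible (Suc n) k x" shows "admissible n k x"
  unfolding admissible_def
proof (intro allI impI)
  fix j assume j: "ziter f j k \<in> Bs n"
  obtain s where s: "ziter f s k \<in> Bs (Suc n)" "s \<le> j" "j < s + int (ret f (Bs (Suc n)) (ziter f s k))" by (rule block_of)
  define a where "a = nat (j - s)"
  have ja: "j = s + int a" using s by (simp add: a_def)
  have v: "word_at (Suc n) (ret f (Bs (Suc n)) (ziter f s k)) x s \<in> Ws (Suc n) (ziter f s k)" using assms s by (simp add: admissible_def)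
  have fa: "(f ^^ a) (ziter f s k) = ziter f j k" by (simp add: ziter_fn ja)
  have al: "a < ret f (Bs (Suc n)) (ziter f s k)" using s ja by simp
  have "a + ret f (Bs n) (ziter f j k) \<le> ret f (Bs (Suc n)) (ziter f s k)"
    using block_starts(1)[OF invs(4) Bs_Suc invs(4) s(1) al] fa by simp
  then show "word_at n (ret f (Bs n) (ziter f j k)) x j \<in> Ws n (ziter f j k)"
    using Ws_sub[OF s(1) v al] j fa sub_word_at[of a "ret f (Bs n) (ziter f j k)" _ n "Suc n" x s] by (simp add: ja)
qed

lemma admissible_mono: "admissible m k x \<Longrightarrow> n \<le> m \<Longrightarrow> admissible n k x"
  by (induction m) (auto simp: le_Suc_eq dest: admissible_Suc)

text \<open>Words of level \<open>0\<close> carry no bits, so the empty word is the only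
  candidate.\<close>

lemma admissible_0: "admissible 0 k x"
proof -
  have "{} \<in> Ws 0 k'" if "k' \<in> Bs 0" for k' using invs(6)[OF that] invs(7)[OF that] by auto
  then show ?thesis by (simp add: admissible_def word_at_def)
qed

text \<open>Only the blocks meeting the window from \<open>-n\<close> to \<open>n\<close> are
  tested. The condition involves finitely many coordinates of the base point, yet it suffices for
  extension to a point of \<open>X\<close>.\<close>

definition admissible_near :: "nat \<Rightarrow> cant \<Rightarrow> cant \<Rightarrow> bool" where
  "admissible_near n k x \<longleftrightarrow> (\<forall>j. ziter f j k \<in> Bs n \<longrightarrow> {j..<j + int (ret f (Bs n) (ziter f j k))} \<inter> {- int n..int n} \<noteq> {} \<longrightarrow>
      word_at n (ret f (Bs n) (ziter f j k)) x j \<in> Ws n (ziter f j k))"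

text \<open>Blocks of level \<open>n + 1\<close> are filled independently: in each one
  \<open>x\<close> prescribes the positions inside the window, at most \<open>2 * n + 1\<close> of
  them, and \<open>Ws_ext\<close> supplies an admissible word. The bit \<open>n\<close> is
  prescribed too, although level \<open>n\<close> does not constrain it.\<close>

lemma ext1:
  assumes admissible_near: "admissible_near n k x"
  shows "\<exists>x'. admissible (Suc n) k x' \<and> (\<forall>j i. \<bar>j\<bar> \<le> int n \<longrightarrow> i \<le> n \<longrightarrow> bt x' j i = bt x j i)"
proof -
  let ?B = "Bs (Suc n)"
  have "\<exists>v\<in>Ws (Suc n) (ziter f s k). \<forall>a<ret f ?B (ziter f s k). \<bar>s + int a\<bar> \<le> int n \<longrightarrow> (\<forall>i\<le>n. (a, i) \<in> v \<longleftrightarrow> bt x (s + int a) i)"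
    if s: "ziter f s k \<in> ?B" for s
  proof -
    let ?ks = "ziter f s k"
    define A where "A = {a. a < ret f ?B ?ks \<and> \<bar>s + int a\<bar> \<le> int n}"
    have "card A \<le> card {- int n..int n}"
      by (rule card_inj_on_le[of "\<lambda>a. s + int a"]) (auto simp: A_def inj_on_def)
    then have cA: "card A \<le> 2 * n + 1" by simp
    have "\<exists>v\<in>Ws (Suc n) ?ks. \<forall>a\<in>A. \<forall>i\<le>n. (a, i) \<in> v \<longleftrightarrow> (a, i) \<in> {(a, i). bt x (s + int a) i}"
    proof (rule Ws_ext[OF s _ cA])
      show "A \<subseteq> {..<ret f ?B ?ks}" by (auto simp: A_def)
      fix j assume j: "j < ret f ?B ?ks" "(f ^^ j) ?ks \<in> Bs n" "A \<inter> {j..<j + ret f (Bs n) ((f ^^ j) ?ks)} \<noteq> {}"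
      let ?r = "ret f (Bs n) (ziter f (s + int j) k)"
      obtain a where a: "a \<in> A" "j \<le> a" "a < j + ?r" using j(3) by (auto simp: ziter_fn)
      then have "s + int a \<in> {s + int j..<s + int j + int ?r} \<inter> {- int n..int n}" by (auto simp: A_def)
      then have "word_at n ?r x (s + int j) \<in> Ws n (ziter f (s + int j) k)" using admissible_near j(2) unfolding admissible_near_def ziter_fn by blast
      moreover have "sub n j ?r {(a, i). bt x (s + int a) i} = word_at n ?r x (s + int j)" by (auto simp: sub_def word_at_def algebra_simps)
      ultimately show "sub n j (ret f (Bs n) ((f ^^ j) ?ks)) {(a, i). bt x (s + int a) i} \<in> Ws n ((f ^^ j) ?ks)" by (simp add: ziter_fn)
    qed
    then show ?thesis by (auto simp: A_def)
  qed
  then obtain V where V: "\<And>s. ziter f s k \<in> ?B \<Longrightarrow> V s \<in> Ws (Suc n) (ziter f s k)"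
    "\<And>s a i. ziter f s k \<in> ?B \<Longrightarrow> a < ret f ?B (ziter f s k) \<Longrightarrow> \<bar>s + int a\<bar> \<le> int n \<Longrightarrow> i \<le> n \<Longrightarrow> (a, i) \<in> V s \<longleftrightarrow> bt x (s + int a) i"
    by metis
  \<comment> \<open>Gluing: time \<open>j\<close> reads the word of the block that contains it, at
    its height in that block.\<close>
  define x' where "x' = mk (\<lambda>j i. (off f ?B (ziter f j k), i) \<in> V (j - int (off f ?B (ziter f j k))))"
  have x': "bt x' (s + int a) i \<longleftrightarrow> (a, i) \<in> V s" if "ziter f s k \<in> ?B" "a < ret f ?B (ziter f s k)" for s a i
    using off_block[OF that] by (simp add: x'_def)
  have "admissible (Suc n) k x'"
    unfolding admissible_def
  proof (intro allI impI)
    fix s assume s: "ziter f s k \<in> ?B"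
    have "V s \<subseteq> {..<ret f ?B (ziter f s k)} \<times> {..<Suc n}" using V(1)[OF s] invs(7)[OF s] by auto
    then have "word_at (Suc n) (ret f ?B (ziter f s k)) x' s = V s" using x'[OF s] by (auto simp: word_at_def)
    then show "word_at (Suc n) (ret f ?B (ziter f s k)) x' s \<in> Ws (Suc n) (ziter f s k)" using V(1)[OF s] by simp
  qed
  moreover have "bt x' j i = bt x j i" if "\<bar>j\<bar> \<le> int n" "i \<le> n" for j i
  proof -
    obtain s where s: "ziter f s k \<in> ?B" "s \<le> j" "j < s + int (ret f ?B (ziter f s k))" by (rule block_of)
    define a where "a = nat (j - s)"
    have ja: "j = s + int a" using s by (simp add: a_def)
    have "a < ret f ?B (ziter f s k)" using s ja by simp
    then show ?thesis using x'[OF s(1)] V(2)[OF s(1)] that ja by simp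
  qed
  ultimately show ?thesis by blast
qed

lemma admissible_admissible_near: "admissible n k x \<Longrightarrow> admissible_near n k x" by (auto simp: admissible_def admissible_near_def)

text \<open>Iterating \<open>ext1\<close> freezes ever larger windows, so the approximations
  converge; each level of admissibility is a condition on finite blocks and passes to the
  limit.\<close>

lemma extX:
  assumes "admissible_near n k x"
  shows "\<exists>x'. (k, x') \<in> X \<and> (\<forall>j i. \<bar>j\<bar> \<le> int n \<longrightarrow> i \<le> n \<longrightarrow> bt x' j i = bt x j i)"
proof -
  obtain x1 where x1: "admissible (Suc n) k x1" "\<And>j i. \<bar>j\<bar> \<le> int n \<Longrightarrow> i \<le> n \<Longrightarrow> bt x1 j i = bt x j i" using ext1[OF assms] by blast
  have "\<exists>z. \<forall>m. (admissible (Suc n + m) k (z m) \<and> (m = 0 \<longrightarrow> z m = x1)) \<and>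
     (\<forall>j i. \<bar>j\<bar> \<le> int (Suc n + m) \<longrightarrow> i \<le> Suc n + m \<longrightarrow> bt (z (Suc m)) j i = bt (z m) j i)"
  proof (rule dependent_nat_choice[where P="\<lambda>m z. admissible (Suc n + m) k z \<and> (m = 0 \<longrightarrow> z = x1)" and
        Q="\<lambda>m z z'. \<forall>j i. \<bar>j\<bar> \<le> int (Suc n + m) \<longrightarrow> i \<le> Suc n + m \<longrightarrow> bt z' j i = bt z j i"])
    show "\<exists>z. admissible (Suc n + 0) k z \<and> (0 = 0 \<longrightarrow> z = x1)" using x1 by auto
    fix z m assume "admissible (Suc n + m) k z \<and> (m = 0 \<longrightarrow> z = x1)"
    then show "\<exists>z'. (admissible (Suc n + Suc m) k z' \<and> (Suc m = 0 \<longrightarrow> z' = x1)) \<and>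
        (\<forall>j i. \<bar>j\<bar> \<le> int (Suc n + m) \<longrightarrow> i \<le> Suc n + m \<longrightarrow> bt z' j i = bt z j i)"
      using ext1[OF admissible_admissible_near, of "Suc n + m" k z] by auto
  qed
  then obtain z where z: "\<And>m. admissible (Suc n + m) k (z m)" "z 0 = x1"
    "\<And>m j i. \<bar>j\<bar> \<le> int (Suc n + m) \<Longrightarrow> i \<le> Suc n + m \<Longrightarrow> bt (z (Suc m)) j i = bt (z m) j i" by metis
  have zz: "bt (z m') j i = bt (z m) j i" if "\<bar>j\<bar> \<le> int (n + m)" "i \<le> n + m" "m \<le> m'" for m m' j i
    using that(3)
  proof (induction m' rule: dec_induct)
    case (step p)
    then have "bt (z (Suc p)) j i = bt (z p) j i" using that(1,2) by (intro z(3)) auto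
    then show ?case using step by simp
  qed simp
  \<comment> \<open>The bit of index \<open>i\<close> at time \<open>j\<close> no longer changes
    from step \<open>nat \<bar>j\<bar> + i\<close> on.\<close>
  define y where "y = mk (\<lambda>j i. bt (z (nat \<bar>j\<bar> + i)) j i)"
  have y: "bt y j i = bt (z m) j i" if "nat \<bar>j\<bar> + i \<le> m" for j i m
    using zz[of j "nat \<bar>j\<bar> + i" i m] that by (simp add: y_def)
  have "admissible l k y" for l
    unfolding admissible_def
  proof (intro allI impI)
    fix j assume j: "ziter f j k \<in> Bs l"
    let ?r = "ret f (Bs l) (ziter f j k)"
    define m where "m = l + nat \<bar>j\<bar> + ?r + l"
    have "admissible l k (z m)" by (rule admissible_mono[OF z(1)[of m]]) (simp add: m_def)
    then have "word_at l ?r (z m) j \<in> Ws l (ziter f j k)" using j by (simp add: admissible_def)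
    moreover have "word_at l ?r y j = word_at l ?r (z m) j"
      using y[of "j + int _" _ m] by (auto simp: word_at_def m_def)
    ultimately show "word_at l ?r y j \<in> Ws l (ziter f j k)" by simp
  qed
  moreover have "bt y j i = bt x j i" if "\<bar>j\<bar> \<le> int n" "i \<le> n" for j i
    using zz[of j 0 i "nat \<bar>j\<bar> + i"] that z(2) x1(2) by (simp add: y_def)
  ultimately show ?thesis by (auto simp: X_def)
qed

section \<open>Topology of the limit system and its minimality\<close>

lemma X_nonempty: "\<exists>x. (k, x) \<in> X" using extX[OF admissible_admissible_near[OF admissible_0]] by blast

lemma agr_of_window: "(\<forall>j i. \<bar>j\<bar> \<le> int n \<longrightarrow> i \<le> n \<longrightarrow> bt x' j i = bt x j i) \<Longrightarrow> agr n x x'"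
  by (rule agr_btI) auto

lemma dep_ziter: "dep \<psi> \<Longrightarrow> dep (\<lambda>k. \<psi> (ziter f j k))" by (rule dep_compose[OF _ cont_ziter])

lemma dep_level: "dep (\<lambda>k. (k \<in> Bs n, ret f (Bs n) k, Ws n k))"
  by (intro dep_Pair dep_clopen invs dep_ret[OF invs(1,2,4)])

text \<open>The window condition sees \<open>k\<close> through finitely many coordinates only, so
  the same \<open>x\<close> satisfies it over every nearby \<open>k'\<close> and extends to a point
  of \<open>X\<close> there.\<close>

lemma X_fib_open:
  assumes "(k, x) \<in> X" shows "\<exists>N'. \<forall>k'. agr N' k k' \<longrightarrow> (\<exists>x'. (k', x') \<in> X \<and> agr N x x')"
proof -
  let ?n = N
  \<comment> \<open>A block that meets the window starts at most \<open>Rs N\<close> before it, so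
    this finite range of times is enough.\<close>
  have "dep (\<lambda>k. restrict (\<lambda>j. (ziter f j k \<in> Bs ?n, ret f (Bs ?n) (ziter f j k), Ws ?n (ziter f j k))) {- int (?n + Rs ?n)..int ?n})"
    by (intro dep_family dep_ziter[OF dep_level]) simp
  then obtain N' where N': "\<And>k'. agr N' k k' \<Longrightarrow>
      restrict (\<lambda>j. (ziter f j k \<in> Bs ?n, ret f (Bs ?n) (ziter f j k), Ws ?n (ziter f j k))) {- int (?n + Rs ?n)..int ?n}
    = restrict (\<lambda>j. (ziter f j k' \<in> Bs ?n, ret f (Bs ?n) (ziter f j k'), Ws ?n (ziter f j k'))) {- int (?n + Rs ?n)..int ?n}"
    unfolding dep_def by blast
  have "\<exists>x'. (k', x') \<in> X \<and> agr N x x'" if a: "agr N' k k'" for k'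
  proof -
    have "admissible_near ?n k' x"
      unfolding admissible_near_def
    proof (intro allI impI)
      fix j assume j: "ziter f j k' \<in> Bs ?n" "{j..<j + int (ret f (Bs ?n) (ziter f j k'))} \<inter> {- int ?n..int ?n} \<noteq> {}"
      have "ret f (Bs ?n) (ziter f j k') \<le> Rs ?n" using ret_props(3)[OF invs(4)] .
      then have "j \<in> {- int (?n + Rs ?n)..int ?n}" using j(2) by auto
      then have "(ziter f j k \<in> Bs ?n, ret f (Bs ?n) (ziter f j k), Ws ?n (ziter f j k)) = (ziter f j k' \<in> Bs ?n, ret f (Bs ?n) (ziter f j k'), Ws ?n (ziter f j k'))"
        using fun_cong[OF N'[OF a], of j] by simp
      moreover have "admissible ?n k x" using assms by (simp add: X_def)
      ultimately show "word_at ?n (ret f (Bs ?n) (ziter f j k')) x j \<in> Ws ?n (ziter f j k')"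
        using j(1) unfolding admissible_def by (metis prod.inject)
    qed
    then show ?thesis using extX agr_of_window by blast
  qed
  then show ?thesis by blast
qed

text \<open>The bit of index \<open>N\<close> at time \<open>0\<close> is invisible to admissibility
  of level \<open>N\<close>, so both of its values extend to points of \<open>X\<close> agreeing
  with \<open>x\<close> on the indices below \<open>N\<close> in the window.\<close>

lemma X_perfect:
  assumes "(k, x) \<in> X" shows "\<exists>x'. (k, x') \<in> X \<and> agr N x x' \<and> x \<noteq> x'"
proof -
  define xb where "xb b = mk (\<lambda>j i. if j = 0 \<and> i = N then b else bt x j i)" for b
  have "word_at N l (xb b) j = word_at N l x j" for b l j by (auto simp: word_at_def xb_def)
  then have "admissible N k (xb b)" for b using assms by (simp add: X_def admissible_def)
  then have "\<exists>x'. (k, x') \<in> X \<and> (\<forall>j i. \<bar>j\<bar> \<le> int N \<longrightarrow> i \<le> N \<longrightarrow> bt x' j i = bt (xb b) j i)" for b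
    using extX admissible_admissible_near by blast
  then obtain y where y: "\<And>b. (k, y b) \<in> X" "\<And>b j i. \<bar>j\<bar> \<le> int N \<Longrightarrow> i \<le> N \<Longrightarrow> bt (y b) j i = bt (xb b) j i" by metis
  have "agr N x (y b)" for b by (rule agr_btI) (simp add: y(2) xb_def)
  moreover have "bt (y b) 0 N = b" for b using y(2)[of 0 N b] by (simp add: xb_def)
  then have "y (\<not> bt x 0 N) \<noteq> x" by metis
  ultimately show ?thesis using y(1) by metis
qed

text \<open>Failure of membership is witnessed by one block at one level, hence is an open
  condition.\<close>

lemma X_compact: "compact X"
proof -
  have "open (- X)"
  proof (rule open_prod_agrI)
    fix k x assume "(k, x) \<in> - X"
    then obtain n j where j: "ziter f j k \<in> Bs n" "word_at n (ret f (Bs n) (ziter f j k)) x j \<notin> Ws n (ziter f j k)"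
      by (auto simp: X_def admissible_def)
    let ?r = "ret f (Bs n) (ziter f j k)"
    obtain N1 where N1: "\<And>k'. agr N1 k k' \<Longrightarrow> (ziter f j k \<in> Bs n, ret f (Bs n) (ziter f j k), Ws n (ziter f j k)) = (ziter f j k' \<in> Bs n, ret f (Bs n) (ziter f j k'), Ws n (ziter f j k'))"
      using dep_ziter[OF dep_level[of n], of j] unfolding dep_def by blast
    define m where "m = nat \<bar>j\<bar> + ?r + n"
    obtain N2 where N2: "\<And>x x' j i. agr N2 x x' \<Longrightarrow> \<bar>j\<bar> \<le> int m \<Longrightarrow> i \<le> m \<Longrightarrow> bt x j i = bt x' j i" using bt_local[of m] by blast
    have "(k', x') \<notin> X" if "agr (max N1 N2) k k'" "agr (max N1 N2) x x'" for k' x'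
    proof -
      have "word_at n ?r x' j = word_at n ?r x j"
        using N2[OF agr_mono[OF that(2)]] by (auto simp: word_at_def m_def)
      then show ?thesis using j N1[OF agr_mono[OF that(1)]] by (auto simp: X_def admissible_def intro!: exI[of _ n] exI[of _ j])
    qed
    then show "\<exists>N. \<forall>k' x'. agr N k k' \<longrightarrow> agr N x x' \<longrightarrow> (k', x') \<in> - X" by blast
  qed
  then have "closed X" by (simp add: closed_def)
  moreover have "compact (UNIV :: (cant \<times> cant) set)"
    using compact_Times[OF compact_cantor compact_cantor] by simp
  ultimately show ?thesis by (metis compact_Int_closed inf_top_left)
qed

sublocale ft: fibre_tree X
  by unfold_locales (auto intro: X_compact X_perfect X_fib_open X_nonempty)

lemma word_at_shift_by: "word_at n l (shift_by i x) j = word_at n l x (j + i)" by (simp add: word_at_def algebra_simps)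

lemma admissible_shift: "admissible n (ziter f i k) (shift_by i x) \<longleftrightarrow> admissible n k x"
proof -
  have *: "admissible n (ziter f i k) (shift_by i x)" if "admissible n k x" for i k x
    using that unfolding admissible_def word_at_shift_by by (simp add: ziter_add[OF bijf, symmetric])
  have "admissible n k x" if "admissible n (ziter f i k) (shift_by i x)"
    using *[OF that, of "- i"] by (simp add: ziter_add[OF bijf, symmetric] shift_by_shift_by)
  then show ?thesis using * by blast
qed

lemma X_ziter: "ziter g0 j z \<in> X \<longleftrightarrow> z \<in> X"
  by (cases z) (simp add: ziter_g0 X_def admissible_shift)

text \<open>Leaves room to choose a point of a cylinder off any given finite set.\<close>

lemma infinite_cyl: "infinite {k'. agr N k k'}"
proof
  define h where "h n = (\<lambda>i. if i < N then k i else i = n + N)" for n :: nat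
  assume "finite {k'. agr N k k'}"
  then have "finite (range h)" by (rule rev_finite_subset) (auto simp: h_def agr_def)
  moreover have "inj h"
  proof (rule injI)
    fix a b assume "h a = h b"
    then have "h a (a + N) = h b (a + N)" by simp
    then show "a = b" by (simp add: h_def)
  qed
  ultimately show False using finite_imageD by blast
qed

text \<open>The window around time \<open>0\<close> should lie inside one block, which fails at
  every level if the orbit of \<open>k1\<close> meets \<open>x0\<close> within the window. So the
  target is replaced by a nearby point of \<open>X\<close> over a base point without this defect. At
  a high level its window lies in one block, whose word occurs, over the same type, in every word of
  the next level, and in particular along the orbit of \<open>z\<close>.\<close>

lemma X_minimal:
  assumes z: "z \<in> X" and z1: "(k1, x1) \<in> X"
  shows "\<exists>j. agr N k1 (fst (ziter g0 j z)) \<and> agr N x1 (snd (ziter g0 j z))"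
proof -
  obtain k0 y where zy: "z = (k0, y)" by (cases z)
  obtain N' where N': "\<And>k'. agr N' k1 k' \<Longrightarrow> \<exists>x'. (k', x') \<in> X \<and> agr N x1 x'" using X_fib_open[OF z1] by blast
  \<comment> \<open>The base points to avoid are those whose orbit meets \<open>x0\<close> within
    the window, finitely many.\<close>
  have "infinite ({k'. agr (max N N') k1 k'} - (\<lambda>j. ziter f (- j) x0) ` {- int N..int N})"
    using infinite_cyl by (rule Diff_infinite_finite[rotated]) simp
  then obtain k' where k': "agr (max N N') k1 k'" "k' \<notin> (\<lambda>j. ziter f (- j) x0) ` {- int N..int N}"
    by (metis (no_types, lifting) Diff_iff finite.emptyI equals0I mem_Collect_eq)
  obtain x' where x': "(k', x') \<in> X" "agr N x1 x'" using N'[of k'] agr_mono[OF k'(1), of N'] by auto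
  have "\<exists>n. \<not> agr n x0 (ziter f j k')" if "j \<in> {- int N..int N}" for j
  proof (rule ccontr)
    assume "\<not> ?thesis"
    then have "x0 = ziter f j k'" by (intro agr_all_eq) blast
    then have "ziter f (- j) x0 = k'" by (simp add: ziter_add[OF bijf, symmetric])
    then show False using k'(2) that by blast
  qed
  then obtain nj where nj: "\<And>j. j \<in> {- int N..int N} \<Longrightarrow> \<not> agr (nj j) x0 (ziter f j k')" by metis
  \<comment> \<open>From this level on the base is so small around \<open>x0\<close> that the orbit
    of \<open>k'\<close> avoids it throughout the window.\<close>
  define n where "n = Max (insert N (nj ` {- int N..int N}))"
  have n1: "N \<le> n" unfolding n_def by (rule Max_ge) auto
  have n2: "nj j \<le> n" if "j \<in> {- int N..int N}" for j
    unfolding n_def using that by (intro Max_ge) auto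
  note n = n1 n2
  define m where "m = Suc n"
  have notB: "ziter f j k' \<notin> Bs m" if "j \<in> {- int N..int N}" for j
    using Bs_small[of "ziter f j k'" n] nj[OF that] n(2)[OF that] agr_mono unfolding m_def by blast
  obtain s where s: "ziter f s k' \<in> Bs m" "s \<le> - int N" "- int N < s + int (ret f (Bs m) (ziter f s k'))" by (rule block_of)
  define L where "L = ret f (Bs m) (ziter f s k')"
  have "ziter f (s + int L) k' \<in> Bs m" using ret_props(2)[OF invs(4), of m "ziter f s k'"] by (simp add: ziter_fn L_def)
  then have sL: "int N < s + int L" using notB[of "s + int L"] s(3) by (fastforce simp: L_def)
  have w: "word_at m L x' s \<in> Ws m (ziter f s k')" using x'(1) s(1) by (simp add: X_def admissible_def L_def)
  obtain j0 where j0: "ziter f j0 k0 \<in> Bs (Suc m)" by (rule block_of)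
  define k2 where "k2 = ziter f j0 k0"
  define L2 where "L2 = ret f (Bs (Suc m)) k2"
  have v: "word_at (Suc m) L2 y j0 \<in> Ws (Suc m) k2" using z j0 by (simp add: zy X_def admissible_def k2_def L2_def)
  obtain Nm where Nm: "resol m (Bs m) (Rs m) (Ws m) Nm" and
    ct: "\<forall>k\<in>Bs (Suc m). \<forall>v\<in>Ws (Suc m) k. \<forall>k1\<in>Bs m. \<forall>w\<in>Ws m k1. \<exists>j<ret f (Bs (Suc m)) k. (f ^^ j) k \<in> Bs m \<and> agr Nm k1 ((f ^^ j) k) \<and> sub m j (ret f (Bs m) k1) v = w"
    using Ws_freq[of m] by blast
  have "k2 \<in> Bs (Suc m)" using j0 by (simp add: k2_def)
  then obtain j where j: "j < L2" "(f ^^ j) k2 \<in> Bs m" "agr Nm (ziter f s k') ((f ^^ j) k2)" "sub m j L (word_at (Suc m) L2 y j0) = word_at m L x' s"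
    using ct[rule_format, OF \<open>k2 \<in> Bs (Suc m)\<close> v s(1) w] unfolding L2_def L_def by blast
  define t where "t = j0 + int j"
  have ft: "(f ^^ j) k2 = ziter f t k0" by (simp add: k2_def ziter_fn t_def)
  have Leq: "ret f (Bs m) ((f ^^ j) k2) = L" using Nm j(3) unfolding resol_def L_def by metis
  have "j + L \<le> L2" using block_starts(1)[OF invs(4) Bs_Suc invs(4), of k2 m j] j(1) \<open>k2 \<in> Bs (Suc m)\<close> Leq by (simp add: L2_def)
  then have weq: "word_at m L y t = word_at m L x' s" using j(4) sub_word_at[of j L L2 m "Suc m" y j0] by (simp add: t_def)
  define a0 where "a0 = nat (- s)"
  have a0: "int a0 = - s" using s(2) by (simp add: a0_def)
  have "a0 \<le> Rs m" using sL a0 ret_props(3)[OF invs(4), of m "ziter f s k'"] by (simp add: L_def)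
  \<comment> \<open>Equality of types also makes the base points agree along the block, here at the
    position \<open>a0\<close> that corresponds to time \<open>0\<close>.\<close>
  then have "agr m ((f ^^ a0) (ziter f s k')) ((f ^^ a0) (ziter f t k0))" using Nm j(3) ft unfolding resol_def by metis
  then have "agr m k' (ziter f (t - s) k0)" by (simp add: ziter_fn a0)
  then have A: "agr N k1 (ziter f (t - s) k0)"
    using agr_mono[OF k'(1), of N] n(1) by (auto simp: m_def agr_def)
  have "bt x' p i = bt (shift_by (t - s) y) p i" if p: "\<bar>p\<bar> \<le> int N" "i < N" for p i
  proof -
    define a where "a = nat (p - s)"
    have a: "int a = p - s" "a < L" using p s(2) sL by (auto simp: a_def)
    have "(a, i) \<in> word_at m L y t \<longleftrightarrow> (a, i) \<in> word_at m L x' s" using weq by simp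
    then show ?thesis using a p n(1) by (simp add: word_at_def m_def algebra_simps)
  qed
  then have "agr N x' (shift_by (t - s) y)" by (rule agr_btI)
  then have "agr N x1 (shift_by (t - s) y)" using x'(2) agr_trans by blast
  then show ?thesis using A by (intro exI[of _ "t - s"]) (simp add: zy ziter_g0)
qed

end

section \<open>The factor map and unique ergodicity\<close>

text \<open>Second countability makes the Borel sets of \<open>cant\<close> and of
  \<open>cant \<times> cant\<close> accessible coordinate by coordinate.\<close>

instance bool :: second_countable_topology
proof
  show "\<exists>B::bool set set. countable B \<and> open = generate_topology B"
    by (intro exI[of _ "range lessThan \<union> range greaterThan"]) (auto simp: open_bool_def)
qed

definition cyl2 :: "nat \<Rightarrow> cant \<Rightarrow> cant \<Rightarrow> (cant \<times> cant) set" where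
  "cyl2 N k x = {z. agr N k (fst z) \<and> agr N x (snd z)}"

lemma open_cyl2: "open (cyl2 N k x)"
proof -
  have "cyl2 N k x = {k'. agr N k k'} \<times> {x'. agr N x x'}" by (auto simp: cyl2_def)
  then show ?thesis by (simp add: open_Times open_cyl)
qed

text \<open>Cylinders are nested or disjoint; together with the empty set they form a countable
  generator that is stable under intersections.\<close>

lemma measure_eq_cyl2:
  fixes m1 m2 :: "(cant \<times> cant) measure"
  assumes sets: "sets m1 = sets borel" "sets m2 = sets borel" and eq: "\<And>N k x. emeasure m1 (cyl2 N k x) = emeasure m2 (cyl2 N k x)"
    and fin: "emeasure m1 UNIV \<noteq> \<infinity>"
  shows "m1 = m2"
proof -
  define C where "C = insert {} (\<Union>N. range (case_prod (cyl2 N)))"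
  have cC: "cyl2 N k x \<in> C" for N k x by (auto simp: C_def intro!: exI[of _ N] image_eqI[of _ _ "(k, x)"])
  have "finite (range (case_prod (cyl2 N)))" for N
  proof -
    define g where "g = (\<lambda>(t, s). cyl2 N (SOME k. pfx N k = t) (SOME x. pfx N x = s))"
    have "agr N k (SOME k'. pfx N k' = pfx N k)" for k
      using someI[of "\<lambda>k'. pfx N k' = pfx N k" k] pfx_eq_iff by metis
    then have "cyl2 N k x = g (pfx N k, pfx N x)" for k x
      unfolding g_def cyl2_def by (auto intro: agr_trans agr_sym)
    then have "range (case_prod (cyl2 N)) \<subseteq> g ` (range (pfx N) \<times> range (pfx N))" by auto
    then show ?thesis using pfx_finite by (meson finite_SigmaI finite_surj)
  qed
  then have cntC: "countable C" by (auto simp: C_def countable_finite)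
  have "Int_stable C"
  proof (rule Int_stableI)
    fix a b assume "a \<in> C" "b \<in> C"
    have "cyl2 N k x \<inter> cyl2 N' k' x' \<in> C" for N k x N' k' x'
    proof (induction N N' arbitrary: k x k' x' rule: linorder_wlog)
      case (le N N')
      show ?case
      proof (cases "agr N k k' \<and> agr N x x'")
        case True
        then have "cyl2 N k x \<inter> cyl2 N' k' x' = cyl2 N' k' x'"
          unfolding cyl2_def using le by (auto intro: agr_trans agr_mono)
        then show ?thesis using cC by simp
      next
        case False
        then have "cyl2 N k x \<inter> cyl2 N' k' x' = {}"
          unfolding cyl2_def using le by (auto dest!: agr_mono[of N' _ _ N] intro: agr_trans agr_sym)
        then show ?thesis by (simp add: C_def)
      qed
    next
      case (sym N N') then show ?case by (simp add: Int_commute)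
    qed
    moreover have "c = {} \<or> (\<exists>N k x. c = cyl2 N k x)" if "c \<in> C" for c using that by (auto simp: C_def)
    moreover have "{} \<in> C" by (simp add: C_def)
    ultimately show "a \<inter> b \<in> C" using \<open>a \<in> C\<close> \<open>b \<in> C\<close> by (metis inf_bot_left inf_bot_right)
  qed
  moreover have gen: "sets borel = sigma_sets UNIV C"
  proof
    have "open U \<Longrightarrow> U \<in> sigma_sets UNIV C" for U
    proof -
      assume U: "open U"
      have "U = \<Union>{c\<in>C. c \<subseteq> U}"
      proof
        show "U \<subseteq> \<Union>{c\<in>C. c \<subseteq> U}"
        proof
          fix z assume "z \<in> U"
          then obtain N where N: "\<And>k' x'. agr N (fst z) k' \<Longrightarrow> agr N (snd z) x' \<Longrightarrow> (k', x') \<in> U"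
            using open_prod_agr[OF U, of "fst z" "snd z"] by auto
          then have "cyl2 N (fst z) (snd z) \<subseteq> U" by (auto simp: cyl2_def)
          then show "z \<in> \<Union>{c\<in>C. c \<subseteq> U}" using cC by (force simp: cyl2_def)
        qed
      qed auto
      moreover have "\<Union>{c\<in>C. c \<subseteq> U} \<in> sigma_sets UNIV C"
        by (rule sigma_sets_UNION) (use cntC in \<open>auto intro: countable_subset[OF _ cntC]\<close>)
      ultimately show ?thesis by simp
    qed
    then show "sets borel \<subseteq> sigma_sets UNIV C"
      unfolding borel_def by (auto simp: intro!: sigma_sets_mono) 
    show "sigma_sets UNIV C \<subseteq> sets borel"
      by (rule sets.sigma_sets_subset[of C borel, simplified]) (auto simp: C_def open_cyl2)
  qed
  ultimately show ?thesis
  proof (intro measure_eqI_generator_eq[of C, where A="\<lambda>_. UNIV"])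
    show "\<And>A. A \<in> C \<Longrightarrow> emeasure m1 A = emeasure m2 A" using eq by (auto simp: C_def)
    have "UNIV = cyl2 0 undefined undefined" by (auto simp: cyl2_def)
    then have "UNIV \<in> C" using cC by metis
    then show "range (\<lambda>_. UNIV) \<subseteq> C" by auto
    show "sets m1 = sigma_sets UNIV C" "sets m2 = sigma_sets UNIV C" using sets gen by auto
  qed (use fin in auto)
qed

lemma dep_bounded: assumes "dep (\<psi> :: cant \<Rightarrow> real)" shows "\<exists>C. \<forall>k. \<bar>\<psi> k\<bar> \<le> C"
proof -
  obtain N where N: "\<And>k k'. agr N k k' \<Longrightarrow> \<psi> k = \<psi> k'" using assms unfolding dep_def by blast
  have "\<psi> k = \<psi> (SOME k'. pfx N k' = pfx N k)" for k
    by (rule N) (metis (mono_tags, lifting) pfx_eq_iff someI agr_sym)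
  then have "range \<psi> \<subseteq> (\<lambda>t. \<psi> (SOME k'. pfx N k' = t)) ` range (pfx N)" by blast
  then have "finite (range (\<lambda>k. \<bar>\<psi> k\<bar>))" using pfx_finite finite_surj by (metis (no_types) finite_imageI image_image)
  then show ?thesis by (intro exI[of _ "Max (range (\<lambda>k. \<bar>\<psi> k\<bar>))"]) auto
qed

lemma Hausdorff_cantor_prod: "Hausdorff_space (euclidean :: (cant \<times> cant) topology)"
proof -
  have "Hausdorff_space (prod_topology (euclidean :: cant topology) (euclidean :: cant topology))"
    unfolding Hausdorff_space_prod_topology using Hausdorff_cantor by blast
  then show ?thesis unfolding prod_topology_euclidean .
qed

lemma compact_imp_closed_prod: "compact (Z :: (cant \<times> cant) set) \<Longrightarrow> closed Z"
  using compactin_imp_closedin[OF Hausdorff_cantor_prod, of Z] by simp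

context mps begin

lemma emeasure_Tn: "A \<in> sets M \<Longrightarrow> emeasure M ((T ^^ n) -` A \<inter> space M) = emeasure M A"
  using emeasure_distr[OF Tn_meas, of A n] Tn_pres[of n] by simp

text \<open>For negative powers the positive power pulls the preimage back to \<open>A\<close>, and
  that power preserves the measure.\<close>

lemma emeasure_ziter: assumes A: "A \<in> sets M" shows "emeasure M (ziter T j -` A \<inter> space M) = emeasure M A"
proof (cases "0 \<le> j")
  case True
  then show ?thesis using emeasure_Tn[OF A] by (simp add: ziter_def)
next
  case False
  define n where "n = nat (- j)"
  define B where "B = ziter T j -` A \<inter> space M"
  have B: "B \<in> sets M" unfolding B_def using A by (rule measurable_sets[OF ziter_meas])
  have "ziter T j ((T ^^ n) y) = y" for y
    using ziter_add[OF bijT, of j "int n" y] False by (simp add: n_def ziter_nat[symmetric])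
  then have "(T ^^ n) -` B \<inter> space M = A"
    using sets.sets_into_space[OF A] measurable_space[OF Tn_meas] by (auto simp: B_def)
  then show ?thesis using emeasure_Tn[OF B, of n] by (simp add: B_def)
qed

end

section \<open>Convergence of the names\<close>

context tow begin

definition changed :: "nat \<Rightarrow> 'a set" where "changed n = {y\<in>space M. \<exists>i\<le>n. qs (Suc n) y i \<noteq> qs n y i}"

lemma q_sets: "{y\<in>space M. qs n y i} \<in> sets M" using invs(8) by (simp add: bits_meas_def)

lemma changed_sets [measurable]: "changed n \<in> sets M"
proof -
  note q_sets[measurable]
  have "changed n = (\<Union>i\<in>{..n}. ({y\<in>space M. qs (Suc n) y i} - {y\<in>space M. qs n y i}) \<union> ({y\<in>space M. qs n y i} - {y\<in>space M. qs (Suc n) y i}))"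
    by (auto simp: changed_def)
  also have "\<dots> \<in> sets M" by measurable
  finally show ?thesis .
qed

lemma changed_measure: "measure M (changed n) \<le> (1/2) ^ n"
  and q_high: "i > n \<Longrightarrow> qs (Suc n) y i = qs n y i"
  using STEPs[of n] unfolding STEP_def changed_def by blast+

lemma q_stable: "y \<in> space M \<Longrightarrow> y \<notin> changed n \<Longrightarrow> qs (Suc n) y = qs n y"
  using q_high[of n] by (auto simp: changed_def fun_eq_iff) (metis linorder_not_le)+

text \<open>Names are required to stabilise along the whole orbit, so that the set is
  invariant.\<close>

definition Y0 :: "'a set" where "Y0 = {y\<in>space M. \<forall>j::int. \<exists>m. \<forall>n. m \<le> n \<longrightarrow> ziter T j y \<notin> changed n}"

lemma Y0_sets [measurable]: "Y0 \<in> sets M" unfolding Y0_def by measurable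

text \<open>Borel-Cantelli at time \<open>0\<close>, carried to the countably many other times by
  invariance of the measure.\<close>

lemma Y0_AE: "AE y in M. y \<in> Y0"
proof -
  have "AE y in M. eventually (\<lambda>n. y \<in> space M - changed n) sequentially"
  proof (rule borel_cantelli_AE1)
    show "summable (\<lambda>n. measure M (changed n))"
      by (rule summable_comparison_test'[of "\<lambda>n. (1/2::real) ^ n"]) (use changed_measure in \<open>auto intro: summable_geometric\<close>)
  qed (auto simp: emeasure_eq_measure)
  then have 1: "AE y in M. \<exists>m. \<forall>n. m \<le> n \<longrightarrow> y \<notin> changed n"
    by eventually_elim (auto simp: eventually_sequentially)
  define A where "A = {y\<in>space M. \<not> (\<exists>m. \<forall>n. m \<le> n \<longrightarrow> y \<notin> changed n)}"
  have A: "A \<in> sets M" unfolding A_def by measurable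
  have A0: "emeasure M A = 0" using 1 by (subst (asm) AE_iff_measurable[OF A]) (auto simp: A_def)
  have "AE y in M. \<exists>m. \<forall>n. m \<le> n \<longrightarrow> ziter T j y \<notin> changed n" for j
  proof (rule AE_I[of _ _ "ziter T j -` A \<inter> space M"])
    show "emeasure M (ziter T j -` A \<inter> space M) = 0" using emeasure_ziter[OF A] A0 by simp
    show "ziter T j -` A \<inter> space M \<in> sets M" using A by (rule measurable_sets[OF ziter_meas])
    show "{x \<in> space M. \<not> (\<exists>m. \<forall>n\<ge>m. ziter T j x \<notin> changed n)} \<subseteq> ziter T j -` A \<inter> space M"
      using ziter_space by (auto simp: A_def)
  qed
  then have "AE y in M. \<forall>j::int. \<exists>m. \<forall>n. m \<le> n \<longrightarrow> ziter T j y \<notin> changed n" by (subst AE_all_countable) simp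
  then show ?thesis using AE_space by eventually_elim (simp add: Y0_def)
qed

lemma Y0_ziter: "y \<in> Y0 \<Longrightarrow> ziter T j y \<in> Y0"
  unfolding Y0_def by (auto simp: ziter_space ziter_add[OF bijT, symmetric])

lemma Y0_space: "y \<in> Y0 \<Longrightarrow> y \<in> space M" by (simp add: Y0_def)

lemma Y0_image: "T ` Y0 = Y0"
proof
  show "T ` Y0 \<subseteq> Y0" using Y0_ziter[of _ 1] by (auto simp: ziter_def)
  show "Y0 \<subseteq> T ` Y0"
  proof
    fix y assume "y \<in> Y0"
    then have "ziter T (- 1) y \<in> Y0" "T (ziter T (- 1) y) = y"
      using Y0_ziter ziter_Suc[OF bijT, of "- 1" y] by auto
    then show "y \<in> T ` Y0" by (metis imageI)
  qed
qed

lemma Y0_ev: "y \<in> Y0 \<Longrightarrow> \<exists>m. \<forall>n\<ge>m. y \<notin> changed n"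
proof -
  assume "y \<in> Y0"
  then have "\<exists>m. \<forall>n. m \<le> n \<longrightarrow> ziter T 0 y \<notin> changed n" unfolding Y0_def by blast
  then show ?thesis by simp
qed

text \<open>Eventual truth is defined and measurable without any convergence; on \<open>Y0\<close>
  the sequence is eventually constant, so this is its limit.\<close>

definition q_lim :: "'a \<Rightarrow> nat \<Rightarrow> bool" where "q_lim y i \<longleftrightarrow> (\<exists>m. \<forall>n. m \<le> n \<longrightarrow> qs n y i)"

definition itinerary :: "('a \<Rightarrow> nat \<Rightarrow> bool) \<Rightarrow> 'a \<Rightarrow> cant" where "itinerary q y = mk (\<lambda>j i. q (ziter T j y) i)"

definition \<Phi> :: "'a \<Rightarrow> cant \<times> cant" where "\<Phi> y = (P y, itinerary q_lim y)"

lemma q_lim_eventually: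
  assumes "y \<in> Y0" shows "\<exists>m. \<forall>n\<ge>m. qs n y = q_lim y"
proof -
  obtain m where m: "\<And>n. m \<le> n \<Longrightarrow> y \<notin> changed n" using Y0_ev[OF assms] by blast
  have c: "qs n y = qs m y" if "m \<le> n" for n
    using that by (induction n rule: dec_induct) (use m q_stable[OF Y0_space[OF assms]] in auto)
  have "q_lim y i = qs m y i" for i
    unfolding q_lim_def using c by (metis le_cases order_trans)
  then have qm: "q_lim y = qs m y" by (rule ext)
  have "qs n y = q_lim y" if "m \<le> n" for n
    unfolding qm using that by (rule c)
  then show ?thesis by blast
qed

lemma word_at_itinerary:
  "word_at n l (itinerary q y) j = word n l q (ziter T j y)"
proof -
  have "ziter T (j + int a) y = (T ^^ a) (ziter T j y)" for a
    using ziter_add[OF bijT, of "int a" j y] by (simp add: ziter_nat add.commute)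
  then show ?thesis by (simp add: word_at_def word_def itinerary_def)
qed

lemma admissible_qs: "y \<in> space M \<Longrightarrow> admissible m (P y) (itinerary (qs m) y)"
  unfolding admissible_def word_at_itinerary using invs(9)[of "ziter T _ y" m] by (auto simp: P_ziter ziter_space)

text \<open>A block is finite, so on it the limit name coincides with the name at a late stage
  \<open>M0 \<ge> n\<close>; that one is admissible at level \<open>M0\<close>, hence at level
  \<open>n\<close>.\<close>

lemma \<Phi>_X:
  assumes y: "y \<in> Y0" shows "\<Phi> y \<in> X"
proof -
  have "admissible n (P y) (itinerary q_lim y)" for n
    unfolding admissible_def
  proof (intro allI impI)
    fix j assume j: "ziter f j (P y) \<in> Bs n"
    let ?r = "ret f (Bs n) (ziter f j (P y))"
    have "\<forall>a. \<exists>m. \<forall>n\<ge>m. qs n ((T ^^ a) (ziter T j y)) = q_lim ((T ^^ a) (ziter T j y))"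
      using q_lim_eventually Y0_ziter[OF Y0_ziter[OF y]] by (metis ziter_nat)
    then obtain m where m: "\<And>a n. m a \<le> n \<Longrightarrow> qs n ((T ^^ a) (ziter T j y)) = q_lim ((T ^^ a) (ziter T j y))" by metis
    define M0 where "M0 = n + Max (insert 0 (m ` {..<?r}))"
    have "m a \<le> M0" if "a < ?r" for a
    proof -
      have "m a \<le> Max (insert 0 (m ` {..<?r}))" using that by (intro Max_ge) auto
      then show ?thesis by (simp add: M0_def)
    qed
    then have "word n ?r q_lim (ziter T j y) = word n ?r (qs M0) (ziter T j y)" using m by (auto simp: word_def)
    moreover have "admissible n (P y) (itinerary (qs M0) y)" by (rule admissible_mono[OF admissible_qs[OF Y0_space[OF y]]]) (simp add: M0_def)
    ultimately show "word_at n ?r (itinerary q_lim y) j \<in> Ws n (ziter f j (P y))" using j by (simp add: admissible_def word_at_itinerary)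
  qed
  then show ?thesis by (simp add: X_def \<Phi>_def)
qed

lemma \<Phi>_T: "y \<in> space M \<Longrightarrow> \<Phi> (T y) = g0 (\<Phi> y)"
proof -
  assume y: "y \<in> space M"
  have "ziter T j (T y) = ziter T (j + 1) y" for j using ziter_add[OF bijT, of j 1 y] by (simp add: ziter_def)
  then have "itinerary q_lim (T y) = shift_by 1 (itinerary q_lim y)" by (intro bt_ext) (simp add: itinerary_def)
  then show ?thesis using y by (simp add: \<Phi>_def g0_apply P_equi)
qed

text \<open>Bit \<open>i\<close> keeps its initial value up to stage \<open>i\<close>, since stage
  \<open>n\<close> leaves the bits above \<open>n\<close> alone; if \<open>i \<ge> m\<close> and the
  point is untouched from stage \<open>m\<close> on, it keeps this value afterwards too.\<close>

lemma q_lim_E: assumes "y \<in> Y0" shows "\<exists>m. \<forall>i\<ge>m. q_lim y i \<longleftrightarrow> y \<in> E i"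
proof -
  obtain m where m: "\<And>n. m \<le> n \<Longrightarrow> y \<notin> changed n" using Y0_ev[OF assms] by blast
  obtain m' where m': "\<And>n. m' \<le> n \<Longrightarrow> qs n y = q_lim y" using q_lim_eventually[OF assms] by blast
  have "q_lim y i \<longleftrightarrow> y \<in> E i" if i: "m \<le> i" for i
  proof -
    have lo: "qs n y i = qs 0 y i" if "n \<le> i" for n
      using that by (induction n) (simp_all add: q_high)
    have hi: "qs n y i = qs i y i" if "i \<le> n" for n
      using that
    proof (induction n rule: dec_induct)
      case (step n)
      then show ?case using q_stable[OF Y0_space[OF assms] m[of n]] i by simp
    qed simp
    have "qs (max i m') y i = qs 0 y i" by (rule trans[OF hi lo]) simp_all
    then show ?thesis using m' q0 by simp
  qed
  then show ?thesis by blast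
qed

text \<open>Equal codes give equal limit bits at time \<open>0\<close>; from some index on these are
  membership in the sets \<open>E i\<close>, which separate points arbitrarily far out.\<close>

lemma \<Phi>_inj: "inj_on \<Phi> Y0"
proof (rule inj_onI, rule ccontr)
  fix y y' assume y: "y \<in> Y0" "y' \<in> Y0" "\<Phi> y = \<Phi> y'" "y \<noteq> y'"
  have "bt (itinerary q_lim y) 0 i = bt (itinerary q_lim y') 0 i" for i using y(3) by (simp add: \<Phi>_def)
  then have "q_lim y = q_lim y'" by (simp add: itinerary_def fun_eq_iff)
  moreover obtain m where "\<And>i. m \<le> i \<Longrightarrow> q_lim y i \<longleftrightarrow> y \<in> E i" using q_lim_E[OF y(1)] by blast
  moreover obtain m' where "\<And>i. m' \<le> i \<Longrightarrow> q_lim y' i \<longleftrightarrow> y' \<in> E i" using q_lim_E[OF y(2)] by blast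
  moreover obtain i where "max m m' \<le> i" "(y \<in> E i) \<noteq> (y' \<in> E i)" using sep[of y y'] y Y0_space by blast
  ultimately show False by (metis max.boundedE)
qed

lemma \<Phi>_meas [measurable]: "\<Phi> \<in> borel_measurable M"
proof -
  note q_sets[measurable]
  have 1: "{y\<in>space M. q_lim y i} \<in> sets M" for i unfolding q_lim_def by measurable
  have "(\<lambda>y. q_lim (ziter T j y) i) \<in> borel_measurable M" for j i
  proof (rule measurableI)
    fix A :: "bool set"
    have "{y\<in>space M. q_lim y i} \<in> sets M" "{y\<in>space M. \<not> q_lim y i} \<in> sets M" using 1 by (auto intro: sets.sets_Collect_neg)
    then have "{y\<in>space M. q_lim y i = b} \<in> sets M" for b by (cases b) auto
    then have "ziter T j -` {y\<in>space M. q_lim y i = b} \<inter> space M \<in> sets M" for b by (rule measurable_sets[OF ziter_meas])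
    then have "(\<Union>b\<in>A. ziter T j -` {y\<in>space M. q_lim y i = b} \<inter> space M) \<in> sets M" by (intro sets.finite_UN) auto
    also have "(\<Union>b\<in>A. ziter T j -` {y\<in>space M. q_lim y i = b} \<inter> space M) = (\<lambda>y. q_lim (ziter T j y) i) -` A \<inter> space M"
      using ziter_space by auto
    finally show "(\<lambda>y. q_lim (ziter T j y) i) -` A \<inter> space M \<in> sets M" .
  qed simp
  then have "itinerary q_lim \<in> borel_measurable M"
    by (intro measurable_coordinatewise_then_product) (simp add: itinerary_def mk_def)
  then have "(\<lambda>y. (P y, itinerary q_lim y)) \<in> borel_measurable M" by (intro borel_measurable_Pair P_meas)
  then show ?thesis by (simp add: \<Phi>_def[abs_def])
qed

text \<open>The point is that \<open>c\<close> is chosen before \<open>m\<close> and depends on it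
  only through the projection \<open>\<mu>\<close>. Visits to the cylinder are counted block by
  block: the ends cost \<open>2 * V0\<close> for each block of level \<open>n\<close>, whose length
  is at least \<open>n\<close>, and along a block of level \<open>n + 1\<close> the counts may be
  replaced by \<open>\<tau>\<close>-averages, functions of the base alone, at cost
  \<open>(1/2) ^ n\<close>.\<close>

lemma cyl_estimate:
  fixes \<mu> :: "cant measure"
  assumes V0: "V0 \<le> n" and n: "0 < n"
  shows "\<exists>c. \<forall>m::(cant \<times> cant) measure. ext f m g0 fst \<longrightarrow> sets m = sets (restrict_space borel X) \<longrightarrow> distr m borel fst = \<mu> \<longrightarrow>
    \<bar>measure m (cyl2 V0 ka xa \<inter> X) - c\<bar> \<le> (1/2) ^ n + 2 * real V0 / n"
proof -
  let ?B = "Bs n" and ?B' = "Bs (Suc n)"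
  obtain N \<tau> where N: "resol n ?B (Rs n) (Ws n) N" and fr: "FREQ n ((1/2) ^ n) ?B (Rs n) (Ws n) ?B' (Ws (Suc n)) N \<tau>"
    using Ws_freq[of n] by blast
  have Nd: "agr N k k' \<Longrightarrow> k \<in> ?B \<longleftrightarrow> k' \<in> ?B" "agr N k k' \<Longrightarrow> Ws n k = Ws n k'" "agr N k k' \<Longrightarrow> ret f ?B k = ret f ?B k'"
    "agr N k k' \<Longrightarrow> a \<le> Rs n \<Longrightarrow> agr n ((f ^^ a) k) ((f ^^ a) k')" for k k' a
    using N unfolding resol_def by blast+
  have retR: "ret f ?B k \<le> Rs n" for k using ret_props(3)[OF invs(4)] .
  define pj where "pj p = int_decode (fst (prod_decode p))" for p
  define pi where "pi p = snd (prod_decode p)" for p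
  have pb: "\<bar>pj p\<bar> \<le> int V0" "pi p < V0" if "p < V0" for p using decode_bound[OF that] by (auto simp: pj_def pi_def)
  \<comment> \<open>Counts visits to the cylinder inside a block, as read from its word. Margins of
    width \<open>V0\<close> are dropped so that the window of every counted time stays inside the
    block.\<close>
  define \<theta>1 where "\<theta>1 k w = (\<Sum>a\<in>{V0..<ret f ?B k - V0}. of_bool (agr V0 ka ((f ^^ a) k) \<and>
     (\<forall>p<V0. (nat (int a + pj p), pi p) \<in> w \<longleftrightarrow> xa p)) :: real)" for k and w :: "(nat \<times> nat) set"
  have \<theta>1_dep: "\<theta>1 k = \<theta>1 k'" if kk: "agr N k k'" for k k'
  proof
    fix w
    have "agr V0 ka ((f ^^ a) k) \<longleftrightarrow> agr V0 ka ((f ^^ a) k')" if "a < ret f ?B k" for a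
    proof -
      have "a \<le> Rs n" using that retR[of k] by simp
      then have "agr V0 ((f ^^ a) k) ((f ^^ a) k')" using Nd(4)[OF kk] agr_mono V0 by blast
      then show ?thesis using agr_trans agr_sym by blast
    qed
    then show "\<theta>1 k w = \<theta>1 k' w" unfolding \<theta>1_def using Nd(3)[OF kk] by (intro sum.cong) auto
  qed
  have \<theta>1_bound: "\<bar>\<theta>1 k w\<bar> \<le> Rs n" for k w
  proof -
    have "\<bar>\<theta>1 k w\<bar> \<le> (\<Sum>a\<in>{V0..<ret f ?B k - V0}. 1)"
      unfolding \<theta>1_def by (rule order_trans[OF sum_abs sum_mono]) auto
    then show ?thesis using retR[of k] by simp
  qed
  define \<theta> where "\<theta> t w = \<theta>1 (SOME k. pfx N k = t) w" for t w
  have \<theta>_eq: "\<theta> (pfx N k) w = \<theta>1 k w" for k w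
  proof -
    have "pfx N (SOME k'. pfx N k' = pfx N k) = pfx N k" by (rule someI[of _ k]) simp
    then show ?thesis unfolding \<theta>_def using \<theta>1_dep pfx_eq_iff by metis
  qed
  \<comment> \<open>The expected count given the type, a function of the base point alone.\<close>
  define \<Psi> where "\<Psi> k = (if k \<in> ?B then \<Sum>w\<in>Ws n k. \<tau> (pfx N k) w * \<theta> (pfx N k) w else 0)" for k
  have \<Psi>_dep: "dep \<Psi>"
    unfolding dep_def
  proof (intro exI[of _ N] allI impI)
    fix k k' assume kk: "agr N k k'"
    then have "pfx N k = pfx N k'" by (simp add: pfx_eq_iff)
    then show "\<Psi> k = \<Psi> k'" using Nd(1,2)[OF kk] by (simp add: \<Psi>_def)
  qed
  obtain K where K: "\<And>k. \<bar>\<Psi> k\<bar> \<le> K" using dep_bounded[OF \<Psi>_dep] by blast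
  define \<phi> where "\<phi> = indicat_real (cyl2 V0 ka xa)"
  have \<phi>m: "\<phi> \<in> borel_measurable borel" unfolding \<phi>_def by (simp add: open_cyl2)
  define \<Theta> where "\<Theta> z = (if fst z \<in> ?B then \<theta>1 (fst z) (word_at n (ret f ?B (fst z)) (snd z) 0) else 0)" for z
  obtain N2 where N2: "\<And>x x' j i. agr N2 x x' \<Longrightarrow> \<bar>j\<bar> \<le> int (Rs n + n) \<Longrightarrow> i \<le> Rs n + n \<Longrightarrow> bt x j i = bt x' j i"
    using bt_local[of "Rs n + n"] by blast
  have \<Theta>m: "\<Theta> \<in> borel_measurable borel"
  proof (rule measurable_loc_const)
    fix k x k' x' assume a: "agr (max N N2) k k'" "agr (max N N2) x x'"
    have kk: "agr N k k'" and xx: "agr N2 x x'" using agr_mono[OF a(1), of N] agr_mono[OF a(2), of N2] by auto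
    have "word_at n (ret f ?B k) x 0 = word_at n (ret f ?B k) x' 0" using N2[OF xx] retR[of k] by (auto simp: word_at_def)
    then show "\<Theta> (k, x) = \<Theta> (k', x')" using Nd(1,3)[OF kk] \<theta>1_dep[OF kk] by (simp add: \<Theta>_def)
  qed
  have \<Theta>b: "\<bar>\<Theta> z\<bar> \<le> Rs n" for z using \<theta>1_bound by (simp add: \<Theta>_def)
  define c where "c = (\<integral>k. \<Psi> k \<partial>\<mu>)"
  have "\<bar>measure m (cyl2 V0 ka xa \<inter> X) - c\<bar> \<le> (1/2) ^ n + 2 * real V0 / n"
    if ex: "ext f m g0 fst" and sm: "sets m = sets (restrict_space borel X)" and dm: "distr m borel fst = \<mu>" for m :: "(cant \<times> cant) measure"
  proof -
    interpret m: ext f m g0 fst by (rule ex)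
    have spm: "space m = X" using sets_eq_imp_space_eq[OF sm] by (simp add: space_restrict_space)
    have bm: "g \<in> borel_measurable m" if "g \<in> borel_measurable borel" for g :: "cant \<times> cant \<Rightarrow> real"
      using measurable_restrict_space1[OF that] measurable_cong_sets[OF sm refl] by blast
    have Bm: "?B \<in> sets borel" "?B' \<in> sets borel" using invs(1) by auto
    have \<phi>m': "\<phi> \<in> borel_measurable m" and \<Theta>m': "\<Theta> \<in> borel_measurable m" by (rule bm[OF \<phi>m], rule bm[OF \<Theta>m])
    have \<phi>b: "\<bar>\<phi> z\<bar> \<le> 1" for z by (simp add: \<phi>_def indicator_def)
    have \<Psi>m: "\<Psi> \<in> borel_measurable borel"
    proof (rule measurableI)
      fix A :: "real set"
      have "open {k. \<Psi> k \<in> A}" using \<Psi>_dep by (rule dep_open)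
      then show "\<Psi> -` A \<inter> space borel \<in> sets borel" by (simp add: vimage_def)
    qed simp
    have \<Psi>m': "(\<lambda>z. \<Psi> (fst z)) \<in> borel_measurable m" using m.P_meas \<Psi>m by (rule measurable_compose)
    have \<Psi>b: "\<bar>\<Psi> (fst z)\<bar> \<le> K" for z :: "cant \<times> cant" using K .
    \<comment> \<open>The two counts differ only at times within \<open>V0\<close> of an end of the
      block.\<close>
    have claim1: "\<bar>m.rsum ?B \<phi> z - \<Theta> z\<bar> \<le> 2 * real V0 * indicat_real {z\<in>space m. fst z \<in> ?B} z" if z: "z \<in> space m" for z
    proof (cases "fst z \<in> ?B")
      case True
      obtain k x where kx: "z = (k, x)" by (cases z)
      define L where "L = ret f ?B k"
      define h where "h a = (of_bool (agr V0 ka ((f ^^ a) k) \<and> (\<forall>p<V0. bt x (int a + pj p) (pi p) \<longleftrightarrow> xa p)) :: real)" for a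
      have xap: "bt xa (pj p) (pi p) = xa p" for p by (simp add: bt_def pj_def pi_def)
      have "agr V0 xa (shift_by (int a) x) \<longleftrightarrow> (\<forall>p<V0. bt xa (pj p) (pi p) = bt (shift_by (int a) x) (pj p) (pi p))" for a
        unfolding pj_def pi_def by (rule agr_bt)
      then have "agr V0 xa (shift_by (int a) x) \<longleftrightarrow> (\<forall>p<V0. bt x (int a + pj p) (pi p) \<longleftrightarrow> xa p)" for a
        unfolding xap bt_shift_by by (simp only: add.commute eq_commute)
      then have "\<phi> ((g0 ^^ a) z) = h a" for a
        unfolding kx g0_pow \<phi>_def h_def by (simp add: cyl2_def indicator_def)
      then have "m.rsum ?B \<phi> z = (\<Sum>a<L. h a)" using True by (simp add: m.rsum_def kx L_def)
      moreover have "\<Theta> z = (\<Sum>a\<in>{V0..<L - V0}. h a)"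
      proof -
        have "(nat (int a + pj p), pi p) \<in> word_at n L x 0 \<longleftrightarrow> bt x (int a + pj p) (pi p)" if "a \<in> {V0..<L - V0}" "p < V0" for a p
        proof -
          have "0 \<le> int a + pj p" "int a + pj p < int L" using that pb(1)[OF that(2)] by auto
          then show ?thesis using pb(2)[OF that(2)] V0 by (simp add: word_at_def nat_less_iff)
        qed
        then show ?thesis using True unfolding \<Theta>_def \<theta>1_def h_def kx L_def[symmetric]
          by (auto simp: L_def[symmetric] intro!: sum.cong)
      qed
      moreover have "(\<Sum>a<L. h a) - (\<Sum>a\<in>{V0..<L - V0}. h a) = (\<Sum>a\<in>{..<L} - {V0..<L - V0}. h a)"
        by (subst sum_diff) auto
      moreover have "\<bar>\<Sum>a\<in>{..<L} - {V0..<L - V0}. h a\<bar> \<le> (\<Sum>a\<in>{..<L} - {V0..<L - V0}. 1)"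
        by (rule order_trans[OF sum_abs sum_mono]) (simp add: h_def)
      moreover have "card ({..<L} - {V0..<L - V0}) \<le> 2 * V0"
      proof -
        have "{..<L} - {V0..<L - V0} \<subseteq> {..<V0} \<union> {L - V0..<L}" by auto
        then have "card ({..<L} - {V0..<L - V0}) \<le> card ({..<V0} \<union> {L - V0..<L})" by (intro card_mono) auto
        also have "\<dots> \<le> card {..<V0} + card {L - V0..<L}" by (rule card_Un_le)
        finally show ?thesis by simp
      qed
      ultimately have "\<bar>m.rsum ?B \<phi> z - \<Theta> z\<bar> \<le> real (2 * V0)" by simp
      then show ?thesis using True z by simp
    qed (simp add: m.rsum_def \<Theta>_def)
    have ir: "integrable m (m.rsum ?B \<phi>)"
      by (rule m.bounded_integrable[OF m.rsum_meas[OF invs(4) Bm(1) \<phi>m'] m.rsum_bound[OF invs(4) \<phi>b]])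
    have i\<Theta>: "integrable m \<Theta>" by (rule m.bounded_integrable[OF \<Theta>m' \<Theta>b])
    have sB: "{z\<in>space m. fst z \<in> ?B} \<in> sets m" using m.P_meas Bm(1) by measurable
    have iB: "integrable m (indicat_real {z\<in>space m. fst z \<in> ?B})"
      using sB by (intro m.bounded_integrable[of _ 1]) (auto simp: indicator_def)
    have "measure m (cyl2 V0 ka xa \<inter> X) = (\<integral>z. \<phi> z \<partial>m)"
      by (simp add: \<phi>_def spm Int_commute)
    also have "\<dots> = (\<integral>z. m.rsum ?B \<phi> z \<partial>m)" by (rule m.tower[OF invs(4) Bm(1) \<phi>m' \<phi>b])
    finally have "measure m (cyl2 V0 ka xa \<inter> X) - (\<integral>z. \<Theta> z \<partial>m) = (\<integral>z. m.rsum ?B \<phi> z - \<Theta> z \<partial>m)"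
      using ir i\<Theta> by simp
    then have "\<bar>measure m (cyl2 V0 ka xa \<inter> X) - (\<integral>z. \<Theta> z \<partial>m)\<bar> = \<bar>\<integral>z. m.rsum ?B \<phi> z - \<Theta> z \<partial>m\<bar>" by simp
    also have "\<dots> \<le> (\<integral>z. \<bar>m.rsum ?B \<phi> z - \<Theta> z\<bar> \<partial>m)" by (rule integral_abs_bound)
    also have "\<dots> \<le> (\<integral>z. 2 * real V0 * indicat_real {z\<in>space m. fst z \<in> ?B} z \<partial>m)"
      using ir i\<Theta> iB claim1 by (intro integral_mono) auto
    also have "\<dots> = 2 * real V0 * measure m {z\<in>space m. fst z \<in> ?B}" using sB by simp
    also have "\<dots> \<le> 2 * real V0 * (1 / n)"
    proof (intro mult_left_mono m.base_measure[OF invs(1) invs(4) _ n])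
      fix k assume "k \<in> ?B"
      moreover obtain n' where "n = Suc n'" using n by (cases n) auto
      ultimately show "n \<le> ret f ?B k" using Bs_small[of k n'] by auto
    qed simp
    finally have e1: "\<bar>measure m (cyl2 V0 ka xa \<inter> X) - (\<integral>z. \<Theta> z \<partial>m)\<bar> \<le> 2 * real V0 / n" by simp
    \<comment> \<open>The frequency condition, applied to the word of the column over the next
      base.\<close>
    have claim2: "\<bar>m.rsum ?B' \<Theta> z - m.rsum ?B' (\<lambda>z. \<Psi> (fst z)) z\<bar> \<le> (1/2) ^ n * m.rsum ?B' (\<lambda>_. 1) z" if z: "z \<in> space m" for z
    proof (cases "fst z \<in> ?B'")
      case True
      obtain k x where kx: "z = (k, x)" by (cases z)
      define L where "L = ret f ?B' k"
      define S where "S = {j. j < L \<and> (f ^^ j) k \<in> ?B}"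
      define v where "v = word_at (Suc n) L x 0"
      have k: "k \<in> ?B'" using True kx by simp
      have "admissible (Suc n) k x" using z spm kx by (simp add: X_def)
      then have v: "v \<in> Ws (Suc n) k" using k by (auto simp: admissible_def v_def L_def dest: spec[of _ 0])
      have \<Theta>j: "\<Theta> ((g0 ^^ j) z) = (if (f ^^ j) k \<in> ?B then \<theta> (pfx N ((f ^^ j) k)) (sub n j (ret f ?B ((f ^^ j) k)) v) else 0)" if "j < L" for j
      proof -
        have "j + ret f ?B ((f ^^ j) k) \<le> L"
          using block_starts(1)[OF invs(4) Bs_Suc invs(4) k, of j] that by (simp add: L_def)
        then have "sub n j (ret f ?B ((f ^^ j) k)) v = word_at n (ret f ?B ((f ^^ j) k)) x (int j)"
          unfolding v_def by (subst sub_word_at) auto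
        then show ?thesis unfolding kx g0_pow by (simp add: \<Theta>_def \<theta>_eq word_at_shift_by)
      qed
      have "m.rsum ?B' \<Theta> z = (\<Sum>j<L. \<Theta> ((g0 ^^ j) z))" using True by (simp add: m.rsum_def kx L_def)
      also have "\<dots> = (\<Sum>j\<in>S. \<theta> (pfx N ((f ^^ j) k)) (sub n j (ret f ?B ((f ^^ j) k)) v))"
        by (rule sum.mono_neutral_cong_right) (auto simp: S_def \<Theta>j)
      finally have A: "m.rsum ?B' \<Theta> z = (\<Sum>j\<in>S. \<theta> (pfx N ((f ^^ j) k)) (sub n j (ret f ?B ((f ^^ j) k)) v))" .
      have "m.rsum ?B' (\<lambda>z. \<Psi> (fst z)) z = (\<Sum>j<L. \<Psi> ((f ^^ j) k))" using True by (simp add: m.rsum_def kx L_def g0_pow)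
      also have "\<dots> = (\<Sum>j\<in>S. \<Sum>w\<in>Ws n ((f ^^ j) k). \<tau> (pfx N ((f ^^ j) k)) w * \<theta> (pfx N ((f ^^ j) k)) w)"
        by (rule sum.mono_neutral_cong_right) (auto simp: S_def \<Psi>_def)
      finally have B: "m.rsum ?B' (\<lambda>z. \<Psi> (fst z)) z = (\<Sum>j\<in>S. \<Sum>w\<in>Ws n ((f ^^ j) k). \<tau> (pfx N ((f ^^ j) k)) w * \<theta> (pfx N ((f ^^ j) k)) w)" .
      have "\<forall>t w. \<bar>\<theta> t w\<bar> \<le> real (Rs n)" by (simp add: \<theta>_def \<theta>1_bound)
      then have "\<bar>m.rsum ?B' \<Theta> z - m.rsum ?B' (\<lambda>z. \<Psi> (fst z)) z\<bar> \<le> (1/2) ^ n * real L"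
        unfolding A B sum_subtractf[symmetric] S_def L_def using fr k v unfolding FREQ_def by blast
      moreover have "m.rsum ?B' (\<lambda>_. 1) z = real L" using True by (simp add: m.rsum_def kx L_def)
      ultimately show ?thesis by simp
    qed (simp add: m.rsum_def)
    have j1: "integrable m (m.rsum ?B' \<Theta>)"
      by (rule m.bounded_integrable[OF m.rsum_meas[OF invs(4) Bm(2) \<Theta>m'] m.rsum_bound[OF invs(4) \<Theta>b]])
    have j2: "integrable m (m.rsum ?B' (\<lambda>z. \<Psi> (fst z)))"
      by (rule m.bounded_integrable[OF m.rsum_meas[OF invs(4) Bm(2) \<Psi>m'] m.rsum_bound[OF invs(4) \<Psi>b]])
    have j3: "integrable m (m.rsum ?B' (\<lambda>_. 1))"
      using m.rsum_bound[OF invs(4), of "\<lambda>_. 1" 1] by (intro m.bounded_integrable[OF m.rsum_meas[OF invs(4) Bm(2)]]) auto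
    have "(\<integral>z. \<Theta> z \<partial>m) = (\<integral>z. m.rsum ?B' \<Theta> z \<partial>m)" by (rule m.tower[OF invs(4) Bm(2) \<Theta>m' \<Theta>b])
    moreover have "(\<integral>z. \<Psi> (fst z) \<partial>m) = (\<integral>z. m.rsum ?B' (\<lambda>z. \<Psi> (fst z)) z \<partial>m)" by (rule m.tower[OF invs(4) Bm(2) \<Psi>m' \<Psi>b])
    moreover have "(\<integral>z. \<Psi> (fst z) \<partial>m) = c"
      unfolding c_def dm[symmetric] by (rule integral_distr[symmetric]) (auto simp: \<Psi>m m.P_meas)
    ultimately have "(\<integral>z. \<Theta> z \<partial>m) - c = (\<integral>z. m.rsum ?B' \<Theta> z - m.rsum ?B' (\<lambda>z. \<Psi> (fst z)) z \<partial>m)"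
      using j1 j2 by simp
    then have "\<bar>(\<integral>z. \<Theta> z \<partial>m) - c\<bar> = \<bar>\<integral>z. m.rsum ?B' \<Theta> z - m.rsum ?B' (\<lambda>z. \<Psi> (fst z)) z \<partial>m\<bar>" by simp
    also have "\<dots> \<le> (\<integral>z. \<bar>m.rsum ?B' \<Theta> z - m.rsum ?B' (\<lambda>z. \<Psi> (fst z)) z\<bar> \<partial>m)" by (rule integral_abs_bound)
    also have "\<dots> \<le> (\<integral>z. (1/2) ^ n * m.rsum ?B' (\<lambda>_. 1) z \<partial>m)"
      using j1 j2 j3 claim2 by (intro integral_mono) auto
    also have "\<dots> = (1/2) ^ n * (\<integral>z. m.rsum ?B' (\<lambda>_. 1) z \<partial>m)" by simp
    also have "(\<integral>z. m.rsum ?B' (\<lambda>_. 1) z \<partial>m) = (\<integral>z. 1 \<partial>m)" by (rule m.tower[OF invs(4) Bm(2), symmetric, of _ 1]) auto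
    finally have "\<bar>(\<integral>z. \<Theta> z \<partial>m) - c\<bar> \<le> (1/2) ^ n" by (simp add: m.prob_space)
    then show ?thesis using e1 by linarith
  qed
  then show ?thesis by blast
qed

text \<open>Equal projections put the values of both measures on a cylinder within a vanishing
  distance of the same \<open>c\<close>.\<close>

lemma X_uniquely_ergodic:
  fixes m1 m2 :: "(cant \<times> cant) measure"
  assumes ex: "ext f m1 g0 fst" "ext f m2 g0 fst"
    and sm: "sets m1 = sets (restrict_space borel X)" "sets m2 = sets (restrict_space borel X)"
    and dm: "distr m1 borel fst = distr m2 borel fst"
  shows "m1 = m2"
proof -
  interpret m1: ext f m1 g0 fst by (rule ex)
  interpret m2: ext f m2 g0 fst by (rule ex)
  have eq: "measure m1 (cyl2 V ka xa \<inter> X) = measure m2 (cyl2 V ka xa \<inter> X)" for V ka xa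
  proof (rule ccontr)
    let ?d = "\<bar>measure m1 (cyl2 V ka xa \<inter> X) - measure m2 (cyl2 V ka xa \<inter> X)\<bar>"
    assume "\<not> ?thesis"
    then have d: "0 < ?d" by simp
    have "(\<lambda>n. 2 * ((1/2) ^ n + 2 * real V / n)) \<longlonglongrightarrow> 2 * (0 + 0)"
      by (intro tendsto_intros LIMSEQ_power_zero lim_const_over_n) auto
    then have "\<forall>\<^sub>F n in sequentially. 2 * ((1/2) ^ n + 2 * real V / n) < ?d" using d by (intro order_tendstoD) auto
    then have "\<forall>\<^sub>F n in sequentially. V \<le> n \<and> 0 < n \<and> 2 * ((1/2) ^ n + 2 * real V / n) < ?d"
      using eventually_ge_at_top[of V] eventually_gt_at_top[of 0] by eventually_elim simp
    then obtain n where n: "V \<le> n" "0 < n" "2 * ((1/2) ^ n + 2 * real V / n) < ?d" by (auto simp: eventually_sequentially)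
    obtain c where "\<And>m::(cant \<times> cant) measure. ext f m g0 fst \<Longrightarrow> sets m = sets (restrict_space borel X) \<Longrightarrow> distr m borel fst = distr m1 borel fst \<Longrightarrow>
      \<bar>measure m (cyl2 V ka xa \<inter> X) - c\<bar> \<le> (1/2) ^ n + 2 * real V / n"
      using cyl_estimate[OF n(1,2), where \<mu>="distr m1 borel fst" and ka=ka and xa=xa] by blast
    from this[OF ex(1) sm(1)] this[OF ex(2) sm(2)] dm n(3) show False by simp
  qed
  have Xb: "X \<in> sets borel"
  proof -
    have "closed X" by (rule compact_imp_closed_prod[OF X_compact])
    then show ?thesis by simp
  qed
  have sp: "space m1 = X" "space m2 = X" using sets_eq_imp_space_eq[OF sm(1)] sets_eq_imp_space_eq[OF sm(2)] by (simp_all add: space_restrict_space)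
  have idm: "(\<lambda>z. z) \<in> measurable m1 borel" "(\<lambda>z. z) \<in> measurable m2 borel"
    using measurable_restrict_space1[of "\<lambda>z. z" borel borel X] measurable_cong_sets[OF sm(1) refl] measurable_cong_sets[OF sm(2) refl] by auto
  have em: "emeasure (distr m1 borel (\<lambda>z. z)) A = emeasure m1 (A \<inter> X)" "emeasure (distr m2 borel (\<lambda>z. z)) A = emeasure m2 (A \<inter> X)" if "A \<in> sets borel" for A
    using that idm sp by (simp_all add: emeasure_distr)
  have "distr m1 borel (\<lambda>z. z) = distr m2 borel (\<lambda>z. z)"
  proof (rule measure_eq_cyl2)
    fix N k x
    have "cyl2 N k x \<in> sets borel" by (simp add: open_cyl2)
    then show "emeasure (distr m1 borel (\<lambda>z. z)) (cyl2 N k x) = emeasure (distr m2 borel (\<lambda>z. z)) (cyl2 N k x)"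
      using eq[of N k x] em by (simp add: m1.emeasure_eq_measure m2.emeasure_eq_measure)
    show "emeasure (distr m1 borel (\<lambda>z. z)) UNIV \<noteq> \<infinity>" using em(1)[of UNIV] m1.emeasure_finite by simp
  qed auto
  note D = this
  show ?thesis
  proof (rule measure_eqI)
    fix A assume "A \<in> sets m1"
    then have A: "A \<in> sets borel" "A \<inter> X = A" using sm(1) Xb by (auto simp: sets_restrict_space)
    then show "emeasure m1 A = emeasure m2 A" using em[OF A(1)] D by simp
  qed (simp add: sm)
qed

end

section \<open>Measurability of the inverse\<close>

text \<open>Dependent choice over the stages, started with blocks of length \<open>1\<close> and
  words without bits; the initial names are the indicators of the sets \<open>E i\<close>.\<close>

lemma (in sys) tow_exists:
  assumes E: "\<And>i. E i \<in> sets M"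
    and sep: "\<And>y y' m. y \<in> space M \<Longrightarrow> y' \<in> space M \<Longrightarrow> y \<noteq> y' \<Longrightarrow> \<exists>i\<ge>m. (y \<in> E i) \<noteq> (y' \<in> E i)"
  shows "\<exists>Bs Rs Ws qs. tow f M T P x0 E Bs Rs Ws qs"
proof -
  define inv where "inv n s = (case s of (B, R, W, q) \<Rightarrow> INV n B R W q)" for n s
  define stp :: "nat \<Rightarrow> cant set \<times> nat \<times> (cant \<Rightarrow> (nat \<times> nat) set set) \<times> ('a \<Rightarrow> nat \<Rightarrow> bool) \<Rightarrow>
      cant set \<times> nat \<times> (cant \<Rightarrow> (nat \<times> nat) set set) \<times> ('a \<Rightarrow> nat \<Rightarrow> bool) \<Rightarrow> bool" where "stp n s s' = (case s of (B, R, W, q) \<Rightarrow> case s' of (B', R', W', q') \<Rightarrow>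
    STEP n (2 * n + 1) ((1/2) ^ n) n B R W q B' W' q')" for n s s'
  define s0 where "s0 = (UNIV :: cant set, 1 :: nat, (\<lambda>k. {{}}) :: cant \<Rightarrow> (nat \<times> nat) set set, (\<lambda>y i. y \<in> E i))"
  have "\<exists>s. \<forall>n. (inv n (s n) \<and> (n = 0 \<longrightarrow> s n = s0)) \<and> stp n (s n) (s (Suc n))"
  proof (rule dependent_nat_choice[where P="\<lambda>n s. inv n s \<and> (n = 0 \<longrightarrow> s = s0)" and Q=stp])
    have "recur f UNIV 1" unfolding recur_def by auto
    moreover have "{y\<in>space M. y \<in> E i} = E i" for i using sets.sets_into_space[OF E[of i]] by auto
    moreover have "dep (\<lambda>k. {{}} :: (nat \<times> nat) set set)" by (simp add: dep_def)
    ultimately have "inv 0 s0" using E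
      by (auto simp: inv_def s0_def INV_def bits_meas_def word_def)
    then show "\<exists>s. inv 0 s \<and> (0 = (0::nat) \<longrightarrow> s = s0)" by blast
    fix s n assume s: "inv n s \<and> (n = 0 \<longrightarrow> s = s0)"
    obtain B R W q where sq: "s = (B, R, W, q)" by (cases s)
    have "INV n B R W q" using s by (simp add: inv_def sq)
    from step[OF this, of "(1/2) ^ n" "2 * n + 1" n]
    obtain B' R' W' q' where "INV (Suc n) B' R' W' q'" "STEP n (2 * n + 1) ((1/2) ^ n) n B R W q B' W' q'" by auto
    then show "\<exists>s'. (inv (Suc n) s' \<and> (Suc n = 0 \<longrightarrow> s' = s0)) \<and> stp n s s'"
      by (intro exI[of _ "(B', R', W', q')"]) (simp add: inv_def stp_def sq)
  qed
  then obtain s where s: "\<And>n. inv n (s n)" "s 0 = s0" "\<And>n. stp n (s n) (s (Suc n))" by metis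
  have "tow f M T P x0 E (\<lambda>n. fst (s n)) (\<lambda>n. fst (snd (s n))) (\<lambda>n. fst (snd (snd (s n)))) (\<lambda>n. snd (snd (snd (s n))))"
  proof unfold_locales
    fix n
    show "INV n (fst (s n)) (fst (snd (s n))) (fst (snd (snd (s n)))) (snd (snd (snd (s n))))"
      using s(1)[of n] by (simp add: inv_def case_prod_beta)
    show "STEP n (2 * n + 1) ((1/2) ^ n) n (fst (s n)) (fst (snd (s n))) (fst (snd (snd (s n)))) (snd (snd (snd (s n))))
      (fst (s (Suc n))) (fst (snd (snd (s (Suc n))))) (snd (snd (snd (s (Suc n)))))"
      using s(3)[of n] by (simp add: stp_def case_prod_beta)
    show "snd (snd (snd (s 0))) = (\<lambda>y i. y \<in> E i)" by (simp add: s(2) s0_def)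
  qed (rule sep)
  then show ?thesis by blast
qed

text \<open>A Lusin-type statement: all the sets \<open>D i\<close> become relatively clopen on
  \<open>A\<close>. Each \<open>D i\<close> and its complement within \<open>W\<close> are
  approximated from inside by compact sets, and the unions of the two approximations are intersected
  over \<open>i\<close>.\<close>

lemma compact_regular:
  fixes N :: "'p::polish_space measure"
  assumes N: "finite_measure N" "sets N = sets borel" and W: "W \<in> sets borel" and D: "\<And>i::nat. D i \<in> sets borel" and \<epsilon>: "0 < \<epsilon>"
  shows "\<exists>A. compact A \<and> A \<subseteq> W \<and> measure N (W - A) \<le> \<epsilon> \<and> (\<forall>i. closed (A \<inter> D i) \<and> closed (A - D i))"
proof -
  interpret N: finite_measure N by (rule N(1))
  have reg: "\<exists>C. compact C \<and> C \<subseteq> V \<and> measure N (V - C) < \<delta>" if V: "V \<in> sets borel" and \<delta>: "0 < \<delta>" for V \<delta>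
  proof -
    have sp: "emeasure N (space N) \<noteq> \<infinity>" by simp
    have V': "emeasure N V = (SUP K\<in>{K. K \<subseteq> V \<and> compact K}. emeasure N K)"
      by (rule inner_regular[OF N(2) sp V])
    have "\<exists>K\<in>{K. K \<subseteq> V \<and> compact K}. emeasure N V < emeasure N K + ennreal \<delta>"
    proof (rule ccontr)
      assume n: "\<not> ?thesis"
      then have a: "emeasure N K + ennreal \<delta> \<le> emeasure N V" if "K \<subseteq> V" "compact K" for K using that by (auto simp: not_less)
      have "(SUP K\<in>{K. K \<subseteq> V \<and> compact K}. emeasure N K) \<le> ennreal (measure N V - \<delta>)"
      proof (rule SUP_least)
        fix K assume K: "K \<in> {K. K \<subseteq> V \<and> compact K}"
        then have "ennreal (measure N K + \<delta>) \<le> ennreal (measure N V)" using a[of K] \<delta> by (simp add: N.emeasure_eq_measure)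
        then have "measure N K \<le> measure N V - \<delta>" by (simp add: ennreal_le_iff)
        then show "emeasure N K \<le> ennreal (measure N V - \<delta>)" by (simp add: N.emeasure_eq_measure ennreal_leI)
      qed
      then have le: "ennreal (measure N V) \<le> ennreal (measure N V - \<delta>)"
        unfolding V'[symmetric] by (simp add: N.emeasure_eq_measure)
      have "emeasure N {} + ennreal \<delta> \<le> emeasure N V" by (rule a) auto
      then have "\<delta> \<le> measure N V" by (simp add: N.emeasure_eq_measure ennreal_le_iff)
      then show False using \<delta> le by (simp add: ennreal_le_iff)
    qed
    then obtain K where K: "K \<subseteq> V" "compact K" "emeasure N V < emeasure N K + ennreal \<delta>" by blast
    have "closed K" using K(2) by (rule compact_imp_closed)
    then have Kb: "K \<in> sets N" by (simp add: N(2))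
    have "measure N V < measure N K + \<delta>"
      using K(3) \<delta> by (simp add: N.emeasure_eq_measure ennreal_plus[symmetric] ennreal_less_iff del: ennreal_plus)
    then have "measure N (V - K) < \<delta>" using N.finite_measure_Diff[OF _ Kb K(1)] V N(2) by simp
    then show ?thesis using K by blast
  qed
  \<comment> \<open>The two errors for index \<open>i\<close> together are at most
    \<open>\<epsilon> * (1/2) ^ Suc i\<close>, and these add up to
    \<open>\<epsilon>\<close>.\<close>
  have "\<exists>C. compact (fst C) \<and> fst C \<subseteq> W \<inter> D i \<and> measure N (W \<inter> D i - fst C) < \<epsilon> / 2 * (1/2) ^ Suc i \<and>
      compact (snd C) \<and> snd C \<subseteq> W - D i \<and> measure N (W - D i - snd C) < \<epsilon> / 2 * (1/2) ^ Suc i" for i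
  proof -
    have p: "0 < \<epsilon> / 2 * (1/2) ^ Suc i" using \<epsilon> by simp
    obtain C1 where "compact C1" "C1 \<subseteq> W \<inter> D i" "measure N (W \<inter> D i - C1) < \<epsilon> / 2 * (1/2) ^ Suc i" using reg[OF _ p, of "W \<inter> D i"] W D by blast
    moreover obtain C2 where "compact C2" "C2 \<subseteq> W - D i" "measure N (W - D i - C2) < \<epsilon> / 2 * (1/2) ^ Suc i" using reg[OF _ p, of "W - D i"] W D by blast
    ultimately show ?thesis by (intro exI[of _ "(C1, C2)"]) simp
  qed
  then obtain C where C: "\<And>i. compact (fst (C i))" "\<And>i. fst (C i) \<subseteq> W \<inter> D i" "\<And>i. measure N (W \<inter> D i - fst (C i)) < \<epsilon> / 2 * (1/2) ^ Suc i"
      "\<And>i. compact (snd (C i))" "\<And>i. snd (C i) \<subseteq> W - D i" "\<And>i. measure N (W - D i - snd (C i)) < \<epsilon> / 2 * (1/2) ^ Suc i" by metis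
  define A where "A = (\<Inter>i. fst (C i) \<union> snd (C i))"
  have cl: "closed (fst (C i))" "closed (snd (C i))" for i
    by (rule compact_imp_closed[OF C(1)], rule compact_imp_closed[OF C(4)])
  have "closed A" unfolding A_def using cl by (intro closed_INT) auto
  moreover have "A \<subseteq> fst (C 0) \<union> snd (C 0)" by (auto simp: A_def)
  moreover have "compact (fst (C 0) \<union> snd (C 0))" using C by auto
  ultimately have cA: "compact A" by (metis compact_Int_closed inf.absorb_iff2)
  have AW: "A \<subseteq> W" using C(2)[of 0] C(5)[of 0] by (auto simp: A_def)
  have "A \<inter> D i = A \<inter> fst (C i)" "A - D i = A \<inter> snd (C i)" for i using C(2)[of i] C(5)[of i] by (auto simp: A_def)
  then have "closed (A \<inter> D i) \<and> closed (A - D i)" for i using \<open>closed A\<close> cl by auto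
  moreover have "measure N (W - A) \<le> \<epsilon>"
  proof -
    have s: "fst (C i) \<in> sets N" "snd (C i) \<in> sets N" "W \<in> sets N" "D i \<in> sets N" for i using cl W D N(2) by auto
    define B where "B i = (W \<inter> D i - fst (C i)) \<union> (W - D i - snd (C i))" for i
    have B: "B i \<in> sets N" for i using s by (auto simp: B_def)
    have mB: "measure N (B i) \<le> \<epsilon> * (1/2) ^ Suc i" for i
    proof -
      have "measure N (B i) \<le> measure N (W \<inter> D i - fst (C i)) + measure N (W - D i - snd (C i))"
        unfolding B_def by (rule measure_Un_le) (use s in auto)
      then show ?thesis using C(3)[of i] C(6)[of i] by simp
    qed
    have sm: "(\<lambda>i. \<epsilon> * (1/2) ^ Suc i) sums \<epsilon>" using sums_mult[OF power_half_series, of \<epsilon>] by simp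
    have smB: "summable (\<lambda>i. measure N (B i))"
      by (rule summable_comparison_test'[OF sums_summable[OF sm]]) (use mB in simp)
    have "W - A \<subseteq> (\<Union>i. B i)" by (auto simp: A_def B_def)
    then have "measure N (W - A) \<le> measure N (\<Union>i. B i)" using B by (intro N.finite_measure_mono) auto
    also have "\<dots> \<le> (\<Sum>i. measure N (B i))" using B smB by (intro N.finite_measure_subadditive_countably) auto
    also have "\<dots> \<le> \<epsilon>" using suminf_le[OF mB smB sums_summable[OF sm]] sums_unique[OF sm] by simp
    finally show ?thesis .
  qed
  ultimately show ?thesis using cA AW by blast
qed

text \<open>A point is sent to its distances from a dense sequence. This realises the space as a
  Borel set of real sequences with the same Borel structure, where inner regularity by compact sets
  is at hand.\<close>

lemma polish_embed:
  assumes "polish_space Y" "topspace Y \<noteq> {}"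
  shows "\<exists>e :: 'y \<Rightarrow> nat \<Rightarrow> real. inj_on e (topspace Y) \<and> e ` topspace Y \<in> sets borel \<and>
    sets (borel_of Y) = sets (vimage_algebra (topspace Y) e borel)"
proof -
  obtain S d where "Metric_space S d" and mc: "Metric_space.mcomplete S d" and Y: "Y = Metric_space.mtopology S d"
    using assms(1) unfolding polish_space_def completely_metrizable_space_def by blast
  interpret Metric_space S d by fact
  have top: "topspace Y = S" by (simp add: Y)
  obtain C where C: "countable C" "C \<subseteq> S" "Y closure_of C = S"
    using assms(1) unfolding polish_space_def separable_space_def top by blast
  have "C \<noteq> {}" using C assms(2) top by auto
  define a where "a = from_nat_into C"
  have aS: "a i \<in> S" for i using C from_nat_into[OF \<open>C \<noteq> {}\<close>] by (auto simp: a_def)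
  have dense: "\<exists>i. d y (a i) < r" if "y \<in> S" "0 < r" for y r
  proof -
    have "y \<in> Y closure_of C" using C(3) that by simp
    moreover have "openin Y (mball y r)" by (simp add: Y)
    moreover have "y \<in> mball y r" using that by simp
    ultimately obtain c where "c \<in> C" "c \<in> mball y r" unfolding in_closure_of by blast
    then show ?thesis using from_nat_into_surj[OF C(1)] by (auto simp: a_def)
  qed
  define e where "e y = (\<lambda>i. d y (a i))" for y
  have inj: "inj_on e S"
  proof (rule inj_onI, rule ccontr)
    fix y y' assume y: "y \<in> S" "y' \<in> S" "e y = e y'" "y \<noteq> y'"
    then obtain i where i: "d y (a i) < d y y' / 2" using dense[of y "d y y' / 2"] by auto
    have "d y' (a i) = d y (a i)" using y(3) by (simp add: e_def fun_eq_iff)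
    then show False using i triangle[OF y(1) aS[of i] y(2)] commute[of y' "a i"] by simp
  qed
  \<comment> \<open>A sequence satisfying these inequalities is the distance sequence of the limit of a Cauchy sequence in the dense set.\<close>
  have img: "e ` S = {w. (\<forall>n. \<exists>i. w i < 1 / real (Suc n)) \<and> (\<forall>i j. w i - w j \<le> d (a i) (a j) \<and> d (a i) (a j) \<le> w i + w j)}"
  proof (intro equalityI subsetI)
    fix w assume "w \<in> e ` S"
    then obtain y where y: "y \<in> S" "w = e y" by blast
    have "w i - w j \<le> d (a i) (a j) \<and> d (a i) (a j) \<le> w i + w j" for i j
      using triangle[OF y(1) aS[of j] aS[of i]] triangle[OF aS[of i] y(1) aS[of j]] commute by (simp add: y e_def)
    then show "w \<in> {w. (\<forall>n. \<exists>i. w i < 1 / real (Suc n)) \<and> (\<forall>i j. w i - w j \<le> d (a i) (a j) \<and> d (a i) (a j) \<le> w i + w j)}"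
      using dense[OF y(1)] by (simp add: y e_def)
  next
    fix w assume "w \<in> {w. (\<forall>n. \<exists>i. w i < 1 / real (Suc n)) \<and> (\<forall>i j. w i - w j \<le> d (a i) (a j) \<and> d (a i) (a j) \<le> w i + w j)}"
    then have w1: "\<And>n. \<exists>i. w i < 1 / real (Suc n)" and w2: "\<And>i j. w i - w j \<le> d (a i) (a j)" "\<And>i j. d (a i) (a j) \<le> w i + w j" by auto
    obtain c where c: "\<And>n. w (c n) < 1 / real (Suc n)" using w1 by metis
    have small: "\<exists>N. \<forall>n\<ge>N. w (c n) < r" if r: "0 < r" for r
    proof -
      obtain N where N: "inverse (real (Suc N)) < r" using reals_Archimedean[OF r] by blast
      have "w (c n) < r" if "n \<ge> N" for n
      proof -
        have "1 / real (Suc n) \<le> 1 / real (Suc N)" using that by (intro divide_left_mono) auto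
        then show ?thesis using c[of n] N by (simp add: inverse_eq_divide)
      qed
      then show ?thesis by blast
    qed
    have "MCauchy (\<lambda>n. a (c n))"
      unfolding MCauchy_def
    proof (intro conjI allI impI)
      show "range (\<lambda>n. a (c n)) \<subseteq> S" using aS by auto
      fix r :: real assume "0 < r"
      then obtain N where N: "\<forall>n\<ge>N. w (c n) < r / 2" using small[of "r / 2"] by auto
      have "d (a (c n)) (a (c n')) < r" if "N \<le> n" "N \<le> n'" for n n'
        using w2(2)[of "c n" "c n'"] N that by (smt (verit) field_sum_of_halves)
      then show "\<exists>N. \<forall>n n'. N \<le> n \<longrightarrow> N \<le> n' \<longrightarrow> d (a (c n)) (a (c n')) < r" by blast
    qed
    then obtain y where "limitin mtopology (\<lambda>n. a (c n)) y sequentially" using mc unfolding mcomplete_def by blast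
    then have y: "y \<in> S" "\<And>r. 0 < r \<Longrightarrow> \<exists>N. \<forall>n\<ge>N. d (a (c n)) y < r" unfolding limit_metric_sequentially by blast+
    have "d y (a j) = w j" for j
    proof (rule ccontr)
      assume "d y (a j) \<noteq> w j"
      then have p: "0 < \<bar>d y (a j) - w j\<bar> / 2" by simp
      obtain N1 where N1: "\<forall>n\<ge>N1. w (c n) < \<bar>d y (a j) - w j\<bar> / 2" using small[OF p] by blast
      obtain N2 where N2: "\<forall>n\<ge>N2. d (a (c n)) y < \<bar>d y (a j) - w j\<bar> / 2" using y(2)[OF p] by blast
      define b where "b = a (c (max N1 N2))"
      have 1: "d b y < \<bar>d y (a j) - w j\<bar> / 2" "w (c (max N1 N2)) < \<bar>d y (a j) - w j\<bar> / 2" using N1 N2 by (auto simp: b_def)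
      have "\<bar>d b (a j) - w j\<bar> \<le> w (c (max N1 N2))"
        using w2(1)[of j "c (max N1 N2)"] w2(2)[of "c (max N1 N2)" j] commute[of "a j" b] by (simp add: b_def)
      moreover have "\<bar>d y (a j) - d b (a j)\<bar> \<le> d b y"
        using triangle[OF y(1) _ aS[of j], of b] triangle[of b y "a j"] y(1) aS[of j] aS[of "c (max N1 N2)"] commute[of b y] by (simp add: b_def)
      moreover have "\<bar>d y (a j) - w j\<bar> \<le> \<bar>d y (a j) - d b (a j)\<bar> + \<bar>d b (a j) - w j\<bar>" by linarith
      ultimately have "\<bar>d y (a j) - w j\<bar> < \<bar>d y (a j) - w j\<bar> / 2 + \<bar>d y (a j) - w j\<bar> / 2" using 1 by linarith
      then show False by simp
    qed
    then have "e y = w" by (simp add: e_def fun_eq_iff)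
    then show "w \<in> e ` S" using y(1) by blast
  qed
  have "e ` S \<in> sets borel" unfolding img by measurable
  moreover have "sets (borel_of Y) = sets (vimage_algebra S e borel)"
  proof
    have spY: "space (borel_of Y) = S" by (simp add: borel_of_def top space_measure_of_conv)
    have opb: "openin Y U \<Longrightarrow> U \<in> sets (borel_of Y)" for U
      unfolding borel_of_def using openin_subset by (subst sets_measure_of) (auto intro: sigma_sets.Basic)
    have "(\<lambda>y. d y (a i)) \<in> borel_measurable (borel_of Y)" for i
    proof (rule borel_measurableI_less)
      fix r
      have "{y \<in> space (borel_of Y). d y (a i) < r} = mball (a i) r" using aS by (auto simp: spY commute)
      then show "{y \<in> space (borel_of Y). d y (a i) < r} \<in> sets (borel_of Y)" using opb[of "mball (a i) r"] by (simp add: Y)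
    qed
    then have "e \<in> measurable (borel_of Y) borel"
      unfolding e_def by (intro measurable_coordinatewise_then_product)
    then show "sets (vimage_algebra S e borel) \<subseteq> sets (borel_of Y)"
      unfolding sets_vimage_algebra spY[symmetric] by (rule measurable_iff_sets[THEN iffD1, THEN conjunct2, unfolded sets_vimage_algebra])
    have "U \<in> sets (vimage_algebra S e borel)" if U: "openin Y U" for U
    proof -
      \<comment> \<open>\<open>U\<close> is a union of balls of rational radius around the dense
        points, and each such ball is a condition on one coordinate of \<open>e\<close>.\<close>
      define V where "V = (\<Union>(i, q)\<in>{(i, q::rat). mball (a i) (real_of_rat q) \<subseteq> U}. {w. w i < real_of_rat q})"
      have ow: "open {w :: nat \<Rightarrow> real. w i < r}" for i r
        by (intro open_Collect_less continuous_intros) auto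
      have "open V" unfolding V_def by (intro open_UN ballI) (auto simp: ow)
      moreover have "e -` V \<inter> S = U"
      proof (intro equalityI subsetI)
        fix y assume "y \<in> e -` V \<inter> S"
        then show "y \<in> U" using aS by (auto simp: V_def e_def commute)
      next
        fix y assume y: "y \<in> U"
        have yS: "y \<in> S" using y openin_subset[OF U] top by auto
        obtain r where r: "0 < r" "mball y r \<subseteq> U" using U y unfolding Y openin_mtopology by blast
        obtain q where q: "0 < real_of_rat q" "real_of_rat q < r / 2" using of_rat_dense[of 0 "r/2"] r by auto
        obtain i where i: "d y (a i) < real_of_rat q" using dense[OF yS q(1)] by blast
        have "mball (a i) (real_of_rat q) \<subseteq> mball y r"
        proof
          fix z assume z: "z \<in> mball (a i) (real_of_rat q)"
          then show "z \<in> mball y r" using triangle[OF yS aS[of i], of z] i q yS by auto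
        qed
        then have "e y \<in> V" using r i by (auto simp: V_def e_def intro!: exI[of _ i] exI[of _ q])
        then show "y \<in> e -` V \<inter> S" using yS by simp
      qed
      ultimately show ?thesis using in_vimage_algebra[of V borel e S] by simp
    qed
    then have sub: "{U. openin Y U} \<subseteq> sets (vimage_algebra S e borel)" by blast
    have "sets (borel_of Y) = sigma_sets S {U. openin Y U}"
      unfolding borel_of_def top using openin_subset[of Y] by (intro sets_measure_of) (auto simp: top)
    also have "\<dots> \<subseteq> sets (vimage_algebra S e borel)"
      using sets.sigma_sets_subset[OF sub] by simp
    finally show "sets (borel_of Y) \<subseteq> sets (vimage_algebra S e borel)" .
  qed
  ultimately show ?thesis using inj by (intro exI[of _ e]) (simp add: top)
qed

lemma continuous_on_bool:
  assumes "closed {w\<in>A. g w}" "closed {w\<in>A. \<not> g w}" shows "continuous_on A (g :: 'p::topological_space \<Rightarrow> bool)"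
  unfolding continuous_on_closed_invariant
proof (intro allI impI)
  fix B :: "bool set"
  have "closed {w\<in>A. g w = b}" for b using assms by (cases b) auto
  then have "closed (\<Union>b\<in>B. {w\<in>A. g w = b})" by (intro closed_UN) auto
  moreover have "(\<Union>b\<in>B. {w\<in>A. g w = b}) \<inter> A = g -` B \<inter> A" by auto
  ultimately show "\<exists>C. closed C \<and> C \<inter> A = g -` B \<inter> A" by blast
qed

context tow begin

lemma \<Phi>_ziter: "y \<in> space M \<Longrightarrow> \<Phi> (ziter T j y) = ziter g0 j (\<Phi> y)"
  using ziter_intertwine[OF bij_g0 bijT, of "space M" \<Phi> y j] T_space Ti_space \<Phi>_T by blast

text \<open>On compact sets carrying almost all the mass the map \<open>\<Phi>\<close> is continuous
  in the coordinate \<open>e\<close>, so images of closed parts are compact. A countable union of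
  them makes both the image and the inverse Borel off a null set, and passing to points that stay in
  the good set along their orbit restores invariance.\<close>

lemma regular_image:
  fixes e :: "'a \<Rightarrow> nat \<Rightarrow> real"
  assumes inj: "inj_on e (space M)" and img: "e ` space M \<in> sets borel" and gen: "sets M = sets (vimage_algebra (space M) e borel)"
  shows "\<exists>Y2. Y2 \<in> sets M \<and> Y2 \<subseteq> Y0 \<and> (AE y in M. y \<in> Y2) \<and> (\<forall>y\<in>Y2. \<forall>j. ziter T j y \<in> Y2) \<and>
    \<Phi> ` Y2 \<in> sets borel \<and> inv_into Y2 \<Phi> \<in> measurable (restrict_space borel (\<Phi> ` Y2)) M"
proof -
  have em: "e \<in> borel_measurable M"
    using measurable_vimage_algebra1[of e "space M" borel] measurable_cong_sets[OF gen refl] by auto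
  have eimg: "e ` D \<in> sets borel" if Ds: "D \<in> sets M" for D
  proof -
    have eq: "sets M = {e -` A \<inter> space M | A. A \<in> sets borel}"
      unfolding gen by (rule sets_vimage_algebra2) simp
    obtain D' where D': "D = e -` D' \<inter> space M" "D' \<in> sets borel" using Ds[unfolded eq mem_Collect_eq] by blast
    have "e ` D = D' \<inter> e ` space M" unfolding D'(1) by blast
    then show ?thesis using sets.Int[OF D'(2) img] by simp
  qed
  have eY: "e y \<in> e ` D \<longleftrightarrow> y \<in> D" if "y \<in> space M" "D \<subseteq> space M" for y D
    using that inj by (auto dest: inj_onD)
  define ein where "ein = inv_into (space M) e"
  have ein: "ein (e y) = y" if "y \<in> space M" for y using that inj by (simp add: ein_def)
  have Y0s: "Y0 \<subseteq> space M" using Y0_space by blast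
  define N where "N = distr M borel e"
  interpret N: prob_space N unfolding N_def by (rule prob_space_distr[OF em])
  define W where "W = e ` Y0"
  \<comment> \<open>The coordinates of both components of \<open>\<Phi> y\<close>, interleaved into
    one sequence of sets to be made clopen.\<close>
  define bit where "bit i y = (if even i then fst (\<Phi> y) (i div 2) else snd (\<Phi> y) (i div 2))" for i :: nat and y
  define D where "D i = e ` {y\<in>Y0. bit i y}" for i
  have bits: "{y\<in>Y0. bit i y} \<in> sets M" for i
  proof -
    have "fst \<in> borel_measurable (borel :: (cant \<times> cant) measure)" "snd \<in> borel_measurable (borel :: (cant \<times> cant) measure)"
      by (intro borel_measurable_continuous_onI continuous_intros)+
    then have 1: "(\<lambda>y. fst (\<Phi> y)) \<in> borel_measurable M" "(\<lambda>y. snd (\<Phi> y)) \<in> borel_measurable M"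
      using measurable_compose[OF \<Phi>_meas] by auto
    have 2: "{y\<in>space M. h y a} \<in> sets M" if "h \<in> borel_measurable M" for h :: "'a \<Rightarrow> cant" and a
    proof -
      have "h -` {k. k a = True} \<inter> space M \<in> sets M" using open_coord[of a True] by (intro measurable_sets[OF that]) auto
      also have "h -` {k. k a = True} \<inter> space M = {y\<in>space M. h y a}" by auto
      finally show ?thesis .
    qed
    have "{y\<in>space M. bit i y} \<in> sets M" unfolding bit_def using 2[OF 1(1)] 2[OF 1(2)] by (cases "even i") auto
    then have "Y0 \<inter> {y\<in>space M. bit i y} \<in> sets M" by auto
    also have "Y0 \<inter> {y\<in>space M. bit i y} = {y\<in>Y0. bit i y}" using Y0s by auto
    finally show ?thesis .
  qed
  have Wb: "W \<in> sets borel" unfolding W_def by (rule eimg) measurable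
  have Db: "D i \<in> sets borel" for i unfolding D_def by (rule eimg[OF bits])
  have "\<exists>A. compact A \<and> A \<subseteq> W \<and> measure N (W - A) \<le> 1 / real (Suc m) \<and> (\<forall>i. closed (A \<inter> D i) \<and> closed (A - D i))" for m :: nat
    by (rule compact_regular[OF N.finite_measure_axioms _ Wb Db]) (auto simp: N_def)
  then obtain A where A: "\<And>m. compact (A m)" "\<And>m. A m \<subseteq> W" "\<And>m. measure N (W - A m) \<le> 1 / real (Suc m)"
      "\<And>m i. closed (A m \<inter> D i)" "\<And>m i. closed (A m - D i)" by metis
  define \<Phi>e where "\<Phi>e w = \<Phi> (ein w)" for w
  have \<Phi>e: "\<Phi>e (e y) = \<Phi> y" if "y \<in> Y0" for y using ein Y0_space[OF that] by (simp add: \<Phi>e_def)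
  have cont: "continuous_on (A m) \<Phi>e" for m
  proof -
    have D: "w \<in> D i \<longleftrightarrow> bit i (ein w)" if w: "w \<in> A m" for w i
    proof -
      obtain y where y: "y \<in> Y0" "w = e y" using w A(2) by (auto simp: W_def)
      then show ?thesis unfolding D_def using ein[OF Y0_space[OF y(1)]] eY[OF Y0_space[OF y(1)], of "{y\<in>Y0. bit i y}"] Y0s by auto
    qed
    have c: "continuous_on (A m) (\<lambda>w. bit i (ein w))" for i
    proof (rule continuous_on_bool)
      have "{w\<in>A m. bit i (ein w)} = A m \<inter> D i" using D by auto
      then show "closed {w\<in>A m. bit i (ein w)}" using A(4) by simp
      have "{w\<in>A m. \<not> bit i (ein w)} = A m - D i" using D by auto
      then show "closed {w\<in>A m. \<not> bit i (ein w)}" using A(5) by simp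
    qed
    have "continuous_on (A m) (\<lambda>w. fst (\<Phi>e w) i)" "continuous_on (A m) (\<lambda>w. snd (\<Phi>e w) i)" for i
      using c[of "2 * i"] c[of "2 * i + 1"] by (simp_all add: bit_def \<Phi>e_def)
    then have "continuous_on (A m) (\<lambda>w. fst (\<Phi>e w))" "continuous_on (A m) (\<lambda>w. snd (\<Phi>e w))"
      by (auto intro: continuous_on_coordinatewise_then_product)
    then have "continuous_on (A m) (\<lambda>w. (fst (\<Phi>e w), snd (\<Phi>e w)))" by (rule continuous_on_Pair)
    then show ?thesis by simp
  qed
  have imb: "\<Phi>e ` (A m \<inter> F) \<in> sets borel" if "closed F" for m F
  proof -
    have "compact (\<Phi>e ` (A m \<inter> F))"
      by (rule compact_continuous_image[OF continuous_on_subset[OF cont]]) (use A(1) that compact_Int_closed in auto)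
    then show ?thesis by (intro borel_closed compact_imp_closed_prod)
  qed
  define Z where "Z = {y\<in>Y0. e y \<in> (\<Union>m. A m)}"
  have "A m \<in> sets borel" for m by (rule borel_closed[OF compact_imp_closed[OF A(1)]])
  then have Ab: "(\<Union>m. A m) \<in> sets borel" by (intro sets.countable_UN) blast
  have Zs [measurable]: "Z \<in> sets M"
  proof -
    have "Y0 \<inter> (e -` (\<Union>m. A m) \<inter> space M) \<in> sets M" using measurable_sets[OF em Ab] by auto
    also have "Y0 \<inter> (e -` (\<Union>m. A m) \<inter> space M) = Z" using Y0s by (auto simp: Z_def)
    finally show ?thesis .
  qed
  have Z0: "emeasure M (space M - Z) = 0"
  proof -
    have s: "W \<in> sets N" "A m \<in> sets N" "(\<Union>m. A m) \<in> sets N" for m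
      using Wb Ab compact_imp_closed[OF A(1)] by (auto simp: N_def)
    have "measure N (W - (\<Union>m. A m)) \<le> 1 / real (Suc m)" for m
      by (rule order_trans[OF N.finite_measure_mono A(3)[of m]]) (use s in auto)
    then have "measure N (W - (\<Union>m. A m)) \<le> inverse (real (Suc m))" for m by (simp add: inverse_eq_divide)
    then have "measure N (W - (\<Union>m. A m)) \<le> 0"
      using LIMSEQ_le_const[OF LIMSEQ_inverse_real_of_nat] by blast
    then have "emeasure N (W - (\<Union>m. A m)) = 0" by (simp add: N.emeasure_eq_measure measure_le_0_iff)
    then have "emeasure M (e -` (W - (\<Union>m. A m)) \<inter> space M) = 0"
      unfolding N_def using Wb Ab by (subst (asm) emeasure_distr[OF em]) auto
    moreover have "e -` (W - (\<Union>m. A m)) \<inter> space M = Y0 - Z" using eY[of _ Y0] Y0s by (auto simp: W_def Z_def)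
    ultimately have n: "Y0 - Z \<in> null_sets M" by (auto simp: null_sets_def)
    have "AE y in M. y \<in> Z" using Y0_AE AE_not_in[OF n] by eventually_elim auto
    then show ?thesis by (subst (asm) AE_iff_measurable[of "space M - Z"]) auto
  qed
  \<comment> \<open>The part of \<open>Z\<close> whose whole orbit stays in
    \<open>Z\<close>.\<close>
  define Y2 where "Y2 = {y\<in>Y0. \<forall>j::int. ziter T j y \<in> Z}"
  have "Y2 = Y0 \<inter> {y\<in>space M. \<forall>j::int. ziter T j y \<in> Z}" using Y0s by (auto simp: Y2_def)
  also have "\<dots> \<in> sets M" by measurable
  finally have Y2s: "Y2 \<in> sets M" .
  have "AE y in M. ziter T j y \<in> Z" for j
  proof (rule AE_I[of _ _ "ziter T j -` (space M - Z) \<inter> space M"])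
    show "emeasure M (ziter T j -` (space M - Z) \<inter> space M) = 0" using emeasure_ziter[of "space M - Z" j] Z0 by simp
    show "ziter T j -` (space M - Z) \<inter> space M \<in> sets M" by (rule measurable_sets[OF ziter_meas]) auto
  qed (auto simp: ziter_space)
  then have "AE y in M. \<forall>j::int. ziter T j y \<in> Z" by (subst AE_all_countable) simp
  then have Y2ae: "AE y in M. y \<in> Y2" using Y0_AE by eventually_elim (simp add: Y2_def)
  have Y2Z: "y \<in> Z" if "y \<in> Y2" for y using that by (auto simp: Y2_def dest: spec[of _ 0])
  have "\<Phi> ` Z = (\<Union>m. \<Phi>e ` (A m \<inter> UNIV))"
  proof (intro equalityI subsetI)
    fix z assume "z \<in> \<Phi> ` Z"
    then obtain y m where "y \<in> Y0" "e y \<in> A m" "z = \<Phi> y" by (auto simp: Z_def)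
    then show "z \<in> (\<Union>m. \<Phi>e ` (A m \<inter> UNIV))" using \<Phi>e by force
  next
    fix z assume "z \<in> (\<Union>m. \<Phi>e ` (A m \<inter> UNIV))"
    then obtain m w where w: "w \<in> A m" "z = \<Phi>e w" by auto
    then obtain y where "y \<in> Y0" "w = e y" using A(2) by (auto simp: W_def)
    then show "z \<in> \<Phi> ` Z" using w \<Phi>e by (auto simp: Z_def)
  qed
  also have "\<dots> \<in> sets borel" using imb[OF closed_UNIV] by (intro sets.countable_UN) blast
  finally have \<Phi>Z: "\<Phi> ` Z \<in> sets borel" .
  have zpg: "ziter g0 j -` \<Phi> ` Z \<in> sets borel" for j
    using measurable_sets[OF borel_measurable_continuous_onI[OF cont_ziter_g0] \<Phi>Z] by simp
  \<comment> \<open>The image commutes with this intersection because \<open>\<Phi>\<close> is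
    equivariant and injective on \<open>Y0\<close>.\<close>
  have "\<Phi> ` Y2 = (\<Inter>j::int. ziter g0 j -` \<Phi> ` Z)"
  proof (intro equalityI subsetI)
    fix z assume "z \<in> \<Phi> ` Y2"
    then obtain y where y: "y \<in> Y2" "z = \<Phi> y" by blast
    then show "z \<in> (\<Inter>j::int. ziter g0 j -` \<Phi> ` Z)" using \<Phi>_ziter[OF Y0_space, of y] by (auto simp: Y2_def) (metis imageI)
  next
    fix z assume z: "z \<in> (\<Inter>j::int. ziter g0 j -` \<Phi> ` Z)"
    then have "z \<in> \<Phi> ` Z" by (auto dest: spec[of _ 0])
    then obtain y where y: "y \<in> Z" "z = \<Phi> y" by blast
    have y0: "y \<in> Y0" using y by (simp add: Z_def)
    have "ziter T j y \<in> Z" for j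
    proof -
      have "\<Phi> (ziter T j y) \<in> \<Phi> ` Z" using z y \<Phi>_ziter[OF Y0_space[OF y0]] by auto
      then obtain y' where "y' \<in> Z" "\<Phi> (ziter T j y) = \<Phi> y'" by blast
      moreover have "ziter T j y \<in> Y0" "y' \<in> Y0" using Y0_ziter[OF y0] \<open>y' \<in> Z\<close> by (auto simp: Z_def)
      ultimately show ?thesis using \<Phi>_inj by (metis inj_onD)
    qed
    then show "z \<in> \<Phi> ` Y2" using y y0 by (auto simp: Y2_def)
  qed
  also have "\<dots> \<in> sets borel" using zpg by (intro sets.countable_INT) auto
  finally have \<Phi>Y2: "\<Phi> ` Y2 \<in> sets borel" .
  have Y2Y0: "Y2 \<subseteq> Y0" by (auto simp: Y2_def)
  have inj2: "inj_on \<Phi> Y2" using \<Phi>_inj Y2Y0 by (rule inj_on_subset)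
  let ?R = "restrict_space borel (\<Phi> ` Y2)"
  have spR: "space ?R = \<Phi> ` Y2" by (simp add: space_restrict_space)
  \<comment> \<open>Closed sets suffice for measurability, and for them the preimage under the
    inverse is a countable union of compact sets, cut down to the image.\<close>
  have clF: "{z\<in>\<Phi> ` Y2. e (inv_into Y2 \<Phi> z) \<in> F} \<in> sets ?R" if F: "closed F" for F
  proof -
    have "{z\<in>\<Phi> ` Y2. e (inv_into Y2 \<Phi> z) \<in> F} = \<Phi> ` Y2 \<inter> (\<Union>m. \<Phi>e ` (A m \<inter> F))"
    proof (intro equalityI subsetI)
      fix z assume "z \<in> {z\<in>\<Phi> ` Y2. e (inv_into Y2 \<Phi> z) \<in> F}"
      then obtain y where y: "y \<in> Y2" "z = \<Phi> y" "e y \<in> F" using inj2 by auto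
      then obtain m where "e y \<in> A m" using Y2Z[OF y(1)] by (auto simp: Z_def)
      then show "z \<in> \<Phi> ` Y2 \<inter> (\<Union>m. \<Phi>e ` (A m \<inter> F))" using y \<Phi>e[of y] Y2Y0 by (auto intro!: exI[of _ m] image_eqI[of _ _ "e y"])
    next
      fix z assume "z \<in> \<Phi> ` Y2 \<inter> (\<Union>m. \<Phi>e ` (A m \<inter> F))"
      then obtain y m w where y: "y \<in> Y2" "z = \<Phi> y" "w \<in> A m" "w \<in> F" "z = \<Phi>e w" by blast
      obtain y' where y': "y' \<in> Y0" "w = e y'" using y(3) A(2) by (auto simp: W_def)
      have "\<Phi> y = \<Phi> y'" using y y' \<Phi>e by simp
      then have "y = y'" using \<Phi>_inj y(1) y'(1) Y2Y0 by (auto dest: inj_onD)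
      then show "z \<in> {z\<in>\<Phi> ` Y2. e (inv_into Y2 \<Phi> z) \<in> F}" using y y' inj2 by simp
    qed
    moreover have "(\<Union>m. \<Phi>e ` (A m \<inter> F)) \<in> sets borel" using imb[OF F] by (intro sets.countable_UN) blast
    ultimately show ?thesis by (auto simp: sets_restrict_space)
  qed
  have "(\<lambda>z. e (inv_into Y2 \<Phi> z)) \<in> borel_measurable ?R"
  proof (rule borel_measurableI)
    fix U :: "(nat \<Rightarrow> real) set" assume "open U"
    then have "space ?R - {z\<in>\<Phi> ` Y2. e (inv_into Y2 \<Phi> z) \<in> - U} \<in> sets ?R" by (intro sets.compl_sets clF) (simp add: closed_def)
    also have "space ?R - {z\<in>\<Phi> ` Y2. e (inv_into Y2 \<Phi> z) \<in> - U} = (\<lambda>z. e (inv_into Y2 \<Phi> z)) -` U \<inter> space ?R"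
      unfolding spR by auto
    finally show "(\<lambda>z. e (inv_into Y2 \<Phi> z)) -` U \<inter> space ?R \<in> sets ?R" .
  qed
  moreover have "inv_into Y2 \<Phi> \<in> space ?R \<rightarrow> space M" using inv_into_into[of _ \<Phi> Y2] Y2Y0 Y0s unfolding spR by blast
  ultimately have "inv_into Y2 \<Phi> \<in> measurable ?R (vimage_algebra (space M) e borel)"
    by (intro measurable_vimage_algebra2)
  then have invm: "inv_into Y2 \<Phi> \<in> measurable ?R M" using measurable_cong_sets[OF refl gen] by auto
  have "ziter T j y \<in> Y2" if "y \<in> Y2" for y j
    using that Y0_ziter by (auto simp: Y2_def ziter_add[OF bijT, symmetric])
  then show ?thesis using Y2s Y2Y0 Y2ae \<Phi>Y2 invm by blast
qed

end

section \<open>Transfer to the given systems\<close>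

lemma sets_borel_of: "sets (borel_of X) = sigma_sets (topspace X) {U. openin X U}"
  unfolding borel_of_def using openin_subset[of X] by (intro sets_measure_of) auto

lemma space_borel_of: "space (borel_of X) = topspace X"
  by (simp add: borel_of_def space_measure_of_conv)

lemma open_borel_of: "openin X U \<Longrightarrow> U \<in> sets (borel_of X)"
  by (simp add: sets_borel_of sigma_sets.Basic)

lemma borel_of_euclidean: "borel_of euclidean = borel"
  by (simp add: borel_of_def borel_def)

lemma continuous_map_measurable:
  assumes "continuous_map X Y h" shows "h \<in> measurable (borel_of X) (borel_of Y)"
  unfolding borel_of_def[of Y]
proof (rule measurable_measure_of)
  show "{U. openin Y U} \<subseteq> Pow (topspace Y)" using openin_subset by blast
  show "h \<in> space (borel_of X) \<rightarrow> topspace Y" using assms by (auto simp: space_borel_of continuous_map_def)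
  fix U assume "U \<in> {U. openin Y U}"
  then have "openin X {x \<in> topspace X. h x \<in> U}" using openin_continuous_map_preimage[OF assms] by blast
  moreover have "{x \<in> topspace X. h x \<in> U} = h -` U \<inter> space (borel_of X)" by (auto simp: space_borel_of)
  ultimately show "h -` U \<inter> space (borel_of X) \<in> sets (borel_of X)" using open_borel_of by simp
qed

lemma sets_borel_of_subtopology: "sets (borel_of (top_of_set X)) = sets (restrict_space borel X)"
proof
  have "U \<in> sets (restrict_space borel X)" if U: "openin (top_of_set X) U" for U
  proof -
    obtain V where "open V" "U = X \<inter> V" using U by (auto simp: openin_open)
    then show ?thesis by (auto simp: sets_restrict_space)
  qed
  then have "{U. openin (top_of_set X) U} \<subseteq> sets (restrict_space borel X)" by blast
  from sets.sigma_sets_subset[OF this] show "sets (borel_of (top_of_set X)) \<subseteq> sets (restrict_space borel X)"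
    by (simp add: sets_borel_of space_restrict_space)
  have "(\<lambda>x. x) \<in> measurable (borel_of (top_of_set X)) borel"
    using continuous_map_measurable[of "top_of_set X" euclidean "\<lambda>x. x"] by (simp add: borel_of_euclidean)
  then show "sets (restrict_space borel X) \<subseteq> sets (borel_of (top_of_set X))"
    using measurable_sets[of "\<lambda>x. x" "borel_of (top_of_set X)" borel] by (auto simp: sets_restrict_space space_borel_of Int_commute)
qed

section \<open>Conjugation by a homeomorphism\<close>

locale transfer =
  fixes T1 :: "'a topology" and T2 :: "'b topology" and h h' g g'
  assumes hom: "homeomorphic_maps T1 T2 h h'" and gom: "homeomorphic_maps T1 T1 g g'"
begin

definition G :: "'b \<Rightarrow> 'b" where "G z = h (g (h' z))"
definition G' :: "'b \<Rightarrow> 'b" where "G' z = h (g' (h' z))"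

lemma homs: "continuous_map T1 T2 h" "continuous_map T2 T1 h'" "\<And>x. x \<in> topspace T1 \<Longrightarrow> h' (h x) = x"
  "\<And>z. z \<in> topspace T2 \<Longrightarrow> h (h' z) = z" "continuous_map T1 T1 g" "continuous_map T1 T1 g'"
  "\<And>x. x \<in> topspace T1 \<Longrightarrow> g' (g x) = x" "\<And>x. x \<in> topspace T1 \<Longrightarrow> g (g' x) = x"
  using hom gom by (auto simp: homeomorphic_maps_def)

lemma in_top: "x \<in> topspace T1 \<Longrightarrow> h x \<in> topspace T2" "z \<in> topspace T2 \<Longrightarrow> h' z \<in> topspace T1"
  "x \<in> topspace T1 \<Longrightarrow> g x \<in> topspace T1" "x \<in> topspace T1 \<Longrightarrow> g' x \<in> topspace T1"
  using homs(1,2,5,6) by (auto simp: continuous_map_def)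

lemma GG': "homeomorphic_maps T2 T2 G G'"
  unfolding homeomorphic_maps_def
proof (intro conjI ballI)
  have "continuous_map T2 T2 (h \<circ> (g \<circ> h'))" "continuous_map T2 T2 (h \<circ> (g' \<circ> h'))"
    using homs by (auto intro!: continuous_map_compose)
  then show "continuous_map T2 T2 G" "continuous_map T2 T2 G'" by (simp_all add: G_def[abs_def] G'_def[abs_def] o_def)
qed (use homs(3,4,7,8) in_top in \<open>auto simp: G_def G'_def\<close>)

lemma bij_G: "bij_betw G (topspace T2) (topspace T2)"
  using GG' by (intro bij_betw_byWitness[where f'=G']) (auto simp: homeomorphic_maps_def continuous_map_def)

lemma inv_G: "z \<in> topspace T2 \<Longrightarrow> inv_into (topspace T2) G z = G' z"
  using GG' bij_G by (intro inv_into_f_eq) (auto simp: homeomorphic_maps_def bij_betw_def continuous_map_def)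

lemma G_pow: "z \<in> topspace T2 \<Longrightarrow> (G ^^ n) z = h ((g ^^ n) (h' z)) \<and> (g ^^ n) (h' z) \<in> topspace T1"
  by (induction n) (auto simp: homs in_top G_def)

lemma inv_G_pow: "z \<in> topspace T2 \<Longrightarrow> (inv_into (topspace T2) G ^^ n) z = h ((g' ^^ n) (h' z)) \<and> (g' ^^ n) (h' z) \<in> topspace T1"
  by (induction n) (auto simp: homs in_top inv_G G'_def)

lemma minimal_G:
  assumes "\<And>x w U. x \<in> topspace T1 \<Longrightarrow> openin T1 U \<Longrightarrow> w \<in> U \<Longrightarrow> \<exists>n. (g ^^ n) x \<in> U \<or> (g' ^^ n) x \<in> U"
  shows "minimal_homeo T2 G"
  unfolding minimal_homeo_def
proof (intro conjI ballI)
  show "homeomorphic_map T2 T2 G" using GG' homeomorphic_map_maps by blast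
  fix z assume z: "z \<in> topspace T2"
  show "T2 closure_of two_sided_orbit T2 G z = topspace T2"
  proof
    show "topspace T2 \<subseteq> T2 closure_of two_sided_orbit T2 G z"
    proof
      fix w assume w: "w \<in> topspace T2"
      have "\<exists>y. y \<in> two_sided_orbit T2 G z \<and> y \<in> U" if U: "w \<in> U" "openin T2 U" for U
      proof -
        have "openin T1 {x \<in> topspace T1. h x \<in> U}" using openin_continuous_map_preimage[OF homs(1) U(2)] .
        moreover have "h' w \<in> {x \<in> topspace T1. h x \<in> U}" using in_top(2)[OF w] homs(4)[OF w] U by simp
        ultimately obtain n where n: "h ((g ^^ n) (h' z)) \<in> U \<or> h ((g' ^^ n) (h' z)) \<in> U"
          using assms[OF in_top(2)[OF z]] by blast
        then show ?thesis
          using G_pow[OF z, of n] inv_G_pow[OF z, of n] unfolding two_sided_orbit_def by (metis UnCI rangeI)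
      qed
      then show "w \<in> T2 closure_of two_sided_orbit T2 G z" using w by (simp add: in_closure_of)
    qed
  qed (rule closure_of_subset_topspace)
qed

lemma h_meas: "h \<in> measurable (borel_of T1) (borel_of T2)" "h' \<in> measurable (borel_of T2) (borel_of T1)"
  "g \<in> measurable (borel_of T1) (borel_of T1)" "g' \<in> measurable (borel_of T1) (borel_of T1)"
  "G \<in> measurable (borel_of T2) (borel_of T2)" "G' \<in> measurable (borel_of T2) (borel_of T2)"
  using homs GG' by (auto intro!: continuous_map_measurable simp: homeomorphic_maps_def)

lemma push_inv:
  assumes "invariant_prob T1 g m" shows "invariant_prob T2 G (distr m (borel_of T2) h)"
proof -
  have m: "prob_space m" "sets m = sets (borel_of T1)" "g \<in> measurable m m" "distr m m g = m"
    using assms by (auto simp: invariant_prob_def measure_preserving_def)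
  have hm: "h \<in> measurable m (borel_of T2)" using h_meas(1) measurable_cong_sets[OF m(2) refl] by blast
  have sp: "space m = topspace T1" using sets_eq_imp_space_eq[OF m(2)] by (simp add: space_borel_of)
  have "distr (distr m (borel_of T2) h) (borel_of T2) G = distr m (borel_of T2) (G \<circ> h)"
    by (rule distr_distr[OF h_meas(5) hm])
  also have "\<dots> = distr m (borel_of T2) (h \<circ> g)"
    by (rule distr_cong) (auto simp: G_def homs sp)
  also have "\<dots> = distr (distr m m g) (borel_of T2) h" by (rule distr_distr[symmetric, OF hm m(3)])
  finally have "distr (distr m (borel_of T2) h) (borel_of T2) G = distr m (borel_of T2) h" using m(4) by simp
  moreover have "distr (distr m (borel_of T2) h) (distr m (borel_of T2) h) G = distr (distr m (borel_of T2) h) (borel_of T2) G"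
    by (rule distr_cong) auto
  ultimately show ?thesis
    using prob_space.prob_space_distr[OF m(1) hm] h_meas(5) by (simp add: invariant_prob_def measure_preserving_def)
qed

lemma pull_inv:
  assumes "invariant_prob T2 G m"
  shows "invariant_prob T1 g (distr m (borel_of T1) h')" "distr (distr m (borel_of T1) h') (borel_of T2) h = m"
proof -
  have m: "prob_space m" "sets m = sets (borel_of T2)" "G \<in> measurable m m" "distr m m G = m"
    using assms by (auto simp: invariant_prob_def measure_preserving_def)
  have hm: "h' \<in> measurable m (borel_of T1)" using h_meas(2) measurable_cong_sets[OF m(2) refl] by blast
  have sp: "space m = topspace T2" using sets_eq_imp_space_eq[OF m(2)] by (simp add: space_borel_of)
  have "distr (distr m (borel_of T1) h') (borel_of T1) g = distr m (borel_of T1) (g \<circ> h')"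
    by (rule distr_distr[OF h_meas(3) hm])
  also have "\<dots> = distr m (borel_of T1) (h' \<circ> G)"
    by (rule distr_cong) (auto simp: G_def homs sp in_top)
  also have "\<dots> = distr (distr m m G) (borel_of T1) h'" by (rule distr_distr[symmetric, OF hm m(3)])
  finally have "distr (distr m (borel_of T1) h') (borel_of T1) g = distr m (borel_of T1) h'" using m(4) by simp
  moreover have "distr (distr m (borel_of T1) h') (distr m (borel_of T1) h') g = distr (distr m (borel_of T1) h') (borel_of T1) g"
    by (rule distr_cong) auto
  ultimately show "invariant_prob T1 g (distr m (borel_of T1) h')"
    using prob_space.prob_space_distr[OF m(1) hm] h_meas(3) by (simp add: invariant_prob_def measure_preserving_def)
  have "distr (distr m (borel_of T1) h') (borel_of T2) h = distr m (borel_of T2) (h \<circ> h')"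
    by (rule distr_distr[OF h_meas(1) hm])
  also have "\<dots> = distr m m (\<lambda>z. z)" by (rule distr_cong) (auto simp: homs sp m(2))
  also have "\<dots> = m" by (simp add: distr_id2)
  finally show "distr (distr m (borel_of T1) h') (borel_of T2) h = m" .
qed

text \<open>Every invariant measure of the conjugate is the push-forward of its pull-back, so
  uniqueness carries over.\<close>

lemma uniquely_ergodic_G:
  assumes "uniquely_ergodic T1 g" shows "uniquely_ergodic T2 G"
proof -
  obtain m where m: "invariant_prob T1 g m" "\<And>m'. invariant_prob T1 g m' \<Longrightarrow> m' = m"
    using assms unfolding uniquely_ergodic_def by blast
  show ?thesis unfolding uniquely_ergodic_def
  proof (rule ex1I[where P="invariant_prob T2 G", OF push_inv[OF m(1)]])
    fix m2 assume "invariant_prob T2 G m2"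
    from pull_inv[OF this] m(2) show "m2 = distr m (borel_of T2) h" by metis
  qed
qed

lemma measured_G:
  assumes "invariant_prob T2 G m" shows "measured_system m G"
proof -
  have m: "prob_space m" "sets m = sets (borel_of T2)" "measure_preserving m m G"
    using assms by (auto simp: invariant_prob_def)
  have sp: "space m = topspace T2" using sets_eq_imp_space_eq[OF m(2)] by (simp add: space_borel_of)
  have "G' \<in> measurable m m" using h_meas(6) measurable_cong_sets[OF m(2) m(2)] by blast
  then have "inv_into (space m) G \<in> measurable m m"
    by (rule measurable_cong[THEN iffD1, rotated]) (simp add: sp inv_G)
  then show ?thesis using m bij_G by (simp add: measured_system_def sp)
qed

end

lemma cantor_euclidean:
  "product_topology (\<lambda>_::nat. discrete_topology (UNIV :: bool set)) UNIV = (euclidean :: cant topology)"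
proof -
  have "discrete_topology (UNIV :: bool set) = euclidean"
    by (rule topology_eq[THEN iffD2]) (auto intro: Topological_Spaces.open_discrete)
  then show ?thesis by (simp add: euclidean_product_topology)
qed

section \<open>The limit system on its own phase space\<close>

context tow begin

text \<open>A continuous bijection from a compact space onto a Hausdorff space.\<close>

lemma X_homeo: "homeomorphic_maps (top_of_set X) (euclidean :: (cant \<times> cant) topology) (\<lambda>z. (fst z, ft.branch_code z)) (inv_into X (\<lambda>z. (fst z, ft.branch_code z)))"
proof -
  let ?H = "\<lambda>z. (fst z, ft.branch_code z)"
  note Hausdorff_cantor_prod
  moreover have "compact_space (top_of_set X)" using X_compact by (simp add: compact_space_subtopology)
  moreover have "continuous_map (top_of_set X) euclidean ?H" using ft.fibre_homeo(1) by simp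
  moreover have bij: "?H ` X = UNIV" "inj_on ?H X" using ft.fibre_homeo(2) by (auto simp: bij_betw_def)
  ultimately have "homeomorphic_map (top_of_set X) euclidean ?H"
    by (intro continuous_imp_homeomorphic_map) auto
  then obtain h' where h': "homeomorphic_maps (top_of_set X) euclidean ?H h'" using homeomorphic_map_maps by blast
  have "h' z = inv_into X ?H z" for z
  proof -
    have a: "h' z \<in> X" using h' by (auto simp: homeomorphic_maps_def continuous_map_def)
    have b: "?H (h' z) = z" using h' unfolding homeomorphic_maps_def by (cases z) simp
    show ?thesis by (rule inv_into_f_eq[OF bij(2) a b, symmetric])
  qed
  then have "h' = inv_into X ?H" by (rule ext)
  then show ?thesis using h' by simp
qed

lemma g0_homeo: "homeomorphic_maps (top_of_set X) (top_of_set X) g0 (inv g0)"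
proof -
  have 1: "ziter g0 1 = g0" "ziter g0 (- 1) = inv g0" by (auto simp: ziter_def)
  have "continuous_on X g0" "continuous_on X (inv g0)"
    using continuous_on_subset[OF cont_ziter_g0, of X 1] continuous_on_subset[OF cont_ziter_g0, of X "- 1"] 1 by auto
  moreover have "g0 ` X \<subseteq> X" "inv g0 ` X \<subseteq> X" using X_ziter[of 1] X_ziter[of "- 1"] 1 by auto
  ultimately show ?thesis
    using bij_g0 by (auto simp: homeomorphic_maps_def bij_is_inj bij_is_surj surj_f_inv_f image_subset_iff)
qed

lemma X_orbit:
  assumes "z \<in> X" "openin (top_of_set X) U" "w \<in> U"
  shows "\<exists>n. (g0 ^^ n) z \<in> U \<or> (inv g0 ^^ n) z \<in> U"
proof -
  obtain V where V: "open V" "U = X \<inter> V" using assms(2) by (auto simp: openin_open)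
  obtain k x where w: "w = (k, x)" by (cases w)
  obtain N where N: "\<And>k' x'. agr N k k' \<Longrightarrow> agr N x x' \<Longrightarrow> (k', x') \<in> V"
    using open_prod_agr[OF V(1), of k x] assms(3) V w by auto
  obtain j where j: "agr N k (fst (ziter g0 j z))" "agr N x (snd (ziter g0 j z))"
    using X_minimal[OF assms(1), of k x N] assms(3) V w by auto
  then have "ziter g0 j z \<in> U" using N X_ziter assms(1) V by (metis IntI prod.collapse)
  then show ?thesis by (cases "0 \<le> j") (auto simp: ziter_def)
qed

text \<open>Off the full measure set \<open>Y0\<close> an arbitrary point of \<open>X\<close> is
  taken, so that the map is total with values in \<open>X\<close> and its law is a measure on
  \<open>X\<close>.\<close>

definition \<Phi>t :: "'a \<Rightarrow> cant \<times> cant" where "\<Phi>t y = (if y \<in> Y0 then \<Phi> y else (SOME z. z \<in> X))"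

lemma \<Phi>t_X: "\<Phi>t y \<in> X"
proof -
  have "\<exists>z. z \<in> X" using X_nonempty by blast
  then show ?thesis using \<Phi>_X someI_ex[of "\<lambda>z. z \<in> X"] by (simp add: \<Phi>t_def)
qed

lemma \<Phi>t_meas: "\<Phi>t \<in> measurable M (borel_of (top_of_set X))"
proof -
  have "\<Phi>t \<in> borel_measurable M" unfolding \<Phi>t_def[abs_def] by measurable
  then have "\<Phi>t \<in> measurable M (restrict_space borel X)" using \<Phi>t_X by (intro measurable_restrict_space2) auto
  then show ?thesis using measurable_cong_sets[OF refl sets_borel_of_subtopology] by blast
qed

definition m0 :: "(cant \<times> cant) measure" where "m0 = distr M (borel_of (top_of_set X)) \<Phi>t"

lemma g0_meas: "g0 \<in> measurable (borel_of (top_of_set X)) (borel_of (top_of_set X))"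
  "inv g0 \<in> measurable (borel_of (top_of_set X)) (borel_of (top_of_set X))"
  using g0_homeo by (auto intro!: continuous_map_measurable simp only: homeomorphic_maps_def)

lemma m0_inv: "invariant_prob (top_of_set X) g0 m0"
proof -
  let ?B = "borel_of (top_of_set X)"
  have "distr m0 ?B g0 = distr M ?B (g0 \<circ> \<Phi>t)" unfolding m0_def by (rule distr_distr[OF g0_meas(1) \<Phi>t_meas])
  also have "\<dots> = distr M ?B (\<Phi>t \<circ> T)"
  proof (rule distr_cong_AE)
    show "AE y in M. (g0 \<circ> \<Phi>t) y = (\<Phi>t \<circ> T) y"
      using Y0_AE
    proof eventually_elim
      case (elim y)
      then have "T y \<in> Y0" using Y0_image by blast
      then show ?case using elim \<Phi>_T[OF Y0_space[OF elim]] by (simp add: \<Phi>t_def)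
    qed
    show "g0 \<circ> \<Phi>t \<in> measurable M ?B" using \<Phi>t_meas g0_meas(1) by (rule measurable_comp)
    show "\<Phi>t \<circ> T \<in> measurable M ?B" using T_meas \<Phi>t_meas by (rule measurable_comp)
  qed auto
  also have "\<dots> = distr (distr M M T) ?B \<Phi>t" by (rule distr_distr[symmetric, OF \<Phi>t_meas T_meas])
  also have "\<dots> = m0" by (simp add: T_pres m0_def)
  finally have "distr m0 ?B g0 = m0" .
  moreover have "distr m0 m0 g0 = distr m0 ?B g0" by (rule distr_cong) (auto simp: m0_def)
  ultimately show ?thesis
    using prob_space_distr[OF \<Phi>t_meas] g0_meas(1)
    by (simp add: invariant_prob_def measure_preserving_def m0_def)
qed

text \<open>An invariant measure of the limit system projects to an \<open>f\<close>-invariant one;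
  as there is only one of these, any two such measures have the same projection.\<close>

lemma X_uniquely_ergodic':
  assumes ue: "uniquely_ergodic (euclidean :: cant topology) f"
  shows "uniquely_ergodic (top_of_set X) g0"
  unfolding uniquely_ergodic_def
proof (rule ex1I[where P="invariant_prob (top_of_set X) g0", OF m0_inv])
  have *: "ext f m g0 fst \<and> sets m = sets (restrict_space borel X) \<and> invariant_prob euclidean f (distr m borel fst)"
    if inv: "invariant_prob (top_of_set X) g0 m" for m
  proof -
    have m: "prob_space m" "sets m = sets (borel_of (top_of_set X))" "g0 \<in> measurable m m" "distr m m g0 = m"
      using inv by (auto simp: invariant_prob_def measure_preserving_def)
    have sm: "sets m = sets (restrict_space borel X)" using m(2) sets_borel_of_subtopology by blast
    have "(fst :: cant \<times> cant \<Rightarrow> cant) \<in> borel_measurable (borel_of (top_of_set X))"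
      using continuous_map_measurable[of "top_of_set X" euclidean fst] by (simp add: borel_of_euclidean continuous_on_fst)
    then have fm: "fst \<in> borel_measurable m" using measurable_cong_sets[OF m(2) refl] by blast
    have fF: "f \<in> borel_measurable borel" by (rule borel_measurable_continuous_onI[OF contf])
    have "mps m g0"
      by (intro mps.intro m(1) mps_axioms.intro bij_g0 m(3,4)) (use g0_meas(2) measurable_cong_sets[OF m(2) m(2)] in blast)
    then have "ext f m g0 fst"
      by (intro ext.intro cdyn_axioms ext_axioms.intro fm) (auto simp: g0_def)
    moreover have "distr (distr m borel fst) borel f = distr m borel fst"
    proof -
      have "distr (distr m borel fst) borel f = distr m borel (f \<circ> fst)" by (rule distr_distr[OF fF fm])
      also have "\<dots> = distr m borel (fst \<circ> g0)" by (rule distr_cong) (auto simp: g0_def)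
      also have "\<dots> = distr (distr m m g0) borel fst" by (rule distr_distr[symmetric, OF fm m(3)])
      finally show ?thesis using m(4) by simp
    qed
    moreover have "distr (distr m borel fst) (distr m borel fst) f = distr (distr m borel fst) borel f"
      by (rule distr_cong) auto
    ultimately show ?thesis
      using prob_space.prob_space_distr[OF m(1) fm] fF sm by (simp add: invariant_prob_def measure_preserving_def borel_of_euclidean)
  qed
  fix m assume m: "invariant_prob (top_of_set X) g0 m"
  have "distr m borel fst = distr m0 borel fst"
    using ue *[OF m] *[OF m0_inv] unfolding uniquely_ergodic_def by blast
  then show "m = m0" using *[OF m] *[OF m0_inv] by (intro X_uniquely_ergodic) auto
qed

end

text \<open>The construction above assumes total bijections, a map to the base that is equivariant
  everywhere, and the concrete space \<open>cant\<close>. These are arranged on a full measure part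
  of the extension, and the result is carried back along homeomorphisms that respect the first
  coordinate.\<close>

theorem theorem3:
  fixes K :: "'k topology" and f :: "'k \<Rightarrow> 'k" and \<mu> :: "'k measure"
    and \<nu> :: "'y measure" and S :: "'y \<Rightarrow> 'y"
    and Y1 :: "'y set" and X1 :: "'k set" and p :: "'y \<Rightarrow> 'k"
  assumes "cantor_set K"
    and "minimal_homeo K f"
    and "uniquely_ergodic K f"
    and "invariant_prob K f \<mu>"
    and "standard_borel \<nu>"
    and "measured_system \<nu> S"
    and "ergodic \<nu> S"
    and "extension_through \<nu> S \<mu> f Y1 X1 p"
  shows "\<exists>(Q :: (nat \<Rightarrow> bool) topology) (g :: 'k \<times> (nat \<Rightarrow> bool) \<Rightarrow> 'k \<times> (nat \<Rightarrow> bool))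
            (\<nu>' :: ('k \<times> (nat \<Rightarrow> bool)) measure) (Y0 :: 'y set) (\<Phi> :: 'y \<Rightarrow> 'k \<times> (nat \<Rightarrow> bool)).
           cantor_set Q \<and>
           minimal_homeo (prod_topology K Q) g \<and>
           uniquely_ergodic (prod_topology K Q) g \<and>
           invariant_prob (prod_topology K Q) g \<nu>' \<and>
           full_measure \<nu> Y0 \<and> Y0 \<subseteq> Y1 \<and> S ` Y0 = Y0 \<and>
           system_isomorphism \<nu> S \<nu>' g Y0 \<Phi> \<and>
           (\<forall>y\<in>Y0. \<Phi> (S y) = g (\<Phi> y)) \<and>
           (\<forall>z\<in>topspace (prod_topology K Q). fst (g z) = f (fst z)) \<and>
           (\<forall>y\<in>Y0. fst (\<Phi> y) = p y)"
proof -
  obtain \<kappa> \<kappa>' where h\<kappa>: "homeomorphic_maps K (euclidean :: cant topology) \<kappa> \<kappa>'"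
    using assms(1) unfolding cantor_set_def cantor_euclidean homeomorphic_space_def by blast
  obtain fi where hf: "homeomorphic_maps K K f fi"
    using assms(2) unfolding minimal_homeo_def homeomorphic_map_maps by blast
  interpret tk: transfer K "euclidean :: cant topology" \<kappa> \<kappa>' f fi
    by (rule transfer.intro[OF h\<kappa> hf])
  define F where "F = tk.G"
  have \<kappa>K: "\<kappa>' k \<in> topspace K" "\<kappa> (\<kappa>' k) = k" for k using tk.in_top(2) tk.homs(4) by auto
  have bijF: "bij F" using tk.bij_G by (simp add: F_def)
  have invF: "inv F = tk.G'" using tk.inv_G by (auto simp: F_def)
  have ueF: "uniquely_ergodic (euclidean :: cant topology) F" unfolding F_def by (rule tk.uniquely_ergodic_G[OF assms(3)])
  interpret cF: cdyn F
  proof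
    show "bij F" by (rule bijF)
    show "continuous_on UNIV F" "continuous_on UNIV (inv F)"
      using tk.GG' unfolding invF by (auto simp: F_def homeomorphic_maps_def)
    fix U :: "cant set" and k assume U: "open U" "U \<noteq> {}"
    then obtain u where u: "u \<in> U" by blast
    let ?V = "{x \<in> topspace K. \<kappa> x \<in> U}"
    have V: "openin K ?V" using openin_continuous_map_preimage[OF tk.homs(1)] U(1) by simp
    have "\<kappa>' u \<in> K closure_of two_sided_orbit K f (\<kappa>' k)"
      using assms(2) \<kappa>K unfolding minimal_homeo_def by blast
    moreover have "\<kappa>' u \<in> ?V" using u \<kappa>K by simp
    ultimately obtain y where y: "y \<in> two_sided_orbit K f (\<kappa>' k)" "y \<in> ?V"
      using V unfolding in_closure_of by meson
    have inv: "(inv_into (topspace K) f ^^ n) (\<kappa>' k) = (fi ^^ n) (\<kappa>' k) \<and> (fi ^^ n) (\<kappa>' k) \<in> topspace K" for n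
    proof (induction n)
      case (Suc n)
      have "inv_into (topspace K) f z = fi z" if "z \<in> topspace K" for z
        using that tk.in_top(4)[OF that] tk.homs(7,8) by (intro inv_into_f_eq) (auto intro: inj_on_inverseI[where g=fi])
      then show ?case using Suc tk.in_top(4) by simp
    qed (simp add: \<kappa>K)
    from y(1) consider n where "y = (f ^^ n) (\<kappa>' k)" | n where "y = (fi ^^ n) (\<kappa>' k)"
      unfolding two_sided_orbit_def using inv by auto
    then show "\<exists>j. ziter F j k \<in> U"
    proof cases
      case 1
      then have "ziter F (int n) k = \<kappa> y" using tk.G_pow[of k n] by (simp add: ziter_nat F_def)
      then show ?thesis using y(2) by (metis (lifting) mem_Collect_eq)
    next
      case 2
      have "(inv F ^^ n) k = \<kappa> ((fi ^^ n) (\<kappa>' k))" using tk.inv_G_pow[of k n] by (simp add: F_def)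
      then have "ziter F (- int n) k = \<kappa> y" using 2 by (simp add: ziter_neg)
      then show ?thesis using y(2) by (metis (lifting) mem_Collect_eq)
    qed
  qed

  have \<nu>: "prob_space \<nu>" "bij_betw S (space \<nu>) (space \<nu>)" "S \<in> measurable \<nu> \<nu>" "distr \<nu> \<nu> S = \<nu>" "inv_into (space \<nu>) S \<in> measurable \<nu> \<nu>"
    using assms(6) by (auto simp: measured_system_def measure_preserving_def)
  have ext: "full_measure \<nu> Y1" "full_measure \<mu> X1" "p \<in> measurable (restrict_space \<nu> Y1) (restrict_space \<mu> X1)"
    "S ` Y1 \<subseteq> Y1" "\<And>y. y \<in> Y1 \<Longrightarrow> p (S y) = f (p y)"
    using assms(8) by (auto simp: extension_through_def measure_preserving_def)
  have \<mu>: "sets \<mu> = sets (borel_of K)" "space \<mu> = topspace K"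
    using assms(4) sets_eq_imp_space_eq[of \<mu> "borel_of K"] by (auto simp: invariant_prob_def space_borel_of)
  interpret \<nu>: prob_space \<nu> by (rule \<nu>(1))
  \<comment> \<open>Extended by the identity off the space, so that \<open>T\<close> is a bijection
    of the type and its integer powers make sense.\<close>
  define T where "T y = (if y \<in> space \<nu> then S y else y)" for y
  have Tin: "T y \<in> space \<nu> \<longleftrightarrow> y \<in> space \<nu>" for y using \<nu>(2) by (auto simp: T_def bij_betw_def)
  have bijT: "bij T"
  proof (rule bijI')
    show "(T x = T y) = (x = y)" for x y
      using Tin[of x] Tin[of y] \<nu>(2) unfolding T_def bij_betw_def by (metis inj_onD)
    show "\<exists>x. y = T x" for y
      using \<nu>(2) unfolding T_def bij_betw_def by (cases "y \<in> space \<nu>") (metis imageE, metis)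
  qed
  have invT: "inv T y = inv_into (space \<nu>) S y" if "y \<in> space \<nu>" for y
  proof -
    have "inv_into (space \<nu>) S y \<in> space \<nu>" "S (inv_into (space \<nu>) S y) = y"
      using that \<nu>(2) by (auto simp: bij_betw_def inv_into_into f_inv_into_f)
    then have "T (inv_into (space \<nu>) S y) = y" by (simp add: T_def)
    then show ?thesis using bijT by (metis bij_is_inj inv_f_f)
  qed
  interpret m\<nu>: mps \<nu> T
  proof (intro mps.intro \<nu>(1) mps_axioms.intro bijT)
    show "T \<in> measurable \<nu> \<nu>" using \<nu>(3) by (rule measurable_cong[THEN iffD1, rotated]) (simp add: T_def)
    show "inv T \<in> measurable \<nu> \<nu>" using \<nu>(5) by (rule measurable_cong[THEN iffD1, rotated]) (simp add: invT)
    have "distr \<nu> \<nu> T = distr \<nu> \<nu> S" by (rule distr_cong) (auto simp: T_def)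
    then show "distr \<nu> \<nu> T = \<nu>" using \<nu>(4) by simp
  qed
  have Y1: "Y1 \<in> sets \<nu>" "emeasure \<nu> (space \<nu> - Y1) = 0" using ext(1) by (auto simp: full_measure_def)
  \<comment> \<open>The points whose whole orbit stays in the domain of \<open>p\<close>, an
    invariant set of full measure.\<close>
  define Y' where "Y' = {y\<in>space \<nu>. \<forall>j::int. ziter T j y \<in> Y1}"
  have Y's: "Y' \<in> sets \<nu>" unfolding Y'_def using Y1(1) by measurable
  have Y'Y1: "Y' \<subseteq> Y1" unfolding Y'_def by (auto dest: spec[of _ 0])
  have Y'sp: "Y' \<subseteq> space \<nu>" by (auto simp: Y'_def)
  have Y'zp: "ziter T j y \<in> Y'" if "y \<in> Y'" for j y
    using that m\<nu>.ziter_space by (auto simp: Y'_def ziter_add[OF bijT, symmetric])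
  have Y'T: "T y \<in> Y'" "inv T y \<in> Y'" if "y \<in> Y'" for y
    using Y'zp[OF that, of 1] Y'zp[OF that, of "- 1"] by (auto simp: ziter_def)
  have Y'ae: "AE y in \<nu>. y \<in> Y'"
  proof -
    have "AE y in \<nu>. ziter T j y \<in> Y1" for j
    proof (rule AE_I[of _ _ "ziter T j -` (space \<nu> - Y1) \<inter> space \<nu>"])
      show "emeasure \<nu> (ziter T j -` (space \<nu> - Y1) \<inter> space \<nu>) = 0" using m\<nu>.emeasure_ziter[of "space \<nu> - Y1" j] Y1 by simp
      show "ziter T j -` (space \<nu> - Y1) \<inter> space \<nu> \<in> sets \<nu>" using Y1 by (intro measurable_sets[OF m\<nu>.ziter_meas]) auto
    qed (auto simp: m\<nu>.ziter_space)
    then have "AE y in \<nu>. \<forall>j::int. ziter T j y \<in> Y1" by (subst AE_all_countable) simp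
    then show ?thesis using AE_space by eventually_elim (simp add: Y'_def)
  qed
  \<comment> \<open>From here on the space of the measure is \<open>Y'\<close>, where equivariance
    holds at every point.\<close>
  define M where "M = restrict_space \<nu> Y'"
  have spM: "space M = Y'" using Y'sp by (auto simp: M_def space_restrict_space)
  have setsM: "A \<in> sets M \<longleftrightarrow> A \<in> sets \<nu> \<and> A \<subseteq> Y'" for A
    unfolding M_def using Y's by (auto simp: sets_restrict_space_iff)
  have emM: "emeasure M A = emeasure \<nu> A" if "A \<subseteq> Y'" for A
    unfolding M_def using Y's that by (intro emeasure_restrict_space) auto
  have em1: "emeasure \<nu> Y' = 1" using \<nu>.emeasure_eq_1_AE[OF Y's Y'ae] .
  have probM: "prob_space M" by (rule prob_spaceI) (simp add: spM emM em1)
  have mM: "h \<in> measurable M M" if h: "h \<in> measurable \<nu> \<nu>" "\<And>y. y \<in> Y' \<Longrightarrow> h y \<in> Y'" for h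
  proof (rule measurableI)
    fix A assume "A \<in> sets M"
    then have A: "A \<in> sets \<nu>" "A \<subseteq> Y'" by (auto simp: setsM)
    have "h -` A \<inter> space M = (h -` A \<inter> space \<nu>) \<inter> Y'" using Y'sp by (auto simp: spM)
    then show "h -` A \<inter> space M \<in> sets M" using measurable_sets[OF h(1) A(1)] Y's by (auto simp: setsM)
  qed (use h in \<open>simp add: spM\<close>)
  have mpsM: "mps M T"
  proof (intro mps.intro probM mps_axioms.intro bijT)
    show TM: "T \<in> measurable M M" by (rule mM) (auto simp: Y'T)
    show "inv T \<in> measurable M M" by (rule mM) (auto simp: Y'T)
    show "distr M M T = M"
    proof (rule measure_eqI)
      fix A assume "A \<in> sets (distr M M T)"
      then have A: "A \<in> sets M" "A \<in> sets \<nu>" "A \<subseteq> Y'" by (auto simp: setsM)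
      have "T -` A \<inter> space \<nu> = T -` A \<inter> space M"
      proof -
        have "y \<in> Y'" if "T y \<in> A" for y
          using Y'T(2)[of "T y"] that A(3) bijT by (auto simp: bij_is_inj)
        then show ?thesis using Y'sp by (auto simp: spM)
      qed
      moreover have "emeasure \<nu> (T -` A \<inter> space \<nu>) = emeasure \<nu> A" using m\<nu>.emeasure_ziter[OF A(2), of 1] by (simp add: ziter_def)
      ultimately show "emeasure (distr M M T) A = emeasure M A"
        using emeasure_distr[OF TM A(1)] emM[of "T -` A \<inter> space M"] emM[OF A(3)] by (simp add: spM)
    qed simp
  qed
  define P where "P y = \<kappa> (p y)" for y
  have pX: "p y \<in> topspace K" if "y \<in> Y1" for y
  proof -
    have "y \<in> space (restrict_space \<nu> Y1)" using that sets.sets_into_space[OF Y1(1)] by (auto simp: space_restrict_space)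
    then have "p y \<in> space (restrict_space \<mu> X1)" using ext(3) by (rule measurable_space[rotated])
    then show ?thesis by (simp add: space_restrict_space \<mu>)
  qed
  have P_meas: "P \<in> borel_measurable M"
  proof (rule measurableI)
    fix A :: "cant set" assume "A \<in> sets borel"
    then have "\<kappa> -` A \<inter> topspace K \<in> sets \<mu>"
      using measurable_sets[OF tk.h_meas(1), of A] by (simp add: borel_of_euclidean \<mu> space_borel_of)
    then have "X1 \<inter> (\<kappa> -` A \<inter> topspace K) \<in> sets (restrict_space \<mu> X1)" by (auto simp: sets_restrict_space)
    then have "p -` (X1 \<inter> (\<kappa> -` A \<inter> topspace K)) \<inter> space (restrict_space \<nu> Y1) \<in> sets (restrict_space \<nu> Y1)"
      by (rule measurable_sets[OF ext(3)])
    then have "p -` (X1 \<inter> (\<kappa> -` A \<inter> topspace K)) \<inter> Y1 \<in> sets \<nu>"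
      using Y1 sets.sets_into_space[OF Y1(1)] by (simp add: sets_restrict_space_iff space_restrict_space Int_absorb1 Int_absorb2)
    then have "p -` (X1 \<inter> (\<kappa> -` A \<inter> topspace K)) \<inter> Y1 \<inter> Y' \<in> sets \<nu>" using Y's by auto
    moreover have "p y \<in> X1" if "y \<in> Y1" for y
    proof -
      have "y \<in> space (restrict_space \<nu> Y1)" using that sets.sets_into_space[OF Y1(1)] by (auto simp: space_restrict_space)
      then have "p y \<in> space (restrict_space \<mu> X1)" using ext(3) by (rule measurable_space[rotated])
      then show ?thesis by (simp add: space_restrict_space)
    qed
    then have "p -` (X1 \<inter> (\<kappa> -` A \<inter> topspace K)) \<inter> Y1 \<inter> Y' = P -` A \<inter> space M"
      using Y'Y1 pX by (auto simp: P_def spM)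
    ultimately show "P -` A \<inter> space M \<in> sets M" by (auto simp: setsM spM)
  qed simp
  have P_equi: "P (T y) = F (P y)" if "y \<in> space M" for y
  proof -
    have "y \<in> Y1" "y \<in> space \<nu>" using that Y'Y1 Y'sp by (auto simp: spM)
    then show ?thesis using ext(5) tk.homs(3)[OF pX] by (simp add: T_def P_def F_def tk.G_def)
  qed
  \<comment> \<open>Because \<open>Y'\<close> is invariant in both directions, an invariant subset
    of it is also invariant under \<open>S\<close> in the original space.\<close>
  have ergM: "emeasure M A = 0 \<or> emeasure M A = 1" if A: "A \<in> sets M" "T -` A \<inter> space M = A" for A
  proof -
    have A': "A \<in> sets \<nu>" "A \<subseteq> Y'" using A(1) by (auto simp: setsM)
    have "y \<in> Y'" if "T y \<in> A" for y
      using Y'T(2)[of "T y"] that A' bijT by (auto simp: bij_is_inj)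
    then have "S -` A \<inter> space \<nu> = T -` A \<inter> space M" using Y'sp by (auto simp: spM T_def)
    then have "S -` A \<inter> space \<nu> = A" using A(2) by simp
    then have "emeasure \<nu> A = 0 \<or> emeasure \<nu> A = 1" using assms(7) A'(1) unfolding ergodic_def by blast
    then show ?thesis using emM[OF A'(2)] by simp
  qed
  \<comment> \<open>Any point of \<open>cant\<close> can serve as the common point of the
    bases.\<close>
  interpret sy: sys F M T P undefined
    by (intro sys.intro ext.intro erg.intro mpsM cF.cdyn_axioms ext_axioms.intro erg_axioms.intro P_meas P_equi ergM)

  obtain Yt where Yt: "polish_space Yt" "topspace Yt = space \<nu>" "sets \<nu> = sets (borel_of Yt)"
    using assms(5) unfolding standard_borel_def by blast
  obtain e :: "'y \<Rightarrow> nat \<Rightarrow> real" where e: "inj_on e (space \<nu>)" "e ` space \<nu> \<in> sets borel"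
      "sets \<nu> = sets (vimage_algebra (space \<nu>) e borel)"
    using polish_embed[OF Yt(1)] \<nu>.not_empty Yt by auto
  have s\<nu>: "sets \<nu> = {e -` A \<inter> space \<nu> | A. A \<in> sets borel}"
    unfolding e(3) by (rule sets_vimage_algebra2) simp
  have eY': "e ` Y' \<in> sets borel"
  proof -
    obtain D where D: "Y' = e -` D \<inter> space \<nu>" "D \<in> sets borel" using Y's[unfolded s\<nu> mem_Collect_eq] by blast
    have "e ` Y' = D \<inter> e ` space \<nu>" unfolding D(1) by blast
    then show ?thesis using sets.Int[OF D(2) e(2)] by simp
  qed
  have eM: "sets M = sets (vimage_algebra (space M) e borel)"
  proof -
    have mem: "A \<in> sets M \<longleftrightarrow> (\<exists>D\<in>sets borel. A = e -` D \<inter> Y')" for A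
    proof
      assume "A \<in> sets M"
      then have A: "A \<in> sets \<nu>" "A \<subseteq> Y'" by (auto simp: setsM)
      obtain D where D: "A = e -` D \<inter> space \<nu>" "D \<in> sets borel" using A(1)[unfolded s\<nu> mem_Collect_eq] by blast
      then have "A = e -` D \<inter> Y'" using A(2) Y'sp by blast
      then show "\<exists>D\<in>sets borel. A = e -` D \<inter> Y'" using D(2) by blast
    next
      assume "\<exists>D\<in>sets borel. A = e -` D \<inter> Y'"
      then obtain D where D: "D \<in> sets borel" "A = e -` D \<inter> Y'" by blast
      have "e -` D \<inter> space \<nu> \<in> sets \<nu>" unfolding s\<nu> using D(1) by blast
      moreover have "A = (e -` D \<inter> space \<nu>) \<inter> Y'" using D(2) Y'sp by blast
      ultimately have "A \<in> sets \<nu>" using Y's by auto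
      then show "A \<in> sets M" using D(2) by (auto simp: setsM)
    qed
    have vim: "sets (vimage_algebra (space M) e borel) = {e -` A \<inter> space M | A. A \<in> sets borel}"
      by (rule sets_vimage_algebra2) simp
    show ?thesis
    proof (rule set_eqI)
      fix A show "A \<in> sets M \<longleftrightarrow> A \<in> sets (vimage_algebra (space M) e borel)"
        unfolding mem vim unfolding mem_Collect_eq spM by (simp only: Bex_def conj_commute)
    qed
  qed
  have em: "e \<in> borel_measurable M"
    using measurable_vimage_algebra1[of e "space M" borel] measurable_cong_sets[OF eM refl] by auto
  \<comment> \<open>The first component of the decoded index is dropped, so every pair of a
    coordinate and a rational threshold is attained at infinitely many \<open>i\<close>.\<close>
  define aq :: "nat \<Rightarrow> nat \<times> rat" where "aq i = from_nat (snd (prod_decode i))" for i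
  define E where "E i = {y\<in>space M. e y (fst (aq i)) < real_of_rat (snd (aq i))}" for i
  have coord: "(\<lambda>y. e y a) \<in> borel_measurable M" for a
    using measurable_compose[OF em borel_measurable_continuous_onI[OF continuous_on_product_coordinates[of a]]] by simp
  have Em: "E i \<in> sets M" for i unfolding E_def using coord[of "fst (aq i)"] by measurable
  have Esep: "\<exists>i\<ge>m. (y \<in> E i) \<noteq> (y' \<in> E i)" if y: "y \<in> space M" "y' \<in> space M" "y \<noteq> y'" for y y' m
  proof -
    have "e y \<noteq> e y'" using e(1) y Y'sp by (auto simp: spM dest: inj_onD)
    then obtain a where "e y a \<noteq> e y' a" by auto
    then have "min (e y a) (e y' a) < max (e y a) (e y' a)" by linarith
    then obtain q :: rat where q: "min (e y a) (e y' a) < real_of_rat q" "real_of_rat q < max (e y a) (e y' a)"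
      using of_rat_dense by blast
    \<comment> \<open>The dropped component is set to \<open>m\<close>, which pushes the index to at
      least \<open>m\<close>.\<close>
    define i where "i = prod_encode (m, to_nat (a, q))"
    have "aq i = (a, q)" by (simp add: aq_def i_def)
    then have "(y \<in> E i) \<noteq> (y' \<in> E i)" using q y by (auto simp: E_def)
    moreover have "m \<le> i" unfolding i_def by (rule le_prod_encode_1)
    ultimately show ?thesis by blast
  qed
  obtain Bs Rs Ws qs where tw: "tow F M T P undefined E Bs Rs Ws qs"
    using sy.tow_exists[of E] Em Esep by blast
  interpret tw: tow F M T P undefined E Bs Rs Ws qs by (rule tw)
  obtain Y2 where Y2: "Y2 \<in> sets M" "Y2 \<subseteq> tw.Y0" "AE y in M. y \<in> Y2" "\<And>y j. y \<in> Y2 \<Longrightarrow> ziter T j y \<in> Y2"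
      "tw.\<Phi> ` Y2 \<in> sets borel" "inv_into Y2 tw.\<Phi> \<in> measurable (restrict_space borel (tw.\<Phi> ` Y2)) M"
    using tw.regular_image[OF inj_on_subset[OF e(1)] _ eM] Y'sp eY' unfolding spM by blast

  define H where "H = (\<lambda>z. (fst z, tw.ft.branch_code z))"
  define Hi where "Hi = inv_into tw.X H"
  have HX: "homeomorphic_maps (top_of_set tw.X) (euclidean :: (cant \<times> cant) topology) H Hi"
    unfolding H_def Hi_def by (rule tw.X_homeo)
  define Q where "Q = (euclidean :: cant topology)"
  \<comment> \<open>\<open>H\<close> straightens the fibres and fixes the base coordinate, which
    \<open>\<kappa>'\<close> then carries back to \<open>K\<close>; this is why the first projection
    is respected in the end.\<close>
  define h where "h = (\<lambda>(k, x). (\<kappa>' k, x)) \<circ> H"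
  define h' where "h' = Hi \<circ> (\<lambda>(k, x). (\<kappa> k, x))"
  have "homeomorphic_maps (euclidean :: cant topology) K \<kappa>' \<kappa>" using h\<kappa> homeomorphic_maps_sym by blast
  moreover have "homeomorphic_maps Q Q (\<lambda>x. x) (\<lambda>x. x)" by (simp add: homeomorphic_maps_def)
  ultimately have "homeomorphic_maps (prod_topology (euclidean :: cant topology) Q) (prod_topology K Q) (\<lambda>(k, x). (\<kappa>' k, x)) (\<lambda>(k, x). (\<kappa> k, x))"
    by (simp add: homeomorphic_maps_prod)
  then have hX: "homeomorphic_maps (top_of_set tw.X) (prod_topology K Q) h h'"
    unfolding h_def h'_def using HX by (intro homeomorphic_maps_compose) (auto simp: Q_def)
  interpret tr: transfer "top_of_set tw.X" "prod_topology K Q" h h' cF.g0 "inv cF.g0"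
    by (rule transfer.intro[OF hX tw.g0_homeo])
  define g where "g = tr.G"
  define \<nu>' where "\<nu>' = distr tw.m0 (borel_of (prod_topology K Q)) h"
  define \<Phi> where "\<Phi> y = h (tw.\<Phi> y)" for y
  have inv\<nu>': "invariant_prob (prod_topology K Q) g \<nu>'"
    unfolding g_def \<nu>'_def by (rule tr.push_inv[OF tw.m0_inv])
  have H1: "fst (h z) = \<kappa>' (fst z)" for z by (simp add: h_def H_def case_prod_beta)
  have H2: "fst (h' w) = \<kappa> (fst w)" for w
  proof -
    have "H (Hi v) = v" for v using HX unfolding homeomorphic_maps_def by (cases v) simp
    then have "fst (Hi v) = fst v" for v by (metis H_def fst_conv)
    then show ?thesis by (simp add: h'_def case_prod_beta)
  qed
  have fstg: "fst (g z) = f (fst z)" if "z \<in> topspace (prod_topology K Q)" for z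
  proof -
    have k: "fst z \<in> topspace K" using that by (auto simp: topspace_prod_topology)
    have "fst (g z) = \<kappa>' (F (\<kappa> (fst z)))"
      by (simp add: g_def tr.G_def H1 H2 cF.g0_def)
    then have "fst (g z) = \<kappa>' (\<kappa> (f (\<kappa>' (\<kappa> (fst z)))))" by (simp add: F_def tk.G_def)
    then show ?thesis using tk.homs(3)[OF k] tk.homs(3)[OF tk.in_top(3)[OF k]] by simp
  qed
  have Y2Y': "Y2 \<subseteq> Y'" using Y2(1) by (simp add: setsM)
  have Y2sp: "Y2 \<subseteq> space \<nu>" using Y2Y' Y'sp by blast
  have fst\<Phi>: "fst (\<Phi> y) = p y" if "y \<in> Y2" for y
    using tk.homs(3)[OF pX] that Y2Y' Y'Y1 by (auto simp: \<Phi>_def H1 tw.\<Phi>_def P_def)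
  have \<Phi>X: "tw.\<Phi> y \<in> tw.X" if "y \<in> Y2" for y using tw.\<Phi>_X that Y2(2) by blast
  have ST: "S y = T y" if "y \<in> Y2" for y using that Y2sp by (auto simp: T_def)
  have SY2: "S ` Y2 = Y2"
  proof
    show "S ` Y2 \<subseteq> Y2" using Y2(4)[of _ 1] ST by (auto simp: ziter_def)
    show "Y2 \<subseteq> S ` Y2"
    proof
      fix y assume y: "y \<in> Y2"
      have "ziter T (- 1) y \<in> Y2" using Y2(4)[OF y] .
      moreover have "T (ziter T (- 1) y) = y" using ziter_Suc[OF bijT, of "- 1" y] by simp
      ultimately show "y \<in> S ` Y2" using ST by (metis imageI)
    qed
  qed
  have \<Phi>S: "\<Phi> (S y) = g (\<Phi> y)" if y: "y \<in> Y2" for y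
  proof -
    have "y \<in> space M" using y Y2Y' by (auto simp: spM)
    then have "tw.\<Phi> (T y) = cF.g0 (tw.\<Phi> y)" by (rule tw.\<Phi>_T)
    then show ?thesis using ST[OF y] tr.homs(3)[of "tw.\<Phi> y"] \<Phi>X[OF y] by (simp add: \<Phi>_def g_def tr.G_def)
  qed
  have inj\<Phi>0: "inj_on tw.\<Phi> Y2" using tw.\<Phi>_inj Y2(2) by (rule inj_on_subset)
  have inj\<Phi>: "inj_on \<Phi> Y2"
  proof (rule inj_onI)
    fix y y' assume y: "y \<in> Y2" "y' \<in> Y2" "\<Phi> y = \<Phi> y'"
    have "h' (\<Phi> y) = tw.\<Phi> y" "h' (\<Phi> y') = tw.\<Phi> y'"
      using tr.homs(3) \<Phi>X y(1,2) by (simp_all add: \<Phi>_def)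
    then have "tw.\<Phi> y = tw.\<Phi> y'" using y(3) by simp
    then show "y = y'" using inj\<Phi>0 y(1,2) by (auto dest: inj_onD)
  qed
  have full: "full_measure \<nu> Y2"
  proof -
    have s: "Y2 \<in> sets \<nu>" using Y2(1) by (simp add: setsM)
    have "emeasure M Y2 = 1" using sy.emeasure_eq_1_AE[OF Y2(1,3)] .
    then have "emeasure \<nu> Y2 = 1" using emM[OF Y2Y'] by simp
    then have "emeasure \<nu> (space \<nu> - Y2) = 0" using s by (simp add: emeasure_compl \<nu>.emeasure_space_1)
    then show ?thesis using s by (simp add: full_measure_def)
  qed
  have sp\<nu>': "space \<nu>' = topspace (prod_topology K Q)" by (simp add: \<nu>'_def space_borel_of)
  have sets\<nu>': "sets \<nu>' = sets (borel_of (prod_topology K Q))" by (simp add: \<nu>'_def)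
  have \<Phi>t: "tw.\<Phi>t y = tw.\<Phi> y" if "y \<in> Y2" for y using that Y2(2) by (auto simp: tw.\<Phi>t_def)
  have hm: "(\<lambda>y. h (tw.\<Phi>t y)) \<in> measurable M (borel_of (prod_topology K Q))"
    by (rule measurable_compose[OF tw.\<Phi>t_meas tr.h_meas(1)])
  \<comment> \<open>\<open>\<nu>'\<close> is the law of the total map \<open>tw.\<Phi>t\<close>
    followed by \<open>h\<close>; on the full measure set \<open>Y2\<close> this composition is
    \<open>\<Phi>\<close>.\<close>
  have em\<nu>': "emeasure \<nu>' A = emeasure \<nu> (\<Phi> -` A \<inter> Y2)" and ms\<nu>': "\<Phi> -` A \<inter> Y2 \<in> sets \<nu>" if A: "A \<in> sets \<nu>'" for A
  proof -
    have A': "A \<in> sets (borel_of (prod_topology K Q))" using A by (simp add: sets\<nu>')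
    have B: "(\<lambda>y. h (tw.\<Phi>t y)) -` A \<inter> space M \<in> sets M" by (rule measurable_sets[OF hm A'])
    have eq: "\<Phi> -` A \<inter> Y2 = ((\<lambda>y. h (tw.\<Phi>t y)) -` A \<inter> space M) \<inter> Y2" using Y2Y' \<Phi>t by (auto simp: \<Phi>_def spM)
    then have s: "\<Phi> -` A \<inter> Y2 \<in> sets M" using B Y2(1) by auto
    then show "\<Phi> -` A \<inter> Y2 \<in> sets \<nu>" by (simp add: setsM)
    have "\<nu>' = distr M (borel_of (prod_topology K Q)) (h \<circ> tw.\<Phi>t)"
      unfolding \<nu>'_def tw.m0_def by (rule distr_distr[OF tr.h_meas(1) tw.\<Phi>t_meas])
    then have "emeasure \<nu>' A = emeasure M ((\<lambda>y. h (tw.\<Phi>t y)) -` A \<inter> space M)"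
      using emeasure_distr[OF hm A'] by (simp add: o_def)
    also have "\<dots> = emeasure M (\<Phi> -` A \<inter> Y2)"
    proof (rule emeasure_eq_AE[OF _ B s])
      show "AE y in M. y \<in> (\<lambda>y. h (tw.\<Phi>t y)) -` A \<inter> space M \<longleftrightarrow> y \<in> \<Phi> -` A \<inter> Y2"
        using Y2(3) AE_space by eventually_elim (auto simp: \<Phi>_def \<Phi>t)
    qed
    finally show "emeasure \<nu>' A = emeasure \<nu> (\<Phi> -` A \<inter> Y2)" using emM[of "\<Phi> -` A \<inter> Y2"] Y2Y' by auto
  qed
  have h'\<Phi>: "h' (\<Phi> y) = tw.\<Phi> y" and \<Phi>top: "\<Phi> y \<in> topspace (prod_topology K Q)" if "y \<in> Y2" for y
    using tr.homs(3)[of "tw.\<Phi> y"] tr.in_top(1)[of "tw.\<Phi> y"] \<Phi>X[OF that] by (simp_all add: \<Phi>_def)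
  have \<Phi>im: "\<Phi> ` Y2 = h' -` (tw.\<Phi> ` Y2) \<inter> topspace (prod_topology K Q)"
  proof (intro equalityI subsetI)
    fix z assume "z \<in> \<Phi> ` Y2"
    then obtain y where "y \<in> Y2" "z = \<Phi> y" by blast
    then show "z \<in> h' -` (tw.\<Phi> ` Y2) \<inter> topspace (prod_topology K Q)"
      using h'\<Phi> \<Phi>top by auto
  next
    fix z assume z: "z \<in> h' -` (tw.\<Phi> ` Y2) \<inter> topspace (prod_topology K Q)"
    then obtain y where "y \<in> Y2" "h' z = tw.\<Phi> y" by blast
    moreover have "h (h' z) = z" using z tr.homs(4) by blast
    ultimately show "z \<in> \<Phi> ` Y2" by (metis \<Phi>_def imageI)
  qed
  have "tw.\<Phi> ` Y2 \<in> sets (restrict_space borel tw.X)"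
    using Y2(5) \<Phi>X by (auto simp: sets_restrict_space intro!: image_eqI[of _ _ "tw.\<Phi> ` Y2"])
  then have "tw.\<Phi> ` Y2 \<in> sets (borel_of (top_of_set tw.X))" by (simp add: sets_borel_of_subtopology)
  then have ims: "\<Phi> ` Y2 \<in> sets \<nu>'"
    unfolding \<Phi>im sets\<nu>' using measurable_sets[OF tr.h_meas(2)] by (simp add: space_borel_of)
  have full': "full_measure \<nu>' (\<Phi> ` Y2)"
  proof -
    have "\<Phi> -` (space \<nu>' - \<Phi> ` Y2) \<inter> Y2 = {}" by blast
    then have "emeasure \<nu>' (space \<nu>' - \<Phi> ` Y2) = 0" using em\<nu>'[of "space \<nu>' - \<Phi> ` Y2"] ims by auto
    then show ?thesis using ims by (simp add: full_measure_def)
  qed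
  let ?R = "restrict_space \<nu> Y2" and ?R' = "restrict_space \<nu>' (\<Phi> ` Y2)"
  have Y2s: "Y2 \<in> sets \<nu>" using full by (simp add: full_measure_def)
  have spR: "space ?R = Y2" using Y2sp by (auto simp: space_restrict_space)
  have im_sp: "\<Phi> ` Y2 \<subseteq> space \<nu>'" using sets.sets_into_space[OF ims] .
  have spR': "space ?R' = \<Phi> ` Y2" using im_sp by (auto simp: space_restrict_space)
  have setsR: "A \<in> sets ?R \<longleftrightarrow> A \<in> sets \<nu> \<and> A \<subseteq> Y2" for A using Y2s by (auto simp: sets_restrict_space_iff)
  have setsR': "A \<in> sets ?R' \<longleftrightarrow> A \<in> sets \<nu>' \<and> A \<subseteq> \<Phi> ` Y2" for A using ims by (auto simp: sets_restrict_space_iff)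
  have \<Phi>m: "\<Phi> \<in> measurable ?R ?R'"
  proof (rule measurableI)
    fix A assume "A \<in> sets ?R'"
    then show "\<Phi> -` A \<inter> space ?R \<in> sets ?R" using ms\<nu>'[of A] by (auto simp: setsR setsR' spR)
  qed (simp add: spR spR')
  have mp: "measure_preserving ?R ?R' \<Phi>"
    unfolding measure_preserving_def
  proof (intro conjI \<Phi>m measure_eqI)
    fix A assume "A \<in> sets (distr ?R ?R' \<Phi>)"
    then have A: "A \<in> sets ?R'" by simp
    then have A': "A \<in> sets \<nu>'" "A \<subseteq> \<Phi> ` Y2" by (auto simp: setsR')
    have "emeasure (distr ?R ?R' \<Phi>) A = emeasure ?R (\<Phi> -` A \<inter> Y2)" using emeasure_distr[OF \<Phi>m A] by (simp add: spR)
    also have "\<dots> = emeasure \<nu> (\<Phi> -` A \<inter> Y2)" using Y2s by (intro emeasure_restrict_space) auto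
    also have "\<dots> = emeasure \<nu>' A" using em\<nu>'[OF A'(1)] by simp
    also have "\<dots> = emeasure ?R' A" using ims A'(2) by (intro emeasure_restrict_space[symmetric]) auto
    finally show "emeasure (distr ?R ?R' \<Phi>) A = emeasure ?R' A" .
  qed simp
  have invm: "inv_into Y2 \<Phi> \<in> measurable ?R' ?R"
  proof (rule measurableI)
    fix z assume "z \<in> space ?R'"
    then show "inv_into Y2 \<Phi> z \<in> space ?R" unfolding spR spR' by (rule inv_into_into)
  next
    fix A assume "A \<in> sets ?R"
    then have A: "A \<in> sets \<nu>" "A \<subseteq> Y2" by (auto simp: setsR)
    then have "A \<in> sets M" using Y2Y' by (auto simp: setsM)
    then have "inv_into Y2 tw.\<Phi> -` A \<inter> tw.\<Phi> ` Y2 \<in> sets (restrict_space borel (tw.\<Phi> ` Y2))"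
      using measurable_sets[OF Y2(6), of A] by (simp add: space_restrict_space)
    then have "inv_into Y2 tw.\<Phi> -` A \<inter> tw.\<Phi> ` Y2 \<in> sets borel" using Y2(5) by (simp add: sets_restrict_space_iff)
    moreover have "inv_into Y2 tw.\<Phi> -` A \<inter> tw.\<Phi> ` Y2 = tw.\<Phi> ` A" using A(2) inj\<Phi>0 by auto
    ultimately have "tw.\<Phi> ` A \<in> sets borel" by simp
    then have "tw.\<Phi> ` A \<in> sets (restrict_space borel tw.X)"
      using A(2) \<Phi>X by (auto simp: sets_restrict_space intro!: image_eqI[of _ _ "tw.\<Phi> ` A"])
    then have "h' -` (tw.\<Phi> ` A) \<inter> topspace (prod_topology K Q) \<in> sets \<nu>'"
      unfolding sets\<nu>' using measurable_sets[OF tr.h_meas(2), of "tw.\<Phi> ` A"] by (simp add: space_borel_of sets_borel_of_subtopology)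
    moreover have "h' -` (tw.\<Phi> ` A) \<inter> topspace (prod_topology K Q) = inv_into Y2 \<Phi> -` A \<inter> space ?R'"
    proof (intro equalityI subsetI)
      fix z assume z: "z \<in> h' -` (tw.\<Phi> ` A) \<inter> topspace (prod_topology K Q)"
      then obtain y where y: "y \<in> A" "h' z = tw.\<Phi> y" by blast
      have "z = \<Phi> y" using z tr.homs(4) y(2) unfolding \<Phi>_def by (metis IntD2)
      then show "z \<in> inv_into Y2 \<Phi> -` A \<inter> space ?R'" using y(1) A(2) inj\<Phi> by (auto simp: spR')
    next
      fix z assume "z \<in> inv_into Y2 \<Phi> -` A \<inter> space ?R'"
      then obtain y where y: "y \<in> Y2" "z = \<Phi> y" "inv_into Y2 \<Phi> z \<in> A" by (auto simp: spR')
      then have "y \<in> A" using inj\<Phi> by simp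
      then show "z \<in> h' -` (tw.\<Phi> ` A) \<inter> topspace (prod_topology K Q)"
        using y(1,2) h'\<Phi>[OF y(1)] \<Phi>top[OF y(1)] by auto
    qed
    ultimately show "inv_into Y2 \<Phi> -` A \<inter> space ?R' \<in> sets ?R'" by (auto simp: setsR' spR')
  qed
  have iso: "system_isomorphism \<nu> S \<nu>' g Y2 \<Phi>"
    unfolding system_isomorphism_def
    using assms(6) tr.measured_G[of \<nu>'] inv\<nu>' full full' inj\<Phi> mp invm SY2 \<Phi>S by (auto simp: g_def)
  have "cantor_set Q" unfolding cantor_set_def cantor_euclidean Q_def by (rule homeomorphic_space_refl)
  moreover have "minimal_homeo (prod_topology K Q) g"
    unfolding g_def by (rule tr.minimal_G) (use tw.X_orbit in auto)
  moreover have "uniquely_ergodic (prod_topology K Q) g"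
    unfolding g_def by (rule tr.uniquely_ergodic_G[OF tw.X_uniquely_ergodic'[OF ueF]])
  ultimately show ?thesis
    using inv\<nu>' full Y2Y' Y'Y1 SY2 iso \<Phi>S fstg fst\<Phi> by blast
qed

end
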